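(* Let $R$ be a semisimple ring and let $(A,C)$ be a Koszul pair, where $A$ is a graded, connected, left locally finite $R$-ring and $C$ is a graded, connected, left locally finite $R$-coring. Then the canonical morphism of graded rings $\phi^\bullet:\mathscr{E}(A)=\mathrm{Ext}_A^\bullet(R,R)\to {}^{*\text{-gr}}C$ is invertible, and it induces an isomorphism of graded rings $$\mathscr{E}(A)\;\simeq\;{}^{*\text{-gr}}\,T(A),$$ where $T(A)=\mathrm{Tor}^A_\bullet(R,R)$.
   Context: Unadorned tensor products are over $R$. An $R$-ring (resp. $R$-coring) is an algebra (resp. coalgebra) in the tensor category of $R$-bimodules. A graded $R$-ring $A=\bigoplus_{n\ge0}A^n$ is connected if $A^0=R$; a graded $R$-coring $C=\bigoplus_{n\ge0}C_n$ is connected if $C_0=R$. They are left locally finite if every homogeneous component is finitely generated as a left $R$-module. Components of the multiplication and comultiplication are $\mu^{m,n}:A^m\otimes A^n\to A^{m+n}$ and $\Delta_{m,n}:C_{m+n}\to C_m\otimes C_n$, $\Delta_{m,n}(c)=\sum c_{1,m}\otimes c_{2,n}$. Put $A_+=\bigoplus_{n>0}A^n$; $A_+^{(n)}$ is its $n$-fold tensor power over $R$ (with $A_+^{(0)}=R$). Almost Koszul pair: a pair $(A,C)$ consisting of a graded, connected $R$-ring $A$ and a graded, connected $R$-coring $C$, with an isomorphism of $R$-bimodules $\theta=\theta_{C,A}:C_1\to A^1$ such that $\mu^{1,1}\circ(\theta\otimes\theta)\circ\Delta_{1,1}:C_2\to A^2$ is zero. Koszul pair: an almost Koszul pair for which the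 complex of left $A$-modules $\cdots\to \mathrm{K}^l_1\to \mathrm{K}^l_0\to R\to0$ is exact, where $\mathrm{K}^l_n=A\otimes C_n$, $d_0^l(a\otimes c)=\pi_A^0(a)c$ ($\pi_A^0:A\to A^0=R$ the projection), and $d_n^l(a\otimes c)=\sum a\,\theta(c_{1,1})\otimes c_{2,n-1}$ for $n\ge1$. $T(A)$: the homology of the normalised bar complex $\Omega_\bullet(A)$, $\Omega_n(A)=A_+^{(n)}$, $d_1=0$, $d_n(a_1\otimes\cdots\otimes a_n)=\sum_{i=1}^{n-1}(-1)^{i-1}a_1\otimes\cdots\otimes a_ia_{i+1}\otimes\cdots\otimes a_n$. It is a DG coring under deconcatenation of tensors, so $T(A)=\mathrm{Tor}^A_\bullet(R,R)$ is a connected graded $R$-coring. Graded duals: for a graded $R$-coring $D$, ${}^{*\text{-gr}}D=\bigoplus_n{}^*D_n$ with ${}^*D_n=\mathrm{Hom}_R({}_RD_n,{}_RR)$ (left $R$-linear maps), with convolution product $(\alpha*\beta)(c)=\sum\alpha(c_{1,n}\,\beta(c_{2,m}))$ for $\alpha\in{}^*D_n$, $\beta\in{}^*D_m$, $c\in D_{n+m}$; it is a graded $R^{op}$-ring. $\mathscr{E}(A)=\mathrm{Ext}^\bullet_A(R,R)$ (Ext of left $A$-modules) is computed as the cohomology of $\Omega^\bullet(A,R)=\mathrm{Hom}_R(\Omega_\bullet(A),R)={}^{*\text{-gr}}\Omega_\bullet(A)$ (left $R$-linear maps) and has the cup product, i.e. the product induced by the convolution product. The morphism $\phi^\bullet$: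 for $f:A_+^{(n)}\to R$ and $c\in C_n$, $\phi^n(f)(c)=f\big(\sum\theta(c_{1,1})\otimes\theta(c_{2,1})\otimes\cdots\otimes\theta(c_{n,1})\big)$, where $\sum c_{1,1}\otimes\cdots\otimes c_{n,1}$ is the image of $c$ under the iterated comultiplication $C_n\to C_1^{(n)}$ (for $n=0$, $\phi^0$ is the identity of $\mathrm{Hom}_R(R,R)$); here ${}^{*\text{-gr}}C$ carries the zero differential and $\phi^\bullet$ also denotes the map induced on cohomology. "Induces" refers to composing with the isomorphism ${}^{*\text{-gr}}C\simeq{}^{*\text{-gr}}T(A)$ coming from the known isomorphism of graded $R$-corings $C\simeq T(A)$ valid for Koszul pairs. *)

theory Defs
  imports
    "HOL-Algebra.Module" "HOL-Algebra.AbelCoset" "HOL-Algebra.Generated_Groups"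
    "HOL-Library.Poly_Mapping"
begin

section \<open>Modules and bimodules over a noncommutative ring\<close>

text \<open>The locale \<^locale>\<open>module\<close> of the library requires a commutative base ring.  As for the library
  record \<^typ>\<open>('r, 'm) module\<close>, the fields \<open>mult\<close> and \<open>one\<close> inherited from \<^typ>\<open>'m ring\<close> play no
  role unless the bimodule is an \<open>R\<close>-ring; they are left \<open>undefined\<close> in the constructions below.\<close>

record ('r, 'm) bimodule = "('r, 'm) module" +
  rsmult :: "'m \<Rightarrow> 'r \<Rightarrow> 'm" (infixl "\<triangleleft>\<index>" 70)

locale left_module = R: ring R + M: abelian_group M
  for R :: "('r, 'k) ring_scheme" (structure) and M :: "('r, 'm, 'l) module_scheme" (structure) +
  assumes smult_closed: "r \<in> carrier R \<Longrightarrow> x \<in> carrier M \<Longrightarrow> r \<odot>\<^bsub>M\<^esub> x \<in> carrier M"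
    and smult_l_distr: "r \<in> carrier R \<Longrightarrow> s \<in> carrier R \<Longrightarrow> x \<in> carrier M \<Longrightarrow>
      (r \<oplus>\<^bsub>R\<^esub> s) \<odot>\<^bsub>M\<^esub> x = (r \<odot>\<^bsub>M\<^esub> x) \<oplus>\<^bsub>M\<^esub> (s \<odot>\<^bsub>M\<^esub> x)"
    and smult_r_distr: "r \<in> carrier R \<Longrightarrow> x \<in> carrier M \<Longrightarrow> y \<in> carrier M \<Longrightarrow>
      r \<odot>\<^bsub>M\<^esub> (x \<oplus>\<^bsub>M\<^esub> y) = (r \<odot>\<^bsub>M\<^esub> x) \<oplus>\<^bsub>M\<^esub> (r \<odot>\<^bsub>M\<^esub> y)"
    and smult_assoc: "r \<in> carrier R \<Longrightarrow> s \<in> carrier R \<Longrightarrow> x \<in> carrier M \<Longrightarrow>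
      (r \<otimes>\<^bsub>R\<^esub> s) \<odot>\<^bsub>M\<^esub> x = r \<odot>\<^bsub>M\<^esub> (s \<odot>\<^bsub>M\<^esub> x)"
    and smult_one: "x \<in> carrier M \<Longrightarrow> \<one>\<^bsub>R\<^esub> \<odot>\<^bsub>M\<^esub> x = x"

locale bimodule = left_module R M
  for R :: "('r, 'k) ring_scheme" (structure) and M :: "('r, 'm, 'l) bimodule_scheme" (structure) +
  assumes rsmult_closed: "r \<in> carrier R \<Longrightarrow> x \<in> carrier M \<Longrightarrow> x \<triangleleft>\<^bsub>M\<^esub> r \<in> carrier M"
    and rsmult_r_distr: "r \<in> carrier R \<Longrightarrow> s \<in> carrier R \<Longrightarrow> x \<in> carrier M \<Longrightarrow>
      x \<triangleleft>\<^bsub>M\<^esub> (r \<oplus>\<^bsub>R\<^esub> s) = (x \<triangleleft>\<^bsub>M\<^esub> r) \<oplus>\<^bsub>M\<^esub> (x \<triangleleft>\<^bsub>M\<^esub> s)"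
    and rsmult_l_distr: "r \<in> carrier R \<Longrightarrow> x \<in> carrier M \<Longrightarrow> y \<in> carrier M \<Longrightarrow>
      (x \<oplus>\<^bsub>M\<^esub> y) \<triangleleft>\<^bsub>M\<^esub> r = (x \<triangleleft>\<^bsub>M\<^esub> r) \<oplus>\<^bsub>M\<^esub> (y \<triangleleft>\<^bsub>M\<^esub> r)"
    and rsmult_assoc: "r \<in> carrier R \<Longrightarrow> s \<in> carrier R \<Longrightarrow> x \<in> carrier M \<Longrightarrow>
      x \<triangleleft>\<^bsub>M\<^esub> (r \<otimes>\<^bsub>R\<^esub> s) = (x \<triangleleft>\<^bsub>M\<^esub> r) \<triangleleft>\<^bsub>M\<^esub> s"
    and rsmult_one: "x \<in> carrier M \<Longrightarrow> x \<triangleleft>\<^bsub>M\<^esub> \<one>\<^bsub>R\<^esub> = x"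
    and bimodule_assoc: "r \<in> carrier R \<Longrightarrow> s \<in> carrier R \<Longrightarrow> x \<in> carrier M \<Longrightarrow>
      (r \<odot>\<^bsub>M\<^esub> x) \<triangleleft>\<^bsub>M\<^esub> s = r \<odot>\<^bsub>M\<^esub> (x \<triangleleft>\<^bsub>M\<^esub> s)"

definition regular_bimodule :: "('r, 'k) ring_scheme \<Rightarrow> ('r, 'r) bimodule" where
  "regular_bimodule R = \<lparr>carrier = carrier R, mult = mult R, one = one R, zero = zero R, add = add R,
     smult = mult R, rsmult = mult R\<rparr>"

definition bimodule_hom ::
  "('r, 'k) ring_scheme \<Rightarrow> ('r, 'm, 'l) bimodule_scheme \<Rightarrow> ('r, 'n, 'l2) bimodule_scheme \<Rightarrow> ('m \<Rightarrow> 'n) set"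
where
  "bimodule_hom R M N = {h \<in> carrier M \<rightarrow> carrier N.
     (\<forall>x\<in>carrier M. \<forall>y\<in>carrier M. h (x \<oplus>\<^bsub>M\<^esub> y) = h x \<oplus>\<^bsub>N\<^esub> h y) \<and>
     (\<forall>r\<in>carrier R. \<forall>x\<in>carrier M. h (r \<odot>\<^bsub>M\<^esub> x) = r \<odot>\<^bsub>N\<^esub> h x \<and> h (x \<triangleleft>\<^bsub>M\<^esub> r) = h x \<triangleleft>\<^bsub>N\<^esub> r)}"

definition left_submodule ::
  "('r, 'k) ring_scheme \<Rightarrow> ('r, 'm, 'l) module_scheme \<Rightarrow> 'm set \<Rightarrow> bool" where
  "left_submodule R M N \<longleftrightarrow> subgroup N (add_monoid M) \<and> (\<forall>r\<in>carrier R. \<forall>x\<in>N. r \<odot>\<^bsub>M\<^esub> x \<in> N)"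

definition sub_bimodule ::
  "('r, 'k) ring_scheme \<Rightarrow> ('r, 'm, 'l) bimodule_scheme \<Rightarrow> 'm set \<Rightarrow> bool" where
  "sub_bimodule R M N \<longleftrightarrow> left_submodule R M N \<and> (\<forall>r\<in>carrier R. \<forall>x\<in>N. x \<triangleleft>\<^bsub>M\<^esub> r \<in> N)"

definition simple_submodule ::
  "('r, 'k) ring_scheme \<Rightarrow> ('r, 'm, 'l) module_scheme \<Rightarrow> 'm set \<Rightarrow> bool" where
  "simple_submodule R M N \<longleftrightarrow> left_submodule R M N \<and> N \<noteq> {\<zero>\<^bsub>M\<^esub>} \<and>
     (\<forall>K. left_submodule R M K \<and> K \<subseteq> N \<longrightarrow> K = {\<zero>\<^bsub>M\<^esub>} \<or> K = N)"

text \<open>A module is semisimple if it is the sum of its simple submodules.\<close>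

definition semisimple_module ::
  "('r, 'k) ring_scheme \<Rightarrow> ('r, 'm, 'l) module_scheme \<Rightarrow> bool" where
  "semisimple_module R M \<longleftrightarrow> left_module R M \<and>
     generate (add_monoid M) (\<Union>{N. simple_submodule R M N}) = carrier M"

definition semisimple_ring :: "('r, 'k) ring_scheme \<Rightarrow> bool" where
  "semisimple_ring R \<longleftrightarrow> ring R \<and> semisimple_module R (regular_bimodule R)"

definition finitely_generated ::
  "('r, 'k) ring_scheme \<Rightarrow> ('r, 'm, 'l) module_scheme \<Rightarrow> bool" where
  "finitely_generated R M \<longleftrightarrow> (\<exists>X. finite X \<and> X \<subseteq> carrier M \<and>
     \<Inter>{N. left_submodule R M N \<and> X \<subseteq> N} = carrier M)"

definition quot_bimodule ::
  "('r, 'm, 'l) bimodule_scheme \<Rightarrow> 'm set \<Rightarrow> ('r, 'm set) bimodule" where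
  "quot_bimodule M N = \<lparr>carrier = a_rcosets\<^bsub>M\<^esub> N, mult = undefined, one = undefined, zero = N,
     add = set_add M,
     smult = (\<lambda>r X. \<Union>x\<in>X. N +>\<^bsub>M\<^esub> (r \<odot>\<^bsub>M\<^esub> x)),
     rsmult = (\<lambda>X r. \<Union>x\<in>X. N +>\<^bsub>M\<^esub> (x \<triangleleft>\<^bsub>M\<^esub> r))\<rparr>"


section \<open>Tensor products over \<open>R\<close>\<close>

text \<open>The free abelian group on a set \<open>S\<close> of words, with the operators obtained by extending
  additively a left and a right action of \<open>R\<close> on words.  It becomes a bimodule only
  after passing to the quotient by suitable relations.\<close>

definition word_module ::
  "'w set \<Rightarrow> ('r \<Rightarrow> 'w \<Rightarrow> 'w) \<Rightarrow> ('w \<Rightarrow> 'r \<Rightarrow> 'w) \<Rightarrow> ('r, 'w \<Rightarrow>\<^sub>0 int) bimodule" where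
  "word_module S lact ract = \<lparr>carrier = {t. Poly_Mapping.keys t \<subseteq> S}, mult = undefined, one = undefined,
     zero = 0, add = (+),
     smult = (\<lambda>r. frag_extend (\<lambda>w. frag_of (lact r w))),
     rsmult = (\<lambda>t r. frag_extend (\<lambda>w. frag_of (ract w r)) t)\<rparr>"

definition presented_bimodule ::
  "('r, 'w \<Rightarrow>\<^sub>0 int) bimodule \<Rightarrow> ('w \<Rightarrow>\<^sub>0 int) set \<Rightarrow> ('r, ('w \<Rightarrow>\<^sub>0 int) set) bimodule" where
  "presented_bimodule F E = quot_bimodule F (generate (add_monoid F) E)"

definition frag_eval ::
  "('x, 'k) ring_scheme \<Rightarrow> ('w \<Rightarrow> 'x) \<Rightarrow> ('w \<Rightarrow>\<^sub>0 int) \<Rightarrow> 'x" where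
  "frag_eval X f t = (\<Oplus>\<^bsub>X\<^esub>w\<in>Poly_Mapping.keys t. [Poly_Mapping.lookup t w] \<cdot>\<^bsub>X\<^esub> f w)"

text \<open>The map induced by \<open>f\<close> on a presented group, with values in the additive group of \<open>X\<close>; meaningful
  when \<open>f\<close> respects the relations, so that all representatives of a coset have the same value.\<close>

definition lift ::
  "('x, 'k) ring_scheme \<Rightarrow> ('w \<Rightarrow> 'x) \<Rightarrow> ('w \<Rightarrow>\<^sub>0 int) set \<Rightarrow> 'x" where
  "lift X f T = the_elem (frag_eval X f ` T)"

definition tensor_words ::
  "('r, 'm, 'l) bimodule_scheme \<Rightarrow> ('r, 'n, 'l2) bimodule_scheme \<Rightarrow> ('r, ('m \<times> 'n) \<Rightarrow>\<^sub>0 int) bimodule" where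
  "tensor_words M N = word_module (carrier M \<times> carrier N)
     (\<lambda>r (x, y). (r \<odot>\<^bsub>M\<^esub> x, y)) (\<lambda>(x, y) r. (x, y \<triangleleft>\<^bsub>N\<^esub> r))"

definition tensor_rels ::
  "('r, 'k) ring_scheme \<Rightarrow> ('r, 'm, 'l) bimodule_scheme \<Rightarrow> ('r, 'n, 'l2) bimodule_scheme
    \<Rightarrow> (('m \<times> 'n) \<Rightarrow>\<^sub>0 int) set" where
  "tensor_rels R M N =
     {frag_of (x \<oplus>\<^bsub>M\<^esub> x', y) - frag_of (x, y) - frag_of (x', y) | x x' y.
        x \<in> carrier M \<and> x' \<in> carrier M \<and> y \<in> carrier N} \<union>
     {frag_of (x, y \<oplus>\<^bsub>N\<^esub> y') - frag_of (x, y) - frag_of (x, y') | x y y'.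
        x \<in> carrier M \<and> y \<in> carrier N \<and> y' \<in> carrier N} \<union>
     {frag_of (x \<triangleleft>\<^bsub>M\<^esub> r, y) - frag_of (x, r \<odot>\<^bsub>N\<^esub> y) | x r y.
        x \<in> carrier M \<and> r \<in> carrier R \<and> y \<in> carrier N}"

definition tensor ::
  "('r, 'k) ring_scheme \<Rightarrow> ('r, 'm, 'l) bimodule_scheme \<Rightarrow> ('r, 'n, 'l2) bimodule_scheme
    \<Rightarrow> ('r, (('m \<times> 'n) \<Rightarrow>\<^sub>0 int) set) bimodule" where
  "tensor R M N = presented_bimodule (tensor_words M N) (tensor_rels R M N)"

definition tens ::
  "('r, 'k) ring_scheme \<Rightarrow> ('r, 'm, 'l) bimodule_scheme \<Rightarrow> ('r, 'n, 'l2) bimodule_scheme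
    \<Rightarrow> 'm \<Rightarrow> 'n \<Rightarrow> (('m \<times> 'n) \<Rightarrow>\<^sub>0 int) set" where
  "tens R M N x y =
     generate (add_monoid (tensor_words M N)) (tensor_rels R M N) +>\<^bsub>tensor_words M N\<^esub> frag_of (x, y)"

definition tensor_map ::
  "('r, 'k) ring_scheme \<Rightarrow> ('r, 'm, 'l) bimodule_scheme \<Rightarrow> ('r, 'n, 'l2) bimodule_scheme
    \<Rightarrow> ('p \<Rightarrow> 'm) \<Rightarrow> ('q \<Rightarrow> 'n) \<Rightarrow> (('p \<times> 'q) \<Rightarrow>\<^sub>0 int) set \<Rightarrow> (('m \<times> 'n) \<Rightarrow>\<^sub>0 int) set" where
  "tensor_map R M N f g = lift (tensor R M N) (\<lambda>(x, y). tens R M N (f x) (g y))"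

definition tensor_assoc ::
  "('r, 'k) ring_scheme \<Rightarrow> ('r, 'm, 'l) bimodule_scheme \<Rightarrow> ('r, 'n, 'l2) bimodule_scheme
    \<Rightarrow> ('r, 'p, 'l3) bimodule_scheme
    \<Rightarrow> (((('m \<times> 'n) \<Rightarrow>\<^sub>0 int) set \<times> 'p) \<Rightarrow>\<^sub>0 int) set
    \<Rightarrow> (('m \<times> (('n \<times> 'p) \<Rightarrow>\<^sub>0 int) set) \<Rightarrow>\<^sub>0 int) set" where
  "tensor_assoc R M N P =
     lift (tensor R M (tensor R N P)) (\<lambda>(t, z).
       lift (tensor R M (tensor R N P)) (\<lambda>(x, y). tens R M (tensor R N P) x (tens R N P y z)) t)"

text \<open>Tensor powers: \<open>M\<^sup>(\<^sup>0\<^sup>) = R\<close> and \<open>M\<^sup>(\<^sup>n\<^sup>+\<^sup>1\<^sup>) = M\<^sup>(\<^sup>n\<^sup>) \<otimes> M\<close>, that is \<open>R \<otimes> M \<otimes> \<dots> \<otimes> M\<close> with \<open>n\<close> factors \<open>M\<close>,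
  presented at once for all \<open>n\<close> in a single type: a word \<open>(r, [x\<^sub>1, \<dots>, x\<^sub>n])\<close> stands for
  \<open>r x\<^sub>1 \<otimes> \<dots> \<otimes> x\<^sub>n\<close>, and \<open>(r, [])\<close> for the element \<open>r\<close> of \<open>R\<close>.\<close>

definition power_words ::
  "('r, 'k) ring_scheme \<Rightarrow> ('r, 'm, 'l) bimodule_scheme \<Rightarrow> nat \<Rightarrow> ('r, ('r \<times> 'm list) \<Rightarrow>\<^sub>0 int) bimodule" where
  "power_words R M n = word_module (carrier R \<times> {xs. set xs \<subseteq> carrier M \<and> length xs = n})
     (\<lambda>s (r, xs). (s \<otimes>\<^bsub>R\<^esub> r, xs))
     (\<lambda>(r, xs) s. if xs = [] then (r \<otimes>\<^bsub>R\<^esub> s, []) else (r, butlast xs @ [last xs \<triangleleft>\<^bsub>M\<^esub> s]))"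

definition power_rels ::
  "('r, 'k) ring_scheme \<Rightarrow> ('r, 'm, 'l) bimodule_scheme \<Rightarrow> nat \<Rightarrow> (('r \<times> 'm list) \<Rightarrow>\<^sub>0 int) set" where
  "power_rels R M n =
     {frag_of (r \<oplus>\<^bsub>R\<^esub> s, xs) - frag_of (r, xs) - frag_of (s, xs) | r s xs.
        r \<in> carrier R \<and> s \<in> carrier R \<and> set xs \<subseteq> carrier M \<and> length xs = n} \<union>
     {frag_of (r, xs @ [x \<oplus>\<^bsub>M\<^esub> y] @ ys) - frag_of (r, xs @ [x] @ ys) - frag_of (r, xs @ [y] @ ys) | r xs x y ys.
        r \<in> carrier R \<and> x \<in> carrier M \<and> y \<in> carrier M \<and> set xs \<subseteq> carrier M \<and> set ys \<subseteq> carrier M \<and>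
        length xs + 1 + length ys = n} \<union>
     {frag_of (r \<otimes>\<^bsub>R\<^esub> s, [x] @ xs) - frag_of (r, [s \<odot>\<^bsub>M\<^esub> x] @ xs) | r s x xs.
        r \<in> carrier R \<and> s \<in> carrier R \<and> x \<in> carrier M \<and> set xs \<subseteq> carrier M \<and> 1 + length xs = n} \<union>
     {frag_of (r, xs @ [x \<triangleleft>\<^bsub>M\<^esub> s, y] @ ys) - frag_of (r, xs @ [x, s \<odot>\<^bsub>M\<^esub> y] @ ys) | r xs x s y ys.
        r \<in> carrier R \<and> s \<in> carrier R \<and> x \<in> carrier M \<and> y \<in> carrier M \<and>
        set xs \<subseteq> carrier M \<and> set ys \<subseteq> carrier M \<and> length xs + 2 + length ys = n}"

definition tensor_power ::
  "('r, 'k) ring_scheme \<Rightarrow> ('r, 'm, 'l) bimodule_scheme \<Rightarrow> nat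
    \<Rightarrow> ('r, (('r \<times> 'm list) \<Rightarrow>\<^sub>0 int) set) bimodule" where
  "tensor_power R M n = presented_bimodule (power_words R M n) (power_rels R M n)"

definition pword ::
  "('r, 'k) ring_scheme \<Rightarrow> ('r, 'm, 'l) bimodule_scheme \<Rightarrow> 'r \<Rightarrow> 'm list
    \<Rightarrow> (('r \<times> 'm list) \<Rightarrow>\<^sub>0 int) set" where
  "pword R M r xs =
     generate (add_monoid (power_words R M (length xs))) (power_rels R M (length xs))
       +>\<^bsub>power_words R M (length xs)\<^esub> frag_of (r, xs)"


section \<open>Graded rings\<close>

text \<open>A graded ring in terms of its homogeneous components and the components of its multiplication
  (only the additive structure of the component records is used).\<close>

record 'x graded_ring =
  rcomp :: "nat \<Rightarrow> 'x ring"
  gmult :: "nat \<Rightarrow> nat \<Rightarrow> 'x \<Rightarrow> 'x \<Rightarrow> 'x"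
  gone :: 'x

locale graded_ring =
  fixes B :: "'x graded_ring"
  assumes rcomp_group: "abelian_group (rcomp B n)"
    and gmult_closed: "x \<in> carrier (rcomp B m) \<Longrightarrow> y \<in> carrier (rcomp B n) \<Longrightarrow>
      gmult B m n x y \<in> carrier (rcomp B (m + n))"
    and gmult_l_distr: "x \<in> carrier (rcomp B m) \<Longrightarrow> x' \<in> carrier (rcomp B m) \<Longrightarrow> y \<in> carrier (rcomp B n) \<Longrightarrow>
      gmult B m n (x \<oplus>\<^bsub>rcomp B m\<^esub> x') y = gmult B m n x y \<oplus>\<^bsub>rcomp B (m + n)\<^esub> gmult B m n x' y"
    and gmult_r_distr: "x \<in> carrier (rcomp B m) \<Longrightarrow> y \<in> carrier (rcomp B n) \<Longrightarrow> y' \<in> carrier (rcomp B n) \<Longrightarrow>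
      gmult B m n x (y \<oplus>\<^bsub>rcomp B n\<^esub> y') = gmult B m n x y \<oplus>\<^bsub>rcomp B (m + n)\<^esub> gmult B m n x y'"
    and gmult_assoc: "x \<in> carrier (rcomp B m) \<Longrightarrow> y \<in> carrier (rcomp B n) \<Longrightarrow> z \<in> carrier (rcomp B p) \<Longrightarrow>
      gmult B (m + n) p (gmult B m n x y) z = gmult B m (n + p) x (gmult B n p y z)"
    and gone_closed: "gone B \<in> carrier (rcomp B 0)"
    and gone_l: "x \<in> carrier (rcomp B n) \<Longrightarrow> gmult B 0 n (gone B) x = x"
    and gone_r: "x \<in> carrier (rcomp B n) \<Longrightarrow> gmult B n 0 x (gone B) = x"

definition graded_ring_iso ::
  "'x graded_ring \<Rightarrow> 'y graded_ring \<Rightarrow> (nat \<Rightarrow> 'x \<Rightarrow> 'y) \<Rightarrow> bool" where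
  "graded_ring_iso B B' h \<longleftrightarrow> graded_ring B \<and> graded_ring B' \<and>
     (\<forall>n. h n \<in> iso (add_monoid (rcomp B n)) (add_monoid (rcomp B' n))) \<and>
     (\<forall>m n. \<forall>x\<in>carrier (rcomp B m). \<forall>y\<in>carrier (rcomp B n).
        h (m + n) (gmult B m n x y) = gmult B' m n (h m x) (h n y)) \<and>
     h 0 (gone B) = gone B'"


section \<open>Graded \<open>R\<close>-rings and graded \<open>R\<close>-corings\<close>

text \<open>The conditions on \<open>mult\<close> say that it is (the balanced map corresponding to) a morphism of bimodules
  \<open>A \<otimes> A \<rightarrow> A\<close>, and \<open>unit_central\<close> that \<open>r \<mapsto> r 1\<close> is a morphism of bimodules \<open>R \<rightarrow> A\<close>.\<close>

locale R_ring = bimodule R A + A: ring A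
  for R :: "('r, 'k) ring_scheme" (structure) and A :: "('r, 'a, 'l) bimodule_scheme" (structure) +
  assumes mult_left: "r \<in> carrier R \<Longrightarrow> x \<in> carrier A \<Longrightarrow> y \<in> carrier A \<Longrightarrow>
      (r \<odot>\<^bsub>A\<^esub> x) \<otimes>\<^bsub>A\<^esub> y = r \<odot>\<^bsub>A\<^esub> (x \<otimes>\<^bsub>A\<^esub> y)"
    and mult_right: "r \<in> carrier R \<Longrightarrow> x \<in> carrier A \<Longrightarrow> y \<in> carrier A \<Longrightarrow>
      x \<otimes>\<^bsub>A\<^esub> (y \<triangleleft>\<^bsub>A\<^esub> r) = (x \<otimes>\<^bsub>A\<^esub> y) \<triangleleft>\<^bsub>A\<^esub> r"
    and mult_balanced: "r \<in> carrier R \<Longrightarrow> x \<in> carrier A \<Longrightarrow> y \<in> carrier A \<Longrightarrow>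
      (x \<triangleleft>\<^bsub>A\<^esub> r) \<otimes>\<^bsub>A\<^esub> y = x \<otimes>\<^bsub>A\<^esub> (r \<odot>\<^bsub>A\<^esub> y)"
    and unit_central: "r \<in> carrier R \<Longrightarrow> r \<odot>\<^bsub>A\<^esub> \<one>\<^bsub>A\<^esub> = \<one>\<^bsub>A\<^esub> \<triangleleft>\<^bsub>A\<^esub> r"

record ('r, 'a) graded_bimodule = "('r, 'a) bimodule" +
  hcomp :: "nat \<Rightarrow> 'a set"

definition is_decomposition :: "('r, 'a) graded_bimodule \<Rightarrow> 'a \<Rightarrow> (nat \<Rightarrow> 'a) \<Rightarrow> bool" where
  "is_decomposition A a f \<longleftrightarrow> (\<forall>n. f n \<in> hcomp A n) \<and> finite {n. f n \<noteq> \<zero>\<^bsub>A\<^esub>} \<and>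
     a = (\<Oplus>\<^bsub>A\<^esub>n\<in>{n. f n \<noteq> \<zero>\<^bsub>A\<^esub>}. f n)"

locale graded_R_ring = R_ring R A
  for R :: "('r, 'k) ring_scheme" (structure) and A :: "('r, 'a) graded_bimodule" (structure) +
  assumes hcomp_sub: "sub_bimodule R A (hcomp A n)"
    and hcomp_mult: "x \<in> hcomp A m \<Longrightarrow> y \<in> hcomp A n \<Longrightarrow> x \<otimes>\<^bsub>A\<^esub> y \<in> hcomp A (m + n)"
    and hcomp_one: "\<one>\<^bsub>A\<^esub> \<in> hcomp A 0"
    and direct_sum: "a \<in> carrier A \<Longrightarrow> \<exists>!f. is_decomposition A a f"

text \<open>\<open>A\<^sup>0 = R\<close> by way of the unit of \<open>A\<close>.\<close>

definition connected_ring :: "('r, 'k) ring_scheme \<Rightarrow> ('r, 'a) graded_bimodule \<Rightarrow> bool" where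
  "connected_ring R A \<longleftrightarrow> bij_betw (\<lambda>r. r \<odot>\<^bsub>A\<^esub> \<one>\<^bsub>A\<^esub>) (carrier R) (hcomp A 0)"

definition locally_finite_ring :: "('r, 'k) ring_scheme \<Rightarrow> ('r, 'a) graded_bimodule \<Rightarrow> bool" where
  "locally_finite_ring R A \<longleftrightarrow> (\<forall>n. finitely_generated R (A\<lparr>carrier := hcomp A n\<rparr>))"

text \<open>The projection \<open>A \<rightarrow> A\<^sup>0 = R\<close>.\<close>

definition proj0 :: "('r, 'k) ring_scheme \<Rightarrow> ('r, 'a) graded_bimodule \<Rightarrow> 'a \<Rightarrow> 'r" where
  "proj0 R A a = inv_into (carrier R) (\<lambda>r. r \<odot>\<^bsub>A\<^esub> \<one>\<^bsub>A\<^esub>) ((THE f. is_decomposition A a f) 0)"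

definition plus_part :: "('r, 'a) graded_bimodule \<Rightarrow> ('r, 'a) graded_bimodule" where
  "plus_part A = A\<lparr>carrier := generate (add_monoid A) (\<Union>n\<in>{0<..}. hcomp A n)\<rparr>"

record ('r, 'c) graded_coring =
  ccomp :: "nat \<Rightarrow> ('r, 'c) bimodule"
  comult :: "nat \<Rightarrow> nat \<Rightarrow> 'c \<Rightarrow> (('c \<times> 'c) \<Rightarrow>\<^sub>0 int) set"
  counit :: "'c \<Rightarrow> 'r"

text \<open>The counit of a graded coring vanishes in positive degrees and is given by its restriction to
  degree \<open>0\<close>.\<close>

locale graded_coring = R: ring R
  for R :: "('r, 'k) ring_scheme" (structure) and C :: "('r, 'c, 'l) graded_coring_scheme" +
  assumes ccomp_bimodule: "bimodule R (ccomp C n)"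
    and comult_hom: "comult C m n \<in> bimodule_hom R (ccomp C (m + n)) (tensor R (ccomp C m) (ccomp C n))"
    and counit_hom: "counit C \<in> bimodule_hom R (ccomp C 0) (regular_bimodule R)"
    and coassoc: "c \<in> carrier (ccomp C (m + n + p)) \<Longrightarrow>
      tensor_assoc R (ccomp C m) (ccomp C n) (ccomp C p)
        (tensor_map R (tensor R (ccomp C m) (ccomp C n)) (ccomp C p) (comult C m n) (\<lambda>z. z)
          (comult C (m + n) p c)) =
      tensor_map R (ccomp C m) (tensor R (ccomp C n) (ccomp C p)) (\<lambda>x. x) (comult C n p)
        (comult C m (n + p) c)"
    and counit_l: "c \<in> carrier (ccomp C n) \<Longrightarrow>
      lift (ccomp C n) (\<lambda>(x, y). counit C x \<odot>\<^bsub>ccomp C n\<^esub> y) (comult C 0 n c) = c"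
    and counit_r: "c \<in> carrier (ccomp C n) \<Longrightarrow>
      lift (ccomp C n) (\<lambda>(x, y). x \<triangleleft>\<^bsub>ccomp C n\<^esub> counit C y) (comult C n 0 c) = c"

text \<open>\<open>C\<^sub>0 = R\<close> by way of the counit of \<open>C\<close>.\<close>

definition connected_coring :: "('r, 'k) ring_scheme \<Rightarrow> ('r, 'c, 'l) graded_coring_scheme \<Rightarrow> bool" where
  "connected_coring R C \<longleftrightarrow> bij_betw (counit C) (carrier (ccomp C 0)) (carrier R)"

definition locally_finite_coring :: "('r, 'k) ring_scheme \<Rightarrow> ('r, 'c, 'l) graded_coring_scheme \<Rightarrow> bool" where
  "locally_finite_coring R C \<longleftrightarrow> (\<forall>n. finitely_generated R (ccomp C n))"

definition graded_coring_iso ::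
  "('r, 'k) ring_scheme \<Rightarrow> ('r, 'c, 'l) graded_coring_scheme \<Rightarrow> ('r, 'd, 'l2) graded_coring_scheme
    \<Rightarrow> (nat \<Rightarrow> 'c \<Rightarrow> 'd) \<Rightarrow> bool" where
  "graded_coring_iso R C D h \<longleftrightarrow> graded_coring R C \<and> graded_coring R D \<and>
     (\<forall>n. h n \<in> bimodule_hom R (ccomp C n) (ccomp D n) \<and>
          bij_betw (h n) (carrier (ccomp C n)) (carrier (ccomp D n))) \<and>
     (\<forall>m n. \<forall>c\<in>carrier (ccomp C (m + n)).
        comult D m n (h (m + n) c) = tensor_map R (ccomp D m) (ccomp D n) (h m) (h n) (comult C m n c)) \<and>
     (\<forall>c\<in>carrier (ccomp C 0). counit D (h 0 c) = counit C c)"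


section \<open>Graded duals\<close>

definition left_dual ::
  "('r, 'k) ring_scheme \<Rightarrow> ('r, 'm, 'l) module_scheme \<Rightarrow> ('m \<Rightarrow> 'r) ring" where
  "left_dual R M = \<lparr>carrier = {f \<in> carrier M \<rightarrow>\<^sub>E carrier R.
       (\<forall>x\<in>carrier M. \<forall>y\<in>carrier M. f (x \<oplus>\<^bsub>M\<^esub> y) = f x \<oplus>\<^bsub>R\<^esub> f y) \<and>
       (\<forall>r\<in>carrier R. \<forall>x\<in>carrier M. f (r \<odot>\<^bsub>M\<^esub> x) = r \<otimes>\<^bsub>R\<^esub> f x)},
     mult = undefined, one = undefined,
     zero = (\<lambda>x\<in>carrier M. \<zero>\<^bsub>R\<^esub>),
     add = (\<lambda>f g. \<lambda>x\<in>carrier M. f x \<oplus>\<^bsub>R\<^esub> g x)\<rparr>"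

definition convolution ::
  "('r, 'k) ring_scheme \<Rightarrow> ('r, 'c, 'l) graded_coring_scheme \<Rightarrow> nat \<Rightarrow> nat
    \<Rightarrow> ('c \<Rightarrow> 'r) \<Rightarrow> ('c \<Rightarrow> 'r) \<Rightarrow> 'c \<Rightarrow> 'r" where
  "convolution R D n m \<alpha> \<beta> = (\<lambda>c\<in>carrier (ccomp D (n + m)).
     lift R (\<lambda>(x, y). \<alpha> (x \<triangleleft>\<^bsub>ccomp D n\<^esub> \<beta> y)) (comult D n m c))"

definition graded_dual ::
  "('r, 'k) ring_scheme \<Rightarrow> ('r, 'c, 'l) graded_coring_scheme \<Rightarrow> ('c \<Rightarrow> 'r) graded_ring" where
  "graded_dual R D = \<lparr>rcomp = (\<lambda>n. left_dual R (ccomp D n)), gmult = convolution R D,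
     gone = restrict (counit D) (carrier (ccomp D 0))\<rparr>"


section \<open>DG corings, their homology coring, and the cohomology ring of their graded dual\<close>

record ('r, 'c) dg_coring = "('r, 'c) graded_coring" +
  diff :: "nat \<Rightarrow> 'c \<Rightarrow> 'c" \<comment> \<open>\<open>diff D n\<close> maps degree \<open>n\<close> to degree \<open>n - 1\<close>, and is zero for \<open>n = 0\<close>\<close>

definition cycles :: "('r, 'c) dg_coring \<Rightarrow> nat \<Rightarrow> 'c set" where
  "cycles D n = {x \<in> carrier (ccomp D n). diff D n x = \<zero>\<^bsub>ccomp D (n - 1)\<^esub>}"

definition boundaries :: "('r, 'c) dg_coring \<Rightarrow> nat \<Rightarrow> 'c set" where
  "boundaries D n = diff D (Suc n) ` carrier (ccomp D (Suc n))"

definition cycle_bimodule :: "('r, 'c) dg_coring \<Rightarrow> nat \<Rightarrow> ('r, 'c) bimodule" where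
  "cycle_bimodule D n = (ccomp D n)\<lparr>carrier := cycles D n\<rparr>"

definition homology :: "('r, 'c) dg_coring \<Rightarrow> nat \<Rightarrow> ('r, 'c set) bimodule" where
  "homology D n = quot_bimodule (cycle_bimodule D n) (boundaries D n)"

text \<open>The \<open>(p, n - p)\<close>-component of \<open>(D \<otimes> D)\<^sub>n\<close> is \<open>D\<^sub>p \<otimes> D\<^sub>n\<^sub>-\<^sub>p\<close>, and the differential of \<open>D \<otimes> D\<close>
  is \<open>d(x \<otimes> y) = dx \<otimes> y + (-1)\<^sup>p x \<otimes> dy\<close> for \<open>x \<in> D\<^sub>p\<close>.
  Below, \<open>w\<close> is an element of \<open>(D \<otimes> D)\<^sub>n\<^sub>+\<^sub>1\<close>, given by its components \<open>w p\<close> for \<open>p \<le> n + 1\<close>.\<close>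

definition tensor_diff ::
  "('r, 'k) ring_scheme \<Rightarrow> ('r, 'c) dg_coring \<Rightarrow> nat \<Rightarrow> (nat \<Rightarrow> (('c \<times> 'c) \<Rightarrow>\<^sub>0 int) set)
    \<Rightarrow> nat \<Rightarrow> (('c \<times> 'c) \<Rightarrow>\<^sub>0 int) set" where
  "tensor_diff R D n w p =
     tensor_map R (ccomp D p) (ccomp D (n - p)) (diff D (Suc p)) (\<lambda>y. y) (w (Suc p))
     \<oplus>\<^bsub>tensor R (ccomp D p) (ccomp D (n - p))\<^esub>
     [((-1::int) ^ p)] \<cdot>\<^bsub>tensor R (ccomp D p) (ccomp D (n - p))\<^esub>
       tensor_map R (ccomp D p) (ccomp D (n - p)) (\<lambda>x. x) (diff D (Suc n - p)) (w p)"

text \<open>The Kuenneth map \<open>H\<^sub>p(D) \<otimes> H\<^sub>q(D) \<rightarrow> H\<^sub>p\<^sub>+\<^sub>q(D \<otimes> D)\<close> sends \<open>[x] \<otimes> [y]\<close> to \<open>[x \<otimes> y]\<close>.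
  For a cycle \<open>x\<close> of degree \<open>n\<close>, \<open>kunneth_components R D n x \<tau>\<close> states that the sum over \<open>p \<le> n\<close> of the
  images of \<open>\<tau> p \<in> H\<^sub>p(D) \<otimes> H\<^sub>n\<^sub>-\<^sub>p(D)\<close> under these maps is the homology class of
  \<open>\<Delta>(x) \<in> (D \<otimes> D)\<^sub>n\<close>; here \<open>u p\<close> is a representative of \<open>\<tau> p\<close> in the tensor product of cycles.\<close>

definition kunneth_components ::
  "('r, 'k) ring_scheme \<Rightarrow> ('r, 'c) dg_coring \<Rightarrow> nat \<Rightarrow> 'c
    \<Rightarrow> (nat \<Rightarrow> (('c set \<times> 'c set) \<Rightarrow>\<^sub>0 int) set) \<Rightarrow> bool" where
  "kunneth_components R D n x \<tau> \<longleftrightarrow> (\<exists>u w.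
     (\<forall>p\<le>n. u p \<in> carrier (tensor R (cycle_bimodule D p) (cycle_bimodule D (n - p))) \<and>
        \<tau> p = tensor_map R (homology D p) (homology D (n - p))
          (\<lambda>z. boundaries D p +>\<^bsub>ccomp D p\<^esub> z) (\<lambda>z. boundaries D (n - p) +>\<^bsub>ccomp D (n - p)\<^esub> z) (u p)) \<and>
     (\<forall>p\<le>Suc n. w p \<in> carrier (tensor R (ccomp D p) (ccomp D (Suc n - p)))) \<and>
     (\<forall>p\<le>n. comult D p (n - p) x =
        tensor_map R (ccomp D p) (ccomp D (n - p)) (\<lambda>z. z) (\<lambda>z. z) (u p)
        \<oplus>\<^bsub>tensor R (ccomp D p) (ccomp D (n - p))\<^esub> tensor_diff R D n w p))"

text \<open>Over a semisimple ring the sum of the Kuenneth maps is bijective, which makes the homology of a DG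
  coring a graded coring: its comultiplication is the map induced by \<open>\<Delta>\<close> in homology followed by the
  inverse of the Kuenneth isomorphism.\<close>

definition homology_coring ::
  "('r, 'k) ring_scheme \<Rightarrow> ('r, 'c) dg_coring \<Rightarrow> ('r, 'c set) graded_coring" where
  "homology_coring R D = \<lparr>ccomp = homology D,
     comult = (\<lambda>p q X. THE t. \<exists>x\<in>X. \<exists>\<tau>. kunneth_components R D (p + q) x \<tau> \<and> \<tau> p = t),
     counit = (\<lambda>X. the_elem (counit D ` X))\<rparr>"

definition codiff ::
  "('r, 'c) dg_coring \<Rightarrow> nat \<Rightarrow> ('c \<Rightarrow> 'r) \<Rightarrow> 'c \<Rightarrow> 'r" where
  "codiff D n f = (\<lambda>x\<in>carrier (ccomp D (Suc n)). f (diff D (Suc n) x))"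

definition cocycles :: "('r, 'k) ring_scheme \<Rightarrow> ('r, 'c) dg_coring \<Rightarrow> nat \<Rightarrow> ('c \<Rightarrow> 'r) set" where
  "cocycles R D n = {f \<in> carrier (left_dual R (ccomp D n)).
     codiff D n f = \<zero>\<^bsub>left_dual R (ccomp D (Suc n))\<^esub>}"

definition coboundaries :: "('r, 'k) ring_scheme \<Rightarrow> ('r, 'c) dg_coring \<Rightarrow> nat \<Rightarrow> ('c \<Rightarrow> 'r) set" where
  "coboundaries R D n = (case n of
     0 \<Rightarrow> {\<zero>\<^bsub>left_dual R (ccomp D 0)\<^esub>}
   | Suc m \<Rightarrow> codiff D m ` carrier (left_dual R (ccomp D m)))"

definition cohomology_ring ::
  "('r, 'k) ring_scheme \<Rightarrow> ('r, 'c) dg_coring \<Rightarrow> ('c \<Rightarrow> 'r) set graded_ring" where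
  "cohomology_ring R D = \<lparr>
     rcomp = (\<lambda>n. \<lparr>carrier = a_rcosets\<^bsub>(left_dual R (ccomp D n))\<lparr>carrier := cocycles R D n\<rparr>\<^esub> (coboundaries R D n),
        mult = undefined, one = undefined, zero = coboundaries R D n,
        add = set_add (left_dual R (ccomp D n))\<rparr>),
     gmult = (\<lambda>m n X Y. \<Union>f\<in>X. \<Union>g\<in>Y.
        coboundaries R D (m + n) +>\<^bsub>left_dual R (ccomp D (m + n))\<^esub> convolution R D m n f g),
     gone = coboundaries R D 0 +>\<^bsub>left_dual R (ccomp D 0)\<^esub> gone (graded_dual R D)\<rparr>"


section \<open>The normalised bar complex, \<open>Tor\<close> and \<open>Ext\<close>\<close>

definition bar_comp ::
  "('r, 'k) ring_scheme \<Rightarrow> ('r, 'a) graded_bimodule \<Rightarrow> nat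
    \<Rightarrow> ('r, (('r \<times> 'a list) \<Rightarrow>\<^sub>0 int) set) bimodule" where
  "bar_comp R A n = tensor_power R (plus_part A) n"

text \<open>Indices start at \<open>0\<close>, so that the term multiplying entries \<open>i\<close> and \<open>i + 1\<close> has sign \<open>(-1)\<^sup>i\<close>.\<close>

definition bar_diff ::
  "('r, 'k) ring_scheme \<Rightarrow> ('r, 'a) graded_bimodule \<Rightarrow> nat
    \<Rightarrow> (('r \<times> 'a list) \<Rightarrow>\<^sub>0 int) set \<Rightarrow> (('r \<times> 'a list) \<Rightarrow>\<^sub>0 int) set" where
  "bar_diff R A n = lift (bar_comp R A (n - 1)) (\<lambda>(r, as).
     \<Oplus>\<^bsub>bar_comp R A (n - 1)\<^esub>i\<in>{..<n - 1}. [((-1::int) ^ i)] \<cdot>\<^bsub>bar_comp R A (n - 1)\<^esub>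
       pword R (plus_part A) r (take i as @ [as ! i \<otimes>\<^bsub>A\<^esub> as ! Suc i] @ drop (i + 2) as))"

definition bar_coring ::
  "('r, 'k) ring_scheme \<Rightarrow> ('r, 'a) graded_bimodule
    \<Rightarrow> ('r, (('r \<times> 'a list) \<Rightarrow>\<^sub>0 int) set) dg_coring" where
  "bar_coring R A = \<lparr>ccomp = bar_comp R A,
     comult = (\<lambda>p q. lift (tensor R (bar_comp R A p) (bar_comp R A q)) (\<lambda>(r, as).
        tens R (bar_comp R A p) (bar_comp R A q)
          (pword R (plus_part A) r (take p as)) (pword R (plus_part A) \<one>\<^bsub>R\<^esub> (drop p as)))),
     counit = lift R (\<lambda>(r, as). r),
     diff = bar_diff R A\<rparr>"

definition Tor_coring ::
  "('r, 'k) ring_scheme \<Rightarrow> ('r, 'a) graded_bimodule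
    \<Rightarrow> ('r, (('r \<times> 'a list) \<Rightarrow>\<^sub>0 int) set set) graded_coring" where
  "Tor_coring R A = homology_coring R (bar_coring R A)"

definition Ext_ring ::
  "('r, 'k) ring_scheme \<Rightarrow> ('r, 'a) graded_bimodule
    \<Rightarrow> ((('r \<times> 'a list) \<Rightarrow>\<^sub>0 int) set \<Rightarrow> 'r) set graded_ring" where
  "Ext_ring R A = cohomology_ring R (bar_coring R A)"


section \<open>Koszul pairs\<close>

definition almost_koszul_pair ::
  "('r, 'k) ring_scheme \<Rightarrow> ('r, 'a) graded_bimodule \<Rightarrow> ('r, 'c) graded_coring \<Rightarrow> ('c \<Rightarrow> 'a) \<Rightarrow> bool" where
  "almost_koszul_pair R A C \<theta> \<longleftrightarrow>
     graded_R_ring R A \<and> connected_ring R A \<and> graded_coring R C \<and> connected_coring R C \<and>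
     \<theta> \<in> bimodule_hom R (ccomp C 1) (A\<lparr>carrier := hcomp A 1\<rparr>) \<and>
     bij_betw \<theta> (carrier (ccomp C 1)) (hcomp A 1) \<and>
     (\<forall>c\<in>carrier (ccomp C 2). lift A (\<lambda>(x, y). \<theta> x \<otimes>\<^bsub>A\<^esub> \<theta> y) (comult C 1 1 c) = \<zero>\<^bsub>A\<^esub>)"

definition koszul_comp ::
  "('r, 'k) ring_scheme \<Rightarrow> ('r, 'a) graded_bimodule \<Rightarrow> ('r, 'c) graded_coring \<Rightarrow> nat
    \<Rightarrow> ('r, (('a \<times> 'c) \<Rightarrow>\<^sub>0 int) set) bimodule" where
  "koszul_comp R A C n = tensor R A (ccomp C n)"

definition koszul_diff ::
  "('r, 'k) ring_scheme \<Rightarrow> ('r, 'a) graded_bimodule \<Rightarrow> ('r, 'c) graded_coring \<Rightarrow> ('c \<Rightarrow> 'a) \<Rightarrow> nat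
    \<Rightarrow> (('a \<times> 'c) \<Rightarrow>\<^sub>0 int) set \<Rightarrow> (('a \<times> 'c) \<Rightarrow>\<^sub>0 int) set" where
  "koszul_diff R A C \<theta> n = lift (koszul_comp R A C (n - 1)) (\<lambda>(a, c).
     lift (koszul_comp R A C (n - 1))
       (\<lambda>(x, y). tens R A (ccomp C (n - 1)) (a \<otimes>\<^bsub>A\<^esub> \<theta> x) y) (comult C 1 (n - 1) c))"

definition koszul_augmentation ::
  "('r, 'k) ring_scheme \<Rightarrow> ('r, 'a) graded_bimodule \<Rightarrow> ('r, 'c) graded_coring
    \<Rightarrow> (('a \<times> 'c) \<Rightarrow>\<^sub>0 int) set \<Rightarrow> 'r" where
  "koszul_augmentation R A C = lift R (\<lambda>(a, c). proj0 R A a \<otimes>\<^bsub>R\<^esub> counit C c)"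

definition koszul_pair ::
  "('r, 'k) ring_scheme \<Rightarrow> ('r, 'a) graded_bimodule \<Rightarrow> ('r, 'c) graded_coring \<Rightarrow> ('c \<Rightarrow> 'a) \<Rightarrow> bool" where
  "koszul_pair R A C \<theta> \<longleftrightarrow> almost_koszul_pair R A C \<theta> \<and>
     koszul_augmentation R A C ` carrier (koszul_comp R A C 0) = carrier R \<and>
     a_kernel (koszul_comp R A C 0) R (koszul_augmentation R A C) =
       koszul_diff R A C \<theta> 1 ` carrier (koszul_comp R A C 1) \<and>
     (\<forall>n\<ge>1. a_kernel (koszul_comp R A C n) (koszul_comp R A C (n - 1)) (koszul_diff R A C \<theta> n) =
       koszul_diff R A C \<theta> (n + 1) ` carrier (koszul_comp R A C (n + 1)))"


section \<open>The canonical morphisms\<close>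

text \<open>The iterated comultiplication \<open>C\<^sub>n \<rightarrow> C\<^sub>1\<^sup>(\<^sup>n\<^sup>)\<close>; in degree \<open>0\<close> it is the identification \<open>C\<^sub>0 = R\<close>.\<close>

fun iter_comult ::
  "('r, 'k) ring_scheme \<Rightarrow> ('r, 'c) graded_coring \<Rightarrow> nat \<Rightarrow> 'c \<Rightarrow> (('r \<times> 'c list) \<Rightarrow>\<^sub>0 int) set" where
  "iter_comult R C 0 c = pword R (ccomp C 1) (counit C c) []"
| "iter_comult R C (Suc n) c = lift (tensor_power R (ccomp C 1) (Suc n)) (\<lambda>(x, y).
     lift (tensor_power R (ccomp C 1) (Suc n)) (\<lambda>(r, xs). pword R (ccomp C 1) r (xs @ [y]))
       (iter_comult R C n x)) (comult C n 1 c)"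

text \<open>\<open>c \<mapsto> \<theta>(c\<^sub>1\<^sub>,\<^sub>1) \<otimes> \<dots> \<otimes> \<theta>(c\<^sub>n\<^sub>,\<^sub>1)\<close>\<close>

definition coring_to_bar ::
  "('r, 'k) ring_scheme \<Rightarrow> ('r, 'a) graded_bimodule \<Rightarrow> ('r, 'c) graded_coring \<Rightarrow> ('c \<Rightarrow> 'a) \<Rightarrow> nat
    \<Rightarrow> 'c \<Rightarrow> (('r \<times> 'a list) \<Rightarrow>\<^sub>0 int) set" where
  "coring_to_bar R A C \<theta> n c =
     lift (bar_comp R A n) (\<lambda>(r, xs). pword R (plus_part A) r (map \<theta> xs)) (iter_comult R C n c)"

definition phi_cochain ::
  "('r, 'k) ring_scheme \<Rightarrow> ('r, 'a) graded_bimodule \<Rightarrow> ('r, 'c) graded_coring \<Rightarrow> ('c \<Rightarrow> 'a) \<Rightarrow> nat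
    \<Rightarrow> ((('r \<times> 'a list) \<Rightarrow>\<^sub>0 int) set \<Rightarrow> 'r) \<Rightarrow> 'c \<Rightarrow> 'r" where
  "phi_cochain R A C \<theta> n f = (\<lambda>c\<in>carrier (ccomp C n). f (coring_to_bar R A C \<theta> n c))"

definition phi ::
  "('r, 'k) ring_scheme \<Rightarrow> ('r, 'a) graded_bimodule \<Rightarrow> ('r, 'c) graded_coring \<Rightarrow> ('c \<Rightarrow> 'a) \<Rightarrow> nat
    \<Rightarrow> ((('r \<times> 'a list) \<Rightarrow>\<^sub>0 int) set \<Rightarrow> 'r) set \<Rightarrow> 'c \<Rightarrow> 'r" where
  "phi R A C \<theta> n X = the_elem (phi_cochain R A C \<theta> n ` X)"

text \<open>The canonical isomorphism of graded corings \<open>C \<rightarrow> T(A)\<close> of a Koszul pair, and the map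
  \<open>\<E>(A) \<rightarrow> \<^sup>*T(A)\<close> obtained from \<open>phi\<close> by transport along it.\<close>

definition coring_to_Tor ::
  "('r, 'k) ring_scheme \<Rightarrow> ('r, 'a) graded_bimodule \<Rightarrow> ('r, 'c) graded_coring \<Rightarrow> ('c \<Rightarrow> 'a) \<Rightarrow> nat
    \<Rightarrow> 'c \<Rightarrow> (('r \<times> 'a list) \<Rightarrow>\<^sub>0 int) set set" where
  "coring_to_Tor R A C \<theta> n c =
     boundaries (bar_coring R A) n +>\<^bsub>bar_comp R A n\<^esub> coring_to_bar R A C \<theta> n c"

definition phi_Tor ::
  "('r, 'k) ring_scheme \<Rightarrow> ('r, 'a) graded_bimodule \<Rightarrow> ('r, 'c) graded_coring \<Rightarrow> ('c \<Rightarrow> 'a) \<Rightarrow> nat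
    \<Rightarrow> ((('r \<times> 'a list) \<Rightarrow>\<^sub>0 int) set \<Rightarrow> 'r) set \<Rightarrow> (('r \<times> 'a list) \<Rightarrow>\<^sub>0 int) set set \<Rightarrow> 'r" where
  "phi_Tor R A C \<theta> n X = (\<lambda>t\<in>carrier (ccomp (Tor_coring R A) n).
     phi R A C \<theta> n X (inv_into (carrier (ccomp C n)) (coring_to_Tor R A C \<theta> n) t))"

end

theory Submission
  imports Defs
begin

text \<open>Over a semisimple ring every left module is projective, so the Koszul complex \<open>A \<otimes> C\<close> and the
  normalised bar complex \<open>A \<otimes> A\<^sub>+\<^sup>(\<^sup>\<bullet>\<^sup>)\<close> are both projective resolutions of \<open>R\<close>.  The coring
  map \<open>C\<^sub>n \<rightarrow> A\<^sub>+\<^sup>(\<^sup>n\<^sup>)\<close> that applies \<open>\<theta>\<close> to the iterated comultiplication induces a chain map from the first to the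
  second.  Splitting the Koszul differential left \<open>R\<close>-linearly gives a comparison map in the other direction, and
  after applying \<open>R \<otimes>\<^sub>A _\<close> a left \<open>R\<close>-linear retraction \<open>gb\<close> of the bar complex onto \<open>C\<close> with zero differential, together with
  a left \<open>R\<close>-linear homotopy.  Being left linear, the homotopy survives both in homology and after taking left duals, so
  \<open>C \<rightarrow> T(A)\<close> and \<open>\<phi>\<close> are bijective.  Multiplicativity of \<open>\<phi>\<close> is the compatibility of \<open>C \<rightarrow> A\<^sub>+\<^sup>(\<^sup>\<bullet>\<^sup>)\<close> with
  comultiplications.  That the Kuenneth components of a class in \<open>T(A)\<close> are uniquely determined is tested by contracting
  with left linear functionals on \<open>C\<^sub>q\<close>, which suffices because the finitely generated projective module
  \<open>C\<^sub>q\<close> has a dual basis.\<close>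

section \<open>Additive, left linear and right linear maps\<close>

text \<open>Semisimplicity of \<open>R\<close> splits the Koszul differential left linearly, but
  \<open>R \<otimes> R^op\<close> need not be semisimple, so in general there is no splitting by
  bimodule maps. Hence the retraction \<open>gb\<close> is only left linear, and
  \<open>gb \<otimes> gb\<close>, which would compare the comultiplications at once, is not even
  defined on \<open>Om p \<otimes> Om q\<close>. Two facts replace it: on cycles \<open>gb\<close>
  is right linear after all, because there it inverts \<open>ctb\<close> up to boundaries; and in
  the second factor a left linear functional composed with \<open>gb\<close> suffices. The map
  \<open>ctb\<close> in the opposite direction is a strict bimodule map and strictly compatible with
  the comultiplications, so all multiplicative statements are derived from it. The bar resolution
  \<open>A \<otimes> Om n\<close> is never formed. Its \<open>A\<close>-linear maps are recorded by
  their values on \<open>1 \<otimes> Om n\<close>, and every map on the bar complex is given by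
  recursion on the first letter instead of alternating sums. Neither \<open>Ext_ring\<close> nor
  \<open>Tor_coring\<close> is shown to satisfy its axioms by itself: the axioms are carried over
  along the bijections to and from the structures on the side of \<open>C\<close>.\<close>

definition add_hom :: "('m, 'k) ring_scheme \<Rightarrow> ('n, 'l) ring_scheme \<Rightarrow> ('m \<Rightarrow> 'n) set" where
  "add_hom M N = {f \<in> carrier M \<rightarrow> carrier N.
     \<forall>x\<in>carrier M. \<forall>y\<in>carrier M. f (x \<oplus>\<^bsub>M\<^esub> y) = f x \<oplus>\<^bsub>N\<^esub> f y}"

definition left_hom ::
  "('r, 'k) ring_scheme \<Rightarrow> ('r, 'm, 'l) module_scheme \<Rightarrow> ('r, 'n, 'l2) module_scheme \<Rightarrow> ('m \<Rightarrow> 'n) set" where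
  "left_hom R M N = {f \<in> add_hom M N. \<forall>r\<in>carrier R. \<forall>x\<in>carrier M. f (r \<odot>\<^bsub>M\<^esub> x) = r \<odot>\<^bsub>N\<^esub> f x}"

definition right_hom ::
  "('r, 'k) ring_scheme \<Rightarrow> ('r, 'm, 'l) bimodule_scheme \<Rightarrow> ('r, 'n, 'l2) bimodule_scheme \<Rightarrow> ('m \<Rightarrow> 'n) set" where
  "right_hom R M N = {f \<in> add_hom M N. \<forall>r\<in>carrier R. \<forall>x\<in>carrier M. f (x \<triangleleft>\<^bsub>M\<^esub> r) = f x \<triangleleft>\<^bsub>N\<^esub> r}"

lemma add_homI:
  assumes "\<And>x. x \<in> carrier M \<Longrightarrow> f x \<in> carrier N"
    and "\<And>x y. x \<in> carrier M \<Longrightarrow> y \<in> carrier M \<Longrightarrow> f (x \<oplus>\<^bsub>M\<^esub> y) = f x \<oplus>\<^bsub>N\<^esub> f y"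
  shows "f \<in> add_hom M N"
  using assms by (auto simp: add_hom_def)

lemma add_hom_closed: "f \<in> add_hom M N \<Longrightarrow> x \<in> carrier M \<Longrightarrow> f x \<in> carrier N"
  by (auto simp: add_hom_def)

lemma add_hom_add:
  "f \<in> add_hom M N \<Longrightarrow> x \<in> carrier M \<Longrightarrow> y \<in> carrier M \<Longrightarrow> f (x \<oplus>\<^bsub>M\<^esub> y) = f x \<oplus>\<^bsub>N\<^esub> f y"
  by (auto simp: add_hom_def)

lemma add_hom_group_hom:
  "f \<in> add_hom M N \<Longrightarrow> abelian_group M \<Longrightarrow> abelian_group N \<Longrightarrow> abelian_group_hom M N f"
  by (auto simp: add_hom_def intro!: abelian_group_homI group_hom.intro group_hom_axioms.intro homI
      abelian_group.a_group)

lemma add_hom_zero: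
  "f \<in> add_hom M N \<Longrightarrow> abelian_group M \<Longrightarrow> abelian_group N \<Longrightarrow> f \<zero>\<^bsub>M\<^esub> = \<zero>\<^bsub>N\<^esub>"
  by (rule abelian_group_hom.hom_zero[OF add_hom_group_hom])

lemma add_hom_a_inv:
  "f \<in> add_hom M N \<Longrightarrow> abelian_group M \<Longrightarrow> abelian_group N \<Longrightarrow> x \<in> carrier M \<Longrightarrow>
    f (\<ominus>\<^bsub>M\<^esub> x) = \<ominus>\<^bsub>N\<^esub> f x"
  by (rule abelian_group_hom.hom_a_inv[OF add_hom_group_hom])

lemma add_hom_minus:
  "f \<in> add_hom M N \<Longrightarrow> abelian_group M \<Longrightarrow> abelian_group N \<Longrightarrow> x \<in> carrier M \<Longrightarrow> y \<in> carrier M \<Longrightarrow>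
    f (x \<ominus>\<^bsub>M\<^esub> y) = f x \<ominus>\<^bsub>N\<^esub> f y"
  by (simp add: a_minus_def add_hom_add add_hom_a_inv abelian_group.a_inv_closed)

lemma add_hom_comp: "f \<in> add_hom M N \<Longrightarrow> g \<in> add_hom N P \<Longrightarrow> (\<lambda>x. g (f x)) \<in> add_hom M P"
  by (auto simp: add_hom_def Pi_iff)

lemma add_hom_plus:
  assumes "f \<in> add_hom M N" "g \<in> add_hom M N" "abelian_group N"
  shows "(\<lambda>x. f x \<oplus>\<^bsub>N\<^esub> g x) \<in> add_hom M N"
proof -
  interpret N: abelian_group N by fact
  show ?thesis
    using assms by (intro add_homI) (auto simp: add_hom_add add_hom_closed N.a_ac)
qed

lemma add_hom_uminus:
  assumes "f \<in> add_hom M N" "abelian_group N"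
  shows "(\<lambda>x. \<ominus>\<^bsub>N\<^esub> f x) \<in> add_hom M N"
proof -
  interpret N: abelian_group N by fact
  show ?thesis
    using assms by (intro add_homI) (auto simp: add_hom_add add_hom_closed N.minus_add)
qed

lemma add_hom_diff:
  "f \<in> add_hom M N \<Longrightarrow> g \<in> add_hom M N \<Longrightarrow> abelian_group N \<Longrightarrow> (\<lambda>x. f x \<ominus>\<^bsub>N\<^esub> g x) \<in> add_hom M N"
  by (simp add: a_minus_def add_hom_plus add_hom_uminus)

lemma add_hom_zero_map: "abelian_group N \<Longrightarrow> (\<lambda>x. \<zero>\<^bsub>N\<^esub>) \<in> add_hom M N"
  by (auto intro!: add_homI simp: abelian_group.axioms abelian_monoid.zero_closed abelian_monoid.l_zero)

lemma add_hom_ident: "(\<lambda>x. x) \<in> add_hom M M"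
  by (auto intro!: add_homI)

lemma left_homD: "f \<in> left_hom R M N \<Longrightarrow> f \<in> add_hom M N"
  by (simp add: left_hom_def)

lemma left_hom_smult:
  "f \<in> left_hom R M N \<Longrightarrow> r \<in> carrier R \<Longrightarrow> x \<in> carrier M \<Longrightarrow> f (r \<odot>\<^bsub>M\<^esub> x) = r \<odot>\<^bsub>N\<^esub> f x"
  by (simp add: left_hom_def)

lemma left_homI:
  "f \<in> add_hom M N \<Longrightarrow> (\<And>r x. r \<in> carrier R \<Longrightarrow> x \<in> carrier M \<Longrightarrow> f (r \<odot>\<^bsub>M\<^esub> x) = r \<odot>\<^bsub>N\<^esub> f x) \<Longrightarrow>
    f \<in> left_hom R M N"
  by (simp add: left_hom_def)

lemma left_hom_comp: "f \<in> left_hom R M N \<Longrightarrow> g \<in> left_hom R N P \<Longrightarrow> (\<lambda>x. g (f x)) \<in> left_hom R M P"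
  by (auto simp: left_hom_def add_hom_comp add_hom_closed)

lemma right_homD: "f \<in> right_hom R M N \<Longrightarrow> f \<in> add_hom M N"
  by (simp add: right_hom_def)

lemma right_hom_rsmult:
  "f \<in> right_hom R M N \<Longrightarrow> r \<in> carrier R \<Longrightarrow> x \<in> carrier M \<Longrightarrow> f (x \<triangleleft>\<^bsub>M\<^esub> r) = f x \<triangleleft>\<^bsub>N\<^esub> r"
  by (simp add: right_hom_def)

lemma right_homI:
  "f \<in> add_hom M N \<Longrightarrow> (\<And>r x. r \<in> carrier R \<Longrightarrow> x \<in> carrier M \<Longrightarrow> f (x \<triangleleft>\<^bsub>M\<^esub> r) = f x \<triangleleft>\<^bsub>N\<^esub> r) \<Longrightarrow>
    f \<in> right_hom R M N"
  by (simp add: right_hom_def)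

lemma bimodule_hom_iff: "f \<in> bimodule_hom R M N \<longleftrightarrow> f \<in> left_hom R M N \<and> f \<in> right_hom R M N"
  by (auto simp: bimodule_hom_def left_hom_def right_hom_def add_hom_def)

lemma bimodule_homD:
  assumes "f \<in> bimodule_hom R M N"
  shows "f \<in> left_hom R M N" "f \<in> right_hom R M N" "f \<in> add_hom M N"
  using assms by (auto simp: bimodule_hom_iff left_homD)

lemma left_module_abelian: "left_module R M \<Longrightarrow> abelian_group M"
  by (simp add: left_module_def)

lemma bimodule_left_module: "bimodule R M \<Longrightarrow> left_module R M"
  by (simp add: bimodule_def)

lemma bimodule_abelian: "bimodule R M \<Longrightarrow> abelian_group M"
  by (blast dest: bimodule_left_module left_module_abelian)

lemma bimodule_ring: "bimodule R M \<Longrightarrow> ring R"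
  by (simp add: bimodule_def left_module_def)

lemma ring_abelian: "ring R \<Longrightarrow> abelian_group R"
  by (rule ring.is_abelian_group)

lemma (in bimodule) smult_hom: "r \<in> carrier R \<Longrightarrow> (\<lambda>x. r \<odot>\<^bsub>M\<^esub> x) \<in> add_hom M M"
  by (auto intro!: add_homI simp: smult_closed smult_r_distr)

lemma (in bimodule) rsmult_hom: "r \<in> carrier R \<Longrightarrow> (\<lambda>x. x \<triangleleft>\<^bsub>M\<^esub> r) \<in> add_hom M M"
  by (auto intro!: add_homI simp: rsmult_closed rsmult_l_distr)

lemma regular_bimodule_sel [simp]:
  "carrier (regular_bimodule R) = carrier R" "add (regular_bimodule R) = add R"
  "zero (regular_bimodule R) = zero R" "smult (regular_bimodule R) = mult R"
  "rsmult (regular_bimodule R) = mult R"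
  by (simp_all add: regular_bimodule_def)

lemma regular_bimodule:
  assumes "ring R" shows "bimodule R (regular_bimodule R)"
proof -
  interpret R: ring R by fact
  have "abelian_group (regular_bimodule R)"
    by (rule abelian_groupI) (auto simp: R.a_ac intro: R.l_neg R.a_inv_closed)
  then show ?thesis
    by (intro bimodule.intro left_module.intro bimodule_axioms.intro left_module_axioms.intro)
      (auto simp: assms R.l_distr R.r_distr R.m_assoc)
qed

lemma add_hom_finsum:
  assumes f: "f \<in> add_hom M N" and M: "abelian_group M" and N: "abelian_group N"
    and I: "finite I" "\<And>i. i \<in> I \<Longrightarrow> x i \<in> carrier M"
  shows "f (\<Oplus>\<^bsub>M\<^esub>i\<in>I. x i) = (\<Oplus>\<^bsub>N\<^esub>i\<in>I. f (x i))"
proof -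
  interpret M: abelian_group M by (rule M)
  interpret N: abelian_group N by (rule N)
  show ?thesis using I
  proof (induction I)
    case empty
    then show ?case by (simp add: add_hom_zero[OF f M N])
  next
    case (insert i I)
    then show ?case
      by (simp add: M.finsum_insert N.finsum_insert Pi_iff add_hom_add[OF f] M.finsum_closed add_hom_closed[OF f])
  qed
qed

lemma add_hom_int_pow:
  assumes f: "f \<in> add_hom M N" and M: "abelian_group M" and N: "abelian_group N" and x: "x \<in> carrier M"
  shows "f ([(k::int)] \<cdot>\<^bsub>M\<^esub> x) = [k] \<cdot>\<^bsub>N\<^esub> f x"
proof -
  interpret abelian_group_hom M N f by (rule add_hom_group_hom[OF f M N])
  show ?thesis unfolding add_pow_def
    using group_hom.hom_int_pow[OF a_group_hom, of x k] x by simp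
qed

section \<open>Quotients and presented bimodules\<close>

lemma (in abelian_subgroup) coset_eq_iff:
  assumes "x \<in> carrier G" "y \<in> carrier G"
  shows "H +> x = H +> y \<longleftrightarrow> x \<ominus> y \<in> H"
proof
  assume "H +> x = H +> y"
  then have "H +> (x \<ominus> y) = H" using assms a_subset a_coset_add_inv2 by (simp add: a_minus_def)
  then show "x \<ominus> y \<in> H" using assms a_subgroup a_coset_join1 by simp
next
  assume "x \<ominus> y \<in> H"
  then have "H +> (x \<ominus> y) = H" using assms a_subgroup a_coset_join2 by simp
  then show "H +> x = H +> y" using assms a_subset a_coset_add_inv1 by (simp add: a_minus_def)
qed

lemma (in abelian_subgroup) mem_coset_iff:
  assumes "x \<in> carrier G"
  shows "y \<in> H +> x \<longleftrightarrow> y \<in> carrier G \<and> H +> y = H +> x"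
  using assms a_subset a_subgroup
  by (metis a_r_coset_subset_G a_rcos_self a_repr_independence subsetD)

lemma (in abelian_subgroup) mem_coset_iff':
  assumes "x \<in> carrier G"
  shows "y \<in> H +> x \<longleftrightarrow> y \<in> carrier G \<and> y \<ominus> x \<in> H"
  using assms by (metis mem_coset_iff coset_eq_iff)

lemma rcosets_iff: "X \<in> a_rcosets\<^bsub>G\<^esub> H \<longleftrightarrow> (\<exists>x\<in>carrier G. X = H +>\<^bsub>G\<^esub> x)"
  by (auto simp: A_RCOSETS_def')

text \<open>Phrased for an arbitrary record \<open>Q\<close> carrying the coset structure, because
  quotients occur in several record types: presented bimodules, homology, and the components of
  \<open>Ext_ring\<close>.\<close>

lemma (in abelian_subgroup) quotient_abelian_group:
  assumes "carrier Q = a_rcosets H" "zero Q = H" "add Q = set_add G"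
  shows "abelian_group Q"
proof (rule abelian_groupI)
  show "\<exists>y\<in>carrier Q. y \<oplus>\<^bsub>Q\<^esub> x = \<zero>\<^bsub>Q\<^esub>" if x: "x \<in> carrier Q" for x
  proof -
    obtain a where a: "a \<in> carrier G" "x = H +> a" using x unfolding assms(1) rcosets_iff by auto
    then have "(H +> (\<ominus> a)) <+> x = H" by (simp add: a_rcos_sum l_neg a_subset)
    then show ?thesis using a assms a_rcosetsI[OF a_subset, of "\<ominus> a"] by auto
  qed
  show "\<zero>\<^bsub>Q\<^esub> \<in> carrier Q" by (simp add: assms a_subgroup_in_rcosets)
  show "x \<oplus>\<^bsub>Q\<^esub> y = y \<oplus>\<^bsub>Q\<^esub> x" if "x \<in> carrier Q" "y \<in> carrier Q" for x y
    using that unfolding assms rcosets_iff by (auto simp only: a_rcos_sum a_comm)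
qed (simp_all add: assms a_setmult_closed rcosets_add_eq a_rcosets_assoc)

lemma quot_bimodule_sel [simp]:
  "carrier (quot_bimodule M N) = a_rcosets\<^bsub>M\<^esub> N" "zero (quot_bimodule M N) = N"
  "add (quot_bimodule M N) = set_add M"
  by (simp_all add: quot_bimodule_def)

context abelian_subgroup
begin

text \<open>A scalar acts on a quotient by a union over all representatives. An additive
  \<open>f\<close> that preserves \<open>H\<close> sends all of them into one coset, so the union
  collapses to that coset.\<close>

lemma quot_smult_coset:
  fixes f
  assumes "f \<in> add_hom G G" "f ` H \<subseteq> H" "x \<in> carrier G"
  shows "(\<Union>x\<in>H +> x. H +> f x) = H +> f x"
proof -
  have "H +> f y = H +> f x" if "y \<in> H +> x" for y
  proof -
    from that assms have y: "y \<in> carrier G" "y \<ominus> x \<in> H" by (simp_all add: mem_coset_iff')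
    then have "f (y \<ominus> x) \<in> H" using assms by blast
    then have "f y \<ominus> f x \<in> H" using y assms
      by (simp add: add_hom_minus[OF assms(1) abelian_group_axioms abelian_group_axioms])
    then show ?thesis using y assms by (simp add: coset_eq_iff add_hom_closed[OF assms(1)])
  qed
  moreover have "x \<in> H +> x" using assms by (simp add: a_rcos_self)
  ultimately show ?thesis by blast
qed

end

section \<open>Evaluation of formal sums, and groups given by generators and relations\<close>

lemma frag_eval_superset:
  fixes X (structure)
  assumes "abelian_group X" "finite T" "Poly_Mapping.keys t \<subseteq> T" "f \<in> T \<rightarrow> carrier X"
  shows "frag_eval X f t = (\<Oplus>\<^bsub>X\<^esub>w\<in>T. [Poly_Mapping.lookup t w] \<cdot>\<^bsub>X\<^esub> f w)"
proof -
  interpret X: abelian_group X by fact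
  have "[(0::int)] \<cdot>\<^bsub>X\<^esub> x = \<zero>" for x by (simp add: add_pow_def)
  then show ?thesis unfolding frag_eval_def
    by (intro X.add.finprod_mono_neutral_cong_left) (use assms in \<open>auto simp: in_keys_iff\<close>)
qed

lemma frag_eval_closed:
  assumes "abelian_group X" "Poly_Mapping.keys t \<subseteq> S" "f \<in> S \<rightarrow> carrier X"
  shows "frag_eval X f t \<in> carrier X"
proof -
  interpret X: abelian_group X by fact
  show ?thesis unfolding frag_eval_def
    by (rule X.finsum_closed) (use assms in \<open>auto\<close>)
qed

lemma frag_eval_add:
  assumes "abelian_group X" "Poly_Mapping.keys s \<subseteq> S" "Poly_Mapping.keys t \<subseteq> S" "f \<in> S \<rightarrow> carrier X"
  shows "frag_eval X f (s + t) = frag_eval X f s \<oplus>\<^bsub>X\<^esub> frag_eval X f t"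
proof -
  interpret X: abelian_group X by fact
  let ?T = "Poly_Mapping.keys s \<union> Poly_Mapping.keys t"
  have T: "finite ?T" "f \<in> ?T \<rightarrow> carrier X" "Poly_Mapping.keys (s + t) \<subseteq> ?T"
    using assms keys_add[of s t] by (auto simp: in_keys_iff lookup_add)
  have "frag_eval X f (s + t) =
      (\<Oplus>\<^bsub>X\<^esub>w\<in>?T. [Poly_Mapping.lookup s w] \<cdot>\<^bsub>X\<^esub> f w \<oplus>\<^bsub>X\<^esub> [Poly_Mapping.lookup t w] \<cdot>\<^bsub>X\<^esub> f w)"
    unfolding frag_eval_superset[OF assms(1) T(1,3,2)]
    by (rule X.finsum_cong') (use T in \<open>auto simp: lookup_add X.add.int_pow_mult Pi_iff\<close>)
  also have "\<dots> = frag_eval X f s \<oplus>\<^bsub>X\<^esub> frag_eval X f t"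
    unfolding frag_eval_superset[OF assms(1) T(1) _ T(2), of s, simplified]
      frag_eval_superset[OF assms(1) T(1) _ T(2), of t, simplified]
    by (rule X.finsum_addf) (use T in \<open>auto simp: Pi_iff\<close>)
  finally show ?thesis .
qed

lemma frag_eval_of:
  assumes "abelian_group X" "f w \<in> carrier X"
  shows "frag_eval X f (frag_of w) = f w"
proof -
  interpret X: abelian_group X by fact
  show ?thesis using assms by (simp add: frag_eval_def)
qed

lemma word_module_sel [simp]:
  "carrier (word_module S l r) = {t. Poly_Mapping.keys t \<subseteq> S}" "zero (word_module S l r) = 0"
  "add (word_module S l r) = (+)" "smult (word_module S l r) = (\<lambda>r. frag_extend (\<lambda>w. frag_of (l r w)))"
  "rsmult (word_module S l ra) = (\<lambda>t r. frag_extend (\<lambda>w. frag_of (ra w r)) t)"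
  by (simp_all add: word_module_def)

lemma word_module_abelian: "abelian_group (word_module S l r)"
proof (rule abelian_groupI)
  show "\<exists>y\<in>carrier (word_module S l r). y \<oplus>\<^bsub>word_module S l r\<^esub> x = \<zero>\<^bsub>word_module S l r\<^esub>"
    if "x \<in> carrier (word_module S l r)" for x
    using that by (intro bexI[of _ "- x"]) auto
qed (use keys_add in \<open>fastforce simp: add_ac\<close>)+

lemma frag_eval_hom:
  assumes "abelian_group X" "f \<in> S \<rightarrow> carrier X"
  shows "frag_eval X f \<in> add_hom (word_module S l r) X"
  by (rule add_homI)
    (simp_all add: frag_eval_closed[OF assms(1) _ assms(2)] frag_eval_add[OF assms(1) _ _ assms(2)])

lemma word_module_a_inv:
  "x \<in> carrier (word_module S l r) \<Longrightarrow> \<ominus>\<^bsub>word_module S l r\<^esub> x = - x"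
  by (rule abelian_group.minus_equality[OF word_module_abelian]) auto

text \<open>Common frame for \<open>tensor\<close> and \<open>tensor_power\<close>. The set
  \<open>E\<close> itself is required to be stable under both actions: the operators extend
  additively from words to formal sums and then preserve the generated subgroup, so stability is a
  question about single relations.\<close>

locale presentation = R: ring R
  for R :: "('r, 'k) ring_scheme" and S :: "'w set" and lact :: "'r \<Rightarrow> 'w \<Rightarrow> 'w" and ract
    and E :: "('w \<Rightarrow>\<^sub>0 int) set" +
  assumes lact_closed: "\<And>r w. r \<in> carrier R \<Longrightarrow> w \<in> S \<Longrightarrow> lact r w \<in> S"
    and ract_closed: "\<And>r w. r \<in> carrier R \<Longrightarrow> w \<in> S \<Longrightarrow> ract w r \<in> S"
    and rels_words: "\<And>e. e \<in> E \<Longrightarrow> Poly_Mapping.keys e \<subseteq> S"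
    and rels_lact: "\<And>r e. r \<in> carrier R \<Longrightarrow> e \<in> E \<Longrightarrow> frag_extend (\<lambda>w. frag_of (lact r w)) e \<in> E"
    and rels_ract: "\<And>r e. r \<in> carrier R \<Longrightarrow> e \<in> E \<Longrightarrow> frag_extend (\<lambda>w. frag_of (ract w r)) e \<in> E"
begin

abbreviation "F \<equiv> word_module S lact ract"
definition "N = generate (add_monoid F) E"
abbreviation "P \<equiv> presented_bimodule F E"
abbreviation "cls w \<equiv> N +>\<^bsub>F\<^esub> frag_of w"

sublocale F: abelian_group F by (rule word_module_abelian)

sublocale N: abelian_subgroup N F
  by (rule abelian_subgroupI3[OF additive_subgroup.intro word_module_abelian])
    (unfold N_def, rule group.generate_is_subgroup[OF F.a_group], use rels_words in auto)

lemma N_incl: "e \<in> E \<Longrightarrow> e \<in> N"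
  by (auto simp: N_def intro: generate.incl)

lemma P_sel [simp]: "carrier P = a_rcosets\<^bsub>F\<^esub> N" "zero P = N" "add P = set_add F"
  by (simp_all add: presented_bimodule_def N_def)

sublocale P: abelian_group P
  by (rule N.quotient_abelian_group) auto

lemma frag_extend_hom:
  assumes "\<And>w. w \<in> S \<Longrightarrow> h w \<in> S"
  shows "frag_extend (\<lambda>w. frag_of (h w)) \<in> add_hom F F"
  by (rule add_homI)
    (use assms keys_frag_extend[of "\<lambda>w. frag_of (h w)"] in \<open>fastforce simp: frag_extend_add\<close>)+

lemma frag_extend_N:
  assumes "\<And>w. w \<in> S \<Longrightarrow> h w \<in> S" "\<And>e. e \<in> E \<Longrightarrow> frag_extend (\<lambda>w. frag_of (h w)) e \<in> E"
  shows "frag_extend (\<lambda>w. frag_of (h w)) ` N \<subseteq> N"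
proof clarify
  fix t assume t: "t \<in> N"
  have c: "s \<in> carrier F" if "s \<in> N" for s using that N.a_subset by blast
  show "frag_extend (\<lambda>w. frag_of (h w)) t \<in> N" using t[unfolded N_def]
  proof (induction rule: generate.induct)
    case one
    then show ?case using N.zero_closed by simp
  next
    case (incl e)
    then show ?case using assms(2) by (blast intro: N_incl)
  next
    case (inv e)
    have "inv\<^bsub>add_monoid F\<^esub> e = - e" using word_module_a_inv[of e S lact ract] rels_words[OF inv]
      by (simp add: a_inv_def)
    moreover have "frag_extend (\<lambda>w. frag_of (h w)) e \<in> N" using assms(2)[OF inv] by (rule N_incl)
    ultimately show ?case
      using N.a_inv_closed[of "frag_extend (\<lambda>w. frag_of (h w)) e"]
        word_module_a_inv[OF c, of "frag_extend (\<lambda>w. frag_of (h w)) e"]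
      by (simp add: frag_extend_minus)
  next
    case (eng s t)
    then show ?case using N.a_closed by (simp add: frag_extend_add)
  qed
qed

lemma frag_of_closed [simp]: "w \<in> S \<Longrightarrow> frag_of w \<in> carrier F"
  by simp

lemma cls_closed: "w \<in> S \<Longrightarrow> cls w \<in> carrier P"
  using F.a_rcosetsI[OF N.a_subset frag_of_closed] by simp

lemma cosets_closed: "t \<in> carrier F \<Longrightarrow> N +>\<^bsub>F\<^esub> t \<in> carrier P"
  using F.a_rcosetsI[OF N.a_subset] by simp

lemma coset_add:
  "s \<in> carrier F \<Longrightarrow> t \<in> carrier F \<Longrightarrow> (N +>\<^bsub>F\<^esub> s) \<oplus>\<^bsub>P\<^esub> (N +>\<^bsub>F\<^esub> t) = N +>\<^bsub>F\<^esub> (s + t)"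
  using N.a_rcos_sum[of s t] by simp

lemma coset_minus:
  assumes "s \<in> carrier F" "t \<in> carrier F"
  shows "(N +>\<^bsub>F\<^esub> s) \<ominus>\<^bsub>P\<^esub> (N +>\<^bsub>F\<^esub> t) = N +>\<^bsub>F\<^esub> (s - t)"
proof -
  have "- t \<in> carrier F" using assms by simp
  then have "(N +>\<^bsub>F\<^esub> (- t)) \<oplus>\<^bsub>P\<^esub> (N +>\<^bsub>F\<^esub> t) = \<zero>\<^bsub>P\<^esub>"
    using assms coset_add[of "- t" t] F.a_coset_add_zero[OF N.a_subset] by simp
  then have "\<ominus>\<^bsub>P\<^esub> (N +>\<^bsub>F\<^esub> t) = N +>\<^bsub>F\<^esub> (- t)"
    using assms cosets_closed[of t] cosets_closed[of "- t"] by (intro P.minus_equality) auto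
  then show ?thesis using assms coset_add[of s "- t"] by (simp add: a_minus_def)
qed

lemma rel_cls2:
  assumes "frag_of a - frag_of b \<in> E" "a \<in> S" "b \<in> S"
  shows "cls a = cls b"
  using assms N.coset_eq_iff[of "frag_of a" "frag_of b"] N_incl
  by (simp add: a_minus_def word_module_a_inv)

lemma rel_cls3:
  assumes "frag_of a - frag_of b - frag_of c \<in> E" "a \<in> S" "b \<in> S" "c \<in> S"
  shows "cls a = cls b \<oplus>\<^bsub>P\<^esub> cls c"
proof -
  have "frag_of b + frag_of c \<in> carrier F" using assms F.a_closed[of "frag_of b" "frag_of c"] by simp
  moreover have "frag_of a - (frag_of b + frag_of c) \<in> N"
    using N_incl[OF assms(1)] by (simp only: diff_diff_eq)
  ultimately have "cls a = N +>\<^bsub>F\<^esub> (frag_of b + frag_of c)"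
    using assms N.coset_eq_iff[of "frag_of a" "frag_of b + frag_of c"]
    by (simp add: a_minus_def word_module_a_inv del: minus_add_distrib)
  then show ?thesis using assms coset_add[of "frag_of b" "frag_of c"] by simp
qed

lemma cls_induct [consumes 1, case_names zero cls minus]:
  assumes "T \<in> carrier P" and "Q \<zero>\<^bsub>P\<^esub>" and "\<And>w. w \<in> S \<Longrightarrow> Q (cls w)"
    and "\<And>a b. a \<in> carrier P \<Longrightarrow> b \<in> carrier P \<Longrightarrow> Q a \<Longrightarrow> Q b \<Longrightarrow> Q (a \<ominus>\<^bsub>P\<^esub> b)"
  shows "Q T"
proof -
  obtain t where t: "T = N +>\<^bsub>F\<^esub> t" "Poly_Mapping.keys t \<subseteq> S"
    using assms(1) by (auto simp: rcosets_iff)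
  have "Poly_Mapping.keys t \<subseteq> S \<and> Q (N +>\<^bsub>F\<^esub> t)" using t(2)
  proof (induction rule: frag_induction)
    case (diff a b)
    then have c: "a \<in> carrier F" "b \<in> carrier F" by auto
    then have "Q (N +>\<^bsub>F\<^esub> (a - b))"
      using assms(4)[of "N +>\<^bsub>F\<^esub> a" "N +>\<^bsub>F\<^esub> b"] diff cosets_closed coset_minus[of a b] by simp
    moreover have "a \<ominus>\<^bsub>F\<^esub> b \<in> carrier F" using c by (rule F.minus_closed)
    then have "a - b \<in> carrier F" using c by (simp add: a_minus_def word_module_a_inv)
    ultimately show ?case by simp
  qed (use assms(2,3) F.a_coset_add_zero[OF N.a_subset] in auto)
  then show ?thesis using t by simp
qed

lemma hom_ext:
  assumes "f \<in> add_hom P X" "g \<in> add_hom P X" "abelian_group X"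
    and "\<And>w. w \<in> S \<Longrightarrow> f (cls w) = g (cls w)" and "T \<in> carrier P"
  shows "f T = g T"
  using assms(5)
proof (induction rule: cls_induct)
  case zero
  then show ?case using assms add_hom_zero[of _ P X] P.abelian_group_axioms by metis
next
  case (cls w)
  then show ?case using assms by simp
next
  case (minus a b)
  then show ?case using assms add_hom_minus[of _ P X] P.abelian_group_axioms by metis
qed

text \<open>\<open>frag_eval\<close> is additive and kills the relations, so it vanishes on
  \<open>N\<close> and is constant on each coset. Its image of a coset is then a singleton, which is
  what \<open>the_elem\<close> in \<open>lift\<close> asks for.\<close>

lemma lift_coset:
  assumes "abelian_group X" "f \<in> S \<rightarrow> carrier X" "\<And>e. e \<in> E \<Longrightarrow> frag_eval X f e = \<zero>\<^bsub>X\<^esub>" "t \<in> carrier F"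
  shows "lift X f (N +>\<^bsub>F\<^esub> t) = frag_eval X f t"
proof -
  interpret X: abelian_group X by fact
  have h: "frag_eval X f \<in> add_hom F X"
    by (rule frag_eval_hom) fact+
  have c: "s \<in> carrier F" if "s \<in> N" for s using that N.a_subset by blast
  have N0: "frag_eval X f s = \<zero>\<^bsub>X\<^esub>" if "s \<in> N" for s using that[unfolded N_def]
  proof (induction rule: generate.induct)
    case one
    then show ?case by (simp add: frag_eval_def)
  next
    case (inv e)
    then show ?case
      using add_hom_a_inv[OF h F.abelian_group_axioms assms(1), of e, unfolded a_inv_def[of F]]
        assms(3)[of e] rels_words[of e] by simp
  next
    case (eng s t)
    then show ?case using add_hom_add[OF h, of s t] c by (simp add: N_def)
  qed (use assms in auto)
  have "frag_eval X f s = frag_eval X f t" if s: "s \<in> N +>\<^bsub>F\<^esub> t" for s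
  proof -
    obtain n where n: "n \<in> N" "s = n + t" using s unfolding a_r_coset_def' by auto
    then show ?thesis using add_hom_add[OF h, of n t] N0[of n] c assms add_hom_closed[OF h, of t] by simp
  qed
  moreover have "t \<in> N +>\<^bsub>F\<^esub> t" using N.a_rcos_self assms by simp
  ultimately have "frag_eval X f ` (N +>\<^bsub>F\<^esub> t) = {frag_eval X f t}" by blast
  then show ?thesis by (simp add: lift_def)
qed

lemma
  assumes "abelian_group X" "f \<in> S \<rightarrow> carrier X" "\<And>e. e \<in> E \<Longrightarrow> frag_eval X f e = \<zero>\<^bsub>X\<^esub>"
  shows lift_hom: "lift X f \<in> add_hom P X"
    and lift_cls: "w \<in> S \<Longrightarrow> lift X f (cls w) = f w"
proof -
  show "lift X f (cls w) = f w" if "w \<in> S"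
    using lift_coset[OF assms, of "frag_of w"] that frag_eval_of[of X f w] assms(1,2) by auto
  show "lift X f \<in> add_hom P X"
  proof (rule add_homI)
    show "lift X f T \<in> carrier X" if "T \<in> carrier P" for T
    proof -
      obtain t where "t \<in> carrier F" "T = N +>\<^bsub>F\<^esub> t" using \<open>T \<in> carrier P\<close> by (auto simp: rcosets_iff)
      then show ?thesis using lift_coset[OF assms] frag_eval_closed[OF assms(1) _ assms(2)] by simp
    qed
    show "lift X f (T \<oplus>\<^bsub>P\<^esub> U) = lift X f T \<oplus>\<^bsub>X\<^esub> lift X f U" if TU: "T \<in> carrier P" "U \<in> carrier P" for T U
    proof -
      obtain t u where tu: "t \<in> carrier F" "u \<in> carrier F" "T = N +>\<^bsub>F\<^esub> t" "U = N +>\<^bsub>F\<^esub> u"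
        using TU by (auto simp: rcosets_iff)
      then have "t + u \<in> carrier F" using F.a_closed[of t u] by simp
      then show ?thesis using tu coset_add[of t u] lift_coset[OF assms] assms(1,2)
        by (simp add: frag_eval_add)
    qed
  qed
qed

lemma
  assumes "r \<in> carrier R"
  shows smult_hom: "(\<lambda>T. r \<odot>\<^bsub>P\<^esub> T) \<in> add_hom P P"
    and smult_cls: "w \<in> S \<Longrightarrow> r \<odot>\<^bsub>P\<^esub> cls w = cls (lact r w)"
    and rsmult_hom: "(\<lambda>T. T \<triangleleft>\<^bsub>P\<^esub> r) \<in> add_hom P P"
    and rsmult_cls: "w \<in> S \<Longrightarrow> cls w \<triangleleft>\<^bsub>P\<^esub> r = cls (ract w r)"
proof -
  have P: "P = quot_bimodule F N" by (simp only: presented_bimodule_def N_def)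
  have l: "r \<odot>\<^bsub>P\<^esub> (N +>\<^bsub>F\<^esub> t) = N +>\<^bsub>F\<^esub> frag_extend (\<lambda>w. frag_of (lact r w)) t" if "t \<in> carrier F" for t
    unfolding P quot_bimodule_def module.simps word_module_sel
    by (rule N.quot_smult_coset[OF frag_extend_hom[of "lact r"] frag_extend_N[of "lact r"] that])
      (use lact_closed[OF assms] rels_lact[OF assms] in auto)
  have r: "(N +>\<^bsub>F\<^esub> t) \<triangleleft>\<^bsub>P\<^esub> r = N +>\<^bsub>F\<^esub> frag_extend (\<lambda>w. frag_of (ract w r)) t" if "t \<in> carrier F" for t
    unfolding P quot_bimodule_def bimodule.simps word_module_sel
    by (rule N.quot_smult_coset[OF frag_extend_hom[of "\<lambda>w. ract w r"] frag_extend_N[of "\<lambda>w. ract w r"] that])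
      (use ract_closed[OF assms] rels_ract[OF assms] in auto)
  show "r \<odot>\<^bsub>P\<^esub> cls w = cls (lact r w)" if "w \<in> S"
    using l[of "frag_of w"] that by simp
  show "cls w \<triangleleft>\<^bsub>P\<^esub> r = cls (ract w r)" if "w \<in> S"
    using r[of "frag_of w"] that by simp
  have *: "h \<in> add_hom P P" if "\<And>t. t \<in> carrier F \<Longrightarrow> h (N +>\<^bsub>F\<^esub> t) = N +>\<^bsub>F\<^esub> k t" "k \<in> add_hom F F" for h k
  proof (rule add_homI)
    note hk = that
    show "h T \<in> carrier P" if T: "T \<in> carrier P" for T
    proof -
      obtain t where "t \<in> carrier F" "T = N +>\<^bsub>F\<^esub> t" using T by (auto simp: rcosets_iff)
      then show ?thesis using hk(1)[of t] add_hom_closed[OF hk(2), of t] cosets_closed[of "k t"] by simp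
    qed
    show "h (T \<oplus>\<^bsub>P\<^esub> U) = h T \<oplus>\<^bsub>P\<^esub> h U" if TU: "T \<in> carrier P" "U \<in> carrier P" for T U
    proof -
      obtain t u where tu: "t \<in> carrier F" "u \<in> carrier F" "T = N +>\<^bsub>F\<^esub> t" "U = N +>\<^bsub>F\<^esub> u"
        using TU by (auto simp: rcosets_iff)
      then have "t + u \<in> carrier F" using F.a_closed[of t u] by simp
      then show ?thesis using tu coset_add[of t u] coset_add[of "k t" "k u"] add_hom_add[OF hk(2), of t u]
          add_hom_closed[OF hk(2)] hk(1)
        by simp
    qed
  qed
  show "(\<lambda>T. r \<odot>\<^bsub>P\<^esub> T) \<in> add_hom P P"
    by (rule *[OF l frag_extend_hom[of "lact r"]]) (use lact_closed assms in auto)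
  show "(\<lambda>T. T \<triangleleft>\<^bsub>P\<^esub> r) \<in> add_hom P P"
    by (rule *[OF r frag_extend_hom[of "\<lambda>w. ract w r"]]) (use ract_closed assms in auto)
qed

text \<open>Additivity in the module variable is already known from \<open>smult_hom\<close> and
  \<open>rsmult_hom\<close>, so each remaining axiom equates two additive maps and can be tested on
  classes of words. Additivity in the scalar fails for formal sums themselves; it has to come from
  the relations, hence the hypotheses about classes.\<close>

lemma bimodule_presented:
  assumes l_add: "\<And>r s w. r \<in> carrier R \<Longrightarrow> s \<in> carrier R \<Longrightarrow> w \<in> S \<Longrightarrow>
      cls (lact (r \<oplus>\<^bsub>R\<^esub> s) w) = cls (lact r w) \<oplus>\<^bsub>P\<^esub> cls (lact s w)"
    and l_mult: "\<And>r s w. r \<in> carrier R \<Longrightarrow> s \<in> carrier R \<Longrightarrow> w \<in> S \<Longrightarrow>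
      cls (lact (r \<otimes>\<^bsub>R\<^esub> s) w) = cls (lact r (lact s w))"
    and l_one: "\<And>w. w \<in> S \<Longrightarrow> cls (lact \<one>\<^bsub>R\<^esub> w) = cls w"
    and r_add: "\<And>r s w. r \<in> carrier R \<Longrightarrow> s \<in> carrier R \<Longrightarrow> w \<in> S \<Longrightarrow>
      cls (ract w (r \<oplus>\<^bsub>R\<^esub> s)) = cls (ract w r) \<oplus>\<^bsub>P\<^esub> cls (ract w s)"
    and r_mult: "\<And>r s w. r \<in> carrier R \<Longrightarrow> s \<in> carrier R \<Longrightarrow> w \<in> S \<Longrightarrow>
      cls (ract w (r \<otimes>\<^bsub>R\<^esub> s)) = cls (ract (ract w r) s)"
    and r_one: "\<And>w. w \<in> S \<Longrightarrow> cls (ract w \<one>\<^bsub>R\<^esub>) = cls w"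
    and assoc: "\<And>r s w. r \<in> carrier R \<Longrightarrow> s \<in> carrier R \<Longrightarrow> w \<in> S \<Longrightarrow>
      cls (ract (lact r w) s) = cls (lact r (ract w s))"
  shows "bimodule R P"
proof -
  note ab = P.abelian_group_axioms
  note [simp del] = P_sel
  note [simp] = lact_closed ract_closed smult_cls rsmult_cls cls_closed

  have ext: "f T = g T" if "f \<in> add_hom P P" "g \<in> add_hom P P" "\<And>w. w \<in> S \<Longrightarrow> f (cls w) = g (cls w)"
    "T \<in> carrier P" for f g T
    by (rule hom_ext[OF _ _ ab]) (use that in auto)
  show ?thesis
  proof (intro bimodule.intro left_module.intro bimodule_axioms.intro left_module_axioms.intro ab R.ring_axioms)
    fix r s x y assume r: "r \<in> carrier R" and s: "s \<in> carrier R" and x: "x \<in> carrier P" and y: "y \<in> carrier P"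
    show "r \<odot>\<^bsub>P\<^esub> x \<in> carrier P" "x \<triangleleft>\<^bsub>P\<^esub> r \<in> carrier P"
      using add_hom_closed[OF smult_hom[OF r] x] add_hom_closed[OF rsmult_hom[OF r] x] by auto
    show "r \<odot>\<^bsub>P\<^esub> (x \<oplus>\<^bsub>P\<^esub> y) = r \<odot>\<^bsub>P\<^esub> x \<oplus>\<^bsub>P\<^esub> r \<odot>\<^bsub>P\<^esub> y" "(x \<oplus>\<^bsub>P\<^esub> y) \<triangleleft>\<^bsub>P\<^esub> r = x \<triangleleft>\<^bsub>P\<^esub> r \<oplus>\<^bsub>P\<^esub> y \<triangleleft>\<^bsub>P\<^esub> r"
      using add_hom_add[OF smult_hom[OF r] x y] add_hom_add[OF rsmult_hom[OF r] x y] by auto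
    show "(r \<oplus>\<^bsub>R\<^esub> s) \<odot>\<^bsub>P\<^esub> x = r \<odot>\<^bsub>P\<^esub> x \<oplus>\<^bsub>P\<^esub> s \<odot>\<^bsub>P\<^esub> x"
      by (rule ext[OF _ _ _ x, where f = "\<lambda>x. (r \<oplus>\<^bsub>R\<^esub> s) \<odot>\<^bsub>P\<^esub> x" and g = "\<lambda>x. r \<odot>\<^bsub>P\<^esub> x \<oplus>\<^bsub>P\<^esub> s \<odot>\<^bsub>P\<^esub> x"])
        (use r s l_add in \<open>simp_all add: add_hom_plus[OF smult_hom smult_hom ab] smult_hom\<close>)
    show "x \<triangleleft>\<^bsub>P\<^esub> (r \<oplus>\<^bsub>R\<^esub> s) = x \<triangleleft>\<^bsub>P\<^esub> r \<oplus>\<^bsub>P\<^esub> x \<triangleleft>\<^bsub>P\<^esub> s"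
      by (rule ext[OF _ _ _ x, where f = "\<lambda>x. x \<triangleleft>\<^bsub>P\<^esub> (r \<oplus>\<^bsub>R\<^esub> s)" and g = "\<lambda>x. x \<triangleleft>\<^bsub>P\<^esub> r \<oplus>\<^bsub>P\<^esub> x \<triangleleft>\<^bsub>P\<^esub> s"])
        (use r s r_add in \<open>simp_all add: add_hom_plus[OF rsmult_hom rsmult_hom ab] rsmult_hom\<close>)
    show "(r \<otimes>\<^bsub>R\<^esub> s) \<odot>\<^bsub>P\<^esub> x = r \<odot>\<^bsub>P\<^esub> (s \<odot>\<^bsub>P\<^esub> x)"
      by (rule ext[OF _ _ _ x, where f = "\<lambda>x. (r \<otimes>\<^bsub>R\<^esub> s) \<odot>\<^bsub>P\<^esub> x" and g = "\<lambda>x. r \<odot>\<^bsub>P\<^esub> (s \<odot>\<^bsub>P\<^esub> x)"])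
        (use r s l_mult in \<open>simp_all add: smult_hom add_hom_comp[OF smult_hom smult_hom]\<close>)
    show "x \<triangleleft>\<^bsub>P\<^esub> (r \<otimes>\<^bsub>R\<^esub> s) = x \<triangleleft>\<^bsub>P\<^esub> r \<triangleleft>\<^bsub>P\<^esub> s"
      by (rule ext[OF _ _ _ x, where f = "\<lambda>x. x \<triangleleft>\<^bsub>P\<^esub> (r \<otimes>\<^bsub>R\<^esub> s)" and g = "\<lambda>x. x \<triangleleft>\<^bsub>P\<^esub> r \<triangleleft>\<^bsub>P\<^esub> s"])
        (use r s r_mult in \<open>simp_all add: rsmult_hom add_hom_comp[OF rsmult_hom rsmult_hom]\<close>)
    show "(r \<odot>\<^bsub>P\<^esub> x) \<triangleleft>\<^bsub>P\<^esub> s = r \<odot>\<^bsub>P\<^esub> (x \<triangleleft>\<^bsub>P\<^esub> s)"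
      by (rule ext[OF _ _ _ x, where f = "\<lambda>x. (r \<odot>\<^bsub>P\<^esub> x) \<triangleleft>\<^bsub>P\<^esub> s" and g = "\<lambda>x. r \<odot>\<^bsub>P\<^esub> (x \<triangleleft>\<^bsub>P\<^esub> s)"])
        (use r s assoc in \<open>simp_all add: add_hom_comp[OF smult_hom rsmult_hom] add_hom_comp[OF rsmult_hom smult_hom]\<close>)
  next
    fix x assume x: "x \<in> carrier P"
    show "\<one>\<^bsub>R\<^esub> \<odot>\<^bsub>P\<^esub> x = x"
      by (rule ext[OF _ _ _ x, where g = "\<lambda>x. x"]) (use l_one in \<open>simp_all add: smult_hom add_hom_ident\<close>)
    show "x \<triangleleft>\<^bsub>P\<^esub> \<one>\<^bsub>R\<^esub> = x"
      by (rule ext[OF _ _ _ x, where f = "\<lambda>x. x \<triangleleft>\<^bsub>P\<^esub> \<one>\<^bsub>R\<^esub>" and g = "\<lambda>x. x"]) (use r_one in \<open>simp_all add: rsmult_hom add_hom_ident\<close>)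
  qed
qed

end

lemma frag_eval_rel2:
  assumes "abelian_group X" "f \<in> S \<rightarrow> carrier X" "a \<in> S" "b \<in> S" "f a = f b"
  shows "frag_eval X f (frag_of a - frag_of b) = \<zero>\<^bsub>X\<^esub>"
proof -
  interpret X: abelian_group X by fact
  \<comment> \<open>\<open>frag_eval\<close> does not see the actions on words; trivial ones are
    chosen to have the free abelian group on \<open>S\<close> as a record.\<close>
  define F where "F = word_module S (\<lambda>(_::unit) w. w) (\<lambda>w _. w)"
  have F: "abelian_group F" unfolding F_def by (rule word_module_abelian)
  have h: "frag_eval X f \<in> add_hom F X"
    unfolding F_def by (rule frag_eval_hom) fact+
  have ab: "frag_of a \<in> carrier F" "frag_of b \<in> carrier F" using assms by (auto simp: F_def)
  have "frag_eval X f (frag_of a \<ominus>\<^bsub>F\<^esub> frag_of b) = \<zero>\<^bsub>X\<^esub>"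
    using assms ab by (subst add_hom_minus[OF h F]) (auto simp: frag_eval_of Pi_iff X.r_neg a_minus_def)
  then show ?thesis using ab by (simp add: a_minus_def word_module_a_inv F_def)
qed

lemma frag_eval_rel3:
  assumes "abelian_group X" "f \<in> S \<rightarrow> carrier X" "a \<in> S" "b \<in> S" "c \<in> S" "f a = f b \<oplus>\<^bsub>X\<^esub> f c"
  shows "frag_eval X f (frag_of a - frag_of b - frag_of c) = \<zero>\<^bsub>X\<^esub>"
proof -
  interpret X: abelian_group X by fact
  define F where "F = word_module S (\<lambda>(_::unit) w. w) (\<lambda>w _. w)"
  interpret F: abelian_group F unfolding F_def by (rule word_module_abelian)
  have h: "frag_eval X f \<in> add_hom F X"
    unfolding F_def by (rule frag_eval_hom) fact+
  have abc: "frag_of a \<in> carrier F" "frag_of b \<in> carrier F" "frag_of c \<in> carrier F"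
    using assms by (auto simp: F_def)
  have "frag_eval X f (frag_of a \<ominus>\<^bsub>F\<^esub> (frag_of b \<oplus>\<^bsub>F\<^esub> frag_of c)) = \<zero>\<^bsub>X\<^esub>"
    using assms abc by (subst add_hom_minus[OF h F.abelian_group_axioms])
      (auto simp: add_hom_add[OF h] frag_eval_of Pi_iff X.r_neg a_minus_def)
  moreover have "frag_of a \<ominus>\<^bsub>F\<^esub> (frag_of b \<oplus>\<^bsub>F\<^esub> frag_of c) = frag_of a - frag_of b - frag_of c"
    using abc F.a_closed[of "frag_of b" "frag_of c"]
    by (simp add: a_minus_def word_module_a_inv F_def)
  ultimately show ?thesis by simp
qed

text \<open>Negatives are carried along in the induction, which trades closure under differences for
  closure under sums. This suits tensors, where the negative of a generator is again a
  generator.\<close>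

lemma (in presentation) cls_induct_add [consumes 1, case_names zero cls uminus add]:
  assumes "T \<in> carrier P" and "Q \<zero>\<^bsub>P\<^esub>" and "\<And>w. w \<in> S \<Longrightarrow> Q (cls w)" and "\<And>w. w \<in> S \<Longrightarrow> Q (\<ominus>\<^bsub>P\<^esub> cls w)"
    and add: "\<And>a b. a \<in> carrier P \<Longrightarrow> b \<in> carrier P \<Longrightarrow> Q a \<Longrightarrow> Q b \<Longrightarrow> Q (a \<oplus>\<^bsub>P\<^esub> b)"
  shows "Q T"
proof -
  note [simp del] = P_sel
  have "Q T \<and> Q (\<ominus>\<^bsub>P\<^esub> T)" using assms(1)
  proof (induction rule: cls_induct)
    case (minus a b)
    have "\<ominus>\<^bsub>P\<^esub> (a \<ominus>\<^bsub>P\<^esub> b) = \<ominus>\<^bsub>P\<^esub> a \<oplus>\<^bsub>P\<^esub> b"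
      using minus by (simp add: a_minus_def P.minus_add)
    then show ?case using minus add[of a "\<ominus>\<^bsub>P\<^esub> b"] add[of "\<ominus>\<^bsub>P\<^esub> a" b] by (simp add: a_minus_def)
  next
    case zero
    have "\<ominus>\<^bsub>P\<^esub> \<zero>\<^bsub>P\<^esub> = \<zero>\<^bsub>P\<^esub>" by (rule P.minus_equality) auto
    then show ?case using assms(2) by (simp only:)
  qed (use assms in auto)
  then show ?thesis ..
qed

section \<open>Tensor products\<close>

definition balanced ::
  "('r, 'k) ring_scheme \<Rightarrow> ('r, 'm, 'l) bimodule_scheme \<Rightarrow> ('r, 'n, 'l2) bimodule_scheme
    \<Rightarrow> ('x, 'l3) ring_scheme \<Rightarrow> ('m \<Rightarrow> 'n \<Rightarrow> 'x) \<Rightarrow> bool" where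
  "balanced R M N X \<beta> \<longleftrightarrow>
     (\<forall>x\<in>carrier M. \<beta> x \<in> add_hom N X) \<and> (\<forall>y\<in>carrier N. (\<lambda>x. \<beta> x y) \<in> add_hom M X) \<and>
     (\<forall>x\<in>carrier M. \<forall>r\<in>carrier R. \<forall>y\<in>carrier N. \<beta> (x \<triangleleft>\<^bsub>M\<^esub> r) y = \<beta> x (r \<odot>\<^bsub>N\<^esub> y))"

lemma balancedI:
  assumes "\<And>x. x \<in> carrier M \<Longrightarrow> \<beta> x \<in> add_hom N X" "\<And>y. y \<in> carrier N \<Longrightarrow> (\<lambda>x. \<beta> x y) \<in> add_hom M X"
    and "\<And>x r y. x \<in> carrier M \<Longrightarrow> r \<in> carrier R \<Longrightarrow> y \<in> carrier N \<Longrightarrow> \<beta> (x \<triangleleft>\<^bsub>M\<^esub> r) y = \<beta> x (r \<odot>\<^bsub>N\<^esub> y)"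
  shows "balanced R M N X \<beta>"
  using assms by (auto simp: balanced_def)

lemma balancedD:
  assumes "balanced R M N X \<beta>"
  shows "x \<in> carrier M \<Longrightarrow> \<beta> x \<in> add_hom N X" "y \<in> carrier N \<Longrightarrow> (\<lambda>x. \<beta> x y) \<in> add_hom M X"
    and "x \<in> carrier M \<Longrightarrow> r \<in> carrier R \<Longrightarrow> y \<in> carrier N \<Longrightarrow> \<beta> (x \<triangleleft>\<^bsub>M\<^esub> r) y = \<beta> x (r \<odot>\<^bsub>N\<^esub> y)"
  using assms by (auto simp: balanced_def)

lemma tensor_relsE:
  assumes "e \<in> tensor_rels R M N"
  obtains x x' y where "e = frag_of (x \<oplus>\<^bsub>M\<^esub> x', y) - frag_of (x, y) - frag_of (x', y)"
      "x \<in> carrier M" "x' \<in> carrier M" "y \<in> carrier N"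
  | x y y' where "e = frag_of (x, y \<oplus>\<^bsub>N\<^esub> y') - frag_of (x, y) - frag_of (x, y')"
      "x \<in> carrier M" "y \<in> carrier N" "y' \<in> carrier N"
  | x r y where "e = frag_of (x \<triangleleft>\<^bsub>M\<^esub> r, y) - frag_of (x, r \<odot>\<^bsub>N\<^esub> y)"
      "x \<in> carrier M" "r \<in> carrier R" "y \<in> carrier N"
  using assms unfolding tensor_rels_def by blast

lemma tensor_relsI:
  "x \<in> carrier M \<Longrightarrow> x' \<in> carrier M \<Longrightarrow> y \<in> carrier N \<Longrightarrow>
     frag_of (x \<oplus>\<^bsub>M\<^esub> x', y) - frag_of (x, y) - frag_of (x', y) \<in> tensor_rels R M N"
  "x \<in> carrier M \<Longrightarrow> y \<in> carrier N \<Longrightarrow> y' \<in> carrier N \<Longrightarrow>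
     frag_of (x, y \<oplus>\<^bsub>N\<^esub> y') - frag_of (x, y) - frag_of (x, y') \<in> tensor_rels R M N"
  "x \<in> carrier M \<Longrightarrow> r \<in> carrier R \<Longrightarrow> y \<in> carrier N \<Longrightarrow>
     frag_of (x \<triangleleft>\<^bsub>M\<^esub> r, y) - frag_of (x, r \<odot>\<^bsub>N\<^esub> y) \<in> tensor_rels R M N"
  unfolding tensor_rels_def by blast+

lemma keys_rel2: "a \<in> S \<Longrightarrow> b \<in> S \<Longrightarrow> Poly_Mapping.keys (frag_of a - frag_of b) \<subseteq> S"
  using keys_diff[of "frag_of a" "frag_of b"] by auto

lemma keys_rel3:
  "a \<in> S \<Longrightarrow> b \<in> S \<Longrightarrow> c \<in> S \<Longrightarrow> Poly_Mapping.keys (frag_of a - frag_of b - frag_of c) \<subseteq> S"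
  using keys_diff[of "frag_of a - frag_of b" "frag_of c"] keys_diff[of "frag_of a" "frag_of b"] by auto

locale bimodule_pair = M: bimodule R M + N: bimodule R N
  for R :: "('r, 'k) ring_scheme" and M :: "('r, 'm, 'l) bimodule_scheme" and N :: "('r, 'n, 'l2) bimodule_scheme"
begin

sublocale presentation R "carrier M \<times> carrier N" "\<lambda>r (x, y). (r \<odot>\<^bsub>M\<^esub> x, y)" "\<lambda>(x, y) r. (x, y \<triangleleft>\<^bsub>N\<^esub> r)"
  "tensor_rels R M N"
proof (intro presentation.intro presentation_axioms.intro bimodule_ring[OF M.bimodule_axioms], goal_cases)
  case (3 e)
  then show ?case
    by (cases rule: tensor_relsE)
      (simp_all add: keys_rel2 keys_rel3 M.rsmult_closed N.smult_closed)
next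
  case (4 r e)
  note r = this(1)
  show ?case
    using 4(2) by (cases rule: tensor_relsE)
      (use r in \<open>simp_all add: frag_extend_diff M.smult_r_distr M.bimodule_assoc[symmetric] tensor_relsI M.smult_closed\<close>)
next
  case (5 r e)
  note r = this(1)
  show ?case
    using 5(2) by (cases rule: tensor_relsE)
      (use r in \<open>simp_all add: frag_extend_diff N.rsmult_l_distr N.bimodule_assoc tensor_relsI N.rsmult_closed\<close>)
qed (auto simp: M.smult_closed N.rsmult_closed)

lemma tensor_P: "tensor R M N = P"
  by (simp add: tensor_def tensor_words_def)

lemma tens_cls: "tens R M N x y = cls (x, y)"
  by (simp add: tens_def tensor_words_def N_def)

lemma tensor_bimodule: "bimodule R (tensor R M N)"
  unfolding tensor_P
proof (rule bimodule_presented, goal_cases)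
  case (1 r s w)
  then show ?case
    using rel_cls3[OF tensor_relsI(1)[of "r \<odot>\<^bsub>M\<^esub> fst w" M "s \<odot>\<^bsub>M\<^esub> fst w" "snd w"]]
    by (auto simp: M.smult_l_distr M.smult_closed)
next
  case (4 r s w)
  then show ?case
    using rel_cls3[OF tensor_relsI(2)[of "fst w" M "snd w \<triangleleft>\<^bsub>N\<^esub> r" N "snd w \<triangleleft>\<^bsub>N\<^esub> s"]]
    by (auto simp: N.rsmult_r_distr N.rsmult_closed)
qed (auto simp: M.smult_assoc M.smult_one N.rsmult_assoc N.rsmult_one)

end

context
  fixes R :: "('r, 'k) ring_scheme" and M :: "('r, 'm, 'l) bimodule_scheme" and N :: "('r, 'n, 'l2) bimodule_scheme"
  assumes M: "bimodule R M" and N: "bimodule R N"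
begin

interpretation bimodule_pair R M N by (intro bimodule_pair.intro M N)

lemma tensor_bimodule: "bimodule R (tensor R M N)"
  by (rule tensor_bimodule)

lemma tens_closed: "x \<in> carrier M \<Longrightarrow> y \<in> carrier N \<Longrightarrow> tens R M N x y \<in> carrier (tensor R M N)"
  unfolding tensor_P tens_cls by (rule cls_closed) simp

lemma tens_add_left:
  "x \<in> carrier M \<Longrightarrow> x' \<in> carrier M \<Longrightarrow> y \<in> carrier N \<Longrightarrow>
    tens R M N (x \<oplus>\<^bsub>M\<^esub> x') y = tens R M N x y \<oplus>\<^bsub>tensor R M N\<^esub> tens R M N x' y"
  unfolding tensor_P tens_cls by (rule rel_cls3[OF tensor_relsI(1)]) auto

lemma tens_add_right:
  "x \<in> carrier M \<Longrightarrow> y \<in> carrier N \<Longrightarrow> y' \<in> carrier N \<Longrightarrow>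
    tens R M N x (y \<oplus>\<^bsub>N\<^esub> y') = tens R M N x y \<oplus>\<^bsub>tensor R M N\<^esub> tens R M N x y'"
  unfolding tensor_P tens_cls by (rule rel_cls3[OF tensor_relsI(2)]) auto

lemma tens_balanced:
  "x \<in> carrier M \<Longrightarrow> r \<in> carrier R \<Longrightarrow> y \<in> carrier N \<Longrightarrow> tens R M N (x \<triangleleft>\<^bsub>M\<^esub> r) y = tens R M N x (r \<odot>\<^bsub>N\<^esub> y)"
  unfolding tens_cls by (rule rel_cls2[OF tensor_relsI(3)]) (auto simp: M.rsmult_closed N.smult_closed)

lemma balanced_tens: "balanced R M N (tensor R M N) (tens R M N)"
  by (intro balancedI add_homI) (simp_all add: tens_closed tens_add_left tens_add_right tens_balanced)

lemma tens_smult: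
  "r \<in> carrier R \<Longrightarrow> x \<in> carrier M \<Longrightarrow> y \<in> carrier N \<Longrightarrow>
    r \<odot>\<^bsub>tensor R M N\<^esub> tens R M N x y = tens R M N (r \<odot>\<^bsub>M\<^esub> x) y"
  unfolding tensor_P tens_cls by (simp add: smult_cls)

lemma tens_rsmult:
  "r \<in> carrier R \<Longrightarrow> x \<in> carrier M \<Longrightarrow> y \<in> carrier N \<Longrightarrow>
    tens R M N x y \<triangleleft>\<^bsub>tensor R M N\<^esub> r = tens R M N x (y \<triangleleft>\<^bsub>N\<^esub> r)"
  unfolding tensor_P tens_cls by (simp add: rsmult_cls)

text \<open>Zero and the negatives of pure tensors are pure tensors again, namely
  \<open>0 \<otimes> 0\<close> and \<open>(-x) \<otimes> y\<close>, so only pure tensors and sums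
  remain as cases.\<close>

lemma tensor_induct [consumes 1, case_names tens add]:
  assumes "t \<in> carrier (tensor R M N)" and t: "\<And>x y. x \<in> carrier M \<Longrightarrow> y \<in> carrier N \<Longrightarrow> Q (tens R M N x y)"
    and "\<And>a b. a \<in> carrier (tensor R M N) \<Longrightarrow> b \<in> carrier (tensor R M N) \<Longrightarrow> Q a \<Longrightarrow> Q b \<Longrightarrow>
      Q (a \<oplus>\<^bsub>tensor R M N\<^esub> b)"
  shows "Q t"
proof -
  have h: "(\<lambda>x. tens R M N x y) \<in> add_hom M P" if "y \<in> carrier N" for y
    using balancedD(2)[OF balanced_tens that] by (simp only: tensor_P)
  note ab = bimodule_abelian[OF M] P.abelian_group_axioms
  show ?thesis using assms(1) unfolding tensor_P
  proof (induction rule: cls_induct_add)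
    case zero
    have "Q (tens R M N \<zero>\<^bsub>M\<^esub> \<zero>\<^bsub>N\<^esub>)" by (rule t) auto
    then show ?case using add_hom_zero[OF h[of "\<zero>\<^bsub>N\<^esub>"] ab] by simp
  next
    case (cls w)
    then show ?case using t by (auto simp: tens_cls)
  next
    case (uminus w)
    then have "Q (tens R M N (\<ominus>\<^bsub>M\<^esub> fst w) (snd w))" by (intro t) auto
    then show ?case using uminus add_hom_a_inv[OF h[of "snd w"] ab, of "fst w"] by (auto simp: tens_cls)
  next
    case (add a b)
    then show ?case using assms(3) unfolding tensor_P by blast
  qed
qed

text \<open>The universal property of the tensor product. Each of the three families in
  \<open>tensor_rels\<close> is killed by one clause of \<open>balanced\<close>.\<close>

lemma
  assumes "balanced R M N X \<beta>" "abelian_group X"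
  shows lift_tensor_hom: "lift X (\<lambda>(x, y). \<beta> x y) \<in> add_hom (tensor R M N) X"
    and lift_tens: "x \<in> carrier M \<Longrightarrow> y \<in> carrier N \<Longrightarrow> lift X (\<lambda>(x, y). \<beta> x y) (tens R M N x y) = \<beta> x y"
proof -
  have c: "(\<lambda>(x, y). \<beta> x y) \<in> carrier M \<times> carrier N \<rightarrow> carrier X"
    using balancedD(1)[OF assms(1)] add_hom_closed by fastforce
  have e: "frag_eval X (\<lambda>(x, y). \<beta> x y) e = \<zero>\<^bsub>X\<^esub>" if "e \<in> tensor_rels R M N" for e
    using that
  proof (cases rule: tensor_relsE)
    case (1 x x' y)
    then show ?thesis
      using add_hom_add[OF balancedD(2)[OF assms(1)], of y x x'] unfolding 1(1)
      by (intro frag_eval_rel3[OF assms(2) c]) auto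
  next
    case (2 x y y')
    then show ?thesis
      using add_hom_add[OF balancedD(1)[OF assms(1)], of x y y'] unfolding 2(1)
      by (intro frag_eval_rel3[OF assms(2) c]) auto
  next
    case (3 x r y)
    then show ?thesis
      using balancedD(3)[OF assms(1)] unfolding 3(1)
      by (intro frag_eval_rel2[OF assms(2) c]) (auto simp: M.rsmult_closed N.smult_closed)
  qed
  show "lift X (\<lambda>(x, y). \<beta> x y) \<in> add_hom (tensor R M N) X"
    unfolding tensor_P by (rule lift_hom[OF assms(2) c e])
  show "lift X (\<lambda>(x, y). \<beta> x y) (tens R M N x y) = \<beta> x y" if "x \<in> carrier M" "y \<in> carrier N"
    using lift_cls[OF assms(2) c e, of "(x, y)"] that by (simp add: tens_cls)
qed

lemma tensor_hom_ext:
  assumes "f \<in> add_hom (tensor R M N) X" "g \<in> add_hom (tensor R M N) X"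
    and "\<And>x y. x \<in> carrier M \<Longrightarrow> y \<in> carrier N \<Longrightarrow> f (tens R M N x y) = g (tens R M N x y)"
    and "t \<in> carrier (tensor R M N)"
  shows "f t = g t"
  using assms(4) by (induction rule: tensor_induct) (simp_all add: assms add_hom_add[OF assms(1)] add_hom_add[OF assms(2)])

end

section \<open>Functoriality of the tensor product\<close>

context
  fixes R :: "('r, 'k) ring_scheme" and M :: "('r, 'm, 'l) bimodule_scheme" and N :: "('r, 'n, 'l2) bimodule_scheme"
    and M' :: "('r, 'm1, 'l3) bimodule_scheme" and N' :: "('r, 'n1, 'l4) bimodule_scheme" and f g
  assumes M: "bimodule R M" and N: "bimodule R N" and M': "bimodule R M'" and N': "bimodule R N'"
    and f: "f \<in> right_hom R M M'" and g: "g \<in> left_hom R N N'"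
begin

interpretation M: bimodule R M by (rule M)
interpretation N: bimodule R N by (rule N)

private lemma fc: "x \<in> carrier M \<Longrightarrow> f x \<in> carrier M'"
  by (rule add_hom_closed[OF right_homD[OF f]])

private lemma gc: "x \<in> carrier N \<Longrightarrow> g x \<in> carrier N'"
  by (rule add_hom_closed[OF left_homD[OF g]])

private lemma tensor_map_balanced: "balanced R M N (tensor R M' N') (\<lambda>x y. tens R M' N' (f x) (g y))"
  by (rule balancedI)
    (simp_all add: fc gc right_hom_rsmult[OF f] left_hom_smult[OF g] tens_balanced[OF M' N']
      add_hom_comp[OF left_homD[OF g] balancedD(1)[OF balanced_tens[OF M' N']]]
      add_hom_comp[OF right_homD[OF f] balancedD(2)[OF balanced_tens[OF M' N']]])

text \<open>Balancing takes place between the two factors, so right linearity of \<open>f\<close>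
  and left linearity of \<open>g\<close> make the map well defined. Linearity of the result on an
  outer side is a separate matter and asks for the other linearity of \<open>f\<close> or of
  \<open>g\<close>.\<close>

lemma tensor_map_hom: "tensor_map R M' N' f g \<in> add_hom (tensor R M N) (tensor R M' N')"
  unfolding tensor_map_def
  by (rule lift_tensor_hom[OF M N tensor_map_balanced bimodule_abelian[OF tensor_bimodule[OF M' N']]])

lemma tensor_map_tens:
  "x \<in> carrier M \<Longrightarrow> y \<in> carrier N \<Longrightarrow> tensor_map R M' N' f g (tens R M N x y) = tens R M' N' (f x) (g y)"
  unfolding tensor_map_def
  by (rule lift_tens[OF M N tensor_map_balanced bimodule_abelian[OF tensor_bimodule[OF M' N']]])

lemma tensor_map_left_hom:
  assumes f': "f \<in> left_hom R M M'"
  shows "tensor_map R M' N' f g \<in> left_hom R (tensor R M N) (tensor R M' N')"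
proof (rule left_homI[OF tensor_map_hom])
  interpret T: bimodule R "tensor R M N" by (rule tensor_bimodule[OF M N])
  interpret T': bimodule R "tensor R M' N'" by (rule tensor_bimodule[OF M' N'])
  fix r t assume r: "r \<in> carrier R" and t: "t \<in> carrier (tensor R M N)"
  show "tensor_map R M' N' f g (r \<odot>\<^bsub>tensor R M N\<^esub> t) = r \<odot>\<^bsub>tensor R M' N'\<^esub> tensor_map R M' N' f g t"
    by (rule tensor_hom_ext[OF M N add_hom_comp[OF T.smult_hom[OF r] tensor_map_hom]
          add_hom_comp[OF tensor_map_hom T'.smult_hom[OF r]] _ t])
      (simp add: r tens_smult[OF M N] tens_smult[OF M' N'] tensor_map_tens fc gc M.smult_closed left_hom_smult[OF f'])
qed

lemma tensor_map_right_hom: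
  assumes g': "g \<in> right_hom R N N'"
  shows "tensor_map R M' N' f g \<in> right_hom R (tensor R M N) (tensor R M' N')"
proof (rule right_homI[OF tensor_map_hom])
  interpret T: bimodule R "tensor R M N" by (rule tensor_bimodule[OF M N])
  interpret T': bimodule R "tensor R M' N'" by (rule tensor_bimodule[OF M' N'])
  fix r t assume r: "r \<in> carrier R" and t: "t \<in> carrier (tensor R M N)"
  show "tensor_map R M' N' f g (t \<triangleleft>\<^bsub>tensor R M N\<^esub> r) = tensor_map R M' N' f g t \<triangleleft>\<^bsub>tensor R M' N'\<^esub> r"
    by (rule tensor_hom_ext[OF M N add_hom_comp[OF T.rsmult_hom[OF r] tensor_map_hom]
          add_hom_comp[OF tensor_map_hom T'.rsmult_hom[OF r]] _ t])
      (simp add: r tens_rsmult[OF M N] tens_rsmult[OF M' N'] tensor_map_tens fc gc N.rsmult_closed right_hom_rsmult[OF g'])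
qed

end

section \<open>Tensor powers\<close>

lemma power_relsE:
  assumes "e \<in> power_rels R M n"
  obtains r s xs where "e = frag_of (r \<oplus>\<^bsub>R\<^esub> s, xs) - frag_of (r, xs) - frag_of (s, xs)"
      "r \<in> carrier R" "s \<in> carrier R" "set xs \<subseteq> carrier M" "length xs = n"
  | r xs x y ys where
      "e = frag_of (r, xs @ [x \<oplus>\<^bsub>M\<^esub> y] @ ys) - frag_of (r, xs @ [x] @ ys) - frag_of (r, xs @ [y] @ ys)"
      "r \<in> carrier R" "x \<in> carrier M" "y \<in> carrier M" "set xs \<subseteq> carrier M" "set ys \<subseteq> carrier M"
      "length xs + 1 + length ys = n"
  | r s x xs where "e = frag_of (r \<otimes>\<^bsub>R\<^esub> s, [x] @ xs) - frag_of (r, [s \<odot>\<^bsub>M\<^esub> x] @ xs)"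
      "r \<in> carrier R" "s \<in> carrier R" "x \<in> carrier M" "set xs \<subseteq> carrier M" "1 + length xs = n"
  | r xs x s y ys where "e = frag_of (r, xs @ [x \<triangleleft>\<^bsub>M\<^esub> s, y] @ ys) - frag_of (r, xs @ [x, s \<odot>\<^bsub>M\<^esub> y] @ ys)"
      "r \<in> carrier R" "s \<in> carrier R" "x \<in> carrier M" "y \<in> carrier M"
      "set xs \<subseteq> carrier M" "set ys \<subseteq> carrier M" "length xs + 2 + length ys = n"
  using assms unfolding power_rels_def by blast

lemma power_relsI:
  "r \<in> carrier R \<Longrightarrow> s \<in> carrier R \<Longrightarrow> set xs \<subseteq> carrier M \<Longrightarrow> length xs = n \<Longrightarrow>
     frag_of (r \<oplus>\<^bsub>R\<^esub> s, xs) - frag_of (r, xs) - frag_of (s, xs) \<in> power_rels R M n"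
  "r \<in> carrier R \<Longrightarrow> x \<in> carrier M \<Longrightarrow> y \<in> carrier M \<Longrightarrow> set xs \<subseteq> carrier M \<Longrightarrow> set ys \<subseteq> carrier M \<Longrightarrow>
     length xs + 1 + length ys = n \<Longrightarrow>
     frag_of (r, xs @ (x \<oplus>\<^bsub>M\<^esub> y) # ys) - frag_of (r, xs @ x # ys) - frag_of (r, xs @ y # ys) \<in> power_rels R M n"
  "r \<in> carrier R \<Longrightarrow> s \<in> carrier R \<Longrightarrow> x \<in> carrier M \<Longrightarrow> set xs \<subseteq> carrier M \<Longrightarrow> 1 + length xs = n \<Longrightarrow>
     frag_of (r \<otimes>\<^bsub>R\<^esub> s, x # xs) - frag_of (r, (s \<odot>\<^bsub>M\<^esub> x) # xs) \<in> power_rels R M n"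
  "r \<in> carrier R \<Longrightarrow> s \<in> carrier R \<Longrightarrow> x \<in> carrier M \<Longrightarrow> y \<in> carrier M \<Longrightarrow> set xs \<subseteq> carrier M \<Longrightarrow>
     set ys \<subseteq> carrier M \<Longrightarrow> length xs + 2 + length ys = n \<Longrightarrow>
     frag_of (r, xs @ (x \<triangleleft>\<^bsub>M\<^esub> s) # y # ys) - frag_of (r, xs @ x # (s \<odot>\<^bsub>M\<^esub> y) # ys) \<in> power_rels R M n"
  unfolding power_rels_def append.simps[symmetric] by (simp only: append_Cons append_Nil, blast)+

abbreviation words :: "('r, 'k) ring_scheme \<Rightarrow> ('r, 'm, 'l) bimodule_scheme \<Rightarrow> nat \<Rightarrow> ('r \<times> 'm list) set" where
  "words R M n \<equiv> carrier R \<times> {xs. set xs \<subseteq> carrier M \<and> length xs = n}"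

locale bimodule_power = M: bimodule R M
  for R :: "('r, 'k) ring_scheme" and M :: "('r, 'm, 'l) bimodule_scheme" + fixes n :: nat
begin

abbreviation act_r :: "'r \<times> 'm list \<Rightarrow> 'r \<Rightarrow> 'r \<times> 'm list" where
  "act_r \<equiv> \<lambda>(r, xs) s. if xs = [] then (r \<otimes>\<^bsub>R\<^esub> s, []) else (r, butlast xs @ [last xs \<triangleleft>\<^bsub>M\<^esub> s])"

text \<open>The right action changes the last letter, or the coefficient of the empty word. In each
  family the only question is whether the last letter takes part in the relation; if it does not,
  the result is the same relation with another final letter.\<close>

lemma act_r_rels:
  assumes t: "t \<in> carrier R" and e: "e \<in> power_rels R M n"
  shows "frag_extend (\<lambda>w. frag_of (act_r w t)) e \<in> power_rels R M n"
  using e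
proof (cases rule: power_relsE)
  case (1 r s xs)
  then show ?thesis
  proof (cases xs rule: rev_cases)
    case Nil
    then show ?thesis
      using 1 t power_relsI(1)[of "r \<otimes>\<^bsub>R\<^esub> t" R "s \<otimes>\<^bsub>R\<^esub> t" "[]" M n] by (simp add: frag_extend_diff M.R.l_distr)
  next
    case (snoc ys y)
    then show ?thesis
      using 1 t power_relsI(1)[of r R s "ys @ [y \<triangleleft>\<^bsub>M\<^esub> t]" M n] by (simp add: frag_extend_diff M.rsmult_closed)
  qed
next
  case (2 r xs x y ys)
  then show ?thesis
  proof (cases ys rule: rev_cases)
    case Nil
    then show ?thesis
      using 2 t power_relsI(2)[of r R "x \<triangleleft>\<^bsub>M\<^esub> t" M "y \<triangleleft>\<^bsub>M\<^esub> t" xs "[]" n]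
      by (simp add: frag_extend_diff M.rsmult_closed M.rsmult_l_distr)
  next
    case (snoc zs z)
    then show ?thesis
      using 2 t power_relsI(2)[of r R x M y xs "zs @ [z \<triangleleft>\<^bsub>M\<^esub> t]" n]
      by (simp add: frag_extend_diff M.rsmult_closed butlast_append)
  qed
next
  case (3 r s x xs)
  then show ?thesis
  proof (cases xs rule: rev_cases)
    case Nil
    then show ?thesis
      using 3 t power_relsI(3)[of r R s "x \<triangleleft>\<^bsub>M\<^esub> t" M "[]" n]
      by (simp add: frag_extend_diff M.rsmult_closed M.bimodule_assoc)
  next
    case (snoc zs z)
    then show ?thesis
      using 3 t power_relsI(3)[of r R s x M "zs @ [z \<triangleleft>\<^bsub>M\<^esub> t]" n]
      by (simp add: frag_extend_diff M.rsmult_closed)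
  qed
next
  case (4 r xs x s y ys)
  then show ?thesis
  proof (cases ys rule: rev_cases)
    case Nil
    then show ?thesis
      using 4 t power_relsI(4)[of r R s x M "y \<triangleleft>\<^bsub>M\<^esub> t" xs "[]" n]
      by (simp add: frag_extend_diff M.rsmult_closed M.bimodule_assoc butlast_append)
  next
    case (snoc zs z)
    then show ?thesis
      using 4 t power_relsI(4)[of r R s x M y xs "zs @ [z \<triangleleft>\<^bsub>M\<^esub> t]" n]
      by (simp add: frag_extend_diff M.rsmult_closed butlast_append)
  qed
qed

sublocale presentation R "words R M n" "\<lambda>s (r, xs). (s \<otimes>\<^bsub>R\<^esub> r, xs)" act_r "power_rels R M n"
proof (intro presentation.intro presentation_axioms.intro bimodule_ring[OF M.bimodule_axioms], goal_cases)
  case (2 r w)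
  then show ?case by (cases "snd w" rule: rev_cases) (auto simp: M.rsmult_closed split: prod.splits)
next
  case (3 e)
  then show ?case
    by (cases rule: power_relsE) (simp_all add: keys_rel2 keys_rel3 M.rsmult_closed M.smult_closed)
next
  case (4 r e)
  note r = this(1)
  show ?case
    using 4(2) by (cases rule: power_relsE)
      (use r in \<open>simp_all add: frag_extend_diff M.R.r_distr M.R.m_assoc[symmetric] power_relsI del: append_Cons append_Nil, simp_all add: power_relsI\<close>)
next
  case (5 r e)
  then show ?case by (rule act_r_rels)
qed auto

lemma tensor_power_P: "tensor_power R M n = P"
  by (simp add: tensor_power_def power_words_def)

lemma pword_cls: "length xs = n \<Longrightarrow> pword R M r xs = cls (r, xs)"
  by (simp add: pword_def power_words_def N_def)

lemma bimodule_power: "bimodule R (tensor_power R M n)"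
  unfolding tensor_power_P
proof (rule bimodule_presented, goal_cases)
  case (1 r s w)
  then show ?case
    using rel_cls3[OF power_relsI(1)[of "r \<otimes>\<^bsub>R\<^esub> fst w" R "s \<otimes>\<^bsub>R\<^esub> fst w" "snd w"]]
    by (auto simp: M.R.l_distr)
next
  case (2 r s w)
  then show ?case by (auto simp: M.R.m_assoc)
next
  case (4 r s w)
  show ?case
  proof (cases "snd w" rule: rev_cases)
    case Nil
    then show ?thesis
      using 4 rel_cls3[OF power_relsI(1)[of "fst w \<otimes>\<^bsub>R\<^esub> r" R "fst w \<otimes>\<^bsub>R\<^esub> s" "[]" M n]]
      by (auto simp: M.R.r_distr simp del: P_sel)
  next
    case (snoc ys y)
    then show ?thesis
      using 4 rel_cls3[OF power_relsI(2)[of "fst w" R "y \<triangleleft>\<^bsub>M\<^esub> r" M "y \<triangleleft>\<^bsub>M\<^esub> s" ys "[]" n]]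
      by (auto simp: M.rsmult_r_distr M.rsmult_closed simp del: P_sel)
  qed
next
  case (5 r s w)
  then show ?case by (cases "snd w" rule: rev_cases) (auto simp: M.R.m_assoc M.rsmult_assoc)
next
  case (6 w)
  then show ?case by (cases "snd w" rule: rev_cases) (auto simp: M.rsmult_one)
next
  case (7 r s w)
  then show ?case by (cases "snd w" rule: rev_cases) (auto simp: M.R.m_assoc)
qed auto

end

context
  fixes R :: "('r, 'k) ring_scheme" and M :: "('r, 'm, 'l) bimodule_scheme"
  assumes M: "bimodule R M"
begin

interpretation bimodule_power R M n for n by (intro bimodule_power.intro M)

interpretation M: bimodule R M by (rule M)

lemma tensor_power_bimodule: "bimodule R (tensor_power R M n)"
  by (rule bimodule_power)

lemma pword_closed:
  "r \<in> carrier R \<Longrightarrow> set xs \<subseteq> carrier M \<Longrightarrow> length xs = n \<Longrightarrow> pword R M r xs \<in> carrier (tensor_power R M n)"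
  unfolding tensor_power_P pword_cls by (rule cls_closed) simp

lemma pword_add_coeff:
  "r \<in> carrier R \<Longrightarrow> s \<in> carrier R \<Longrightarrow> set xs \<subseteq> carrier M \<Longrightarrow> length xs = n \<Longrightarrow>
    pword R M (r \<oplus>\<^bsub>R\<^esub> s) xs = pword R M r xs \<oplus>\<^bsub>tensor_power R M n\<^esub> pword R M s xs"
  unfolding tensor_power_P pword_cls by (rule rel_cls3[OF power_relsI(1)]) auto

lemma pword_add_entry:
  "r \<in> carrier R \<Longrightarrow> x \<in> carrier M \<Longrightarrow> y \<in> carrier M \<Longrightarrow> set xs \<subseteq> carrier M \<Longrightarrow> set ys \<subseteq> carrier M \<Longrightarrow>
    n = Suc (length xs + length ys) \<Longrightarrow>
    pword R M r (xs @ (x \<oplus>\<^bsub>M\<^esub> y) # ys) =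
    pword R M r (xs @ x # ys) \<oplus>\<^bsub>tensor_power R M n\<^esub> pword R M r (xs @ y # ys)"
  using rel_cls3[OF power_relsI(2)[of r R x M y xs ys n]]
  by (simp add: tensor_power_P pword_cls)

lemma pword_scalar:
  "r \<in> carrier R \<Longrightarrow> s \<in> carrier R \<Longrightarrow> x \<in> carrier M \<Longrightarrow> set xs \<subseteq> carrier M \<Longrightarrow>
    pword R M (r \<otimes>\<^bsub>R\<^esub> s) (x # xs) = pword R M r ((s \<odot>\<^bsub>M\<^esub> x) # xs)"
  using rel_cls2[OF power_relsI(3)[of r R s x M xs "Suc (length xs)"]]
  by (simp add: pword_cls[of _ "Suc (length xs)"] M.smult_closed)

lemma pword_balanced:
  "r \<in> carrier R \<Longrightarrow> s \<in> carrier R \<Longrightarrow> x \<in> carrier M \<Longrightarrow> y \<in> carrier M \<Longrightarrow> set xs \<subseteq> carrier M \<Longrightarrow>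
    set ys \<subseteq> carrier M \<Longrightarrow>
    pword R M r (xs @ (x \<triangleleft>\<^bsub>M\<^esub> s) # y # ys) = pword R M r (xs @ x # (s \<odot>\<^bsub>M\<^esub> y) # ys)"
  using rel_cls2[OF power_relsI(4)[of r R s x M y xs ys "length xs + 2 + length ys"]]
  by (simp add: pword_cls[of _ "length xs + 2 + length ys"] M.smult_closed M.rsmult_closed)

lemma pword_smult:
  "r \<in> carrier R \<Longrightarrow> s \<in> carrier R \<Longrightarrow> set xs \<subseteq> carrier M \<Longrightarrow> length xs = n \<Longrightarrow>
    s \<odot>\<^bsub>tensor_power R M n\<^esub> pword R M r xs = pword R M (s \<otimes>\<^bsub>R\<^esub> r) xs"
  by (simp add: tensor_power_P pword_cls smult_cls)

lemma pword_rsmult_Nil: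
  "r \<in> carrier R \<Longrightarrow> s \<in> carrier R \<Longrightarrow> pword R M r [] \<triangleleft>\<^bsub>tensor_power R M 0\<^esub> s = pword R M (r \<otimes>\<^bsub>R\<^esub> s) []"
  using rsmult_cls[of s "(r, [])" 0] by (simp add: tensor_power_P pword_cls[of _ 0])

lemma pword_rsmult_snoc:
  "r \<in> carrier R \<Longrightarrow> s \<in> carrier R \<Longrightarrow> set xs \<subseteq> carrier M \<Longrightarrow> x \<in> carrier M \<Longrightarrow> n = Suc (length xs) \<Longrightarrow>
    pword R M r (xs @ [x]) \<triangleleft>\<^bsub>tensor_power R M n\<^esub> s = pword R M r (xs @ [x \<triangleleft>\<^bsub>M\<^esub> s])"
  by (simp add: tensor_power_P pword_cls rsmult_cls)

text \<open>As for tensors: zero is the word of zeros with coefficient zero, and a sign is absorbed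
  by the coefficient.\<close>

lemma tensor_power_induct [consumes 1, case_names pword add]:
  assumes "t \<in> carrier (tensor_power R M n)"
    and t: "\<And>r xs. r \<in> carrier R \<Longrightarrow> set xs \<subseteq> carrier M \<Longrightarrow> length xs = n \<Longrightarrow> Q (pword R M r xs)"
    and "\<And>a b. a \<in> carrier (tensor_power R M n) \<Longrightarrow> b \<in> carrier (tensor_power R M n) \<Longrightarrow> Q a \<Longrightarrow> Q b \<Longrightarrow>
      Q (a \<oplus>\<^bsub>tensor_power R M n\<^esub> b)"
  shows "Q t"
proof -
  have h: "(\<lambda>r. pword R M r xs) \<in> add_hom R (P n)" if "set xs \<subseteq> carrier M" "length xs = n" for xs
    using that pword_closed pword_add_coeff by (auto intro!: add_homI simp: tensor_power_P[symmetric])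
  note ab = ring_abelian[OF bimodule_ring[OF M]] P.abelian_group_axioms
  show ?thesis using assms(1) unfolding tensor_power_P
  proof (induction rule: cls_induct_add)
    case zero
    let ?z = "replicate n \<zero>\<^bsub>M\<^esub>"
    have z: "set ?z \<subseteq> carrier M" "length ?z = n" by auto
    then have "Q (pword R M \<zero>\<^bsub>R\<^esub> ?z)" by (intro t) auto
    then show ?case using add_hom_zero[OF h[OF z] ab] by (simp only:)
  next
    case (cls w)
    then show ?case using t by (auto simp: pword_cls)
  next
    case (uminus w)
    then have "Q (pword R M (\<ominus>\<^bsub>R\<^esub> fst w) (snd w))" by (intro t) auto
    then show ?case using uminus add_hom_a_inv[OF h[of "snd w"] ab, of "fst w"] by (auto simp: pword_cls)
  next
    case (add a b)
    then show ?case using assms(3) unfolding tensor_power_P by blast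
  qed
qed

text \<open>The universal property of the tensor power; the last four hypotheses correspond to the
  four families in \<open>power_rels\<close>.\<close>

lemma
  assumes X: "abelian_group X"
    and c: "\<And>r xs. r \<in> carrier R \<Longrightarrow> set xs \<subseteq> carrier M \<Longrightarrow> length xs = n \<Longrightarrow> f r xs \<in> carrier X"
    and add_coeff: "\<And>r s xs. r \<in> carrier R \<Longrightarrow> s \<in> carrier R \<Longrightarrow> set xs \<subseteq> carrier M \<Longrightarrow> length xs = n \<Longrightarrow>
      f (r \<oplus>\<^bsub>R\<^esub> s) xs = f r xs \<oplus>\<^bsub>X\<^esub> f s xs"
    and add_entry: "\<And>r xs x y ys. r \<in> carrier R \<Longrightarrow> x \<in> carrier M \<Longrightarrow> y \<in> carrier M \<Longrightarrow> set xs \<subseteq> carrier M \<Longrightarrow>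
      set ys \<subseteq> carrier M \<Longrightarrow> n = Suc (length xs + length ys) \<Longrightarrow>
      f r (xs @ (x \<oplus>\<^bsub>M\<^esub> y) # ys) = f r (xs @ x # ys) \<oplus>\<^bsub>X\<^esub> f r (xs @ y # ys)"
    and scalar: "\<And>r s x xs. r \<in> carrier R \<Longrightarrow> s \<in> carrier R \<Longrightarrow> x \<in> carrier M \<Longrightarrow> set xs \<subseteq> carrier M \<Longrightarrow>
      n = Suc (length xs) \<Longrightarrow> f (r \<otimes>\<^bsub>R\<^esub> s) (x # xs) = f r ((s \<odot>\<^bsub>M\<^esub> x) # xs)"
    and bal: "\<And>r s x y xs ys. r \<in> carrier R \<Longrightarrow> s \<in> carrier R \<Longrightarrow> x \<in> carrier M \<Longrightarrow> y \<in> carrier M \<Longrightarrow>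
      set xs \<subseteq> carrier M \<Longrightarrow> set ys \<subseteq> carrier M \<Longrightarrow> n = Suc (Suc (length xs + length ys)) \<Longrightarrow>
      f r (xs @ (x \<triangleleft>\<^bsub>M\<^esub> s) # y # ys) = f r (xs @ x # (s \<odot>\<^bsub>M\<^esub> y) # ys)"
  shows lift_power_hom: "lift X (\<lambda>(r, xs). f r xs) \<in> add_hom (tensor_power R M n) X"
    and lift_pword: "r \<in> carrier R \<Longrightarrow> set xs \<subseteq> carrier M \<Longrightarrow> length xs = n \<Longrightarrow>
      lift X (\<lambda>(r, xs). f r xs) (pword R M r xs) = f r xs"
proof -
  have c': "(\<lambda>(r, xs). f r xs) \<in> words R M n \<rightarrow> carrier X"
    using c by auto
  have e: "frag_eval X (\<lambda>(r, xs). f r xs) e = \<zero>\<^bsub>X\<^esub>" if "e \<in> power_rels R M n" for e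
    using that
  proof (cases rule: power_relsE)
    case (1 r s xs)
    show ?thesis unfolding 1(1)
      by (rule frag_eval_rel3[OF X c']) (use 1 add_coeff in auto)
  next
    case (2 r xs x y ys)
    show ?thesis unfolding 2(1)
      by (rule frag_eval_rel3[OF X c']) (use 2 add_entry[of r x y xs ys] in auto)
  next
    case (3 r s x xs)
    show ?thesis unfolding 3(1)
      by (rule frag_eval_rel2[OF X c']) (use 3 scalar[of r s x xs] in \<open>auto simp: M.smult_closed\<close>)
  next
    case (4 r xs x s y ys)
    show ?thesis unfolding 4(1)
      by (rule frag_eval_rel2[OF X c']) (use 4 bal[of r s x y xs ys] in \<open>auto simp: M.smult_closed M.rsmult_closed\<close>)
  qed
  show "lift X (\<lambda>(r, xs). f r xs) \<in> add_hom (tensor_power R M n) X"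
    unfolding tensor_power_P by (rule lift_hom[OF X c' e])
  show "lift X (\<lambda>(r, xs). f r xs) (pword R M r xs) = f r xs"
    if "r \<in> carrier R" "set xs \<subseteq> carrier M" "length xs = n"
    using lift_cls[OF X c' e, of "(r, xs)"] that by (simp add: pword_cls)
qed

end

lemma lift_tensor_left_hom:
  assumes M: "bimodule R M" and N: "bimodule R N" and X: "left_module R X" and \<beta>: "balanced R M N X \<beta>"
    and l: "\<And>r x y. r \<in> carrier R \<Longrightarrow> x \<in> carrier M \<Longrightarrow> y \<in> carrier N \<Longrightarrow> \<beta> (r \<odot>\<^bsub>M\<^esub> x) y = r \<odot>\<^bsub>X\<^esub> \<beta> x y"
  shows "lift X (\<lambda>(x, y). \<beta> x y) \<in> left_hom R (tensor R M N) X"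
proof -
  interpret M: bimodule R M by fact
  interpret X: left_module R X by fact
  interpret T: bimodule R "tensor R M N" by (rule tensor_bimodule[OF M N])
  note ab = left_module_abelian[OF X]
  note h = lift_tensor_hom[OF M N \<beta> ab] and e = lift_tens[OF M N \<beta> ab]
  have s: "(\<lambda>x. r \<odot>\<^bsub>X\<^esub> x) \<in> add_hom X X" if "r \<in> carrier R" for r
    by (rule add_homI) (simp_all add: that X.smult_closed X.smult_r_distr)
  show ?thesis
  proof (rule left_homI[OF h])
    fix r t assume r: "r \<in> carrier R" and t: "t \<in> carrier (tensor R M N)"
    show "lift X (\<lambda>(x, y). \<beta> x y) (r \<odot>\<^bsub>tensor R M N\<^esub> t) = r \<odot>\<^bsub>X\<^esub> lift X (\<lambda>(x, y). \<beta> x y) t"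
      by (rule tensor_hom_ext[OF M N add_hom_comp[OF T.smult_hom[OF r] h] add_hom_comp[OF h s[OF r]] _ t])
        (simp add: r tens_smult[OF M N] M.smult_closed e l)
  qed
qed

lemma lift_tensor_right_hom:
  assumes M: "bimodule R M" and N: "bimodule R N" and X: "bimodule R X" and \<beta>: "balanced R M N X \<beta>"
    and l: "\<And>r x y. r \<in> carrier R \<Longrightarrow> x \<in> carrier M \<Longrightarrow> y \<in> carrier N \<Longrightarrow> \<beta> x (y \<triangleleft>\<^bsub>N\<^esub> r) = \<beta> x y \<triangleleft>\<^bsub>X\<^esub> r"
  shows "lift X (\<lambda>(x, y). \<beta> x y) \<in> right_hom R (tensor R M N) X"
proof -
  interpret N: bimodule R N by fact
  interpret X: bimodule R X by fact
  interpret T: bimodule R "tensor R M N" by (rule tensor_bimodule[OF M N])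
  note ab = bimodule_abelian[OF X]
  note h = lift_tensor_hom[OF M N \<beta> ab] and e = lift_tens[OF M N \<beta> ab]
  show ?thesis
  proof (rule right_homI[OF h])
    fix r t assume r: "r \<in> carrier R" and t: "t \<in> carrier (tensor R M N)"
    show "lift X (\<lambda>(x, y). \<beta> x y) (t \<triangleleft>\<^bsub>tensor R M N\<^esub> r) = lift X (\<lambda>(x, y). \<beta> x y) t \<triangleleft>\<^bsub>X\<^esub> r"
      by (rule tensor_hom_ext[OF M N add_hom_comp[OF T.rsmult_hom[OF r] h] add_hom_comp[OF h X.rsmult_hom[OF r]] _ t])
        (simp add: r tens_rsmult[OF M N] N.rsmult_closed e l)
  qed
qed

lemma balanced_comp: "balanced R M N X \<beta> \<Longrightarrow> g \<in> add_hom X Y \<Longrightarrow> balanced R M N Y (\<lambda>x y. g (\<beta> x y))"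
  by (rule balancedI) (simp_all add: balancedD(3) add_hom_comp[OF balancedD(1)] add_hom_comp[OF balancedD(2)])

lemma lift_tensor_comp:
  assumes M: "bimodule R M" and N: "bimodule R N" and \<beta>: "balanced R M N X \<beta>" and g: "g \<in> add_hom X Y"
    and X: "abelian_group X" and Y: "abelian_group Y" and t: "t \<in> carrier (tensor R M N)"
  shows "g (lift X (\<lambda>(x, y). \<beta> x y) t) = lift Y (\<lambda>(x, y). g (\<beta> x y)) t"
  by (rule tensor_hom_ext[OF M N add_hom_comp[OF lift_tensor_hom[OF M N \<beta> X] g]
        lift_tensor_hom[OF M N balanced_comp[OF \<beta> g] Y] _ t])
    (simp add: lift_tens[OF M N \<beta> X] lift_tens[OF M N balanced_comp[OF \<beta> g] Y])

lemma balanced_cong: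
  assumes "balanced R M N X \<beta>" "bimodule R M" "bimodule R N"
    and "\<And>x y. x \<in> carrier M \<Longrightarrow> y \<in> carrier N \<Longrightarrow> \<gamma> x y = \<beta> x y"
  shows "balanced R M N X \<gamma>"
proof -
  interpret M: bimodule R M by fact
  interpret N: bimodule R N by fact
  note b = balancedD[OF assms(1)]
  show ?thesis
    by (intro balancedI add_homI)
      (simp_all add: assms(4) add_hom_closed[OF b(1)] add_hom_add[OF b(1)] add_hom_add[OF b(2)] b(3)
        M.rsmult_closed N.smult_closed)
qed

text \<open>\<open>lift\<close> takes its argument as a total function on words, so agreement on the
  carriers does not make the two lifts equal by congruence. The comparison goes through pure
  tensors, where only elements of the carriers occur.\<close>

lemma lift_tensor_cong:
  assumes \<beta>: "balanced R M N X \<beta>" and M: "bimodule R M" and N: "bimodule R N" and X: "abelian_group X"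
    and eq: "\<And>x y. x \<in> carrier M \<Longrightarrow> y \<in> carrier N \<Longrightarrow> \<gamma> x y = \<beta> x y" and t: "t \<in> carrier (tensor R M N)"
  shows "lift X (\<lambda>(x, y). \<gamma> x y) t = lift X (\<lambda>(x, y). \<beta> x y) t"
proof -
  have \<gamma>: "balanced R M N X \<gamma>" by (rule balanced_cong[OF \<beta> M N eq])
  show ?thesis
    by (rule tensor_hom_ext[OF M N lift_tensor_hom[OF M N \<gamma> X] lift_tensor_hom[OF M N \<beta> X] _ t])
      (simp add: lift_tens[OF M N \<beta> X] lift_tens[OF M N \<gamma> X] eq)
qed

lemma lift_tensor_map:
  assumes M: "bimodule R M" and N: "bimodule R N" and M': "bimodule R M'" and N': "bimodule R N'"
    and f: "f \<in> right_hom R M M'" and g: "g \<in> left_hom R N N'"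
    and \<beta>: "balanced R M' N' X \<beta>" and X: "abelian_group X" and t: "t \<in> carrier (tensor R M N)"
  shows "lift X (\<lambda>(x, y). \<beta> x y) (tensor_map R M' N' f g t) = lift X (\<lambda>(x, y). \<beta> (f x) (g y)) t"
    and "balanced R M N X (\<lambda>x y. \<beta> (f x) (g y))"
proof -
  note fc = add_hom_closed[OF right_homD[OF f]] and gc = add_hom_closed[OF left_homD[OF g]]
  show b: "balanced R M N X (\<lambda>x y. \<beta> (f x) (g y))"
    by (rule balancedI) (simp_all add: fc gc right_hom_rsmult[OF f] left_hom_smult[OF g] balancedD(3)[OF \<beta>]
        add_hom_comp[OF left_homD[OF g] balancedD(1)[OF \<beta>]] add_hom_comp[OF right_homD[OF f] balancedD(2)[OF \<beta>]])
  show "lift X (\<lambda>(x, y). \<beta> x y) (tensor_map R M' N' f g t) = lift X (\<lambda>(x, y). \<beta> (f x) (g y)) t"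
    by (rule tensor_hom_ext[OF M N add_hom_comp[OF tensor_map_hom[OF M N M' N' f g] lift_tensor_hom[OF M' N' \<beta> X]]
          lift_tensor_hom[OF M N b X] _ t])
      (simp add: tensor_map_tens[OF M N M' N' f g] lift_tens[OF M' N' \<beta> X] lift_tens[OF M N b X] fc gc)
qed

section \<open>Concatenation in tensor powers\<close>

text \<open>Concatenation with one letter on the left, the balanced map behind
  \<open>M \<otimes> M^n \<rightarrow> M^(n+1)\<close>. The coefficient of the old word stands to
  the left of its first letter, so after concatenation it is absorbed by \<open>a\<close> from the
  right.\<close>

definition consp ::
  "('r, 'k) ring_scheme \<Rightarrow> ('r, 'm, 'l) bimodule_scheme \<Rightarrow> nat \<Rightarrow> 'm
    \<Rightarrow> (('r \<times> 'm list) \<Rightarrow>\<^sub>0 int) set \<Rightarrow> (('r \<times> 'm list) \<Rightarrow>\<^sub>0 int) set" where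
  "consp R M n a = lift (tensor_power R M (Suc n)) (\<lambda>(r, xs). pword R M \<one>\<^bsub>R\<^esub> ((a \<triangleleft>\<^bsub>M\<^esub> r) # xs))"

definition snocp ::
  "('r, 'k) ring_scheme \<Rightarrow> ('r, 'm, 'l) bimodule_scheme \<Rightarrow> nat \<Rightarrow> (('r \<times> 'm list) \<Rightarrow>\<^sub>0 int) set
    \<Rightarrow> 'm \<Rightarrow> (('r \<times> 'm list) \<Rightarrow>\<^sub>0 int) set" where
  "snocp R M n w y = lift (tensor_power R M (Suc n)) (\<lambda>(r, xs). pword R M r (xs @ [y])) w"

text \<open>The map \<open>M\<^sup>(\<^sup>n\<^sup>+\<^sup>1\<^sup>) \<cong> M \<otimes> M\<^sup>(\<^sup>n\<^sup>) \<rightarrow> X\<close> corresponding to a balanced map \<open>\<beta>\<close>.\<close>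

definition peel ::
  "('r, 'k) ring_scheme \<Rightarrow> ('r, 'm, 'l) bimodule_scheme \<Rightarrow> ('x, 'l2) ring_scheme
    \<Rightarrow> ('m \<Rightarrow> (('r \<times> 'm list) \<Rightarrow>\<^sub>0 int) set \<Rightarrow> 'x) \<Rightarrow> (('r \<times> 'm list) \<Rightarrow>\<^sub>0 int) set \<Rightarrow> 'x" where
  "peel R M X \<beta> = lift X (\<lambda>(r, xs). \<beta> (r \<odot>\<^bsub>M\<^esub> hd xs) (pword R M \<one>\<^bsub>R\<^esub> (tl xs)))"

context
  fixes R :: "('r, 'k) ring_scheme" and M :: "('r, 'm, 'l) bimodule_scheme"
  assumes M: "bimodule R M"
begin

interpretation M: bimodule R M by (rule M)

interpretation TP: bimodule R "tensor_power R M n" for n by (rule tensor_power_bimodule[OF M])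

abbreviation "TP n \<equiv> tensor_power R M n"

lemma tensor_power_hom_ext:
  assumes "f \<in> add_hom (tensor_power R M n) X" "g \<in> add_hom (tensor_power R M n) X"
    and "\<And>r xs. r \<in> carrier R \<Longrightarrow> set xs \<subseteq> carrier M \<Longrightarrow> length xs = n \<Longrightarrow> f (pword R M r xs) = g (pword R M r xs)"
    and "t \<in> carrier (tensor_power R M n)"
  shows "f t = g t"
  using assms(4)
  by (induction rule: tensor_power_induct[OF M, consumes 1]) (simp_all add: assms(3) add_hom_add[OF assms(1)] add_hom_add[OF assms(2)])

lemma
  assumes a: "a \<in> carrier M"
  shows consp_hom: "consp R M n a \<in> add_hom (TP n) (TP (Suc n))"
    and consp_pword: "r \<in> carrier R \<Longrightarrow> set xs \<subseteq> carrier M \<Longrightarrow> length xs = n \<Longrightarrow>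
      consp R M n a (pword R M r xs) = pword R M \<one>\<^bsub>R\<^esub> ((a \<triangleleft>\<^bsub>M\<^esub> r) # xs)"
proof -
  let ?f = "\<lambda>r xs. pword R M \<one>\<^bsub>R\<^esub> ((a \<triangleleft>\<^bsub>M\<^esub> r) # xs)"
  note hom = lift_power_hom[OF M, of "TP (Suc n)" n ?f]
  note eq = lift_pword[OF M, of "TP (Suc n)" n ?f]
  have ab: "abelian_group (TP (Suc n))" by (rule bimodule_abelian[OF tensor_power_bimodule[OF M]])
  have cl: "?f r xs \<in> carrier (TP (Suc n))" if "r \<in> carrier R" "set xs \<subseteq> carrier M" "length xs = n" for r xs
    using that a by (intro pword_closed[OF M]) (auto simp: M.rsmult_closed)
  have ac: "?f (r \<oplus>\<^bsub>R\<^esub> s) xs = ?f r xs \<oplus>\<^bsub>TP (Suc n)\<^esub> ?f s xs"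
    if "r \<in> carrier R" "s \<in> carrier R" "set xs \<subseteq> carrier M" "length xs = n" for r s xs
    using that a pword_add_entry[OF M, of "\<one>\<^bsub>R\<^esub>" "a \<triangleleft>\<^bsub>M\<^esub> r" "a \<triangleleft>\<^bsub>M\<^esub> s" "[]" xs]
    by (simp add: M.rsmult_closed M.rsmult_r_distr)
  have ae: "?f r (xs @ (x \<oplus>\<^bsub>M\<^esub> y) # ys) = ?f r (xs @ x # ys) \<oplus>\<^bsub>TP (Suc n)\<^esub> ?f r (xs @ y # ys)"
    if "r \<in> carrier R" "x \<in> carrier M" "y \<in> carrier M" "set xs \<subseteq> carrier M" "set ys \<subseteq> carrier M"
      "n = Suc (length xs + length ys)" for r xs x y ys
    using that a pword_add_entry[OF M, of "\<one>\<^bsub>R\<^esub>" x y "(a \<triangleleft>\<^bsub>M\<^esub> r) # xs" ys] by (simp add: M.rsmult_closed)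
  have sc: "?f (r \<otimes>\<^bsub>R\<^esub> s) (x # xs) = ?f r ((s \<odot>\<^bsub>M\<^esub> x) # xs)"
    if "r \<in> carrier R" "s \<in> carrier R" "x \<in> carrier M" "set xs \<subseteq> carrier M" "n = Suc (length xs)" for r s x xs
    using that a pword_balanced[OF M, of "\<one>\<^bsub>R\<^esub>" s "a \<triangleleft>\<^bsub>M\<^esub> r" x "[]" xs]
    by (simp add: M.rsmult_closed M.rsmult_assoc)
  have ba: "?f r (xs @ (x \<triangleleft>\<^bsub>M\<^esub> s) # y # ys) = ?f r (xs @ x # (s \<odot>\<^bsub>M\<^esub> y) # ys)"
    if "r \<in> carrier R" "s \<in> carrier R" "x \<in> carrier M" "y \<in> carrier M" "set xs \<subseteq> carrier M"
      "set ys \<subseteq> carrier M" "n = Suc (Suc (length xs + length ys))" for r s x y xs ys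
    using that a pword_balanced[OF M, of "\<one>\<^bsub>R\<^esub>" s x y "(a \<triangleleft>\<^bsub>M\<^esub> r) # xs" ys] by (simp add: M.rsmult_closed)
  show "consp R M n a \<in> add_hom (TP n) (TP (Suc n))"
    unfolding consp_def by (rule hom[OF ab cl ac ae sc ba])
  show "consp R M n a (pword R M r xs) = pword R M \<one>\<^bsub>R\<^esub> ((a \<triangleleft>\<^bsub>M\<^esub> r) # xs)"
    if "r \<in> carrier R" "set xs \<subseteq> carrier M" "length xs = n"
    unfolding consp_def by (rule eq[OF ab cl ac ae sc ba that])
qed

lemma consp_closed: "a \<in> carrier M \<Longrightarrow> w \<in> carrier (TP n) \<Longrightarrow> consp R M n a w \<in> carrier (TP (Suc n))"
  by (rule add_hom_closed[OF consp_hom])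

lemma consp_add_left:
  assumes a: "a \<in> carrier M" and b: "b \<in> carrier M" and w: "w \<in> carrier (TP n)"
  shows "consp R M n (a \<oplus>\<^bsub>M\<^esub> b) w = consp R M n a w \<oplus>\<^bsub>TP (Suc n)\<^esub> consp R M n b w"
proof (rule tensor_power_hom_ext[OF consp_hom add_hom_plus[OF consp_hom consp_hom] _ w])
  show "consp R M n (a \<oplus>\<^bsub>M\<^esub> b) (pword R M r xs) =
      consp R M n a (pword R M r xs) \<oplus>\<^bsub>TP (Suc n)\<^esub> consp R M n b (pword R M r xs)"
    if "r \<in> carrier R" "set xs \<subseteq> carrier M" "length xs = n" for r xs
    using that a b pword_add_entry[OF M, of "\<one>\<^bsub>R\<^esub>" "a \<triangleleft>\<^bsub>M\<^esub> r" "b \<triangleleft>\<^bsub>M\<^esub> r" "[]" xs]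
    by (simp add: consp_pword M.rsmult_l_distr M.rsmult_closed)
qed (simp_all add: a b bimodule_abelian[OF tensor_power_bimodule[OF M]])

lemma consp_balanced:
  assumes a: "a \<in> carrier M" and r: "r \<in> carrier R" and w: "w \<in> carrier (TP n)"
  shows "consp R M n (a \<triangleleft>\<^bsub>M\<^esub> r) w = consp R M n a (r \<odot>\<^bsub>TP n\<^esub> w)"
  by (rule tensor_power_hom_ext[OF consp_hom add_hom_comp[OF TP.smult_hom[OF r] consp_hom[OF a]] _ w])
    (simp_all add: a r consp_pword pword_smult[OF M] M.rsmult_closed M.rsmult_assoc)

lemma balanced_consp: "balanced R M (TP n) (TP (Suc n)) (consp R M n)"
  by (rule balancedI) (auto intro!: consp_hom add_homI simp: consp_closed consp_add_left consp_balanced)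

lemma consp_smult:
  assumes a: "a \<in> carrier M" and r: "r \<in> carrier R" and w: "w \<in> carrier (TP n)"
  shows "consp R M n (r \<odot>\<^bsub>M\<^esub> a) w = r \<odot>\<^bsub>TP (Suc n)\<^esub> consp R M n a w"
proof (rule tensor_power_hom_ext[OF consp_hom add_hom_comp[OF consp_hom[OF a] TP.smult_hom[OF r]] _ w])
  show "consp R M n (r \<odot>\<^bsub>M\<^esub> a) (pword R M s xs) = r \<odot>\<^bsub>TP (Suc n)\<^esub> consp R M n a (pword R M s xs)"
    if "s \<in> carrier R" "set xs \<subseteq> carrier M" "length xs = n" for s xs
    using that a r pword_scalar[OF M, of "\<one>\<^bsub>R\<^esub>" r "a \<triangleleft>\<^bsub>M\<^esub> s" xs]
    by (simp add: consp_pword pword_smult[OF M] M.rsmult_closed M.smult_closed M.bimodule_assoc)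
qed (simp add: a r M.smult_closed)

lemma consp_rsmult:
  assumes a: "a \<in> carrier M" and r: "r \<in> carrier R" and w: "w \<in> carrier (TP n)"
  shows "consp R M n a (w \<triangleleft>\<^bsub>TP n\<^esub> r) = consp R M n a w \<triangleleft>\<^bsub>TP (Suc n)\<^esub> r"
proof (rule tensor_power_hom_ext[OF add_hom_comp[OF TP.rsmult_hom[OF r] consp_hom[OF a]]
        add_hom_comp[OF consp_hom[OF a] TP.rsmult_hom[OF r]] _ w])
  show "consp R M n a (pword R M s xs \<triangleleft>\<^bsub>TP n\<^esub> r) = consp R M n a (pword R M s xs) \<triangleleft>\<^bsub>TP (Suc n)\<^esub> r"
    if "s \<in> carrier R" "set xs \<subseteq> carrier M" "length xs = n" for s xs
  proof (cases xs rule: rev_cases)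
    case Nil
    then show ?thesis
      using that a r pword_rsmult_snoc[OF M, of "\<one>\<^bsub>R\<^esub>" r "[]" "a \<triangleleft>\<^bsub>M\<^esub> s" "Suc 0"]
      by (simp add: consp_pword[of a, where n = 0] pword_rsmult_Nil[OF M] M.rsmult_closed M.rsmult_assoc)
  next
    case (snoc ys y)
    then show ?thesis
      using that a r pword_rsmult_snoc[OF M, of "\<one>\<^bsub>R\<^esub>" r "(a \<triangleleft>\<^bsub>M\<^esub> s) # ys" y "Suc n"]
      by (simp add: consp_pword pword_rsmult_snoc[OF M] M.rsmult_closed)
  qed
qed

lemma pword_consp:
  assumes "r \<in> carrier R" "x \<in> carrier M" "set xs \<subseteq> carrier M" "length xs = n"
  shows "pword R M r (x # xs) = consp R M n (r \<odot>\<^bsub>M\<^esub> x) (pword R M \<one>\<^bsub>R\<^esub> xs)"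
  using assms pword_scalar[OF M, of "\<one>\<^bsub>R\<^esub>" r x xs] by (simp add: consp_pword M.smult_closed M.rsmult_one)

text \<open>A nonempty word is its first letter, multiplied by the coefficient, put in front of the
  remaining word with coefficient one. Splitting off the first letter in this way is the pattern of
  all recursions on the bar complex.\<close>

lemma tensor_power_Suc_induct [consumes 1, case_names consp add]:
  assumes "t \<in> carrier (TP (Suc n))"
    and t: "\<And>a w. a \<in> carrier M \<Longrightarrow> w \<in> carrier (TP n) \<Longrightarrow> Q (consp R M n a w)"
    and add: "\<And>a b. a \<in> carrier (TP (Suc n)) \<Longrightarrow> b \<in> carrier (TP (Suc n)) \<Longrightarrow> Q a \<Longrightarrow> Q b \<Longrightarrow>
      Q (a \<oplus>\<^bsub>TP (Suc n)\<^esub> b)"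
  shows "Q t"
  using assms(1)
proof (induction rule: tensor_power_induct[OF M, consumes 1, case_names pword add])
  case (pword r xs)
  then obtain x ys where "xs = x # ys" "length ys = n" by (cases xs) auto
  then show ?case using pword t by (simp add: pword_consp M.smult_closed pword_closed[OF M])
qed (rule add)

lemma tensor_power_Suc_hom_ext:
  assumes "f \<in> add_hom (TP (Suc n)) X" "g \<in> add_hom (TP (Suc n)) X"
    and "\<And>a w. a \<in> carrier M \<Longrightarrow> w \<in> carrier (TP n) \<Longrightarrow> f (consp R M n a w) = g (consp R M n a w)"
    and "t \<in> carrier (TP (Suc n))"
  shows "f t = g t"
  using assms(4)
  by (induction rule: tensor_power_Suc_induct) (simp_all add: assms(3) add_hom_add[OF assms(1)] add_hom_add[OF assms(2)])

text \<open>The universal property of \<open>M \<otimes> M^n\<close>, transferred to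
  \<open>M^(n+1)\<close>. The coefficient acts on the head and the tail gets coefficient one. The
  relation that moves a scalar from the head to the tail is the balancedness of
  \<open>\<beta>\<close>; the others take place inside one argument.\<close>

lemma
  assumes X: "abelian_group X" and \<beta>: "balanced R M (TP n) X \<beta>"
  shows peel_hom: "peel R M X \<beta> \<in> add_hom (TP (Suc n)) X"
    and peel_consp: "a \<in> carrier M \<Longrightarrow> w \<in> carrier (TP n) \<Longrightarrow> peel R M X \<beta> (consp R M n a w) = \<beta> a w"
proof -
  let ?f = "\<lambda>r xs. \<beta> (r \<odot>\<^bsub>M\<^esub> hd xs) (pword R M \<one>\<^bsub>R\<^esub> (tl xs))"
  note hom = lift_power_hom[OF M X, of "Suc n" ?f]
  note eq = lift_pword[OF M X, of "Suc n" ?f]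
  note \<beta>l = balancedD(1)[OF \<beta>] and \<beta>r = balancedD(2)[OF \<beta>] and bb = balancedD(3)[OF \<beta>]
  note simps = M.smult_closed M.rsmult_closed pword_closed[OF M]
  have cl: "?f r xs \<in> carrier X" if "r \<in> carrier R" "set xs \<subseteq> carrier M" "length xs = Suc n" for r xs
    using that by (cases xs) (auto intro!: add_hom_closed[OF \<beta>l] simp: simps)
  have ac: "?f (r \<oplus>\<^bsub>R\<^esub> s) xs = ?f r xs \<oplus>\<^bsub>X\<^esub> ?f s xs"
    if "r \<in> carrier R" "s \<in> carrier R" "set xs \<subseteq> carrier M" "length xs = Suc n" for r s xs
    using that by (cases xs) (auto simp: add_hom_add[OF \<beta>r] M.smult_l_distr simps)
  have ae: "?f r (xs @ (x \<oplus>\<^bsub>M\<^esub> y) # ys) = ?f r (xs @ x # ys) \<oplus>\<^bsub>X\<^esub> ?f r (xs @ y # ys)"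
    if "r \<in> carrier R" "x \<in> carrier M" "y \<in> carrier M" "set xs \<subseteq> carrier M" "set ys \<subseteq> carrier M"
      "Suc n = Suc (length xs + length ys)" for r xs x y ys
  proof (cases xs)
    case Nil
    then show ?thesis using that by (simp add: add_hom_add[OF \<beta>r] M.smult_r_distr simps)
  next
    case (Cons z zs)
    then have "pword R M \<one>\<^bsub>R\<^esub> (zs @ (x \<oplus>\<^bsub>M\<^esub> y) # ys) =
        pword R M \<one>\<^bsub>R\<^esub> (zs @ x # ys) \<oplus>\<^bsub>TP n\<^esub> pword R M \<one>\<^bsub>R\<^esub> (zs @ y # ys)"
      using that by (intro pword_add_entry[OF M]) auto
    moreover have "pword R M \<one>\<^bsub>R\<^esub> (zs @ w # ys) \<in> carrier (TP n)" if "w \<in> carrier M" for w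
      using that Cons \<open>set xs \<subseteq> _\<close> \<open>set ys \<subseteq> _\<close> \<open>Suc n = _\<close> by (intro pword_closed[OF M]) auto
    ultimately show ?thesis
      using that Cons add_hom_add[OF \<beta>l[of "r \<odot>\<^bsub>M\<^esub> z"], of "pword R M \<one>\<^bsub>R\<^esub> (zs @ x # ys)" "pword R M \<one>\<^bsub>R\<^esub> (zs @ y # ys)"]
      by (simp add: simps)
  qed
  have sc: "?f (r \<otimes>\<^bsub>R\<^esub> s) (x # xs) = ?f r ((s \<odot>\<^bsub>M\<^esub> x) # xs)"
    if "r \<in> carrier R" "s \<in> carrier R" "x \<in> carrier M" "set xs \<subseteq> carrier M" "Suc n = Suc (length xs)" for r s x xs
    using that by (simp add: M.smult_assoc)
  have ba: "?f r (xs @ (x \<triangleleft>\<^bsub>M\<^esub> s) # y # ys) = ?f r (xs @ x # (s \<odot>\<^bsub>M\<^esub> y) # ys)"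
    if "r \<in> carrier R" "s \<in> carrier R" "x \<in> carrier M" "y \<in> carrier M" "set xs \<subseteq> carrier M"
      "set ys \<subseteq> carrier M" "Suc n = Suc (Suc (length xs + length ys))" for r s x y xs ys
  proof (cases xs)
    case Nil
    have "r \<odot>\<^bsub>M\<^esub> (x \<triangleleft>\<^bsub>M\<^esub> s) = (r \<odot>\<^bsub>M\<^esub> x) \<triangleleft>\<^bsub>M\<^esub> s" using that by (simp add: M.bimodule_assoc)
    then show ?thesis
      using that Nil pword_scalar[OF M, of "\<one>\<^bsub>R\<^esub>" s y ys] bb[of "r \<odot>\<^bsub>M\<^esub> x" s "pword R M \<one>\<^bsub>R\<^esub> (y # ys)"]
      by (simp add: simps pword_smult[OF M])
  next
    case (Cons z zs)
    then show ?thesis using that pword_balanced[OF M, of "\<one>\<^bsub>R\<^esub>" s x y zs ys] by simp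
  qed
  show hom': "peel R M X \<beta> \<in> add_hom (TP (Suc n)) X"
    unfolding peel_def by (rule hom[OF cl ac ae sc ba])
  have peel_pword: "peel R M X \<beta> (pword R M r xs) = ?f r xs"
    if "r \<in> carrier R" "set xs \<subseteq> carrier M" "length xs = Suc n" for r xs
    unfolding peel_def by (rule eq[OF cl ac ae sc ba that])
  show "peel R M X \<beta> (consp R M n a w) = \<beta> a w" if a: "a \<in> carrier M" and w: "w \<in> carrier (TP n)"
    by (rule tensor_power_hom_ext[OF add_hom_comp[OF consp_hom[OF a] hom'] \<beta>l[OF a] _ w])
      (simp add: a consp_pword peel_pword M.rsmult_closed M.smult_one bb pword_closed[OF M] pword_smult[OF M])
qed

lemma
  assumes y: "y \<in> carrier M"
  shows snocp_hom: "(\<lambda>w. snocp R M n w y) \<in> add_hom (TP n) (TP (Suc n))"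
    and snocp_pword: "r \<in> carrier R \<Longrightarrow> set xs \<subseteq> carrier M \<Longrightarrow> length xs = n \<Longrightarrow>
      snocp R M n (pword R M r xs) y = pword R M r (xs @ [y])"
proof -
  let ?f = "\<lambda>r xs. pword R M r (xs @ [y])"
  note hom = lift_power_hom[OF M, of "TP (Suc n)" n ?f]
  note eq = lift_pword[OF M, of "TP (Suc n)" n ?f]
  have ab: "abelian_group (TP (Suc n))" by (rule bimodule_abelian[OF tensor_power_bimodule[OF M]])
  note facts = y pword_closed[OF M] pword_add_coeff[OF M] pword_add_entry[OF M] pword_scalar[OF M] pword_balanced[OF M]
  show "(\<lambda>w. snocp R M n w y) \<in> add_hom (TP n) (TP (Suc n))"
    unfolding snocp_def by (rule hom[OF ab]) (simp_all add: facts)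
  show "snocp R M n (pword R M r xs) y = pword R M r (xs @ [y])"
    if "r \<in> carrier R" "set xs \<subseteq> carrier M" "length xs = n"
    unfolding snocp_def by (rule eq[OF ab]) (simp_all add: facts that)
qed

lemma snocp_closed: "y \<in> carrier M \<Longrightarrow> w \<in> carrier (TP n) \<Longrightarrow> snocp R M n w y \<in> carrier (TP (Suc n))"
  by (rule add_hom_closed[OF snocp_hom])

lemma snocp_add_right:
  assumes x: "x \<in> carrier M" and y: "y \<in> carrier M" and w: "w \<in> carrier (TP n)"
  shows "snocp R M n w (x \<oplus>\<^bsub>M\<^esub> y) = snocp R M n w x \<oplus>\<^bsub>TP (Suc n)\<^esub> snocp R M n w y"
proof (rule tensor_power_hom_ext[OF snocp_hom add_hom_plus[OF snocp_hom snocp_hom] _ w])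
  show "snocp R M n (pword R M r xs) (x \<oplus>\<^bsub>M\<^esub> y) =
      snocp R M n (pword R M r xs) x \<oplus>\<^bsub>TP (Suc n)\<^esub> snocp R M n (pword R M r xs) y"
    if "r \<in> carrier R" "set xs \<subseteq> carrier M" "length xs = n" for r xs
    using that x y pword_add_entry[OF M, of r x y xs "[]"] by (simp add: snocp_pword)
qed (simp_all add: x y bimodule_abelian[OF tensor_power_bimodule[OF M]])

lemma snocp_balanced:
  assumes y: "y \<in> carrier M" and r: "r \<in> carrier R" and w: "w \<in> carrier (TP n)"
  shows "snocp R M n (w \<triangleleft>\<^bsub>TP n\<^esub> r) y = snocp R M n w (r \<odot>\<^bsub>M\<^esub> y)"
proof (rule tensor_power_hom_ext[OF add_hom_comp[OF TP.rsmult_hom[OF r] snocp_hom[OF y]] snocp_hom _ w])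
  show "snocp R M n (pword R M s xs \<triangleleft>\<^bsub>TP n\<^esub> r) y = snocp R M n (pword R M s xs) (r \<odot>\<^bsub>M\<^esub> y)"
    if "s \<in> carrier R" "set xs \<subseteq> carrier M" "length xs = n" for s xs
  proof (cases xs rule: rev_cases)
    case Nil
    then show ?thesis
      using that y r by (simp add: snocp_pword[where n = 0] pword_rsmult_Nil[OF M] M.smult_closed pword_scalar[OF M])
  next
    case (snoc ys z)
    then show ?thesis
      using that y r pword_balanced[OF M, of s r z y ys "[]"]
      by (simp add: snocp_pword pword_rsmult_snoc[OF M] M.smult_closed M.rsmult_closed)
  qed
qed (simp add: y r M.smult_closed)

lemma balanced_snocp: "balanced R (TP n) M (TP (Suc n)) (snocp R M n)"
  by (rule balancedI) (auto intro!: snocp_hom add_homI simp: snocp_closed snocp_add_right snocp_balanced)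

text \<open>Letters added at opposite ends do not interfere. This links \<open>iter_comult\<close>,
  which grows at the right end, with the maps on the bar complex, which peel at the left
  end.\<close>

lemma snocp_consp:
  assumes y: "y \<in> carrier M" and a: "a \<in> carrier M" and w: "w \<in> carrier (TP n)"
  shows "snocp R M (Suc n) (consp R M n a w) y = consp R M (Suc n) a (snocp R M n w y)"
  by (rule tensor_power_hom_ext[OF add_hom_comp[OF consp_hom[OF a] snocp_hom[OF y]]
        add_hom_comp[OF snocp_hom[OF y] consp_hom[OF a]] _ w])
    (simp add: y a consp_pword snocp_pword M.rsmult_closed)

end

section \<open>Functoriality of tensor powers\<close>

context
  fixes R :: "('r, 'k) ring_scheme" and M :: "('r, 'm, 'l) bimodule_scheme" and N :: "('r, 'n, 'l2) bimodule_scheme" and h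
  assumes M: "bimodule R M" and N: "bimodule R N" and h: "h \<in> bimodule_hom R M N"
begin

lemma
  shows lift_map_hom: "lift (tensor_power R N n) (\<lambda>(r, xs). pword R N r (map h xs)) \<in>
      add_hom (tensor_power R M n) (tensor_power R N n)"
    and lift_map_pword: "r \<in> carrier R \<Longrightarrow> set xs \<subseteq> carrier M \<Longrightarrow> length xs = n \<Longrightarrow>
      lift (tensor_power R N n) (\<lambda>(r, xs). pword R N r (map h xs)) (pword R M r xs) = pword R N r (map h xs)"
proof -
  note hh = bimodule_homD[OF h]
  have hc: "h x \<in> carrier N" if "x \<in> carrier M" for x by (rule add_hom_closed[OF hh(3) that])
  have hs: "set (map h xs) \<subseteq> carrier N" if "set xs \<subseteq> carrier M" for xs using that hc by auto
  note facts = pword_closed[OF N] pword_add_coeff[OF N] pword_add_entry[OF N] pword_scalar[OF N] pword_balanced[OF N]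
    hc hs[unfolded set_map] add_hom_add[OF hh(3)] left_hom_smult[OF hh(1)] right_hom_rsmult[OF hh(2)]
  let ?f = "\<lambda>r xs. pword R N r (map h xs)"
  note hom = lift_power_hom[OF M bimodule_abelian[OF tensor_power_bimodule[OF N, of n]], of n ?f]
  note eq = lift_pword[OF M bimodule_abelian[OF tensor_power_bimodule[OF N, of n]], of n ?f]
  show "lift (tensor_power R N n) (\<lambda>(r, xs). pword R N r (map h xs)) \<in>
      add_hom (tensor_power R M n) (tensor_power R N n)"
    by (rule hom) (simp_all add: facts)
  show "lift (tensor_power R N n) (\<lambda>(r, xs). pword R N r (map h xs)) (pword R M r xs) = pword R N r (map h xs)"
    if "r \<in> carrier R" "set xs \<subseteq> carrier M" "length xs = n"
    by (rule eq) (simp_all add: facts that)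
qed

lemma lift_map_snocp:
  assumes y: "y \<in> carrier M" and w: "w \<in> carrier (tensor_power R M n)"
  shows "lift (tensor_power R N (Suc n)) (\<lambda>(r, xs). pword R N r (map h xs)) (snocp R M n w y) =
    snocp R N n (lift (tensor_power R N n) (\<lambda>(r, xs). pword R N r (map h xs)) w) (h y)"
proof -
  have hc: "h x \<in> carrier N" if "x \<in> carrier M" for x by (rule add_hom_closed[OF bimodule_homD(3)[OF h] that])
  have hs: "h ` set xs \<subseteq> carrier N" if "set xs \<subseteq> carrier M" for xs using that hc by auto
  show ?thesis
    by (rule tensor_power_hom_ext[OF M add_hom_comp[OF snocp_hom[OF M y] lift_map_hom]
          add_hom_comp[OF lift_map_hom snocp_hom[OF N hc[OF y]]] _ w])
      (simp add: y snocp_pword[OF M] snocp_pword[OF N] lift_map_pword hc hs)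
qed

end

text \<open>No relation has to be verified for \<open>f\<close>: agreement on generators with a map
  \<open>g\<close> that is already additive on the quotient forces \<open>f\<close> to respect them.
  The explicit formulas in \<open>bar_diff\<close> and in the comultiplication of
  \<open>bar_coring\<close> are identified in this way with maps built by recursion.\<close>

lemma (in presentation) lift_eq_hom:
  assumes X: "abelian_group X" and g: "g \<in> add_hom P X" and f: "\<And>w. w \<in> S \<Longrightarrow> f w = g (cls w)"
    and T: "T \<in> carrier P"
  shows "lift X f T = g T"
proof -
  note [simp del] = P_sel
  interpret X: abelian_group X by (rule X)
  have c: "f \<in> S \<rightarrow> carrier X" using f add_hom_closed[OF g cls_closed] by auto
  note h = frag_eval_hom[OF X c, of lact ract]
  have k: "(\<lambda>t. g (N +>\<^bsub>F\<^esub> t)) \<in> add_hom F X"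
  proof (rule add_homI)
    fix s t assume st: "s \<in> carrier F" "t \<in> carrier F"
    show "g (N +>\<^bsub>F\<^esub> s) \<in> carrier X" by (rule add_hom_closed[OF g cosets_closed[OF st(1)]])
    have "N +>\<^bsub>F\<^esub> (s \<oplus>\<^bsub>F\<^esub> t) = (N +>\<^bsub>F\<^esub> s) \<oplus>\<^bsub>P\<^esub> (N +>\<^bsub>F\<^esub> t)" using coset_add[OF st] by simp
    then show "g (N +>\<^bsub>F\<^esub> (s \<oplus>\<^bsub>F\<^esub> t)) = g (N +>\<^bsub>F\<^esub> s) \<oplus>\<^bsub>X\<^esub> g (N +>\<^bsub>F\<^esub> t)"
      by (simp only: add_hom_add[OF g cosets_closed[OF st(1)] cosets_closed[OF st(2)]])
  qed
  have eq: "frag_eval X f t = g (N +>\<^bsub>F\<^esub> t)" if t: "t \<in> carrier F" for t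
  proof -
    have "Poly_Mapping.keys t \<subseteq> S" using t by simp
    then have "Poly_Mapping.keys t \<subseteq> S \<and> frag_eval X f t = g (N +>\<^bsub>F\<^esub> t)"
    proof (induction rule: frag_induction)
      case zero
      show ?case
        using add_hom_zero[OF h F.abelian_group_axioms X] add_hom_zero[OF k F.abelian_group_axioms X] by simp
    next
      case (one w)
      then show ?case using frag_eval_of[OF X, of f w] f[of w] add_hom_closed[OF g cls_closed, of w] by simp
    next
      case (diff a b)
      then have ab: "a \<in> carrier F" "b \<in> carrier F" by auto
      have "a \<ominus>\<^bsub>F\<^esub> b = a - b" using ab by (simp add: a_minus_def word_module_a_inv)
      then show ?case
        using add_hom_minus[OF h F.abelian_group_axioms X ab] add_hom_minus[OF k F.abelian_group_axioms X ab]
          F.minus_closed[OF ab] diff by simp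
    qed
    then show ?thesis ..
  qed
  have E0: "frag_eval X f e = \<zero>\<^bsub>X\<^esub>" if e: "e \<in> E" for e
  proof -
    have "e \<in> carrier F" using rels_words[OF e] by simp
    moreover have "N +>\<^bsub>F\<^esub> e = N" using F.a_coset_join2[OF _ N.a_subgroup N_incl[OF e]] rels_words[OF e] by simp
    ultimately have "frag_eval X f e = g \<zero>\<^bsub>P\<^esub>" using eq[of e] by (simp add: P_sel)
    then show ?thesis using add_hom_zero[OF g P.abelian_group_axioms X] by simp
  qed
  show ?thesis
  proof (rule hom_ext[OF lift_hom[OF X c E0] g X _ T])
    show "lift X f (cls w) = g (cls w)" if w: "w \<in> S" for w
      using lift_cls[OF X c E0 w] f[OF w] by (simp only:)
  qed
qed

lemma lift_power_eq_hom:
  assumes M: "bimodule R M" and X: "abelian_group X" and g: "g \<in> add_hom (tensor_power R M n) X"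
    and f: "\<And>r xs. r \<in> carrier R \<Longrightarrow> set xs \<subseteq> carrier M \<Longrightarrow> length xs = n \<Longrightarrow> f r xs = g (pword R M r xs)"
    and T: "T \<in> carrier (tensor_power R M n)"
  shows "lift X (\<lambda>(r, xs). f r xs) T = g T"
proof -
  interpret bimodule_power R M n by (intro bimodule_power.intro M)
  show ?thesis
    by (rule lift_eq_hom[OF X g[unfolded tensor_power_P] _ T[unfolded tensor_power_P]])
      (auto simp: f pword_cls)
qed

lemma lift_tensor_eq_hom:
  assumes M: "bimodule R M" and N: "bimodule R N" and X: "abelian_group X" and g: "g \<in> add_hom (tensor R M N) X"
    and f: "\<And>x y. x \<in> carrier M \<Longrightarrow> y \<in> carrier N \<Longrightarrow> f x y = g (tens R M N x y)"
    and T: "T \<in> carrier (tensor R M N)"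
  shows "lift X (\<lambda>(x, y). f x y) T = g T"
proof -
  interpret bimodule_pair R M N by (intro bimodule_pair.intro M N)
  show ?thesis
    by (rule lift_eq_hom[OF X g[unfolded tensor_P] _ T[unfolded tensor_P]])
      (auto simp: f tens_cls)
qed

lemma balanced_comp_left:
  assumes "balanced R M N X \<beta>" "f \<in> right_hom R M' M"
  shows "balanced R M' N X (\<lambda>x y. \<beta> (f x) y)"
  by (rule balancedI) (simp_all add: balancedD[OF assms(1)] add_hom_closed[OF right_homD[OF assms(2)]]
      right_hom_rsmult[OF assms(2)] add_hom_comp[OF right_homD[OF assms(2)] balancedD(2)[OF assms(1)]])

lemma balanced_comp_right:
  assumes "balanced R M N X \<beta>" "g \<in> left_hom R N' N"
  shows "balanced R M N' X (\<lambda>x y. \<beta> x (g y))"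
  by (rule balancedI) (simp_all add: balancedD[OF assms(1)] add_hom_closed[OF left_homD[OF assms(2)]]
      left_hom_smult[OF assms(2)] add_hom_comp[OF left_homD[OF assms(2)] balancedD(1)[OF assms(1)]])

lemma balanced_diff:
  assumes "balanced R M N X \<beta>" "balanced R M N X \<gamma>" "abelian_group X"
  shows "balanced R M N X (\<lambda>x y. \<beta> x y \<ominus>\<^bsub>X\<^esub> \<gamma> x y)"
  by (rule balancedI) (simp_all add: balancedD[OF assms(1)] balancedD[OF assms(2)]
      add_hom_diff[OF balancedD(1)[OF assms(1)] balancedD(1)[OF assms(2)] assms(3)]
      add_hom_diff[OF balancedD(2)[OF assms(1)] balancedD(2)[OF assms(2)] assms(3)])

context left_module
begin

lemma smult_add_hom: "r \<in> carrier R \<Longrightarrow> (\<lambda>x. r \<odot>\<^bsub>M\<^esub> x) \<in> add_hom M M"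
  by (rule add_homI) (simp_all add: smult_closed smult_r_distr)

lemma left_hom_diff:
  assumes "f \<in> left_hom R L M" "g \<in> left_hom R L M"
  shows "(\<lambda>x. f x \<ominus>\<^bsub>M\<^esub> g x) \<in> left_hom R L M"
  using add_hom_closed[OF left_homD[OF assms(1)]] add_hom_closed[OF left_homD[OF assms(2)]]
  by (intro left_homI[OF add_hom_diff[OF left_homD[OF assms(1)] left_homD[OF assms(2)] M.abelian_group_axioms]])
    (simp_all add: left_hom_smult[OF assms(1)] left_hom_smult[OF assms(2)]
      add_hom_minus[OF smult_add_hom M.abelian_group_axioms M.abelian_group_axioms])

end

lemma peel_left_hom:
  assumes M: "bimodule R M" and X: "left_module R X" and \<beta>: "balanced R M (tensor_power R M n) X \<beta>"
    and l: "\<And>r a v. r \<in> carrier R \<Longrightarrow> a \<in> carrier M \<Longrightarrow> v \<in> carrier (tensor_power R M n) \<Longrightarrow>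
      \<beta> (r \<odot>\<^bsub>M\<^esub> a) v = r \<odot>\<^bsub>X\<^esub> \<beta> a v"
  shows "peel R M X \<beta> \<in> left_hom R (tensor_power R M (Suc n)) X"
proof -
  interpret X: left_module R X by (rule X)
  interpret M: bimodule R M by (rule M)
  interpret T: bimodule R "tensor_power R M (Suc n)" by (rule tensor_power_bimodule[OF M])
  note h = peel_hom[OF M left_module_abelian[OF X] \<beta>] and e = peel_consp[OF M left_module_abelian[OF X] \<beta>]
  show ?thesis
  proof (rule left_homI[OF h])
    fix r w assume r: "r \<in> carrier R" and w: "w \<in> carrier (tensor_power R M (Suc n))"
    show "peel R M X \<beta> (r \<odot>\<^bsub>tensor_power R M (Suc n)\<^esub> w) = r \<odot>\<^bsub>X\<^esub> peel R M X \<beta> w"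
      by (rule tensor_power_Suc_hom_ext[OF M add_hom_comp[OF T.smult_hom[OF r] h] add_hom_comp[OF h X.smult_add_hom[OF r]] _ w])
        (simp add: r consp_smult[OF M, symmetric] e M.smult_closed l)
  qed
qed

lemma peel_right_hom:
  assumes M: "bimodule R M" and X: "bimodule R X" and \<beta>: "balanced R M (tensor_power R M n) X \<beta>"
    and l: "\<And>r a v. r \<in> carrier R \<Longrightarrow> a \<in> carrier M \<Longrightarrow> v \<in> carrier (tensor_power R M n) \<Longrightarrow>
      \<beta> a (v \<triangleleft>\<^bsub>tensor_power R M n\<^esub> r) = \<beta> a v \<triangleleft>\<^bsub>X\<^esub> r"
  shows "peel R M X \<beta> \<in> right_hom R (tensor_power R M (Suc n)) X"
proof -
  interpret X: bimodule R X by (rule X)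
  interpret M: bimodule R M by (rule M)
  interpret T0: bimodule R "tensor_power R M n" by (rule tensor_power_bimodule[OF M])
  interpret T: bimodule R "tensor_power R M (Suc n)" by (rule tensor_power_bimodule[OF M])
  note h = peel_hom[OF M bimodule_abelian[OF X] \<beta>] and e = peel_consp[OF M bimodule_abelian[OF X] \<beta>]
  show ?thesis
  proof (rule right_homI[OF h])
    fix r w assume r: "r \<in> carrier R" and w: "w \<in> carrier (tensor_power R M (Suc n))"
    show "peel R M X \<beta> (w \<triangleleft>\<^bsub>tensor_power R M (Suc n)\<^esub> r) = peel R M X \<beta> w \<triangleleft>\<^bsub>X\<^esub> r"
      by (rule tensor_power_Suc_hom_ext[OF M add_hom_comp[OF T.rsmult_hom[OF r] h] add_hom_comp[OF h X.rsmult_hom[OF r]] _ w])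
        (simp add: r consp_rsmult[OF M, symmetric] e T0.rsmult_closed l)
  qed
qed

lemma right_hom_ident: "(\<lambda>x. x) \<in> right_hom R M M"
  by (simp add: right_hom_def add_hom_ident)

lemma left_hom_ident: "(\<lambda>x. x) \<in> left_hom R M M"
  by (simp add: left_hom_def add_hom_ident)

lemma tensor_map_comp:
  assumes M: "bimodule R M" and N: "bimodule R N" and M': "bimodule R M'" and N': "bimodule R N'"
    and M'': "bimodule R M''" and N'': "bimodule R N''"
    and f: "f \<in> right_hom R M M'" and g: "g \<in> left_hom R N N'"
    and f': "f' \<in> right_hom R M' M''" and g': "g' \<in> left_hom R N' N''" and t: "t \<in> carrier (tensor R M N)"
  shows "tensor_map R M'' N'' f' g' (tensor_map R M' N' f g t) = tensor_map R M'' N'' (\<lambda>x. f' (f x)) (\<lambda>y. g' (g y)) t"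
  unfolding tensor_map_def[of R M'' N'']
  by (rule lift_tensor_map(1)[OF M N M' N' f g balanced_comp_left[OF balanced_comp_right[OF balanced_tens[OF M'' N''] g'] f']
        bimodule_abelian[OF tensor_bimodule[OF M'' N'']] t])

lemma tensor_map_ident:
  assumes M: "bimodule R M" and N: "bimodule R N" and t: "t \<in> carrier (tensor R M N)"
    and "\<And>x. x \<in> carrier M \<Longrightarrow> f x = x" "\<And>y. y \<in> carrier N \<Longrightarrow> g y = y"
  shows "tensor_map R M N f g t = t"
  unfolding tensor_map_def
  by (rule lift_tensor_eq_hom[OF M N bimodule_abelian[OF tensor_bimodule[OF M N]] add_hom_ident _ t]) (simp add: assms)

lemma snocp_rsmult:
  assumes M: "bimodule R M" and y: "y \<in> carrier M" and r: "r \<in> carrier R" and w: "w \<in> carrier (tensor_power R M n)"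
  shows "snocp R M n w (y \<triangleleft>\<^bsub>M\<^esub> r) = snocp R M n w y \<triangleleft>\<^bsub>tensor_power R M (Suc n)\<^esub> r"
proof -
  interpret M: bimodule R M by (rule M)
  interpret T: bimodule R "tensor_power R M (Suc n)" by (rule tensor_power_bimodule[OF M])
  show ?thesis
    by (rule tensor_power_hom_ext[OF M snocp_hom[OF M] add_hom_comp[OF snocp_hom[OF M y] T.rsmult_hom[OF r]] _ w])
      (simp_all add: y r M.rsmult_closed snocp_pword[OF M] pword_rsmult_snoc[OF M])
qed

section \<open>Modules over a semisimple ring\<close>

context abelian_group
begin

text \<open>Used as rewrite rules, these collect all negatives into one outer difference, so that
  commutativity decides the remaining equality of sums.\<close>

lemma diff_simps:
  assumes "a \<in> carrier G" "b \<in> carrier G"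
  shows "\<ominus> a = \<zero> \<ominus> a"
    and "c \<in> carrier G \<Longrightarrow> a \<ominus> b = c \<longleftrightarrow> a = c \<oplus> b" "c \<in> carrier G \<Longrightarrow> c = a \<ominus> b \<longleftrightarrow> c \<oplus> b = a"
    and "c \<in> carrier G \<Longrightarrow> a \<oplus> (b \<ominus> c) = a \<oplus> b \<ominus> c" "c \<in> carrier G \<Longrightarrow> (a \<ominus> b) \<oplus> c = a \<oplus> c \<ominus> b"
    and "c \<in> carrier G \<Longrightarrow> a \<ominus> b \<ominus> c = a \<ominus> (b \<oplus> c)" "c \<in> carrier G \<Longrightarrow> a \<ominus> (b \<ominus> c) = a \<oplus> c \<ominus> b"
proof -
  show "\<ominus> a = \<zero> \<ominus> a" using assms by (simp add: a_minus_def)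
  show *: "a \<ominus> b = c \<longleftrightarrow> a = c \<oplus> b" if "c \<in> carrier G" for c
    using assms that by (auto simp: a_minus_def a_assoc l_neg r_neg)
  show "c = a \<ominus> b \<longleftrightarrow> c \<oplus> b = a" if "c \<in> carrier G"
    using *[OF that] by auto
qed (use assms in \<open>simp_all add: a_minus_def minus_add minus_minus a_ac\<close>)

end

lemma (in abelian_group) eq_of_minus_zero:
  assumes "x \<ominus> y = \<zero>" "x \<in> carrier G" "y \<in> carrier G"
  shows "x = y"
  using assms minus_equality[of x "\<ominus> y"] by (simp add: a_minus_def)

context left_module
begin

lemma smult_hom_left: "x \<in> carrier M \<Longrightarrow> (\<lambda>r. r \<odot>\<^bsub>M\<^esub> x) \<in> left_hom R (regular_bimodule R) M"
  by (intro left_homI add_homI) (simp_all add: smult_closed smult_l_distr smult_assoc)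

lemma smult_l_null [simp]: "x \<in> carrier M \<Longrightarrow> \<zero>\<^bsub>R\<^esub> \<odot>\<^bsub>M\<^esub> x = \<zero>\<^bsub>M\<^esub>"
  using smult_l_distr[of "\<zero>\<^bsub>R\<^esub>" "\<zero>\<^bsub>R\<^esub>" x] M.add.l_cancel_one[of "\<zero>\<^bsub>R\<^esub> \<odot>\<^bsub>M\<^esub> x" "\<zero>\<^bsub>R\<^esub> \<odot>\<^bsub>M\<^esub> x"]
  by (simp add: smult_closed)

lemma smult_r_null [simp]: "r \<in> carrier R \<Longrightarrow> r \<odot>\<^bsub>M\<^esub> \<zero>\<^bsub>M\<^esub> = \<zero>\<^bsub>M\<^esub>"
  using smult_r_distr[of r "\<zero>\<^bsub>M\<^esub>" "\<zero>\<^bsub>M\<^esub>"] M.add.l_cancel_one[of "r \<odot>\<^bsub>M\<^esub> \<zero>\<^bsub>M\<^esub>" "r \<odot>\<^bsub>M\<^esub> \<zero>\<^bsub>M\<^esub>"]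
  by (simp add: smult_closed)

lemma smult_minus_one: "x \<in> carrier M \<Longrightarrow> (\<ominus>\<^bsub>R\<^esub> \<one>\<^bsub>R\<^esub>) \<odot>\<^bsub>M\<^esub> x = \<ominus>\<^bsub>M\<^esub> x"
  using smult_l_distr[of "\<ominus>\<^bsub>R\<^esub> \<one>\<^bsub>R\<^esub>" "\<one>\<^bsub>R\<^esub>" x] M.minus_equality[of "(\<ominus>\<^bsub>R\<^esub> \<one>\<^bsub>R\<^esub>) \<odot>\<^bsub>M\<^esub> x" x]
  by (simp add: smult_closed smult_one R.l_neg)

lemma smult_a_inv:
  assumes "r \<in> carrier R" "x \<in> carrier M" shows "r \<odot>\<^bsub>M\<^esub> (\<ominus>\<^bsub>M\<^esub> x) = \<ominus>\<^bsub>M\<^esub> (r \<odot>\<^bsub>M\<^esub> x)"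
proof -
  have "r \<odot>\<^bsub>M\<^esub> (\<ominus>\<^bsub>M\<^esub> x) \<oplus>\<^bsub>M\<^esub> r \<odot>\<^bsub>M\<^esub> x = \<zero>\<^bsub>M\<^esub>"
    using assms smult_r_distr[of r "\<ominus>\<^bsub>M\<^esub> x" x] by (simp add: M.l_neg)
  then show ?thesis using assms M.minus_equality by (simp add: smult_closed)
qed

lemma left_submoduleI:
  assumes "N \<subseteq> carrier M" "\<zero>\<^bsub>M\<^esub> \<in> N" "\<And>x y. x \<in> N \<Longrightarrow> y \<in> N \<Longrightarrow> x \<oplus>\<^bsub>M\<^esub> y \<in> N"
    and s: "\<And>r x. r \<in> carrier R \<Longrightarrow> x \<in> N \<Longrightarrow> r \<odot>\<^bsub>M\<^esub> x \<in> N"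
  shows "left_submodule R M N"
proof -
  have "\<ominus>\<^bsub>M\<^esub> x \<in> N" if "x \<in> N" for x
    using s[of "\<ominus>\<^bsub>R\<^esub> \<one>\<^bsub>R\<^esub>" x] smult_minus_one[of x] that assms(1) by auto
  then have "subgroup N (add_monoid M)"
    using assms by (intro M.add.subgroupI) auto
  then show ?thesis using s by (simp add: left_submodule_def)
qed

lemma left_submoduleD:
  assumes "left_submodule R M N"
  shows "N \<subseteq> carrier M" "\<zero>\<^bsub>M\<^esub> \<in> N" "x \<in> N \<Longrightarrow> y \<in> N \<Longrightarrow> x \<oplus>\<^bsub>M\<^esub> y \<in> N"
    "r \<in> carrier R \<Longrightarrow> x \<in> N \<Longrightarrow> r \<odot>\<^bsub>M\<^esub> x \<in> N" "x \<in> N \<Longrightarrow> \<ominus>\<^bsub>M\<^esub> x \<in> N" "x \<in> N \<Longrightarrow> y \<in> N \<Longrightarrow> x \<ominus>\<^bsub>M\<^esub> y \<in> N"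
    "x \<in> N \<Longrightarrow> x \<in> carrier M"
proof -
  interpret N: additive_subgroup N M using assms by (simp add: additive_subgroup_def left_submodule_def)
  show "N \<subseteq> carrier M" "\<zero>\<^bsub>M\<^esub> \<in> N" "x \<in> N \<Longrightarrow> y \<in> N \<Longrightarrow> x \<oplus>\<^bsub>M\<^esub> y \<in> N"
    "x \<in> N \<Longrightarrow> \<ominus>\<^bsub>M\<^esub> x \<in> N" "x \<in> N \<Longrightarrow> y \<in> N \<Longrightarrow> x \<ominus>\<^bsub>M\<^esub> y \<in> N" "x \<in> N \<Longrightarrow> x \<in> carrier M"
    using N.a_subset by (auto simp: a_minus_def)
  show "r \<in> carrier R \<Longrightarrow> x \<in> N \<Longrightarrow> r \<odot>\<^bsub>M\<^esub> x \<in> N" using assms by (simp add: left_submodule_def)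
qed

section \<open>Complements of submodules over a semisimple ring\<close>

lemma left_submodule_sum:
  assumes K: "left_submodule R M K" and W: "left_submodule R M W"
  shows "left_submodule R M {k \<oplus>\<^bsub>M\<^esub> w | k w. k \<in> K \<and> w \<in> W}"
proof (rule left_submoduleI)
  note k = left_submoduleD[OF K] and w = left_submoduleD[OF W]
  show "\<zero>\<^bsub>M\<^esub> \<in> {k \<oplus>\<^bsub>M\<^esub> w | k w. k \<in> K \<and> w \<in> W}" using k(2) w(2) by force
  show "{k \<oplus>\<^bsub>M\<^esub> w | k w. k \<in> K \<and> w \<in> W} \<subseteq> carrier M" using k(1) w(1) by auto
  fix x y assume "x \<in> {k \<oplus>\<^bsub>M\<^esub> w | k w. k \<in> K \<and> w \<in> W}" "y \<in> {k \<oplus>\<^bsub>M\<^esub> w | k w. k \<in> K \<and> w \<in> W}"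
  then obtain a b a' b' where *: "x = a \<oplus>\<^bsub>M\<^esub> b" "y = a' \<oplus>\<^bsub>M\<^esub> b'" "a \<in> K" "a' \<in> K" "b \<in> W" "b' \<in> W" by auto
  then have "x \<oplus>\<^bsub>M\<^esub> y = (a \<oplus>\<^bsub>M\<^esub> a') \<oplus>\<^bsub>M\<^esub> (b \<oplus>\<^bsub>M\<^esub> b')"
    using k(7) w(7) by (simp add: M.a_ac)
  then show "x \<oplus>\<^bsub>M\<^esub> y \<in> {k \<oplus>\<^bsub>M\<^esub> w | k w. k \<in> K \<and> w \<in> W}" using * k(3) w(3) by blast
next
  note k = left_submoduleD[OF K] and w = left_submoduleD[OF W]
  fix r x assume r: "r \<in> carrier R" and "x \<in> {k \<oplus>\<^bsub>M\<^esub> w | k w. k \<in> K \<and> w \<in> W}"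
  then obtain a b where *: "x = a \<oplus>\<^bsub>M\<^esub> b" "a \<in> K" "b \<in> W" by auto
  then have "r \<odot>\<^bsub>M\<^esub> x = r \<odot>\<^bsub>M\<^esub> a \<oplus>\<^bsub>M\<^esub> r \<odot>\<^bsub>M\<^esub> b" using k(7) w(7) r by (simp add: smult_r_distr)
  then show "r \<odot>\<^bsub>M\<^esub> x \<in> {k \<oplus>\<^bsub>M\<^esub> w | k w. k \<in> K \<and> w \<in> W}" using * k(4) w(4) r by blast
qed

lemma left_submodule_image:
  assumes L: "left_module R L" and f: "f \<in> left_hom R L M" and S: "left_submodule R L S"
  shows "left_submodule R M (f ` S)"
proof (rule left_submoduleI)
  interpret L: left_module R L by (rule L)
  note s = L.left_submoduleD[OF S] and h = left_homD[OF f]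
  show "f ` S \<subseteq> carrier M" using s(1) add_hom_closed[OF h] by auto
  show "\<zero>\<^bsub>M\<^esub> \<in> f ` S"
    using add_hom_zero[OF h left_module_abelian[OF L] M.abelian_group_axioms] s(2) by (metis imageI)
  show "x \<oplus>\<^bsub>M\<^esub> y \<in> f ` S" if "x \<in> f ` S" "y \<in> f ` S" for x y
    using that s by (auto simp: add_hom_add[OF h, symmetric])
  show "r \<odot>\<^bsub>M\<^esub> x \<in> f ` S" if "r \<in> carrier R" "x \<in> f ` S" for r x
    using that s by (auto simp: left_hom_smult[OF f, symmetric])
qed

lemma left_submodule_vimage:
  assumes N: "left_module R N" and f: "f \<in> left_hom R M N" and S: "left_submodule R M S" and T: "left_submodule R N T"
  shows "left_submodule R M {x \<in> S. f x \<in> T}"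
proof (rule left_submoduleI)
  interpret N: left_module R N by (rule N)
  note s = left_submoduleD[OF S] and t = N.left_submoduleD[OF T] and h = left_homD[OF f]
  show "\<zero>\<^bsub>M\<^esub> \<in> {x \<in> S. f x \<in> T}"
    using add_hom_zero[OF h M.abelian_group_axioms left_module_abelian[OF N]] s(2) t(2) by simp
qed (use left_submoduleD[OF S] left_module.left_submoduleD[OF N T] in
    \<open>auto simp: add_hom_add[OF left_homD[OF f]] left_hom_smult[OF f]\<close>)

lemma left_submodule_zero: "left_submodule R M {\<zero>\<^bsub>M\<^esub>}"
  by (rule left_submoduleI) auto

lemma left_submodule_carrier: "left_submodule R M (carrier M)"
  by (rule left_submoduleI) (auto simp: smult_closed)

text \<open>The scalars in \<open>S\<close> that send \<open>x\<close> into \<open>K + W\<close>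
  form a submodule of the simple module \<open>S\<close>, hence zero or everything. If it is zero,
  then \<open>W + S x\<close> still meets \<open>K\<close> trivially, and maximality puts
  \<open>S x\<close> inside \<open>W\<close>. In both cases \<open>s x\<close> lies in
  \<open>K + W\<close>.\<close>

lemma maximal_complement_absorbs:
  assumes K: "left_submodule R M K" and W: "left_submodule R M W" and WK: "W \<inter> K = {\<zero>\<^bsub>M\<^esub>}"
    and max: "\<And>W'. left_submodule R M W' \<Longrightarrow> W \<subseteq> W' \<Longrightarrow> W' \<inter> K = {\<zero>\<^bsub>M\<^esub>} \<Longrightarrow> W' = W"
    and S: "simple_submodule R (regular_bimodule R) S" and x: "x \<in> carrier M" and s: "s \<in> S"
  shows "s \<odot>\<^bsub>M\<^esub> x \<in> {k \<oplus>\<^bsub>M\<^esub> w | k w. k \<in> K \<and> w \<in> W}" (is "_ \<in> ?N")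
proof -
  interpret L: bimodule R "regular_bimodule R" by (rule regular_bimodule[OF R.ring_axioms])
  note LM = bimodule_left_module[OF L.bimodule_axioms]
  have S': "left_submodule R (regular_bimodule R) S" using S by (simp add: simple_submodule_def)
  have N: "left_submodule R M ?N" by (rule left_submodule_sum[OF K W])
  let ?T = "{s \<in> S. s \<odot>\<^bsub>M\<^esub> x \<in> ?N}"
  have "left_submodule R (regular_bimodule R) ?T"
    by (rule L.left_submodule_vimage[OF left_module_axioms smult_hom_left[OF x] S' N])
  then have "?T = {\<zero>\<^bsub>R\<^esub>} \<or> ?T = S" using S by (auto simp: simple_submodule_def)
  then show ?thesis
  proof
    assume T: "?T = {\<zero>\<^bsub>R\<^esub>}"
    let ?W = "{w \<oplus>\<^bsub>M\<^esub> y | w y. w \<in> W \<and> y \<in> (\<lambda>r. r \<odot>\<^bsub>M\<^esub> x) ` S}"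
    have sx: "left_submodule R M ((\<lambda>r. r \<odot>\<^bsub>M\<^esub> x) ` S)"
      by (rule left_submodule_image[OF LM smult_hom_left[OF x] S'])
    have W': "left_submodule R M ?W" by (rule left_submodule_sum[OF W sx])
    note w = left_submoduleD[OF W] and k = left_submoduleD[OF K] and y = left_submoduleD[OF sx]
    have WW: "W \<subseteq> ?W"
    proof
      fix v assume v: "v \<in> W"
      then have "v = v \<oplus>\<^bsub>M\<^esub> \<zero>\<^bsub>M\<^esub>" using w(7) by simp
      then show "v \<in> ?W" using v y(2) by blast
    qed
    moreover have "?W \<inter> K = {\<zero>\<^bsub>M\<^esub>}"
    proof -
      have "z = \<zero>\<^bsub>M\<^esub>" if z: "z \<in> K" "z = v \<oplus>\<^bsub>M\<^esub> r \<odot>\<^bsub>M\<^esub> x" "v \<in> W" "r \<in> S" for z v r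
      proof -
        have r: "r \<in> carrier R" using L.left_submoduleD(7)[OF S' z(4)] by simp
        have "r \<odot>\<^bsub>M\<^esub> x = z \<oplus>\<^bsub>M\<^esub> (\<ominus>\<^bsub>M\<^esub> v)"
          using z w(7) r x by (simp add: M.a_ac smult_closed M.r_neg1 M.r_neg2)
        then have "r \<odot>\<^bsub>M\<^esub> x \<in> ?N" using z w(5) by blast
        then have "r = \<zero>\<^bsub>R\<^esub>" using T z(4) by blast
        then have "z = v" using z x w(7) by simp
        then show ?thesis using z WK by blast
      qed
      then show ?thesis using left_submoduleD(2)[OF W'] k(2) by auto
    qed
    ultimately have "?W = W" using max[OF W'] by blast
    moreover have "s \<odot>\<^bsub>M\<^esub> x \<in> ?W"
    proof -
      have sS: "s \<odot>\<^bsub>M\<^esub> x \<in> (\<lambda>r. r \<odot>\<^bsub>M\<^esub> x) ` S" using s by blast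
      then have "s \<odot>\<^bsub>M\<^esub> x = \<zero>\<^bsub>M\<^esub> \<oplus>\<^bsub>M\<^esub> s \<odot>\<^bsub>M\<^esub> x" using y(7) by simp
      then show ?thesis using sS w(2) by blast
    qed
    ultimately have sW: "s \<odot>\<^bsub>M\<^esub> x \<in> W" by simp
    then have "s \<odot>\<^bsub>M\<^esub> x = \<zero>\<^bsub>M\<^esub> \<oplus>\<^bsub>M\<^esub> s \<odot>\<^bsub>M\<^esub> x" using w(7) by simp
    then show ?thesis using k(2) sW by blast
  next
    assume "?T = S"
    then show ?thesis using s by blast
  qed
qed

text \<open>Zorn's lemma gives a submodule \<open>W\<close> that is maximal among those containing
  \<open>V\<close> and meeting \<open>K\<close> trivially. For a fixed \<open>x\<close> the scalars
  sending \<open>x\<close> into \<open>K + W\<close> form a left ideal; it contains every simple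
  left ideal, so by semisimplicity it contains \<open>1\<close>. Forcing \<open>V\<close> into the
  complement is what later allows sections with prescribed values.\<close>

lemma complement_exists:
  assumes ss: "semisimple_ring R" and K: "left_submodule R M K" and V: "left_submodule R M V"
    and KV: "V \<inter> K = {\<zero>\<^bsub>M\<^esub>}"
  obtains W where "left_submodule R M W" "V \<subseteq> W" "W \<inter> K = {\<zero>\<^bsub>M\<^esub>}"
    "\<forall>x\<in>carrier M. \<exists>k\<in>K. \<exists>w\<in>W. x = k \<oplus>\<^bsub>M\<^esub> w"
proof -
  let ?\<W> = "{W. left_submodule R M W \<and> V \<subseteq> W \<and> W \<inter> K = {\<zero>\<^bsub>M\<^esub>}}"
  have "\<exists>W\<in>?\<W>. \<forall>X\<in>?\<W>. W \<subseteq> X \<longrightarrow> X = W"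
  proof (rule subset_Zorn_nonempty)
    show "?\<W> \<noteq> {}" using V KV by blast
    fix \<C> assume ne: "\<C> \<noteq> {}" and ch: "subset.chain ?\<W> \<C>"
    have c: "left_submodule R M X" "V \<subseteq> X" "X \<inter> K = {\<zero>\<^bsub>M\<^esub>}" if "X \<in> \<C>" for X
      using ch that by (auto simp: subset_chain_def)
    have "left_submodule R M (\<Union>\<C>)"
    proof (rule left_submoduleI)
      fix x y assume "x \<in> \<Union>\<C>" "y \<in> \<Union>\<C>"
      then obtain X Y where XY: "X \<in> \<C>" "Y \<in> \<C>" "x \<in> X" "y \<in> Y" by blast
      then have "X \<subseteq> Y \<or> Y \<subseteq> X" using ch by (auto simp: subset_chain_def)
      then show "x \<oplus>\<^bsub>M\<^esub> y \<in> \<Union>\<C>" using XY left_submoduleD(3)[OF c(1)] by blast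
    next
      show "\<Union>\<C> \<subseteq> carrier M" using left_submoduleD(1)[OF c(1)] by blast
      show "\<zero>\<^bsub>M\<^esub> \<in> \<Union>\<C>" using ne left_submoduleD(2)[OF c(1)] by blast
      show "r \<odot>\<^bsub>M\<^esub> x \<in> \<Union>\<C>" if "r \<in> carrier R" "x \<in> \<Union>\<C>" for r x
        using that left_submoduleD(4)[OF c(1)] by blast
    qed
    moreover have "V \<subseteq> \<Union>\<C>" "\<Union>\<C> \<inter> K = {\<zero>\<^bsub>M\<^esub>}" using ne c by blast+
    ultimately show "\<Union>\<C> \<in> ?\<W>" by simp
  qed
  then obtain W where W0: "W \<in> ?\<W>" and max0: "\<forall>X\<in>?\<W>. W \<subseteq> X \<longrightarrow> X = W" by (rule bexE)
  then have W: "left_submodule R M W" "V \<subseteq> W" "W \<inter> K = {\<zero>\<^bsub>M\<^esub>}" by simp_all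
  have max: "W' = W" if "left_submodule R M W'" "W \<subseteq> W'" "W' \<inter> K = {\<zero>\<^bsub>M\<^esub>}" for W'
    using max0 that W(2) by simp
  have "\<exists>k\<in>K. \<exists>w\<in>W. x = k \<oplus>\<^bsub>M\<^esub> w" if x: "x \<in> carrier M" for x
  proof -
    let ?N = "{k \<oplus>\<^bsub>M\<^esub> w | k w. k \<in> K \<and> w \<in> W}"
    interpret L: bimodule R "regular_bimodule R" by (rule regular_bimodule[OF R.ring_axioms])
    have "left_submodule R (regular_bimodule R) {r \<in> carrier (regular_bimodule R). r \<odot>\<^bsub>M\<^esub> x \<in> ?N}"
      by (rule L.left_submodule_vimage[OF left_module_axioms smult_hom_left[OF x] L.left_submodule_carrier
            left_submodule_sum[OF K W(1)]])
    then have sg: "subgroup {r \<in> carrier R. r \<odot>\<^bsub>M\<^esub> x \<in> ?N} (add_monoid (regular_bimodule R))"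
      by (simp add: left_submodule_def)
    have sub: "\<Union>{S. simple_submodule R (regular_bimodule R) S} \<subseteq> {r \<in> carrier R. r \<odot>\<^bsub>M\<^esub> x \<in> ?N}"
    proof
      fix s assume "s \<in> \<Union>{S. simple_submodule R (regular_bimodule R) S}"
      then obtain S where S: "simple_submodule R (regular_bimodule R) S" "s \<in> S" by blast
      then have "left_submodule R (regular_bimodule R) S" by (simp add: simple_submodule_def)
      then have "s \<in> carrier R" using L.left_submoduleD(7) S(2) by force
      moreover have "s \<odot>\<^bsub>M\<^esub> x \<in> ?N"
        by (rule maximal_complement_absorbs[OF K W(1,3) max S(1) x S(2)])
      ultimately show "s \<in> {r \<in> carrier R. r \<odot>\<^bsub>M\<^esub> x \<in> ?N}" by blast
    qed
    have "generate (add_monoid (regular_bimodule R)) (\<Union>{S. simple_submodule R (regular_bimodule R) S})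
        \<subseteq> {r \<in> carrier R. r \<odot>\<^bsub>M\<^esub> x \<in> ?N}"
      by (rule group.generate_subgroup_incl[OF abelian_group.a_group[OF bimodule_abelian[OF L.bimodule_axioms]] sub sg])
    then have "\<one>\<^bsub>R\<^esub> \<in> {r \<in> carrier R. r \<odot>\<^bsub>M\<^esub> x \<in> ?N}"
      using ss by (auto simp: semisimple_ring_def semisimple_module_def)
    then show ?thesis using smult_one[OF x] by auto
  qed
  with W show ?thesis by (intro that) auto
qed

lemma complement_unique:
  assumes K: "left_submodule R M K" and W: "left_submodule R M W" and WK: "W \<inter> K = {\<zero>\<^bsub>M\<^esub>}"
    and "w \<in> W" "w' \<in> W" "w \<ominus>\<^bsub>M\<^esub> w' \<in> K"
  shows "w = w'"
proof -
  have "w \<ominus>\<^bsub>M\<^esub> w' = \<zero>\<^bsub>M\<^esub>" using left_submoduleD(6)[OF W assms(4,5)] assms(6) WK by blast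
  then show ?thesis using left_submoduleD(7)[OF W] assms(4,5) M.eq_of_minus_zero by blast
qed

text \<open>A complement \<open>W\<close> of the kernel maps bijectively onto the image, and
  \<open>\<sigma>\<close> is the inverse bijection. Since \<open>d\<close> is injective on
  \<open>V\<close>, the complement can be chosen to contain \<open>V\<close>, and then
  \<open>\<sigma>\<close> returns \<open>v\<close> from \<open>d v\<close>.\<close>

lemma linear_section:
  assumes ss: "semisimple_ring R" and N: "left_module R N" and d: "d \<in> left_hom R M N"
    and V: "left_submodule R M V" and inj: "\<And>v. v \<in> V \<Longrightarrow> d v = \<zero>\<^bsub>N\<^esub> \<Longrightarrow> v = \<zero>\<^bsub>M\<^esub>"
  shows "\<exists>\<sigma>. (\<forall>y\<in>d ` carrier M. \<sigma> y \<in> carrier M \<and> d (\<sigma> y) = y \<and>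
      (\<forall>z\<in>d ` carrier M. \<sigma> (y \<oplus>\<^bsub>N\<^esub> z) = \<sigma> y \<oplus>\<^bsub>M\<^esub> \<sigma> z) \<and>
      (\<forall>r\<in>carrier R. \<sigma> (r \<odot>\<^bsub>N\<^esub> y) = r \<odot>\<^bsub>M\<^esub> \<sigma> y)) \<and> (\<forall>v\<in>V. \<sigma> (d v) = v)"
proof -
  interpret N: left_module R N by (rule N)
  note h = left_homD[OF d]
  note ab = M.abelian_group_axioms N.M.abelian_group_axioms
  let ?K = "{x \<in> carrier M. d x \<in> {\<zero>\<^bsub>N\<^esub>}}"
  have K: "left_submodule R M ?K"
    by (rule left_submodule_vimage[OF N d left_submodule_carrier N.left_submodule_zero])
  note v = left_submoduleD[OF V]
  have VK: "V \<inter> ?K = {\<zero>\<^bsub>M\<^esub>}" using inj v(2) left_submoduleD(2)[OF K] by blast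
  obtain W where W: "left_submodule R M W" "V \<subseteq> W" "W \<inter> ?K = {\<zero>\<^bsub>M\<^esub>}"
    and dec: "\<forall>x\<in>carrier M. \<exists>k\<in>?K. \<exists>w\<in>W. x = k \<oplus>\<^bsub>M\<^esub> w"
    by (rule complement_exists[OF ss K V VK])
  note w = left_submoduleD[OF W(1)]
  have uniq: "w = w'" if "w \<in> W" "w' \<in> W" "d w = d w'" for w w'
  proof (rule complement_unique[OF K W(1,3) that(1,2)])
    show "w \<ominus>\<^bsub>M\<^esub> w' \<in> ?K"
      using that w(7) add_hom_minus[OF h ab, of w w'] add_hom_closed[OF h] by (simp add: a_minus_def N.M.r_neg)
  qed
  have ex: "\<exists>w\<in>W. d w = y" if y: "y \<in> d ` carrier M" for y
  proof -
    obtain x where x: "x \<in> carrier M" "y = d x" using y by blast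
    obtain k v where "k \<in> ?K" "v \<in> W" "x = k \<oplus>\<^bsub>M\<^esub> v" using dec x(1) by blast
    then show ?thesis using x w(7) add_hom_closed[OF h] by (auto simp: add_hom_add[OF h])
  qed
  define \<sigma> where "\<sigma> y = (SOME w. w \<in> W \<and> d w = y)" for y
  have \<sigma>: "\<sigma> y \<in> W" "d (\<sigma> y) = y" if "y \<in> d ` carrier M" for y
    using someI_ex[of "\<lambda>w. w \<in> W \<and> d w = y"] ex[OF that] unfolding \<sigma>_def by blast+
  have \<sigma>_eq: "\<sigma> y = x" if "x \<in> W" "d x = y" for x y
  proof -
    have "y \<in> d ` carrier M" using that w(7) by blast
    then show ?thesis using uniq[OF \<sigma>(1) that(1)] \<sigma>(2) that(2) by simp
  qed
  show ?thesis
  proof (intro exI[of _ \<sigma>] conjI ballI)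
    show "\<sigma> y \<in> carrier M" if "y \<in> d ` carrier M" for y using \<sigma>(1)[OF that] w(7) by simp
    show "d (\<sigma> y) = y" if "y \<in> d ` carrier M" for y using \<sigma>(2)[OF that] .
    show "\<sigma> (y \<oplus>\<^bsub>N\<^esub> z) = \<sigma> y \<oplus>\<^bsub>M\<^esub> \<sigma> z" if "y \<in> d ` carrier M" "z \<in> d ` carrier M" for y z
      by (rule \<sigma>_eq) (use \<sigma>[OF that(1)] \<sigma>[OF that(2)] w in \<open>simp_all add: add_hom_add[OF h]\<close>)
    show "\<sigma> (r \<odot>\<^bsub>N\<^esub> y) = r \<odot>\<^bsub>M\<^esub> \<sigma> y" if "r \<in> carrier R" "y \<in> d ` carrier M" for r y
      by (rule \<sigma>_eq) (use \<sigma>[OF that(2)] that w in \<open>simp_all add: left_hom_smult[OF d]\<close>)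
    show "\<sigma> (d v) = v" if "v \<in> V" for v by (rule \<sigma>_eq) (use that W(2) in auto)
  qed
qed

text \<open>Projection along a complement: \<open>p x\<close> is the only element of
  \<open>K\<close> that differs from \<open>x\<close> by an element of the complement, and
  uniqueness yields linearity.\<close>

lemma linear_projection:
  assumes ss: "semisimple_ring R" and K: "left_submodule R M K"
  shows "\<exists>p\<in>left_hom R M M. (\<forall>x\<in>carrier M. p x \<in> K) \<and> (\<forall>x\<in>K. p x = x)"
proof -
  note k = left_submoduleD[OF K]
  have zK: "{\<zero>\<^bsub>M\<^esub>} \<inter> K = {\<zero>\<^bsub>M\<^esub>}" using k(2) by blast
  obtain W where W: "left_submodule R M W" "{\<zero>\<^bsub>M\<^esub>} \<subseteq> W" "W \<inter> K = {\<zero>\<^bsub>M\<^esub>}"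
    and dec: "\<forall>x\<in>carrier M. \<exists>k\<in>K. \<exists>w\<in>W. x = k \<oplus>\<^bsub>M\<^esub> w"
    by (rule complement_exists[OF ss K left_submodule_zero zK])
  note w = left_submoduleD[OF W(1)]
  define p where "p x = (SOME k. k \<in> K \<and> x \<ominus>\<^bsub>M\<^esub> k \<in> W)" for x
  have p: "p x \<in> K" "x \<ominus>\<^bsub>M\<^esub> p x \<in> W" if x: "x \<in> carrier M" for x
  proof -
    obtain a b where ab: "a \<in> K" "b \<in> W" "x = a \<oplus>\<^bsub>M\<^esub> b" using dec x by blast
    then have "x \<ominus>\<^bsub>M\<^esub> a = b" using k(7) w(7) by (simp add: a_minus_def M.a_comm[of a b] M.a_assoc M.r_neg)
    then show "p x \<in> K" "x \<ominus>\<^bsub>M\<^esub> p x \<in> W"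
      using someI[of "\<lambda>k. k \<in> K \<and> x \<ominus>\<^bsub>M\<^esub> k \<in> W" a] ab unfolding p_def by auto
  qed
  have p_eq: "p x = a" if "x \<in> carrier M" "a \<in> K" "x \<ominus>\<^bsub>M\<^esub> a \<in> W" for x a
  proof -
    have "p x \<ominus>\<^bsub>M\<^esub> a = (x \<ominus>\<^bsub>M\<^esub> a) \<ominus>\<^bsub>M\<^esub> (x \<ominus>\<^bsub>M\<^esub> p x)"
      using that(1,2) k(7) p(1)[OF that(1)] by (simp add: M.diff_simps M.a_ac)
    then have "p x \<ominus>\<^bsub>M\<^esub> a \<in> W" using w(6)[OF that(3) p(2)[OF that(1)]] by simp
    then show ?thesis using complement_unique[OF W(1) K _ p(1)[OF that(1)] that(2)] W(3) by (simp add: Int_commute)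
  qed
  have ph: "p \<in> left_hom R M M"
  proof (intro left_homI add_homI)
    show "p (x \<oplus>\<^bsub>M\<^esub> y) = p x \<oplus>\<^bsub>M\<^esub> p y" if xy: "x \<in> carrier M" "y \<in> carrier M" for x y
    proof (rule p_eq)
      have "(x \<oplus>\<^bsub>M\<^esub> y) \<ominus>\<^bsub>M\<^esub> (p x \<oplus>\<^bsub>M\<^esub> p y) = (x \<ominus>\<^bsub>M\<^esub> p x) \<oplus>\<^bsub>M\<^esub> (y \<ominus>\<^bsub>M\<^esub> p y)"
        using xy p(1)[THEN k(7)] by (simp add: a_minus_def M.minus_add M.a_ac)
      then show "(x \<oplus>\<^bsub>M\<^esub> y) \<ominus>\<^bsub>M\<^esub> (p x \<oplus>\<^bsub>M\<^esub> p y) \<in> W" using xy p w(3) by simp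
    qed (use xy p k in auto)
    show "p (r \<odot>\<^bsub>M\<^esub> x) = r \<odot>\<^bsub>M\<^esub> p x" if rx: "r \<in> carrier R" "x \<in> carrier M" for r x
    proof (rule p_eq)
      have "r \<odot>\<^bsub>M\<^esub> x \<ominus>\<^bsub>M\<^esub> r \<odot>\<^bsub>M\<^esub> p x = r \<odot>\<^bsub>M\<^esub> (x \<ominus>\<^bsub>M\<^esub> p x)"
        using rx p(1)[THEN k(7)] by (simp add: a_minus_def smult_r_distr smult_a_inv)
      then show "r \<odot>\<^bsub>M\<^esub> x \<ominus>\<^bsub>M\<^esub> r \<odot>\<^bsub>M\<^esub> p x \<in> W" using rx p w(4) by simp
    qed (use rx p k smult_closed in auto)
  qed (use p k in auto)
  show ?thesis
    by (rule bexI[OF _ ph]) (auto intro!: p_eq p(1) simp: a_minus_def M.r_neg k(7) w(2))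
qed

end

section \<open>Dual bases of finitely generated modules\<close>

definition dual_basis ::
  "('r, 'k) ring_scheme \<Rightarrow> ('r, 'm, 'l) module_scheme \<Rightarrow> (('m \<Rightarrow> 'r) \<times> 'm) list \<Rightarrow> bool" where
  "dual_basis R M B \<longleftrightarrow>
     (\<forall>(f, e)\<in>set B. f \<in> left_hom R M (regular_bimodule R) \<and> e \<in> carrier M) \<and>
     (\<forall>x\<in>carrier M. foldr (\<lambda>(f, e) y. f x \<odot>\<^bsub>M\<^esub> e \<oplus>\<^bsub>M\<^esub> y) B \<zero>\<^bsub>M\<^esub> = x)"

context left_module
begin

lemma foldr_left_hom:
  assumes "\<forall>(f, e)\<in>set B. f \<in> left_hom R M (regular_bimodule R) \<and> e \<in> carrier M"
  shows "(\<lambda>x. foldr (\<lambda>(f, e) y. f x \<odot>\<^bsub>M\<^esub> e \<oplus>\<^bsub>M\<^esub> y) B \<zero>\<^bsub>M\<^esub>) \<in> left_hom R M M"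
  using assms
proof (induction B)
  case Nil
  then show ?case by (simp add: left_hom_def add_hom_def)
next
  case (Cons p B)
  obtain f e where p: "p = (f, e)" by (cases p)
  then have f: "f \<in> left_hom R M (regular_bimodule R)" and e: "e \<in> carrier M" using Cons by auto
  have g: "(\<lambda>x. f x \<odot>\<^bsub>M\<^esub> e) \<in> left_hom R M M"
    by (rule left_hom_comp[OF f smult_hom_left[OF e]])
  have IH: "(\<lambda>x. foldr (\<lambda>(f, e) y. f x \<odot>\<^bsub>M\<^esub> e \<oplus>\<^bsub>M\<^esub> y) B \<zero>\<^bsub>M\<^esub>) \<in> left_hom R M M" using Cons by simp
  show ?case
    using add_hom_plus[OF left_homD[OF g] left_homD[OF IH] M.abelian_group_axioms]
      left_hom_smult[OF g] left_hom_smult[OF IH] add_hom_closed[OF left_homD[OF g]] add_hom_closed[OF left_homD[OF IH]]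
    by (intro left_homI) (simp_all add: p smult_r_distr)
qed

text \<open>Induction on the generators. Suppose the sum \<open>P\<close> over the pairs found so
  far fixes the old generators. A new generator \<open>x\<close> leaves the defect
  \<open>k = x - P x\<close>, and one further pair \<open>(f, k)\<close> repairs it:
  \<open>f z\<close> is obtained by projecting the defect \<open>z - P z\<close> to
  \<open>R k\<close> and lifting the result along \<open>r \<mapsto> r k\<close>. Old generators
  have no defect and stay fixed.\<close>

lemma dual_basis_exists:
  assumes ss: "semisimple_ring R" and fg: "finitely_generated R M"
  obtains B where "dual_basis R M B"
proof -
  interpret L: bimodule R "regular_bimodule R" by (rule regular_bimodule[OF R.ring_axioms])
  note LM = bimodule_left_module[OF L.bimodule_axioms]
  obtain X where X: "finite X" "X \<subseteq> carrier M" "\<Inter>{N. left_submodule R M N \<and> X \<subseteq> N} = carrier M"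
    using fg by (auto simp: finitely_generated_def)
  let ?P = "\<lambda>B x. foldr (\<lambda>(f, e) y. f x \<odot>\<^bsub>M\<^esub> e \<oplus>\<^bsub>M\<^esub> y) B \<zero>\<^bsub>M\<^esub>"
  have "\<exists>B. (\<forall>(f, e)\<in>set B. f \<in> left_hom R M (regular_bimodule R) \<and> e \<in> carrier M) \<and> (\<forall>x\<in>X. ?P B x = x)"
    using X(1,2)
  proof (induction X)
    case empty
    then show ?case by (intro exI[of _ "[]"]) simp
  next
    case (insert x X)
    then obtain B where B: "\<forall>(f, e)\<in>set B. f \<in> left_hom R M (regular_bimodule R) \<and> e \<in> carrier M"
      "\<forall>x\<in>X. ?P B x = x" by auto
    note P = foldr_left_hom[OF B(1)]
    note Pc = add_hom_closed[OF left_homD[OF P]]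
    have x: "x \<in> carrier M" using insert by simp
    define k where "k = x \<ominus>\<^bsub>M\<^esub> ?P B x"
    have k: "k \<in> carrier M" using x Pc by (simp add: k_def)
    let ?K = "(\<lambda>r. r \<odot>\<^bsub>M\<^esub> k) ` carrier (regular_bimodule R)"
    have K: "left_submodule R M ?K"
      by (rule left_submodule_image[OF LM smult_hom_left[OF k] L.left_submodule_carrier])
    have inj: "v = \<zero>\<^bsub>regular_bimodule R\<^esub>" if "v \<in> {\<zero>\<^bsub>regular_bimodule R\<^esub>}" "v \<odot>\<^bsub>M\<^esub> k = \<zero>\<^bsub>M\<^esub>" for v
      using that by simp
    obtain \<sigma> where "\<forall>y\<in>?K. \<sigma> y \<in> carrier (regular_bimodule R) \<and> \<sigma> y \<odot>\<^bsub>M\<^esub> k = y \<and>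
        (\<forall>z\<in>?K. \<sigma> (y \<oplus>\<^bsub>M\<^esub> z) = \<sigma> y \<oplus>\<^bsub>regular_bimodule R\<^esub> \<sigma> z) \<and>
        (\<forall>r\<in>carrier R. \<sigma> (r \<odot>\<^bsub>M\<^esub> y) = r \<odot>\<^bsub>regular_bimodule R\<^esub> \<sigma> y)"
      using L.linear_section[OF ss left_module_axioms smult_hom_left[OF k] L.left_submodule_zero] inj
      by (elim meta_impE exE conjE) auto
    then have \<sigma>: "\<And>y. y \<in> ?K \<Longrightarrow> \<sigma> y \<in> carrier (regular_bimodule R)" "\<And>y. y \<in> ?K \<Longrightarrow> \<sigma> y \<odot>\<^bsub>M\<^esub> k = y"
      "\<And>y z. y \<in> ?K \<Longrightarrow> z \<in> ?K \<Longrightarrow> \<sigma> (y \<oplus>\<^bsub>M\<^esub> z) = \<sigma> y \<oplus>\<^bsub>regular_bimodule R\<^esub> \<sigma> z"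
      "\<And>r y. r \<in> carrier R \<Longrightarrow> y \<in> ?K \<Longrightarrow> \<sigma> (r \<odot>\<^bsub>M\<^esub> y) = r \<odot>\<^bsub>regular_bimodule R\<^esub> \<sigma> y"
      by blast+
    obtain p where p': "p \<in> left_hom R M M" "(\<forall>x\<in>carrier M. p x \<in> ?K) \<and> (\<forall>x\<in>?K. p x = x)"
      using linear_projection[OF ss K] by (rule bexE)
    then have p: "p \<in> left_hom R M M" "\<And>x. x \<in> carrier M \<Longrightarrow> p x \<in> ?K" "\<And>x. x \<in> ?K \<Longrightarrow> p x = x"
      by blast+
    define f where "f z = \<sigma> (p (z \<ominus>\<^bsub>M\<^esub> ?P B z))" for z
    note ph = left_homD[OF p(1)]
    have qh: "(\<lambda>z. z \<ominus>\<^bsub>M\<^esub> ?P B z) \<in> left_hom R M M"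
      using add_hom_diff[OF add_hom_ident left_homD[OF P] M.abelian_group_axioms] Pc
      by (intro left_homI) (simp_all add: left_hom_smult[OF P] a_minus_def smult_r_distr smult_a_inv)
    note pqh = left_hom_comp[OF qh p(1)]
    have pq: "p (z \<ominus>\<^bsub>M\<^esub> ?P B z) \<in> ?K" if "z \<in> carrier M" for z
      using that Pc by (intro p(2)) simp
    have f: "f \<in> left_hom R M (regular_bimodule R)"
      unfolding f_def
    proof (intro left_homI add_homI)
      show "\<sigma> (p (x \<ominus>\<^bsub>M\<^esub> ?P B x)) \<in> carrier (regular_bimodule R)" if "x \<in> carrier M" for x
        by (rule \<sigma>(1)[OF pq[OF that]])
    qed (simp_all only: add_hom_add[OF left_homD[OF pqh]] left_hom_smult[OF pqh] \<sigma>(3)[OF pq pq] \<sigma>(4)[OF _ pq])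
    have "k = \<one>\<^bsub>R\<^esub> \<odot>\<^bsub>M\<^esub> k" using k by (simp add: smult_one)
    then have kK: "k \<in> ?K" by auto
    have z0: "f z \<odot>\<^bsub>M\<^esub> k = \<zero>\<^bsub>M\<^esub>" if "z \<in> X" for z
    proof -
      have z: "z \<in> carrier M" using that insert by blast
      then have "z \<ominus>\<^bsub>M\<^esub> ?P B z = \<zero>\<^bsub>M\<^esub>" using B(2) that by (simp add: a_minus_def M.r_neg)
      then have "p (z \<ominus>\<^bsub>M\<^esub> ?P B z) = \<zero>\<^bsub>M\<^esub>"
        using add_hom_zero[OF ph M.abelian_group_axioms M.abelian_group_axioms] by simp
      then show ?thesis using \<sigma>(2)[OF left_submoduleD(2)[OF K]] by (simp add: f_def)
    qed
    have "f x \<odot>\<^bsub>M\<^esub> k = k" using \<sigma>(2)[OF kK] p(3)[OF kK] by (simp add: f_def k_def[symmetric])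
    then have "?P ((f, k) # B) x = x" using x Pc by (simp add: k_def a_minus_def M.a_assoc M.l_neg)
    moreover have "?P ((f, k) # B) z = z" if "z \<in> X" for z using z0[OF that] B(2) that insert by auto
    ultimately show ?case using f k B(1) by (intro exI[of _ "(f, k) # B"]) auto
  qed
  then obtain B where B: "\<forall>(f, e)\<in>set B. f \<in> left_hom R M (regular_bimodule R) \<and> e \<in> carrier M"
    "\<forall>x\<in>X. ?P B x = x" by blast
  note P = foldr_left_hom[OF B(1)]
  have "left_submodule R M {x \<in> carrier M. ?P B x = x}"
    using add_hom_add[OF left_homD[OF P]] left_hom_smult[OF P]
      add_hom_zero[OF left_homD[OF P] M.abelian_group_axioms M.abelian_group_axioms]
    by (intro left_submoduleI) (auto simp: smult_closed)
  then have "carrier M \<subseteq> {x \<in> carrier M. ?P B x = x}" using X B(2) by blast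
  then show ?thesis using that[of B] B(1) by (auto simp: dual_basis_def)
qed

end

text \<open>A dual basis rebuilds a tensor from its contractions: \<open>t\<close> is the sum over
  the pairs \<open>(f, e)\<close> of the contraction of \<open>t\<close> with \<open>f\<close>,
  tensored with \<open>e\<close>. On pure tensors this is the dual basis identity for
  \<open>y\<close>, with the coefficients moved across the tensor sign.\<close>

lemma dual_basis_tensor_eqI:
  assumes M: "bimodule R M" and N: "bimodule R N" and B: "dual_basis R N B"
    and t: "t \<in> carrier (tensor R M N)" "t' \<in> carrier (tensor R M N)"
    and eq: "\<And>f e. (f, e) \<in> set B \<Longrightarrow> lift M (\<lambda>(x, y). x \<triangleleft>\<^bsub>M\<^esub> f y) t = lift M (\<lambda>(x, y). x \<triangleleft>\<^bsub>M\<^esub> f y) t'"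
  shows "t = t'"
proof -
  interpret M: bimodule R M by fact
  interpret N: bimodule R N by fact
  let ?T = "tensor R M N"
  interpret T: bimodule R ?T by (rule tensor_bimodule[OF M N])
  note Tab = bimodule_abelian[OF T.bimodule_axioms]
  have bal: "balanced R M N M (\<lambda>x y. x \<triangleleft>\<^bsub>M\<^esub> f y)" if "f \<in> left_hom R N (regular_bimodule R)" for f
    using add_hom_closed[OF left_homD[OF that]] add_hom_add[OF left_homD[OF that]] left_hom_smult[OF that]
    by (intro balancedI add_homI) (simp_all add: M.rsmult_closed M.rsmult_r_distr M.rsmult_l_distr M.rsmult_assoc)
  let ?G = "\<lambda>f. lift M (\<lambda>(x, y). x \<triangleleft>\<^bsub>M\<^esub> f y)"
  let ?S = "\<lambda>B t. foldr (\<lambda>(f, e) s. tens R M N (?G f t) e \<oplus>\<^bsub>?T\<^esub> s) B \<zero>\<^bsub>?T\<^esub>"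
  have S: "?S B \<in> add_hom ?T ?T"
    "x \<in> carrier M \<Longrightarrow> y \<in> carrier N \<Longrightarrow>
      ?S B (tens R M N x y) = tens R M N x (foldr (\<lambda>(f, e) z. f y \<odot>\<^bsub>N\<^esub> e \<oplus>\<^bsub>N\<^esub> z) B \<zero>\<^bsub>N\<^esub>)"
    if "\<forall>(f, e)\<in>set B. f \<in> left_hom R N (regular_bimodule R) \<and> e \<in> carrier N" for B x y
    using that
  proof (induction B)
    case Nil
    note h = balancedD(1)[OF balanced_tens[OF M N]]
    { case 1 then show ?case by (simp add: add_hom_def) }
    { case 2 then show ?case
        using add_hom_zero[OF h bimodule_abelian[OF N] Tab] by simp }
  next
    case (Cons p B)
    obtain f e where p: "p = (f, e)" by (cases p)
    { case 1
      then have f: "f \<in> left_hom R N (regular_bimodule R)" and e: "e \<in> carrier N" by (auto simp: p)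
      have "(\<lambda>t. tens R M N (?G f t) e) \<in> add_hom ?T ?T"
        by (rule add_hom_comp[OF lift_tensor_hom[OF M N bal[OF f] bimodule_abelian[OF M]]
              balancedD(2)[OF balanced_tens[OF M N] e]])
      then show ?case using add_hom_plus[OF _ Cons.IH(1) Tab] 1 by (simp add: p) }
    { case 2
      then have f: "f \<in> left_hom R N (regular_bimodule R)" and e: "e \<in> carrier N" by (auto simp: p)
      have fy: "f y \<in> carrier R" using add_hom_closed[OF left_homD[OF f] 2(2)] by simp
      have "foldr (\<lambda>(f, e) z. f y \<odot>\<^bsub>N\<^esub> e \<oplus>\<^bsub>N\<^esub> z) B \<zero>\<^bsub>N\<^esub> \<in> carrier N"
        using add_hom_closed[OF left_homD[OF N.foldr_left_hom[of B]] 2(2)] 2(3) by simp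
      then show ?case using 2 Cons.IH(2)[OF 2(1,2)] fy e
        by (simp add: p lift_tens[OF M N bal[OF f] bimodule_abelian[OF M]] tens_balanced[OF M N]
            tens_add_right[OF M N] N.smult_closed) }
  qed
  have "?S B s = s" if "s \<in> carrier ?T" for s
    by (rule tensor_hom_ext[OF M N S(1) add_hom_ident _ that]) (use B S(2) in \<open>auto simp: dual_basis_def\<close>)
  moreover have "?S B t = ?S B t'"
  proof -
    have "?S B' t = ?S B' t'" if "set B' \<subseteq> set B" for B'
      using that by (induction B') (auto simp: eq)
    then show ?thesis by blast
  qed
  ultimately show ?thesis using t by metis
qed

section \<open>Sub-bimodules\<close>

lemma sub_bimodule_bimodule:
  assumes M: "bimodule R M" and N: "sub_bimodule R M N"
  shows "bimodule R (M\<lparr>carrier := N\<rparr>)"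
proof -
  interpret M: bimodule R M by (rule M)
  have sub: "left_submodule R M N" and rs: "\<And>r x. r \<in> carrier R \<Longrightarrow> x \<in> N \<Longrightarrow> x \<triangleleft>\<^bsub>M\<^esub> r \<in> N"
    using N by (auto simp: sub_bimodule_def)
  note n = M.left_submoduleD[OF sub]
  have "abelian_group (M\<lparr>carrier := N\<rparr>)"
  proof (rule abelian_groupI)
    show "\<exists>y\<in>carrier (M\<lparr>carrier := N\<rparr>). y \<oplus>\<^bsub>M\<lparr>carrier := N\<rparr>\<^esub> x = \<zero>\<^bsub>M\<lparr>carrier := N\<rparr>\<^esub>"
      if "x \<in> carrier (M\<lparr>carrier := N\<rparr>)" for x
      using that n M.M.l_neg by (intro bexI[of _ "\<ominus>\<^bsub>M\<^esub> x"]) simp_all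
  qed (use n M.M.a_ac in simp_all)
  then show ?thesis
    by (intro bimodule.intro left_module.intro bimodule_axioms.intro left_module_axioms.intro M.R.ring_axioms)
      (use n rs in \<open>auto simp: M.smult_l_distr M.smult_r_distr M.smult_assoc M.smult_one M.rsmult_l_distr
          M.rsmult_r_distr M.rsmult_assoc M.rsmult_one M.bimodule_assoc\<close>)
qed

section \<open>The augmentation ideal of a connected graded ring\<close>

lemma plus_part_sel [simp]:
  "add (plus_part A) = add A" "zero (plus_part A) = zero A" "smult (plus_part A) = smult A"
  "rsmult (plus_part A) = rsmult A" "mult (plus_part A) = mult A"
  by (simp_all add: plus_part_def)

locale connected_graded_ring = graded_R_ring R A
  for R :: "('r, 'k) ring_scheme" and A :: "('r, 'a) graded_bimodule" +
  assumes connected: "connected_ring R A"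
begin

lemma bimodule_A: "bimodule R A" ..

lemma hcompD:
  shows "x \<in> hcomp A n \<Longrightarrow> x \<in> carrier A" "\<zero>\<^bsub>A\<^esub> \<in> hcomp A n"
    "x \<in> hcomp A n \<Longrightarrow> y \<in> hcomp A n \<Longrightarrow> x \<oplus>\<^bsub>A\<^esub> y \<in> hcomp A n" "x \<in> hcomp A n \<Longrightarrow> \<ominus>\<^bsub>A\<^esub> x \<in> hcomp A n"
    "r \<in> carrier R \<Longrightarrow> x \<in> hcomp A n \<Longrightarrow> r \<odot>\<^bsub>A\<^esub> x \<in> hcomp A n"
    "r \<in> carrier R \<Longrightarrow> x \<in> hcomp A n \<Longrightarrow> x \<triangleleft>\<^bsub>A\<^esub> r \<in> hcomp A n"
proof -
  have s: "left_submodule R A (hcomp A n)" using hcomp_sub[of n] by (simp add: sub_bimodule_def)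
  show "x \<in> hcomp A n \<Longrightarrow> x \<in> carrier A" "\<zero>\<^bsub>A\<^esub> \<in> hcomp A n"
    "x \<in> hcomp A n \<Longrightarrow> y \<in> hcomp A n \<Longrightarrow> x \<oplus>\<^bsub>A\<^esub> y \<in> hcomp A n" "x \<in> hcomp A n \<Longrightarrow> \<ominus>\<^bsub>A\<^esub> x \<in> hcomp A n"
    "r \<in> carrier R \<Longrightarrow> x \<in> hcomp A n \<Longrightarrow> r \<odot>\<^bsub>A\<^esub> x \<in> hcomp A n"
    by (rule left_submoduleD[OF s]; assumption)+
  show "r \<in> carrier R \<Longrightarrow> x \<in> hcomp A n \<Longrightarrow> x \<triangleleft>\<^bsub>A\<^esub> r \<in> hcomp A n"
    using hcomp_sub[of n] by (simp add: sub_bimodule_def)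
qed

abbreviation "Ap \<equiv> plus_part A"

lemma plus_induct [consumes 1, case_names zero homogeneous add]:
  assumes x: "x \<in> carrier Ap" and "Q \<zero>\<^bsub>A\<^esub>" and h: "\<And>n x. n > 0 \<Longrightarrow> x \<in> hcomp A n \<Longrightarrow> Q x"
    and add: "\<And>x y. x \<in> carrier A \<Longrightarrow> y \<in> carrier A \<Longrightarrow> x \<in> carrier Ap \<Longrightarrow> y \<in> carrier Ap \<Longrightarrow> Q x \<Longrightarrow> Q y \<Longrightarrow> Q (x \<oplus>\<^bsub>A\<^esub> y)"
  shows "Q x"
proof -
  have x': "x \<in> generate (add_monoid A) (\<Union>n\<in>{0<..}. hcomp A n)" using x by (simp add: plus_part_def)
  have sub: "(\<Union>n\<in>{0<..}. hcomp A n) \<subseteq> carrier (add_monoid A)" using hcompD(1) by auto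
  have gen: "y \<in> carrier A" "y \<in> carrier Ap" if "y \<in> generate (add_monoid A) (\<Union>n\<in>{0<..}. hcomp A n)" for y
    using M.add.generate_incl sub that by (auto simp: plus_part_def)
  show ?thesis using x'
  proof (induction rule: generate.induct)
    case one
    then show ?case using assms(2) by simp
  next
    case (incl y)
    then show ?case using h by auto
  next
    case (inv y)
    then show ?case using h hcompD(4) by (auto simp: a_inv_def[symmetric])
  next
    case (eng y z)
    then show ?case using add gen by simp
  qed
qed

lemma hcomp_plus: "n > 0 \<Longrightarrow> x \<in> hcomp A n \<Longrightarrow> x \<in> carrier Ap"
  unfolding plus_part_def by (auto intro: generate.incl)

lemma plus_carrier: "x \<in> carrier Ap \<Longrightarrow> x \<in> carrier A"
  by (induction rule: plus_induct) (auto intro: hcompD)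

lemma plus_zero: "\<zero>\<^bsub>A\<^esub> \<in> carrier Ap"
  unfolding plus_part_def using generate.one[of "add_monoid A"] by simp

lemma plus_add: "x \<in> carrier Ap \<Longrightarrow> y \<in> carrier Ap \<Longrightarrow> x \<oplus>\<^bsub>A\<^esub> y \<in> carrier Ap"
  unfolding plus_part_def using generate.eng[of x "add_monoid A" _ y] by simp

lemma plus_smult: "x \<in> carrier Ap \<Longrightarrow> r \<in> carrier R \<Longrightarrow> r \<odot>\<^bsub>A\<^esub> x \<in> carrier Ap"
  by (induction rule: plus_induct) (auto simp: plus_zero smult_r_distr plus_add intro: hcomp_plus hcompD)

lemma plus_rsmult: "x \<in> carrier Ap \<Longrightarrow> r \<in> carrier R \<Longrightarrow> x \<triangleleft>\<^bsub>A\<^esub> r \<in> carrier Ap"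
proof (induction rule: plus_induct)
  case zero
  then show ?case
    using add_hom_zero[OF rsmult_hom, of r] M.abelian_group_axioms by (simp add: plus_zero)
qed (auto simp: rsmult_l_distr plus_add intro: hcomp_plus hcompD)

lemma plus_mult: "x \<in> carrier Ap \<Longrightarrow> y \<in> carrier Ap \<Longrightarrow> x \<otimes>\<^bsub>A\<^esub> y \<in> carrier Ap"
proof (induction rule: plus_induct)
  case (homogeneous n x)
  note n = homogeneous(1,2)
  show ?case using homogeneous(3)
  proof (induction rule: plus_induct)
    case (homogeneous m y)
    then show ?case using hcomp_mult[of x n y m] hcomp_plus[of "n + m"] n by simp
  qed (use n hcompD(1) in \<open>auto simp: plus_zero plus_add A.r_distr\<close>)
qed (auto simp: plus_zero plus_carrier plus_add A.l_distr)

lemma sub_bimodule_plus: "sub_bimodule R A (carrier Ap)"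
  by (auto simp: sub_bimodule_def plus_rsmult plus_zero plus_add plus_smult plus_carrier intro!: left_submoduleI)

lemma bimodule_plus: "bimodule R Ap"
  using sub_bimodule_bimodule[OF bimodule_A sub_bimodule_plus] by (simp add: plus_part_def)

lemma decomposition_add:
  assumes f: "is_decomposition A a f" and g: "is_decomposition A b g"
  shows "is_decomposition A (a \<oplus>\<^bsub>A\<^esub> b) (\<lambda>n. f n \<oplus>\<^bsub>A\<^esub> g n)"
proof -
  have fc: "f n \<in> carrier A" and gc: "g n \<in> carrier A" for n
    using f g hcompD(1) by (auto simp: is_decomposition_def)
  let ?S = "{n. f n \<noteq> \<zero>\<^bsub>A\<^esub>} \<union> {n. g n \<noteq> \<zero>\<^bsub>A\<^esub>}"
  have fin: "finite ?S" using f g by (simp add: is_decomposition_def)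
  have ext: "(\<Oplus>\<^bsub>A\<^esub>n\<in>{n. k n \<noteq> \<zero>\<^bsub>A\<^esub>}. k n) = (\<Oplus>\<^bsub>A\<^esub>n\<in>?S. k n)"
    if "{n. k n \<noteq> \<zero>\<^bsub>A\<^esub>} \<subseteq> ?S" "\<And>n. k n \<in> carrier A" for k
    by (rule M.add.finprod_mono_neutral_cong_left) (use fin that in auto)
  have sub: "{n. f n \<oplus>\<^bsub>A\<^esub> g n \<noteq> \<zero>\<^bsub>A\<^esub>} \<subseteq> ?S" using fc gc by auto
  have "a \<oplus>\<^bsub>A\<^esub> b = (\<Oplus>\<^bsub>A\<^esub>n\<in>?S. f n) \<oplus>\<^bsub>A\<^esub> (\<Oplus>\<^bsub>A\<^esub>n\<in>?S. g n)"
    using f g ext[of f] ext[of g] fc gc by (simp add: is_decomposition_def)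
  also have "\<dots> = (\<Oplus>\<^bsub>A\<^esub>n\<in>?S. f n \<oplus>\<^bsub>A\<^esub> g n)"
    using fc gc by (simp add: M.finsum_addf Pi_iff)
  also have "\<dots> = (\<Oplus>\<^bsub>A\<^esub>n\<in>{n. f n \<oplus>\<^bsub>A\<^esub> g n \<noteq> \<zero>\<^bsub>A\<^esub>}. f n \<oplus>\<^bsub>A\<^esub> g n)"
    using ext[OF sub] fc gc by simp
  finally show ?thesis
    using f g hcompD(3) finite_subset[OF sub fin] by (simp add: is_decomposition_def)
qed

lemma decomposition_single:
  assumes "x \<in> hcomp A n"
  shows "is_decomposition A x (\<lambda>m. if m = n then x else \<zero>\<^bsub>A\<^esub>)"
proof (cases "x = \<zero>\<^bsub>A\<^esub>")
  case True
  then show ?thesis using hcompD(2) by (simp add: is_decomposition_def)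
next
  case False
  then have "{m. (if m = n then x else \<zero>\<^bsub>A\<^esub>) \<noteq> \<zero>\<^bsub>A\<^esub>} = {n}" by auto
  then show ?thesis using assms hcompD(1,2) by (simp add: is_decomposition_def)
qed

lemma plus_decomposition: "x \<in> carrier Ap \<Longrightarrow> \<exists>f. is_decomposition A x f \<and> f 0 = \<zero>\<^bsub>A\<^esub>"
proof (induction rule: plus_induct)
  case zero
  then show ?case using decomposition_single[OF hcompD(2), of 0] by auto
next
  case (homogeneous n x)
  then show ?case using decomposition_single[of x n] by (intro exI) auto
next
  case (add x y)
  then obtain f g where "is_decomposition A x f" "f 0 = \<zero>\<^bsub>A\<^esub>" "is_decomposition A y g" "g 0 = \<zero>\<^bsub>A\<^esub>" by blast
  then show ?case using decomposition_add[of x f y g] by (intro exI) auto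
qed

lemma scalar_hcomp: "r \<in> carrier R \<Longrightarrow> r \<odot>\<^bsub>A\<^esub> \<one>\<^bsub>A\<^esub> \<in> hcomp A 0"
  using hcompD(5) hcomp_one by simp

text \<open>\<open>proj0\<close> reads off a decomposition picked by definite description. The one
  exhibited has \<open>r 1\<close> in degree 0, because an element of \<open>Ap\<close> has no
  component there, and \<open>direct_sum\<close> makes it the only one.\<close>

lemma proj0_eq:
  assumes r: "r \<in> carrier R" and x: "x \<in> carrier Ap"
  shows "proj0 R A (r \<odot>\<^bsub>A\<^esub> \<one>\<^bsub>A\<^esub> \<oplus>\<^bsub>A\<^esub> x) = r"
proof -
  obtain f where f: "is_decomposition A x f" "f 0 = \<zero>\<^bsub>A\<^esub>" using plus_decomposition[OF x] by blast
  note d = decomposition_add[OF decomposition_single[OF scalar_hcomp[OF r]] f(1)]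
  have rc: "r \<odot>\<^bsub>A\<^esub> \<one>\<^bsub>A\<^esub> \<in> carrier A" using scalar_hcomp[OF r] hcompD(1) by blast
  then have "\<exists>!f. is_decomposition A (r \<odot>\<^bsub>A\<^esub> \<one>\<^bsub>A\<^esub> \<oplus>\<^bsub>A\<^esub> x) f" using direct_sum plus_carrier[OF x] by simp
  then have "(THE f. is_decomposition A (r \<odot>\<^bsub>A\<^esub> \<one>\<^bsub>A\<^esub> \<oplus>\<^bsub>A\<^esub> x) f) =
      (\<lambda>n. (if n = 0 then r \<odot>\<^bsub>A\<^esub> \<one>\<^bsub>A\<^esub> else \<zero>\<^bsub>A\<^esub>) \<oplus>\<^bsub>A\<^esub> f n)"
    by (rule the1_equality) (rule d)
  then have "(THE f. is_decomposition A (r \<odot>\<^bsub>A\<^esub> \<one>\<^bsub>A\<^esub> \<oplus>\<^bsub>A\<^esub> x) f) 0 = r \<odot>\<^bsub>A\<^esub> \<one>\<^bsub>A\<^esub>"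
    using f(2) rc by simp
  then show ?thesis
    using connected r inv_into_f_f[of "\<lambda>r. r \<odot>\<^bsub>A\<^esub> \<one>\<^bsub>A\<^esub>" "carrier R" r]
    unfolding proj0_def connected_ring_def bij_betw_def by simp
qed

text \<open>By connectedness the elements of degree 0 are multiples of the unit, homogeneous
  elements of positive degree lie in \<open>Ap\<close>, and the set of such sums is closed under
  addition.\<close>

lemma decompose:
  assumes a: "a \<in> carrier A"
  obtains r x where "r \<in> carrier R" "x \<in> carrier Ap" "a = r \<odot>\<^bsub>A\<^esub> \<one>\<^bsub>A\<^esub> \<oplus>\<^bsub>A\<^esub> x"
proof -
  let ?D = "{r \<odot>\<^bsub>A\<^esub> \<one>\<^bsub>A\<^esub> \<oplus>\<^bsub>A\<^esub> x | r x. r \<in> carrier R \<and> x \<in> carrier Ap}"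
  have D: "r \<odot>\<^bsub>A\<^esub> \<one>\<^bsub>A\<^esub> \<oplus>\<^bsub>A\<^esub> x \<in> ?D" if "r \<in> carrier R" "x \<in> carrier Ap" for r x using that by blast
  have oc: "r \<odot>\<^bsub>A\<^esub> \<one>\<^bsub>A\<^esub> \<in> carrier A" if "r \<in> carrier R" for r using scalar_hcomp[OF that] hcompD(1) by blast
  have add: "x \<oplus>\<^bsub>A\<^esub> y \<in> ?D" if "x \<in> ?D" "y \<in> ?D" for x y
  proof -
    from that obtain r s u v where *: "r \<in> carrier R" "s \<in> carrier R" "u \<in> carrier Ap" "v \<in> carrier Ap"
      "x = r \<odot>\<^bsub>A\<^esub> \<one>\<^bsub>A\<^esub> \<oplus>\<^bsub>A\<^esub> u" "y = s \<odot>\<^bsub>A\<^esub> \<one>\<^bsub>A\<^esub> \<oplus>\<^bsub>A\<^esub> v" by blast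
    then have "x \<oplus>\<^bsub>A\<^esub> y = (r \<oplus>\<^bsub>R\<^esub> s) \<odot>\<^bsub>A\<^esub> \<one>\<^bsub>A\<^esub> \<oplus>\<^bsub>A\<^esub> (u \<oplus>\<^bsub>A\<^esub> v)"
      by (simp add: smult_l_distr oc plus_carrier M.a_ac)
    then show ?thesis using D[of "r \<oplus>\<^bsub>R\<^esub> s" "u \<oplus>\<^bsub>A\<^esub> v"] * plus_add by simp
  qed
  have homog: "x \<in> ?D" if x: "x \<in> hcomp A n" for x n
  proof (cases "n = 0")
    case True
    then obtain r where r: "r \<in> carrier R" "x = r \<odot>\<^bsub>A\<^esub> \<one>\<^bsub>A\<^esub>"
      using connected x by (auto simp: connected_ring_def bij_betw_def)
    then show ?thesis using D[OF r(1) plus_zero] oc by simp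
  next
    case False
    then show ?thesis
      using D[of "\<zero>\<^bsub>R\<^esub>" x] hcomp_plus[of n x] x hcompD(1)[OF x] smult_l_null[of "\<one>\<^bsub>A\<^esub>"] by simp
  qed
  have zero: "\<zero>\<^bsub>A\<^esub> \<in> ?D" using homog[OF hcompD(2)[of 0]] .
  obtain f where f: "is_decomposition A a f" using direct_sum[OF a] by blast
  have "(\<Oplus>\<^bsub>A\<^esub>n\<in>S. f n) \<in> ?D" if "finite S" for S
    using that
  proof (induction S)
    case (insert n S)
    have h: "f m \<in> hcomp A m" for m using f by (simp add: is_decomposition_def)
    then have "f m \<in> carrier A" for m using hcompD(1) by blast
    then have "(\<Oplus>\<^bsub>A\<^esub>n\<in>insert n S. f n) = f n \<oplus>\<^bsub>A\<^esub> (\<Oplus>\<^bsub>A\<^esub>n\<in>S. f n)"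
      using insert by (simp add: M.finsum_insert Pi_iff)
    then show ?case using add[OF homog[OF h] insert.IH] by (simp only:)
  qed (use zero in simp)
  moreover have "finite {n. f n \<noteq> \<zero>\<^bsub>A\<^esub>}" "a = (\<Oplus>\<^bsub>A\<^esub>n\<in>{n. f n \<noteq> \<zero>\<^bsub>A\<^esub>}. f n)"
    using f by (simp_all add: is_decomposition_def)
  ultimately have "a \<in> ?D" by (simp only:)
  then show ?thesis using that by blast
qed

definition plus_proj :: "'a \<Rightarrow> 'a" where
  "plus_proj a = a \<ominus>\<^bsub>A\<^esub> proj0 R A a \<odot>\<^bsub>A\<^esub> \<one>\<^bsub>A\<^esub>"

lemma scalar_closed: "r \<in> carrier R \<Longrightarrow> r \<odot>\<^bsub>A\<^esub> \<one>\<^bsub>A\<^esub> \<in> carrier A"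
  by (rule hcompD(1)[OF scalar_hcomp])

lemma plus_proj_eq:
  assumes r: "r \<in> carrier R" and x: "x \<in> carrier Ap"
  shows "plus_proj (r \<odot>\<^bsub>A\<^esub> \<one>\<^bsub>A\<^esub> \<oplus>\<^bsub>A\<^esub> x) = x"
  unfolding plus_proj_def proj0_eq[OF r x]
  using M.a_comm[of "r \<odot>\<^bsub>A\<^esub> \<one>\<^bsub>A\<^esub>" x] r x by (simp add: scalar_closed plus_carrier M.diff_simps)

lemma proj0_closed: "a \<in> carrier A \<Longrightarrow> proj0 R A a \<in> carrier R"
  by (metis decompose proj0_eq)

lemma plus_proj_closed: "a \<in> carrier A \<Longrightarrow> plus_proj a \<in> carrier Ap"
  by (metis decompose plus_proj_eq)

lemma proj0_plus_proj: "a \<in> carrier A \<Longrightarrow> proj0 R A a \<odot>\<^bsub>A\<^esub> \<one>\<^bsub>A\<^esub> \<oplus>\<^bsub>A\<^esub> plus_proj a = a"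
  by (metis decompose plus_proj_eq proj0_eq)

lemma proj0_plus: "x \<in> carrier Ap \<Longrightarrow> proj0 R A x = \<zero>\<^bsub>R\<^esub>"
  using proj0_eq[of "\<zero>\<^bsub>R\<^esub>" x] by (simp add: plus_carrier)

lemma plus_proj_plus: "x \<in> carrier Ap \<Longrightarrow> plus_proj x = x"
  using plus_proj_eq[of "\<zero>\<^bsub>R\<^esub>" x] by (simp add: plus_carrier)

lemma proj0_scalar: "r \<in> carrier R \<Longrightarrow> proj0 R A (r \<odot>\<^bsub>A\<^esub> \<one>\<^bsub>A\<^esub>) = r"
  using proj0_eq[OF _ plus_zero, of r] by (simp add: scalar_closed)

lemma plus_proj_scalar: "r \<in> carrier R \<Longrightarrow> plus_proj (r \<odot>\<^bsub>A\<^esub> \<one>\<^bsub>A\<^esub>) = \<zero>\<^bsub>A\<^esub>"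
  using plus_proj_eq[OF _ plus_zero, of r] by (simp add: scalar_closed)

lemma
  shows proj0_hom: "proj0 R A \<in> bimodule_hom R A (regular_bimodule R)"
    and plus_proj_hom: "plus_proj \<in> bimodule_hom R A Ap"
proof -
  have *: "proj0 R A (a \<oplus>\<^bsub>A\<^esub> b) = proj0 R A a \<oplus>\<^bsub>R\<^esub> proj0 R A b \<and> plus_proj (a \<oplus>\<^bsub>A\<^esub> b) = plus_proj a \<oplus>\<^bsub>A\<^esub> plus_proj b"
    if a: "a \<in> carrier A" and b: "b \<in> carrier A" for a b
  proof -
    obtain r x where rx: "r \<in> carrier R" "x \<in> carrier Ap" "a = r \<odot>\<^bsub>A\<^esub> \<one>\<^bsub>A\<^esub> \<oplus>\<^bsub>A\<^esub> x" using a by (rule decompose)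
    obtain s y where sy: "s \<in> carrier R" "y \<in> carrier Ap" "b = s \<odot>\<^bsub>A\<^esub> \<one>\<^bsub>A\<^esub> \<oplus>\<^bsub>A\<^esub> y" using b by (rule decompose)
    have "a \<oplus>\<^bsub>A\<^esub> b = (r \<oplus>\<^bsub>R\<^esub> s) \<odot>\<^bsub>A\<^esub> \<one>\<^bsub>A\<^esub> \<oplus>\<^bsub>A\<^esub> (x \<oplus>\<^bsub>A\<^esub> y)"
      using rx sy by (simp add: smult_l_distr scalar_closed plus_carrier M.a_ac)
    then show ?thesis using rx sy by (simp add: proj0_eq plus_proj_eq plus_add)
  qed
  have **: "proj0 R A (t \<odot>\<^bsub>A\<^esub> a) = t \<otimes>\<^bsub>R\<^esub> proj0 R A a \<and> plus_proj (t \<odot>\<^bsub>A\<^esub> a) = t \<odot>\<^bsub>A\<^esub> plus_proj a \<and>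
      proj0 R A (a \<triangleleft>\<^bsub>A\<^esub> t) = proj0 R A a \<otimes>\<^bsub>R\<^esub> t \<and> plus_proj (a \<triangleleft>\<^bsub>A\<^esub> t) = plus_proj a \<triangleleft>\<^bsub>A\<^esub> t"
    if a: "a \<in> carrier A" and t: "t \<in> carrier R" for a t
  proof -
    obtain r x where rx: "r \<in> carrier R" "x \<in> carrier Ap" "a = r \<odot>\<^bsub>A\<^esub> \<one>\<^bsub>A\<^esub> \<oplus>\<^bsub>A\<^esub> x" using a by (rule decompose)
    have "t \<odot>\<^bsub>A\<^esub> a = (t \<otimes>\<^bsub>R\<^esub> r) \<odot>\<^bsub>A\<^esub> \<one>\<^bsub>A\<^esub> \<oplus>\<^bsub>A\<^esub> t \<odot>\<^bsub>A\<^esub> x"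
      using rx t by (simp add: smult_r_distr smult_assoc scalar_closed plus_carrier)
    moreover have "a \<triangleleft>\<^bsub>A\<^esub> t = (r \<otimes>\<^bsub>R\<^esub> t) \<odot>\<^bsub>A\<^esub> \<one>\<^bsub>A\<^esub> \<oplus>\<^bsub>A\<^esub> x \<triangleleft>\<^bsub>A\<^esub> t"
      using rx t by (simp add: rsmult_l_distr rsmult_assoc rsmult_closed scalar_closed plus_carrier unit_central)
    ultimately show ?thesis using rx t by (simp add: proj0_eq plus_proj_eq plus_smult plus_rsmult)
  qed
  show "proj0 R A \<in> bimodule_hom R A (regular_bimodule R)" "plus_proj \<in> bimodule_hom R A Ap"
    using * ** by (auto simp: bimodule_hom_def proj0_closed plus_proj_closed)
qed

text \<open>By \<open>mult_balanced\<close> the scalar part of \<open>a\<close> multiplies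
  \<open>x\<close> through the right action. The second summand will measure how far
  \<open>HK\<close> is from being linear over \<open>A\<close>.\<close>

lemma mult_plus:
  assumes "x \<in> carrier Ap" "a \<in> carrier A"
  shows "x \<otimes>\<^bsub>A\<^esub> a = x \<otimes>\<^bsub>A\<^esub> plus_proj a \<oplus>\<^bsub>A\<^esub> x \<triangleleft>\<^bsub>A\<^esub> proj0 R A a"
proof -
  have "x \<otimes>\<^bsub>A\<^esub> a = x \<otimes>\<^bsub>A\<^esub> (proj0 R A a \<odot>\<^bsub>A\<^esub> \<one>\<^bsub>A\<^esub>) \<oplus>\<^bsub>A\<^esub> x \<otimes>\<^bsub>A\<^esub> plus_proj a"
    using assms proj0_plus_proj[OF assms(2)]
      A.r_distr[of "proj0 R A a \<odot>\<^bsub>A\<^esub> \<one>\<^bsub>A\<^esub>" "plus_proj a" x]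
    by (simp add: scalar_closed proj0_closed plus_proj_closed plus_carrier)
  also have "x \<otimes>\<^bsub>A\<^esub> (proj0 R A a \<odot>\<^bsub>A\<^esub> \<one>\<^bsub>A\<^esub>) = x \<triangleleft>\<^bsub>A\<^esub> proj0 R A a"
    using assms mult_balanced[of "proj0 R A a" x "\<one>\<^bsub>A\<^esub>", symmetric]
    by (simp add: proj0_closed plus_carrier rsmult_closed)
  finally show ?thesis using assms
    by (simp add: M.a_comm proj0_closed plus_proj_closed plus_carrier rsmult_closed)
qed

lemma mult_plus_left: "x \<in> carrier Ap \<Longrightarrow> a \<in> carrier A \<Longrightarrow> x \<otimes>\<^bsub>A\<^esub> a \<in> carrier Ap"
  using mult_plus[of x a] by (simp add: plus_add plus_mult plus_proj_closed plus_rsmult proj0_closed)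

end

section \<open>The normalised bar complex\<close>

context connected_graded_ring
begin

abbreviation "Om n \<equiv> tensor_power R (plus_part A) n"
abbreviation "cn n \<equiv> consp R (plus_part A) n"

lemmas bimodule_Om = tensor_power_bimodule[OF bimodule_plus]
lemmas abelian_Om = bimodule_abelian[OF bimodule_Om]
lemmas left_module_Om = bimodule_left_module[OF bimodule_Om]
lemmas cn_hom = consp_hom[OF bimodule_plus]
lemmas cn_closed = consp_closed[OF bimodule_plus]
lemmas cn_add_left = consp_add_left[OF bimodule_plus, unfolded plus_part_sel]
lemmas cn_balanced = consp_balanced[OF bimodule_plus, unfolded plus_part_sel]
lemmas cn_smult = consp_smult[OF bimodule_plus, unfolded plus_part_sel]
lemmas cn_rsmult = consp_rsmult[OF bimodule_plus, unfolded plus_part_sel]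
lemmas balanced_cn = balanced_consp[OF bimodule_plus]
lemmas Om_Suc_hom_ext = tensor_power_Suc_hom_ext[OF bimodule_plus]
lemmas peel_cn = peel_consp[OF bimodule_plus]

sublocale Om: bimodule R "Om n" for n
  by (rule bimodule_Om)

lemma cn_right_hom: "a \<in> carrier Ap \<Longrightarrow> cn n a \<in> right_hom R (Om n) (Om (Suc n))"
  by (rule right_homI) (simp_all add: cn_hom cn_rsmult)

lemma mult_right_hom: "a \<in> carrier Ap \<Longrightarrow> (\<lambda>b. a \<otimes>\<^bsub>A\<^esub> b) \<in> right_hom R Ap Ap"
  by (intro right_homI add_homI) (simp_all add: plus_mult A.r_distr plus_carrier mult_right)

text \<open>The action of \<open>a\<close> on the first letter of a nonempty word; \<open>n\<close>
  counts the letters after the first one.\<close>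

definition lm :: "nat \<Rightarrow> 'a \<Rightarrow> (('r \<times> 'a list) \<Rightarrow>\<^sub>0 int) set \<Rightarrow> (('r \<times> 'a list) \<Rightarrow>\<^sub>0 int) set" where
  "lm n a = peel R Ap (Om (Suc n)) (\<lambda>b v. cn n (a \<otimes>\<^bsub>A\<^esub> b) v)"

lemma
  assumes a: "a \<in> carrier Ap"
  shows lm_hom: "lm n a \<in> add_hom (Om (Suc n)) (Om (Suc n))"
    and lm_cn: "b \<in> carrier Ap \<Longrightarrow> v \<in> carrier (Om n) \<Longrightarrow> lm n a (cn n b v) = cn n (a \<otimes>\<^bsub>A\<^esub> b) v"
proof -
  note b = balanced_comp_left[OF balanced_cn mult_right_hom[OF a], of n]
  show "lm n a \<in> add_hom (Om (Suc n)) (Om (Suc n))"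
    unfolding lm_def by (rule peel_hom[OF bimodule_plus abelian_Om b])
  show "b \<in> carrier Ap \<Longrightarrow> v \<in> carrier (Om n) \<Longrightarrow> lm n a (cn n b v) = cn n (a \<otimes>\<^bsub>A\<^esub> b) v"
    unfolding lm_def by (rule peel_cn[OF abelian_Om b])
qed

lemma lm_closed: "a \<in> carrier Ap \<Longrightarrow> v \<in> carrier (Om (Suc n)) \<Longrightarrow> lm n a v \<in> carrier (Om (Suc n))"
  by (rule add_hom_closed[OF lm_hom])

lemma lm_add_left:
  assumes "a \<in> carrier Ap" "b \<in> carrier Ap" "v \<in> carrier (Om (Suc n))"
  shows "lm n (a \<oplus>\<^bsub>A\<^esub> b) v = lm n a v \<oplus>\<^bsub>Om (Suc n)\<^esub> lm n b v"
  by (rule Om_Suc_hom_ext[OF lm_hom add_hom_plus[OF lm_hom lm_hom abelian_Om] _ assms(3)])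
    (simp_all add: assms plus_add lm_cn A.l_distr plus_carrier cn_add_left plus_mult)

lemma lm_balanced:
  assumes a: "a \<in> carrier Ap" and r: "r \<in> carrier R" and v: "v \<in> carrier (Om (Suc n))"
  shows "lm n (a \<triangleleft>\<^bsub>A\<^esub> r) v = lm n a (r \<odot>\<^bsub>Om (Suc n)\<^esub> v)"
  by (rule Om_Suc_hom_ext[OF lm_hom add_hom_comp[OF Om.smult_hom[OF r] lm_hom[OF a]] _ v])
    (simp_all add: a r plus_rsmult plus_smult lm_cn cn_smult[symmetric] mult_balanced plus_carrier)

lemma lm_smult:
  assumes a: "a \<in> carrier Ap" and r: "r \<in> carrier R" and v: "v \<in> carrier (Om (Suc n))"
  shows "lm n (r \<odot>\<^bsub>A\<^esub> a) v = r \<odot>\<^bsub>Om (Suc n)\<^esub> lm n a v"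
  by (rule Om_Suc_hom_ext[OF lm_hom add_hom_comp[OF lm_hom[OF a] Om.smult_hom[OF r]] _ v])
    (simp_all add: a r plus_smult lm_cn cn_smult[symmetric] mult_left plus_carrier plus_mult)

lemma lm_rsmult:
  assumes a: "a \<in> carrier Ap" and r: "r \<in> carrier R" and v: "v \<in> carrier (Om (Suc n))"
  shows "lm n a (v \<triangleleft>\<^bsub>Om (Suc n)\<^esub> r) = lm n a v \<triangleleft>\<^bsub>Om (Suc n)\<^esub> r"
  by (rule Om_Suc_hom_ext[OF add_hom_comp[OF Om.rsmult_hom[OF r] lm_hom[OF a]] add_hom_comp[OF lm_hom[OF a] Om.rsmult_hom[OF r]] _ v])
    (simp_all add: a r lm_cn cn_rsmult[symmetric] plus_mult Om.rsmult_closed)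

lemma lm_lm:
  assumes a: "a \<in> carrier Ap" and b: "b \<in> carrier Ap" and v: "v \<in> carrier (Om (Suc n))"
  shows "lm n a (lm n b v) = lm n (a \<otimes>\<^bsub>A\<^esub> b) v"
  by (rule Om_Suc_hom_ext[OF add_hom_comp[OF lm_hom[OF b] lm_hom[OF a]] lm_hom _ v])
    (simp_all add: a b plus_mult lm_cn A.m_assoc plus_carrier)

lemma balanced_lm: "balanced R Ap (Om (Suc n)) (Om (Suc n)) (lm n)"
  by (intro balancedI add_homI) (simp_all add: lm_closed lm_add_left lm_balanced add_hom_add[OF lm_hom])

text \<open>The differential of the bar complex in recursive form:
  \<open>d[a | v] = a v - [a | d v]\<close>, where \<open>a v\<close> multiplies the first entry of \<open>v\<close> by \<open>a\<close>.\<close>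

fun bd :: "nat \<Rightarrow> (('r \<times> 'a list) \<Rightarrow>\<^sub>0 int) set \<Rightarrow> (('r \<times> 'a list) \<Rightarrow>\<^sub>0 int) set" where
  "bd 0 = (\<lambda>w. \<zero>\<^bsub>Om 0\<^esub>)"
| "bd (Suc 0) = (\<lambda>w. \<zero>\<^bsub>Om 0\<^esub>)"
| "bd (Suc (Suc n)) = peel R Ap (Om (Suc n)) (\<lambda>a v. lm n a v \<ominus>\<^bsub>Om (Suc n)\<^esub> cn n a (bd (Suc n) v))"

lemma zero_bimodule_hom:
  assumes M: "bimodule R M" and N: "bimodule R N" shows "(\<lambda>x. \<zero>\<^bsub>N\<^esub>) \<in> bimodule_hom R M N"
proof -
  interpret N: bimodule R N by (rule N)
  have "\<zero>\<^bsub>N\<^esub> \<triangleleft>\<^bsub>N\<^esub> r = \<zero>\<^bsub>N\<^esub>" if "r \<in> carrier R" for r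
    using add_hom_zero[OF N.rsmult_hom[OF that] bimodule_abelian[OF N] bimodule_abelian[OF N]] .
  then show ?thesis by (simp add: bimodule_hom_def)
qed

lemma bd_balanced:
  assumes "bd (Suc n) \<in> left_hom R (Om (Suc n)) (Om n)"
  shows "balanced R Ap (Om (Suc n)) (Om (Suc n)) (\<lambda>a v. lm n a v \<ominus>\<^bsub>Om (Suc n)\<^esub> cn n a (bd (Suc n) v))"
  by (rule balanced_diff[OF balanced_lm balanced_comp_right[OF balanced_cn assms] abelian_Om])

text \<open>Linearity has to be proved along the recursion: \<open>peel\<close> yields a
  well-defined map only for a balanced argument, and balancedness uses the left linearity of the
  previous differential.\<close>

lemma bd_hom: "bd n \<in> bimodule_hom R (Om n) (Om (n - 1))"
proof (induction n rule: bd.induct)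
  case (3 n)
  then have h: "bd (Suc n) \<in> left_hom R (Om (Suc n)) (Om n)" "bd (Suc n) \<in> right_hom R (Om (Suc n)) (Om n)"
    using bimodule_homD by auto
  note hc = add_hom_closed[OF left_homD[OF h(1)]]
  have "bd (Suc (Suc n)) \<in> left_hom R (Om (Suc (Suc n))) (Om (Suc n))"
    unfolding bd.simps
    by (rule peel_left_hom[OF bimodule_plus left_module_Om bd_balanced[OF h(1)]])
      (simp add: lm_smult cn_smult hc lm_closed cn_closed
        add_hom_minus[OF Om.smult_hom abelian_Om abelian_Om])
  moreover have "bd (Suc (Suc n)) \<in> right_hom R (Om (Suc (Suc n))) (Om (Suc n))"
    unfolding bd.simps
    by (rule peel_right_hom[OF bimodule_plus bimodule_Om bd_balanced[OF h(1)]])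
      (simp add: lm_rsmult cn_rsmult right_hom_rsmult[OF h(2)] hc lm_closed cn_closed
        add_hom_minus[OF Om.rsmult_hom abelian_Om abelian_Om])
  ultimately show ?case by (simp add: bimodule_hom_iff)
qed (use zero_bimodule_hom[OF bimodule_Om bimodule_Om] in simp_all)

lemma bd_Suc_hom: "bd (Suc n) \<in> bimodule_hom R (Om (Suc n)) (Om n)"
  using bd_hom[of "Suc n"] by simp

lemmas bd_left_hom = bimodule_homD(1)[OF bd_Suc_hom]
lemmas bd_add_hom = bimodule_homD(3)[OF bd_Suc_hom]
lemmas bd_closed = add_hom_closed[OF bd_add_hom]

lemma bd_cn:
  "a \<in> carrier Ap \<Longrightarrow> v \<in> carrier (Om (Suc n)) \<Longrightarrow>
    bd (Suc (Suc n)) (cn (Suc n) a v) = lm n a v \<ominus>\<^bsub>Om (Suc n)\<^esub> cn n a (bd (Suc n) v)"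
  unfolding bd.simps by (rule peel_cn[OF abelian_Om bd_balanced[OF bd_left_hom]])

text \<open>On \<open>[b | v]\<close> the claim reduces to \<open>a (b v) = (a b) v\<close>. Two
  letters are the minimum, since the differential of the word must still have a first letter for
  \<open>a\<close> to act on.\<close>

lemma bd_lm:
  assumes a: "a \<in> carrier Ap" and v: "v \<in> carrier (Om (Suc (Suc n)))"
  shows "bd (Suc (Suc n)) (lm (Suc n) a v) = lm n a (bd (Suc (Suc n)) v)"
  by (rule Om_Suc_hom_ext[OF add_hom_comp[OF lm_hom[OF a] bd_add_hom] add_hom_comp[OF bd_add_hom lm_hom[OF a]] _ v])
    (simp add: a lm_cn bd_cn plus_mult bd_closed lm_closed cn_closed lm_lm
      add_hom_minus[OF lm_hom abelian_Om abelian_Om] del: bd.simps(3))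

text \<open>On \<open>[a | v]\<close> the double differential is
  \<open>d (a v) - d [a | d v]\<close>, that is, \<open>a d v - (a d v - [a | d d v])\<close>. Only
  the last term survives, and the induction hypothesis removes it.\<close>

lemma bd_bd:
  assumes w: "w \<in> carrier (Om (Suc (Suc n)))"
  shows "bd (Suc n) (bd (Suc (Suc n)) w) = \<zero>\<^bsub>Om n\<^esub>"
  using w
proof (induction n arbitrary: w)
  case (Suc n)
  note [simp del] = bd.simps(3)
  show ?case
  proof (rule Om_Suc_hom_ext[OF add_hom_comp[OF bd_add_hom bd_add_hom] add_hom_zero_map[OF abelian_Om] _ Suc.prems])
    fix a v assume a: "a \<in> carrier Ap" and v: "v \<in> carrier (Om (Suc (Suc n)))"
    have "bd (Suc (Suc n)) (bd (Suc (Suc (Suc n))) (cn (Suc (Suc n)) a v)) =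
        lm n a (bd (Suc (Suc n)) v) \<ominus>\<^bsub>Om (Suc n)\<^esub>
        (lm n a (bd (Suc (Suc n)) v) \<ominus>\<^bsub>Om (Suc n)\<^esub> cn n a (bd (Suc n) (bd (Suc (Suc n)) v)))"
      using a v by (simp add: bd_cn bd_lm bd_closed lm_closed cn_closed add_hom_minus[OF bd_add_hom abelian_Om abelian_Om])
    also have "\<dots> = \<zero>\<^bsub>Om (Suc n)\<^esub>"
      using a v Suc.IH[OF v] add_hom_zero[OF cn_hom[OF a] abelian_Om abelian_Om]
      by (simp add: lm_closed bd_closed Om.M.diff_simps)
    finally show "bd (Suc (Suc n)) (bd (Suc (Suc (Suc n))) (cn (Suc (Suc n)) a v)) = \<zero>\<^bsub>Om (Suc n)\<^esub>" .
  qed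
qed simp

lemmas pword_plus_closed = pword_closed[OF bimodule_plus]

lemma pword_cn:
  "r \<in> carrier R \<Longrightarrow> x \<in> carrier Ap \<Longrightarrow> set xs \<subseteq> carrier Ap \<Longrightarrow>
    pword R Ap r (x # xs) = cn (length xs) (r \<odot>\<^bsub>A\<^esub> x) (pword R Ap \<one>\<^bsub>R\<^esub> xs)"
  using pword_consp[OF bimodule_plus, of r x xs] by simp

text \<open>The term \<open>i = 0\<close> of the alternating sum is \<open>lm\<close>; the terms
  \<open>i + 1\<close> are the terms \<open>i\<close> of the tail with the first letter put in
  front, and the shift of the index produces the minus sign of the recursion. For
  \<open>n \<le> 1\<close> the sum is empty.\<close>

lemma bd_pword:
  "r \<in> carrier R \<Longrightarrow> set as \<subseteq> carrier Ap \<Longrightarrow> length as = n \<Longrightarrow>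
    (\<Oplus>\<^bsub>Om (n - 1)\<^esub>i\<in>{..<n - 1}. [((-1::int) ^ i)] \<cdot>\<^bsub>Om (n - 1)\<^esub>
       pword R Ap r (take i as @ [as ! i \<otimes>\<^bsub>A\<^esub> as ! Suc i] @ drop (i + 2) as)) = bd n (pword R Ap r as)"
proof (induction n arbitrary: r as rule: bd.induct)
  case 1
  show ?case by simp
next
  case 2
  show ?case by simp
next
  case (3 n)
  note [simp del] = bd.simps(3)
  obtain x y zs where as: "as = x # y # zs" "length zs = n"
    using 3(4) by (cases as; cases "tl as") auto
  have r: "r \<in> carrier R" and x: "x \<in> carrier Ap" and y: "y \<in> carrier Ap" and zs: "set zs \<subseteq> carrier Ap"
    using 3 as by auto
  let ?t = "y # zs"
  let ?w = "\<lambda>s xs i. pword R Ap s (take i xs @ [xs ! i \<otimes>\<^bsub>A\<^esub> xs ! Suc i] @ drop (i + 2) xs)"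
  have wc: "?w s xs i \<in> carrier (Om (length xs - 1))" if "s \<in> carrier R" "set xs \<subseteq> carrier Ap" "Suc i < length xs" for s xs i
  proof (rule pword_plus_closed)
    have "xs ! i \<otimes>\<^bsub>A\<^esub> xs ! Suc i \<in> carrier Ap" using that by (intro plus_mult) (auto simp: subset_iff)
    then show "set (take i xs @ [xs ! i \<otimes>\<^bsub>A\<^esub> xs ! Suc i] @ drop (i + 2) xs) \<subseteq> carrier Ap"
      using that set_take_subset[of i xs] set_drop_subset[of "i + 2" xs] by auto
  qed (use that in auto)
  have w_Suc: "?w r as (Suc i) = cn n (r \<odot>\<^bsub>A\<^esub> x) (?w \<one>\<^bsub>R\<^esub> ?t i)" if "i < n" for i
  proof -
    have "?t ! i \<otimes>\<^bsub>A\<^esub> ?t ! Suc i \<in> carrier Ap"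
      using y zs as(2) that by (intro plus_mult) (auto simp: subset_iff nth_Cons')
    then have "set (take i ?t @ [?t ! i \<otimes>\<^bsub>A\<^esub> ?t ! Suc i] @ drop (i + 2) ?t) \<subseteq> carrier Ap"
      using y zs set_take_subset[of i ?t] set_drop_subset[of "i + 2" ?t] by auto
    then show ?thesis
      using pword_cn[OF r x, of "take i ?t @ [?t ! i \<otimes>\<^bsub>A\<^esub> ?t ! Suc i] @ drop (i + 2) ?t"] as that by simp
  qed
  have rx: "r \<odot>\<^bsub>A\<^esub> x \<in> carrier Ap" using r x by (simp add: plus_smult)
  have w0: "?w r as 0 = lm n (r \<odot>\<^bsub>A\<^esub> x) (pword R Ap \<one>\<^bsub>R\<^esub> ?t)"
    using r x y zs as pword_cn[of r "x \<otimes>\<^bsub>A\<^esub> y" zs] pword_cn[of "\<one>\<^bsub>R\<^esub>" y zs]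
    by (simp add: plus_mult plus_smult lm_cn pword_plus_closed mult_left plus_carrier smult_one)
  have IH: "(\<Oplus>\<^bsub>Om n\<^esub>i\<in>{..<n}. [((-1::int) ^ i)] \<cdot>\<^bsub>Om n\<^esub> ?w \<one>\<^bsub>R\<^esub> ?t i) = bd (Suc n) (pword R Ap \<one>\<^bsub>R\<^esub> ?t)"
    using "3.IH"[of "\<one>\<^bsub>R\<^esub>" ?t] y zs as by simp
  have tc: "pword R Ap \<one>\<^bsub>R\<^esub> ?t \<in> carrier (Om (Suc n))" using y zs as by (intro pword_plus_closed) auto
  have wc1: "?w \<one>\<^bsub>R\<^esub> ?t i \<in> carrier (Om n)" if "i < n" for i
    using wc[of "\<one>\<^bsub>R\<^esub>" ?t i] y zs as that by simp
  have wcr: "?w r as i \<in> carrier (Om (Suc n))" if "i < Suc n" for i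
    using wc[of r as i] r x y zs as that by simp
  have neg: "[((-1::int) ^ Suc i)] \<cdot>\<^bsub>Om (Suc n)\<^esub> u = \<ominus>\<^bsub>Om (Suc n)\<^esub> ([((-1::int) ^ i)] \<cdot>\<^bsub>Om (Suc n)\<^esub> u)"
    if "u \<in> carrier (Om (Suc n))" for u i
    using Om.M.add.int_pow_neg[OF that, of "(-1) ^ i"] by simp
  let ?g = "\<lambda>i. [((-1::int) ^ i)] \<cdot>\<^bsub>Om (Suc n)\<^esub> ?w r as i"
  have gc: "?g i \<in> carrier (Om (Suc n))" if "i < Suc n" for i
    by (rule Om.M.add.int_pow_closed[OF wcr[OF that]])
  have nh: "(\<lambda>v. \<ominus>\<^bsub>Om (Suc n)\<^esub> cn n (r \<odot>\<^bsub>A\<^esub> x) v) \<in> add_hom (Om n) (Om (Suc n))"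
    by (rule add_hom_uminus[OF cn_hom[OF rx] abelian_Om])
  have "(\<Oplus>\<^bsub>Om (Suc n)\<^esub>i\<in>{..<Suc n}. ?g i) = ?g 0 \<oplus>\<^bsub>Om (Suc n)\<^esub> (\<Oplus>\<^bsub>Om (Suc n)\<^esub>i\<in>Suc ` {..<n}. ?g i)"
  proof -
    have "{..<Suc n} = insert 0 (Suc ` {..<n})" by (rule lessThan_Suc_eq_insert_0)
    moreover have "?g \<in> Suc ` {..<n} \<rightarrow> carrier (Om (Suc n))"
    proof
      fix i assume "i \<in> Suc ` {..<n}"
      then have "i < Suc n" by auto
      then show "?g i \<in> carrier (Om (Suc n))" by (rule gc)
    qed
    moreover have "?g 0 \<in> carrier (Om (Suc n))" by (rule gc) simp
    ultimately show ?thesis by (simp only:) (rule Om.M.finsum_insert, auto)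
  qed
  also have "(\<Oplus>\<^bsub>Om (Suc n)\<^esub>i\<in>Suc ` {..<n}. ?g i) = (\<Oplus>\<^bsub>Om (Suc n)\<^esub>i\<in>{..<n}. ?g (Suc i))"
  proof (rule Om.M.finsum_reindex)
    show "?g \<in> Suc ` {..<n} \<rightarrow> carrier (Om (Suc n))"
    proof
      fix i assume "i \<in> Suc ` {..<n}"
      then have "i < Suc n" by auto
      then show "?g i \<in> carrier (Om (Suc n))" by (rule gc)
    qed
  qed simp
  also have "\<dots> = (\<Oplus>\<^bsub>Om (Suc n)\<^esub>i\<in>{..<n}. \<ominus>\<^bsub>Om (Suc n)\<^esub> cn n (r \<odot>\<^bsub>A\<^esub> x) ([((-1::int) ^ i)] \<cdot>\<^bsub>Om n\<^esub> ?w \<one>\<^bsub>R\<^esub> ?t i))"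
  proof (rule Om.M.finsum_cong')
    show "?g (Suc i) = \<ominus>\<^bsub>Om (Suc n)\<^esub> cn n (r \<odot>\<^bsub>A\<^esub> x) ([((-1::int) ^ i)] \<cdot>\<^bsub>Om n\<^esub> ?w \<one>\<^bsub>R\<^esub> ?t i)" if "i \<in> {..<n}" for i
    proof -
      from that have i: "i < n" by simp
      show ?thesis
        unfolding w_Suc[OF i] add_hom_int_pow[OF cn_hom[OF rx] abelian_Om abelian_Om wc1[OF i]]
        by (rule neg[OF cn_closed[OF rx wc1[OF i]]])
    qed
    show "(\<lambda>i. \<ominus>\<^bsub>Om (Suc n)\<^esub> cn n (r \<odot>\<^bsub>A\<^esub> x) ([((-1::int) ^ i)] \<cdot>\<^bsub>Om n\<^esub> ?w \<one>\<^bsub>R\<^esub> ?t i)) \<in> {..<n} \<rightarrow> carrier (Om (Suc n))"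
    proof
      fix i assume "i \<in> {..<n}"
      then have i: "i < n" by simp
      show "\<ominus>\<^bsub>Om (Suc n)\<^esub> cn n (r \<odot>\<^bsub>A\<^esub> x) ([((-1::int) ^ i)] \<cdot>\<^bsub>Om n\<^esub> ?w \<one>\<^bsub>R\<^esub> ?t i) \<in> carrier (Om (Suc n))"
        by (rule add_hom_closed[OF nh Om.M.add.int_pow_closed[OF wc1[OF i]]])
    qed
  qed simp
  also have "\<dots> = \<ominus>\<^bsub>Om (Suc n)\<^esub> cn n (r \<odot>\<^bsub>A\<^esub> x) (bd (Suc n) (pword R Ap \<one>\<^bsub>R\<^esub> ?t))"
    unfolding IH[symmetric]
    by (rule add_hom_finsum[OF nh abelian_Om abelian_Om, symmetric]) (use Om.M.add.int_pow_closed[OF wc1] in auto)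
  also have "?g 0 = lm n (r \<odot>\<^bsub>A\<^esub> x) (pword R Ap \<one>\<^bsub>R\<^esub> ?t)"
    using w0 lm_closed[OF rx tc] by simp
  finally have "(\<Oplus>\<^bsub>Om (Suc n)\<^esub>i\<in>{..<Suc n}. ?g i) = bd (Suc (Suc n)) (cn (Suc n) (r \<odot>\<^bsub>A\<^esub> x) (pword R Ap \<one>\<^bsub>R\<^esub> ?t))"
    by (simp add: bd_cn[OF rx tc] a_minus_def)
  also have "cn (Suc n) (r \<odot>\<^bsub>A\<^esub> x) (pword R Ap \<one>\<^bsub>R\<^esub> ?t) = pword R Ap r as"
    using pword_cn[OF r x, of ?t] y zs as by simp
  finally show ?case by simp
qed

text \<open>Covers degree 0 as well: there the truncated difference \<open>0 - 1 = 0\<close> makes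
  \<open>Om 0\<close> its own target, and both sides vanish.\<close>

lemma bar_diff_eq:
  assumes "w \<in> carrier (Om n)"
  shows "bar_diff R A n w = bd n w"
  unfolding bar_diff_def bar_comp_def
  by (rule lift_power_eq_hom[OF bimodule_plus abelian_Om bimodule_homD(3)[OF bd_hom] _ assms])
    (use bd_pword in simp)

text \<open>Deconcatenation by recursion on the number \<open>p\<close> of letters kept on the left:
  the first letter stays in the left factor and the rest is split after \<open>p\<close> letters. An
  empty left part is the unit of \<open>Om 0\<close>.\<close>

fun cop :: "nat \<Rightarrow> nat \<Rightarrow> (('r \<times> 'a list) \<Rightarrow>\<^sub>0 int) set
    \<Rightarrow> (((('r \<times> 'a list) \<Rightarrow>\<^sub>0 int) set \<times> (('r \<times> 'a list) \<Rightarrow>\<^sub>0 int) set) \<Rightarrow>\<^sub>0 int) set" where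
  "cop 0 q = tens R (Om 0) (Om q) (pword R Ap \<one>\<^bsub>R\<^esub> [])"
| "cop (Suc p) q = peel R Ap (tensor R (Om (Suc p)) (Om q))
     (\<lambda>a v. tensor_map R (Om (Suc p)) (Om q) (cn p a) (\<lambda>y. y) (cop p q v))"

lemmas bimodule_OmOm = tensor_bimodule[OF bimodule_Om bimodule_Om]
lemmas abelian_OmOm = bimodule_abelian[OF bimodule_OmOm]

sublocale OmOm: bimodule R "tensor R (Om p) (Om q)" for p q
  by (rule bimodule_OmOm)

abbreviation "tcn p q a \<equiv> tensor_map R (Om (Suc p)) (Om q) (cn p a) (\<lambda>y. y)"

lemma tcn_right_hom:
  "a \<in> carrier Ap \<Longrightarrow> tcn p q a \<in> right_hom R (tensor R (Om p) (Om q)) (tensor R (Om (Suc p)) (Om q))"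
  by (rule tensor_map_right_hom[OF bimodule_Om bimodule_Om bimodule_Om bimodule_Om cn_right_hom left_hom_ident right_hom_ident])

lemmas tcn_hom = right_homD[OF tcn_right_hom]

lemma tcn_tens:
  "a \<in> carrier Ap \<Longrightarrow> x \<in> carrier (Om p) \<Longrightarrow> y \<in> carrier (Om q) \<Longrightarrow>
    tcn p q a (tens R (Om p) (Om q) x y) = tens R (Om (Suc p)) (Om q) (cn p a x) y"
  by (rule tensor_map_tens[OF bimodule_Om bimodule_Om bimodule_Om bimodule_Om cn_right_hom left_hom_ident])

lemmas OmOm_hom_ext = tensor_hom_ext[OF bimodule_Om bimodule_Om]

lemma balanced_tcn: "balanced R Ap (tensor R (Om p) (Om q)) (tensor R (Om (Suc p)) (Om q)) (tcn p q)"
proof (rule balancedI)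
  fix t assume t: "t \<in> carrier (tensor R (Om p) (Om q))"
  show "(\<lambda>a. tcn p q a t) \<in> add_hom Ap (tensor R (Om (Suc p)) (Om q))"
  proof (rule add_homI)
    fix a b assume ab: "a \<in> carrier Ap" "b \<in> carrier Ap"
    have "tcn p q (a \<oplus>\<^bsub>A\<^esub> b) t = tcn p q a t \<oplus>\<^bsub>tensor R (Om (Suc p)) (Om q)\<^esub> tcn p q b t"
      by (rule OmOm_hom_ext[OF tcn_hom add_hom_plus[OF tcn_hom tcn_hom abelian_OmOm] _ t])
        (simp_all add: ab plus_add tcn_tens cn_add_left cn_closed tens_add_left[OF bimodule_Om bimodule_Om])
    then show "tcn p q (a \<oplus>\<^bsub>Ap\<^esub> b) t = tcn p q a t \<oplus>\<^bsub>tensor R (Om (Suc p)) (Om q)\<^esub> tcn p q b t" by simp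
  qed (rule add_hom_closed[OF tcn_hom t])
  fix a r assume a: "a \<in> carrier Ap" and r: "r \<in> carrier R"
  have "tcn p q (a \<triangleleft>\<^bsub>A\<^esub> r) t = tcn p q a (r \<odot>\<^bsub>tensor R (Om p) (Om q)\<^esub> t)"
    by (rule OmOm_hom_ext[OF tcn_hom add_hom_comp[OF OmOm.smult_hom[OF r] tcn_hom[OF a]] _ t])
      (simp_all add: a r plus_rsmult tcn_tens cn_balanced tens_smult[OF bimodule_Om bimodule_Om] Om.smult_closed)
  then show "tcn p q (a \<triangleleft>\<^bsub>Ap\<^esub> r) t = tcn p q a (r \<odot>\<^bsub>tensor R (Om p) (Om q)\<^esub> t)" by simp
qed (rule tcn_hom)

lemma tcn_smult:
  assumes a: "a \<in> carrier Ap" and r: "r \<in> carrier R" and t: "t \<in> carrier (tensor R (Om p) (Om q))"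
  shows "tcn p q (r \<odot>\<^bsub>A\<^esub> a) t = r \<odot>\<^bsub>tensor R (Om (Suc p)) (Om q)\<^esub> tcn p q a t"
  by (rule OmOm_hom_ext[OF tcn_hom add_hom_comp[OF tcn_hom[OF a] OmOm.smult_hom[OF r]] _ t])
    (simp_all add: a r plus_smult tcn_tens cn_smult tens_smult[OF bimodule_Om bimodule_Om] cn_closed)

lemma pword_Nil_closed: "r \<in> carrier R \<Longrightarrow> pword R Ap r [] \<in> carrier (Om 0)"
  by (rule pword_plus_closed) auto

lemma cop_hom: "cop p q \<in> bimodule_hom R (Om (p + q)) (tensor R (Om p) (Om q))"
proof (induction p)
  case 0
  have one: "pword R Ap \<one>\<^bsub>R\<^esub> [] \<in> carrier (Om 0)" by (rule pword_Nil_closed) simp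
  have "r \<odot>\<^bsub>Om 0\<^esub> pword R Ap \<one>\<^bsub>R\<^esub> [] = pword R Ap \<one>\<^bsub>R\<^esub> [] \<triangleleft>\<^bsub>Om 0\<^esub> r" if "r \<in> carrier R" for r
    using that by (simp add: pword_smult[OF bimodule_plus] pword_rsmult_Nil[OF bimodule_plus])
  then show ?case
    using one balancedD(1)[OF balanced_tens[OF bimodule_Om bimodule_Om] one]
    by (auto simp: bimodule_hom_iff tens_smult[OF bimodule_Om bimodule_Om] tens_rsmult[OF bimodule_Om bimodule_Om]
        tens_balanced[OF bimodule_Om bimodule_Om] intro!: left_homI right_homI)
next
  case (Suc p)
  note l = bimodule_homD(1)[OF Suc.IH] and r = bimodule_homD(2)[OF Suc.IH]
  note b = balanced_comp_right[OF balanced_tcn l]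
  note c = add_hom_closed[OF left_homD[OF l]]
  have "cop (Suc p) q \<in> left_hom R (Om (Suc (p + q))) (tensor R (Om (Suc p)) (Om q))"
    unfolding cop.simps
    by (rule peel_left_hom[OF bimodule_plus bimodule_left_module[OF bimodule_OmOm] b]) (simp add: tcn_smult c)
  moreover have "cop (Suc p) q \<in> right_hom R (Om (Suc (p + q))) (tensor R (Om (Suc p)) (Om q))"
    unfolding cop.simps
    by (rule peel_right_hom[OF bimodule_plus bimodule_OmOm b])
      (simp add: right_hom_rsmult[OF r] right_hom_rsmult[OF tcn_right_hom] c)
  ultimately show ?case by (simp add: bimodule_hom_iff)
qed

lemma cop_cn:
  "a \<in> carrier Ap \<Longrightarrow> w \<in> carrier (Om (p + q)) \<Longrightarrow> cop (Suc p) q (cn (p + q) a w) = tcn p q a (cop p q w)"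
  unfolding cop.simps
  by (rule peel_cn[OF abelian_OmOm balanced_comp_right[OF balanced_tcn bimodule_homD(1)[OF cop_hom]]])

text \<open>In the case \<open>p = 0\<close> the two sides differ only in the place of the
  coefficient, which crosses the tensor sign by balancing. The step splits off the first letter on
  both sides.\<close>

lemma cop_pword:
  "r \<in> carrier R \<Longrightarrow> set as \<subseteq> carrier Ap \<Longrightarrow> length as = p + q \<Longrightarrow>
    tens R (Om p) (Om q) (pword R Ap r (take p as)) (pword R Ap \<one>\<^bsub>R\<^esub> (drop p as)) = cop p q (pword R Ap r as)"
proof (induction p arbitrary: r as)
  case 0
  have "tens R (Om 0) (Om q) (pword R Ap r []) (pword R Ap \<one>\<^bsub>R\<^esub> as) =
      tens R (Om 0) (Om q) (pword R Ap \<one>\<^bsub>R\<^esub> [] \<triangleleft>\<^bsub>Om 0\<^esub> r) (pword R Ap \<one>\<^bsub>R\<^esub> as)"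
    using 0 by (simp add: pword_rsmult_Nil[OF bimodule_plus])
  also have "\<dots> = tens R (Om 0) (Om q) (pword R Ap \<one>\<^bsub>R\<^esub> []) (pword R Ap r as)"
    using 0 by (simp add: tens_balanced[OF bimodule_Om bimodule_Om] pword_Nil_closed pword_plus_closed pword_smult[OF bimodule_plus])
  finally show ?case by simp
next
  case (Suc p)
  then obtain x xs where as: "as = x # xs" "length xs = p + q" by (cases as) auto
  have x: "x \<in> carrier Ap" and xs: "set xs \<subseteq> carrier Ap" and r: "r \<in> carrier R" using Suc.prems as by auto
  have t: "set (take p xs) \<subseteq> carrier Ap" "set (drop p xs) \<subseteq> carrier Ap"
    using xs set_take_subset[of p xs] set_drop_subset[of p xs] by auto
  have tc: "pword R Ap \<one>\<^bsub>R\<^esub> (take p xs) \<in> carrier (Om p)" "pword R Ap \<one>\<^bsub>R\<^esub> (drop p xs) \<in> carrier (Om q)"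
    using t as by (auto intro!: pword_plus_closed)
  have "pword R Ap r (x # take p xs) = cn p (r \<odot>\<^bsub>A\<^esub> x) (pword R Ap \<one>\<^bsub>R\<^esub> (take p xs))"
    using pword_cn[OF r x t(1)] as by simp
  moreover have "pword R Ap r (x # xs) = cn (p + q) (r \<odot>\<^bsub>A\<^esub> x) (pword R Ap \<one>\<^bsub>R\<^esub> xs)"
    using pword_cn[OF r x xs] as by simp
  ultimately show ?case
    using Suc.IH[of "\<one>\<^bsub>R\<^esub>" xs] as r x xs tc
    by (simp add: cop_cn plus_smult pword_plus_closed tcn_tens[symmetric] del: cop.simps)
qed

lemma bar_comult_eq:
  assumes "w \<in> carrier (Om (p + q))"
  shows "comult (bar_coring R A) p q w = cop p q w"
  unfolding bar_coring_def bar_comp_def graded_coring.simps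
  by (rule lift_power_eq_hom[OF bimodule_plus abelian_OmOm bimodule_homD(3)[OF cop_hom] _ assms]) (rule cop_pword)

definition ept :: "(('r \<times> 'a list) \<Rightarrow>\<^sub>0 int) set \<Rightarrow> 'r" where
  "ept = lift R (\<lambda>(r, as). r)"

lemma
  shows ept_hom: "ept \<in> add_hom (Om 0) R"
    and ept_pword: "r \<in> carrier R \<Longrightarrow> ept (pword R Ap r []) = r"
proof -
  show "ept \<in> add_hom (Om 0) R"
    unfolding ept_def by (rule lift_power_hom[OF bimodule_plus ring_abelian[OF R.ring_axioms]]) auto
  show "r \<in> carrier R \<Longrightarrow> ept (pword R Ap r []) = r"
    unfolding ept_def by (rule lift_pword[OF bimodule_plus ring_abelian[OF R.ring_axioms]]) auto
qed

lemma pword_ept: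
  assumes "w \<in> carrier (Om 0)" shows "pword R Ap (ept w) [] = w"
proof -
  have "(\<lambda>r. pword R Ap r []) \<in> add_hom R (Om 0)"
    by (rule add_homI) (simp_all add: pword_Nil_closed pword_add_coeff[OF bimodule_plus])
  then show ?thesis
    by (intro tensor_power_hom_ext[OF bimodule_plus add_hom_comp[OF ept_hom] add_hom_ident _ assms]) (auto simp: ept_pword)
qed

lemma ept_closed: "w \<in> carrier (Om 0) \<Longrightarrow> ept w \<in> carrier R"
  by (rule add_hom_closed[OF ept_hom])

lemma ept_bimodule_hom: "ept \<in> bimodule_hom R (Om 0) (regular_bimodule R)"
proof -
  have "ept (r \<odot>\<^bsub>Om 0\<^esub> w) = r \<otimes>\<^bsub>R\<^esub> ept w \<and> ept (w \<triangleleft>\<^bsub>Om 0\<^esub> r) = ept w \<otimes>\<^bsub>R\<^esub> r"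
    if "r \<in> carrier R" "w \<in> carrier (Om 0)" for r w
    using that pword_ept[OF that(2)] ept_closed[OF that(2)]
      ept_pword[of "r \<otimes>\<^bsub>R\<^esub> ept w"] ept_pword[of "ept w \<otimes>\<^bsub>R\<^esub> r"]
      pword_smult[OF bimodule_plus, of "ept w" r "[]" 0] pword_rsmult_Nil[OF bimodule_plus, of "ept w" r]
    by simp
  then show ?thesis using ept_hom by (auto simp: bimodule_hom_def add_hom_def)
qed

end

section \<open>Coassociativity in terms of trilinear maps\<close>

context
  fixes R :: "('r, 'k) ring_scheme" and M :: "('r, 'm, 'l) bimodule_scheme" and N :: "('r, 'n, 'l2) bimodule_scheme"
    and P :: "('r, 'p, 'l3) bimodule_scheme"
  assumes M: "bimodule R M" and N: "bimodule R N" and P: "bimodule R P"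
begin

interpretation M: bimodule R M by (rule M)
interpretation N: bimodule R N by (rule N)
interpretation P: bimodule R P by (rule P)
interpretation MN: bimodule R "tensor R M N" by (rule tensor_bimodule[OF M N])
interpretation NP: bimodule R "tensor R N P" by (rule tensor_bimodule[OF N P])

text \<open>Balancedness across the two adjacent pairs is enough to factor \<open>F\<close> through
  either bracketing of the triple tensor product: what the lift over one pair still owes in the
  remaining variable is supplied by the hypothesis on the other pair.\<close>

lemma
  assumes X: "abelian_group X"
    and F1: "\<And>z. z \<in> carrier P \<Longrightarrow> balanced R M N X (\<lambda>x y. F x y z)"
    and F2: "\<And>x. x \<in> carrier M \<Longrightarrow> balanced R N P X (F x)"
  shows trilinear_left: "balanced R (tensor R M N) P X (\<lambda>t z. lift X (\<lambda>(x, y). F x y z) t)"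
    and trilinear_right: "balanced R M (tensor R N P) X (\<lambda>x s. lift X (\<lambda>(y, z). F x y z) s)"
proof -
  note h1 = lift_tensor_hom[OF M N F1 X] and e1 = lift_tens[OF M N F1 X]
  note h2 = lift_tensor_hom[OF N P F2 X] and e2 = lift_tens[OF N P F2 X]
  have z_add: "F x y (z \<oplus>\<^bsub>P\<^esub> z') = F x y z \<oplus>\<^bsub>X\<^esub> F x y z'"
    if "x \<in> carrier M" "y \<in> carrier N" "z \<in> carrier P" "z' \<in> carrier P" for x y z z'
    by (rule add_hom_add[OF balancedD(1)[OF F2]]) (use that in auto)
  have x_add: "F (x \<oplus>\<^bsub>M\<^esub> x') y z = F x y z \<oplus>\<^bsub>X\<^esub> F x' y z"
    if "x \<in> carrier M" "y \<in> carrier N" "z \<in> carrier P" "x' \<in> carrier M" for x y z x'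
    by (rule add_hom_add[OF balancedD(2)[OF F1]]) (use that in auto)
  show "balanced R (tensor R M N) P X (\<lambda>t z. lift X (\<lambda>(x, y). F x y z) t)"
  proof (intro balancedI)
    show "(\<lambda>z. lift X (\<lambda>(x, y). F x y z) t) \<in> add_hom P X" if t: "t \<in> carrier (tensor R M N)" for t
    proof (rule add_homI)
      show "lift X (\<lambda>(x, y). F x y (z \<oplus>\<^bsub>P\<^esub> z')) t = lift X (\<lambda>(x, y). F x y z) t \<oplus>\<^bsub>X\<^esub> lift X (\<lambda>(x, y). F x y z') t"
        if "z \<in> carrier P" "z' \<in> carrier P" for z z'
        by (rule tensor_hom_ext[OF M N h1 add_hom_plus[OF h1 h1 X] _ t]) (simp_all add: that e1 z_add)
    qed (rule add_hom_closed[OF h1 t])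
    show "lift X (\<lambda>(x, y). F x y z) (t \<triangleleft>\<^bsub>tensor R M N\<^esub> r) = lift X (\<lambda>(x, y). F x y (r \<odot>\<^bsub>P\<^esub> z)) t"
      if t: "t \<in> carrier (tensor R M N)" and r: "r \<in> carrier R" and z: "z \<in> carrier P" for t r z
      by (rule tensor_hom_ext[OF M N add_hom_comp[OF MN.rsmult_hom[OF r] h1[OF z]] h1 _ t])
        (simp_all add: r z P.smult_closed tens_rsmult[OF M N] N.rsmult_closed e1 balancedD(3)[OF F2])
  qed (rule h1)
  show "balanced R M (tensor R N P) X (\<lambda>x s. lift X (\<lambda>(y, z). F x y z) s)"
  proof (intro balancedI)
    show "(\<lambda>x. lift X (\<lambda>(y, z). F x y z) s) \<in> add_hom M X" if s: "s \<in> carrier (tensor R N P)" for s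
    proof (rule add_homI)
      show "lift X (\<lambda>(y, z). F (x \<oplus>\<^bsub>M\<^esub> x') y z) s = lift X (\<lambda>(y, z). F x y z) s \<oplus>\<^bsub>X\<^esub> lift X (\<lambda>(y, z). F x' y z) s"
        if "x \<in> carrier M" "x' \<in> carrier M" for x x'
        by (rule tensor_hom_ext[OF N P h2 add_hom_plus[OF h2 h2 X] _ s]) (simp_all add: that e2 x_add)
    qed (rule add_hom_closed[OF h2 s])
    show "lift X (\<lambda>(y, z). F (x \<triangleleft>\<^bsub>M\<^esub> r) y z) s = lift X (\<lambda>(y, z). F x y z) (r \<odot>\<^bsub>tensor R N P\<^esub> s)"
      if s: "s \<in> carrier (tensor R N P)" and r: "r \<in> carrier R" and x: "x \<in> carrier M" for s r x
      by (rule tensor_hom_ext[OF N P h2 add_hom_comp[OF NP.smult_hom[OF r] h2[OF x]] _ s])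
        (simp_all add: r x M.rsmult_closed tens_smult[OF N P] N.smult_closed e2 balancedD(3)[OF F1])
  qed (rule h2)
qed

lemma
  shows tensor_assoc_balanced: "balanced R (tensor R M N) P (tensor R M (tensor R N P))
      (\<lambda>t z. lift (tensor R M (tensor R N P)) (\<lambda>(x, y). tens R M (tensor R N P) x (tens R N P y z)) t)"
    and tens_tens_balanced:
      "\<And>z. z \<in> carrier P \<Longrightarrow> balanced R M N (tensor R M (tensor R N P)) (\<lambda>x y. tens R M (tensor R N P) x (tens R N P y z))"
proof -
  note b = balanced_tens[OF M NP.bimodule_axioms] and b' = balanced_tens[OF N P]
  show F1: "balanced R M N (tensor R M (tensor R N P)) (\<lambda>x y. tens R M (tensor R N P) x (tens R N P y z))"
    if z: "z \<in> carrier P" for z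
    by (rule balanced_comp_right[OF b]) (simp add: left_hom_def balancedD(2)[OF b' z] tens_smult[OF N P] z)
  show "balanced R (tensor R M N) P (tensor R M (tensor R N P))
      (\<lambda>t z. lift (tensor R M (tensor R N P)) (\<lambda>(x, y). tens R M (tensor R N P) x (tens R N P y z)) t)"
    by (rule trilinear_left[OF bimodule_abelian[OF tensor_bimodule[OF M NP.bimodule_axioms]] F1
          balanced_comp[OF b' balancedD(1)[OF b]]])
qed

lemma lift_tensor_assoc:
  assumes X: "abelian_group X"
    and F1: "\<And>z. z \<in> carrier P \<Longrightarrow> balanced R M N X (\<lambda>x y. F x y z)"
    and F2: "\<And>x. x \<in> carrier M \<Longrightarrow> balanced R N P X (F x)"
    and t: "t \<in> carrier (tensor R (tensor R M N) P)"
  shows "lift X (\<lambda>(x, s). lift X (\<lambda>(y, z). F x y z) s) (tensor_assoc R M N P t) =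
    lift X (\<lambda>(t, z). lift X (\<lambda>(x, y). F x y z) t) t"
proof -
  note bimNP = NP.bimodule_axioms and bimMN = MN.bimodule_axioms
  note tl = trilinear_left[OF X F1 F2] and tr = trilinear_right[OF X F1 F2]
  note G = lift_tensor_hom[OF M bimNP tr X]
  note abT = bimodule_abelian[OF tensor_bimodule[OF M bimNP]]
  have "lift X (\<lambda>(x, s). lift X (\<lambda>(y, z). F x y z) s) (tensor_assoc R M N P t) =
      lift X (\<lambda>(t, z). lift X (\<lambda>(x, s). lift X (\<lambda>(y, z). F x y z) s)
        (lift (tensor R M (tensor R N P)) (\<lambda>(x, y). tens R M (tensor R N P) x (tens R N P y z)) t)) t"
    unfolding tensor_assoc_def
    by (rule lift_tensor_comp[OF bimMN P tensor_assoc_balanced G abT X t])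
  also have "\<dots> = lift X (\<lambda>(t, z). lift X (\<lambda>(x, y). F x y z) t) t"
  proof (rule lift_tensor_cong[OF tl bimMN P X _ t])
    fix u z assume u: "u \<in> carrier (tensor R M N)" and z: "z \<in> carrier P"
    have "lift X (\<lambda>(x, s). lift X (\<lambda>(y, z). F x y z) s)
        (lift (tensor R M (tensor R N P)) (\<lambda>(x, y). tens R M (tensor R N P) x (tens R N P y z)) u) =
      lift X (\<lambda>(x, y). lift X (\<lambda>(x, s). lift X (\<lambda>(y, z). F x y z) s) (tens R M (tensor R N P) x (tens R N P y z))) u"
      by (rule lift_tensor_comp[OF M N tens_tens_balanced[OF z] G abT X u])
    also have "\<dots> = lift X (\<lambda>(x, y). F x y z) u"
      by (rule lift_tensor_cong[OF F1[OF z] M N X _ u])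
        (simp add: z tens_closed[OF N P] lift_tens[OF M bimNP tr X] lift_tens[OF N P F2 X])
    finally show "lift X (\<lambda>(x, s). lift X (\<lambda>(y, z). F x y z) s)
        (lift (tensor R M (tensor R N P)) (\<lambda>(x, y). tens R M (tensor R N P) x (tens R N P y z)) u) =
      lift X (\<lambda>(x, y). F x y z) u" .
  qed
  finally show ?thesis .
qed

end

lemma right_hom_comp: "f \<in> right_hom R M N \<Longrightarrow> g \<in> right_hom R N P \<Longrightarrow> (\<lambda>x. g (f x)) \<in> right_hom R M P"
  by (auto simp: right_hom_def add_hom_comp add_hom_closed)

context graded_coring
begin

lemmas comult_left_hom = bimodule_homD(1)[OF comult_hom]
lemmas comult_right_hom = bimodule_homD(2)[OF comult_hom]
lemmas comult_add_hom = bimodule_homD(3)[OF comult_hom]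
lemmas comult_closed = add_hom_closed[OF comult_add_hom]
lemmas bimodule_comps = tensor_bimodule[OF ccomp_bimodule ccomp_bimodule]

text \<open>Coassociativity in the form used throughout: an \<open>F\<close> balanced in adjacent
  variables does not notice which tensor factor is comultiplied again. It follows by evaluating both
  sides of \<open>coassoc\<close> under the map that \<open>F\<close> induces on the triple tensor
  product.\<close>

lemma coassoc_lift:
  assumes X: "abelian_group X"
    and F1: "\<And>z. z \<in> carrier (ccomp C p) \<Longrightarrow> balanced R (ccomp C m) (ccomp C n) X (\<lambda>x y. F x y z)"
    and F2: "\<And>x. x \<in> carrier (ccomp C m) \<Longrightarrow> balanced R (ccomp C n) (ccomp C p) X (F x)"
    and c: "c \<in> carrier (ccomp C (m + n + p))"
  shows "lift X (\<lambda>(t, z). lift X (\<lambda>(x, y). F x y z) (comult C m n t)) (comult C (m + n) p c) =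
    lift X (\<lambda>(x, t). lift X (\<lambda>(y, z). F x y z) (comult C n p t)) (comult C m (n + p) c)"
proof -
  note B = ccomp_bimodule and T = bimodule_comps
  note tl = trilinear_left[OF B B B X F1 F2] and tr = trilinear_right[OF B B B X F1 F2]
  have c': "c \<in> carrier (ccomp C (m + (n + p)))" using c by (simp add: add.assoc)
  let ?s = "tensor_map R (tensor R (ccomp C m) (ccomp C n)) (ccomp C p) (comult C m n) (\<lambda>z. z) (comult C (m + n) p c)"
  have s: "?s \<in> carrier (tensor R (tensor R (ccomp C m) (ccomp C n)) (ccomp C p))"
    by (rule add_hom_closed[OF tensor_map_hom[OF B B T B comult_right_hom left_hom_ident] comult_closed[OF c]])
  have "lift X (\<lambda>(t, z). lift X (\<lambda>(x, y). F x y z) (comult C m n t)) (comult C (m + n) p c) =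
      lift X (\<lambda>(t, z). lift X (\<lambda>(x, y). F x y z) t) ?s"
    by (rule lift_tensor_map(1)[OF B B T B comult_right_hom left_hom_ident tl X comult_closed[OF c], symmetric])
  also have "\<dots> = lift X (\<lambda>(x, s). lift X (\<lambda>(y, z). F x y z) s) (tensor_assoc R (ccomp C m) (ccomp C n) (ccomp C p) ?s)"
    by (rule lift_tensor_assoc[OF B B B X F1 F2 s, symmetric])
  also have "\<dots> = lift X (\<lambda>(x, s). lift X (\<lambda>(y, z). F x y z) s)
      (tensor_map R (ccomp C m) (tensor R (ccomp C n) (ccomp C p)) (\<lambda>x. x) (comult C n p) (comult C m (n + p) c))"
    by (simp only: coassoc[OF c])
  also have "\<dots> = lift X (\<lambda>(x, t). lift X (\<lambda>(y, z). F x y z) (comult C n p t)) (comult C m (n + p) c)"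
    by (rule lift_tensor_map(1)[OF B B B T right_hom_ident comult_left_hom tr X comult_closed[OF c']])
  finally show ?thesis .
qed

interpretation CC: bimodule R "ccomp C n" for n
  by (rule ccomp_bimodule)

lemmas counit_closed = add_hom_closed[OF bimodule_homD(3)[OF counit_hom], unfolded regular_bimodule_sel]

text \<open>The corresponding device for the counit. The hypothesis says that \<open>F\<close>
  factors through the left counit map, so composing with the comultiplication leaves
  \<open>g\<close> alone.\<close>

lemma counit_left_lift:
  assumes g: "g \<in> add_hom (ccomp C n) X" and X: "abelian_group X" and c: "c \<in> carrier (ccomp C n)"
    and F: "\<And>x y. x \<in> carrier (ccomp C 0) \<Longrightarrow> y \<in> carrier (ccomp C n) \<Longrightarrow> F x y = g (counit C x \<odot>\<^bsub>ccomp C n\<^esub> y)"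
  shows "lift X (\<lambda>(x, y). F x y) (comult C 0 n c) = g c"
proof -
  have b: "balanced R (ccomp C 0) (ccomp C n) (ccomp C n) (\<lambda>x y. counit C x \<odot>\<^bsub>ccomp C n\<^esub> y)"
    by (intro balancedI add_homI)
      (simp_all add: counit_closed CC.smult_closed CC.smult_r_distr CC.smult_l_distr CC.smult_assoc
        add_hom_add[OF bimodule_homD(3)[OF counit_hom]] right_hom_rsmult[OF bimodule_homD(2)[OF counit_hom]])
  have d: "comult C 0 n c \<in> carrier (tensor R (ccomp C 0) (ccomp C n))" using comult_closed[of c 0 n] c by simp
  have "lift X (\<lambda>(x, y). F x y) (comult C 0 n c) = lift X (\<lambda>(x, y). g (counit C x \<odot>\<^bsub>ccomp C n\<^esub> y)) (comult C 0 n c)"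
    by (rule lift_tensor_cong[OF balanced_comp[OF b g] ccomp_bimodule ccomp_bimodule X F d])
  also have "\<dots> = g (lift (ccomp C n) (\<lambda>(x, y). counit C x \<odot>\<^bsub>ccomp C n\<^esub> y) (comult C 0 n c))"
    by (rule lift_tensor_comp[OF ccomp_bimodule ccomp_bimodule b g bimodule_abelian[OF ccomp_bimodule] X d, symmetric])
  finally show ?thesis using counit_l[OF c] by simp
qed

lemma counit_right_lift:
  assumes g: "g \<in> add_hom (ccomp C n) X" and X: "abelian_group X" and c: "c \<in> carrier (ccomp C n)"
    and F: "\<And>x y. x \<in> carrier (ccomp C n) \<Longrightarrow> y \<in> carrier (ccomp C 0) \<Longrightarrow> F x y = g (x \<triangleleft>\<^bsub>ccomp C n\<^esub> counit C y)"
  shows "lift X (\<lambda>(x, y). F x y) (comult C n 0 c) = g c"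
proof -
  have b: "balanced R (ccomp C n) (ccomp C 0) (ccomp C n) (\<lambda>x y. x \<triangleleft>\<^bsub>ccomp C n\<^esub> counit C y)"
    by (intro balancedI add_homI)
      (simp_all add: counit_closed CC.rsmult_closed CC.rsmult_r_distr CC.rsmult_l_distr CC.rsmult_assoc
        add_hom_add[OF bimodule_homD(3)[OF counit_hom]] left_hom_smult[OF bimodule_homD(1)[OF counit_hom]])
  have d: "comult C n 0 c \<in> carrier (tensor R (ccomp C n) (ccomp C 0))" using comult_closed[of c n 0] c by simp
  have "lift X (\<lambda>(x, y). F x y) (comult C n 0 c) = lift X (\<lambda>(x, y). g (x \<triangleleft>\<^bsub>ccomp C n\<^esub> counit C y)) (comult C n 0 c)"
    by (rule lift_tensor_cong[OF balanced_comp[OF b g] ccomp_bimodule ccomp_bimodule X F d])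
  also have "\<dots> = g (lift (ccomp C n) (\<lambda>(x, y). x \<triangleleft>\<^bsub>ccomp C n\<^esub> counit C y) (comult C n 0 c))"
    by (rule lift_tensor_comp[OF ccomp_bimodule ccomp_bimodule b g bimodule_abelian[OF ccomp_bimodule] X d, symmetric])
  finally show ?thesis using counit_r[OF c] by simp
qed

end

section \<open>The map from the coring to the bar complex\<close>

locale almost_koszul = connected_graded_ring R A + C: graded_coring R C
  for R :: "('r, 'k) ring_scheme" and A :: "('r, 'a) graded_bimodule" and C :: "('r, 'c) graded_coring" +
  fixes \<theta> :: "'c \<Rightarrow> 'a"
  assumes almost_koszul: "almost_koszul_pair R A C \<theta>"
begin

text \<open>The codomain is enlarged from the component of degree 1 to \<open>Ap\<close>, where the
  letters of bar words live.\<close>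

lemma \<theta>_hom: "\<theta> \<in> bimodule_hom R (ccomp C (Suc 0)) Ap"
  using almost_koszul hcomp_plus[of 1] by (auto simp: almost_koszul_pair_def bimodule_hom_def)

lemmas \<theta>_left_hom = bimodule_homD(1)[OF \<theta>_hom]
lemmas \<theta>_right_hom = bimodule_homD(2)[OF \<theta>_hom]
lemmas \<theta>_closed = add_hom_closed[OF bimodule_homD(3)[OF \<theta>_hom]]

lemma koszul_relation:
  "c \<in> carrier (ccomp C (Suc (Suc 0))) \<Longrightarrow> lift A (\<lambda>(x, y). \<theta> x \<otimes>\<^bsub>A\<^esub> \<theta> y) (comult C (Suc 0) (Suc 0) c) = \<zero>\<^bsub>A\<^esub>"
  using almost_koszul by (simp add: almost_koszul_pair_def numeral_2_eq_2)

lemmas counit_closed = C.counit_closed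

abbreviation "ctb n \<equiv> coring_to_bar R A C \<theta> n"

lemmas CB = C.ccomp_bimodule
lemmas abelian_C = bimodule_abelian[OF CB]

sublocale C: bimodule R "ccomp C n" for n
  by (rule CB)

text \<open>Both claims go through one induction: the next degree is a lift over a balanced map, and
  balancing against the appended letter rests on the right linearity of the previous degree.\<close>

lemma iter_comult_right_hom: "iter_comult R C n \<in> right_hom R (ccomp C n) (tensor_power R (ccomp C (Suc 0)) n)"
  and iter_comult_balanced: "balanced R (ccomp C n) (ccomp C (Suc 0)) (tensor_power R (ccomp C (Suc 0)) (Suc n))
      (\<lambda>x y. snocp R (ccomp C (Suc 0)) n (iter_comult R C n x) y)"
proof (induction n)
  note TP = tensor_power_bimodule[OF CB[of "Suc 0"]]
  case 0
  { case 1
    show ?case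
    proof (intro right_homI add_homI)
      fix x assume "x \<in> carrier (ccomp C 0)"
      then show "iter_comult R C 0 x \<in> carrier (tensor_power R (ccomp C (Suc 0)) 0)"
        by (simp add: counit_closed pword_closed[OF CB])
    next
      fix x y assume *: "x \<in> carrier (ccomp C 0)" "y \<in> carrier (ccomp C 0)"
      show "iter_comult R C 0 (x \<oplus>\<^bsub>ccomp C 0\<^esub> y) =
          iter_comult R C 0 x \<oplus>\<^bsub>tensor_power R (ccomp C (Suc 0)) 0\<^esub> iter_comult R C 0 y"
        using * by (simp add: counit_closed pword_add_coeff[OF CB] add_hom_add[OF bimodule_homD(3)[OF C.counit_hom]])
    next
      fix r x assume *: "r \<in> carrier R" "x \<in> carrier (ccomp C 0)"
      show "iter_comult R C 0 (x \<triangleleft>\<^bsub>ccomp C 0\<^esub> r) = iter_comult R C 0 x \<triangleleft>\<^bsub>tensor_power R (ccomp C (Suc 0)) 0\<^esub> r"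
        using * by (simp add: counit_closed pword_rsmult_Nil[OF CB] right_hom_rsmult[OF bimodule_homD(2)[OF C.counit_hom]])
    qed }
  note base = this
  { case 2 show ?case by (rule balanced_comp_left[OF balanced_snocp[OF CB] base]) }
next
  note TP = tensor_power_bimodule[OF CB[of "Suc 0"]]
  case (Suc n)
  { case 1
    have eq: "iter_comult R C (Suc n) = (\<lambda>c. lift (tensor_power R (ccomp C (Suc 0)) (Suc n))
        (\<lambda>(x, y). snocp R (ccomp C (Suc 0)) n (iter_comult R C n x) y) (comult C n (Suc 0) c))"
      by (simp add: fun_eq_iff snocp_def)
    have l: "lift (tensor_power R (ccomp C (Suc 0)) (Suc n))
        (\<lambda>(x, y). snocp R (ccomp C (Suc 0)) n (iter_comult R C n x) y) \<in>
        right_hom R (tensor R (ccomp C n) (ccomp C (Suc 0))) (tensor_power R (ccomp C (Suc 0)) (Suc n))"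
      by (rule lift_tensor_right_hom[OF CB CB TP Suc.IH(2)])
        (simp add: snocp_rsmult[OF CB] add_hom_closed[OF right_homD[OF Suc.IH(1)]])
    show ?case
      unfolding eq using l C.comult_right_hom[of n "Suc 0"]
      by (auto simp: right_hom_def add_hom_comp add_hom_closed) }
  note step = this
  { case 2 show ?case by (rule balanced_comp_left[OF balanced_snocp[OF CB] step]) }
qed

lemma ctb_0: "c \<in> carrier (ccomp C 0) \<Longrightarrow> ctb 0 c = pword R Ap (counit C c) []"
  using lift_map_pword[OF CB bimodule_plus \<theta>_hom, of "counit C c" "[]" 0]
  by (simp add: coring_to_bar_def bar_comp_def counit_closed)

text \<open>Appending a letter commutes with applying \<open>\<theta>\<close> letterwise, so the
  recursion of \<open>iter_comult\<close> at the right end carries over.\<close>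

lemma
  shows ctb_snoc: "c \<in> carrier (ccomp C (Suc n)) \<Longrightarrow>
      ctb (Suc n) c = lift (Om (Suc n)) (\<lambda>(x, y). snocp R Ap n (ctb n x) (\<theta> y)) (comult C n (Suc 0) c)"
    and ctb_snoc_balanced: "balanced R (ccomp C n) (ccomp C (Suc 0)) (Om (Suc n)) (\<lambda>x y. snocp R Ap n (ctb n x) (\<theta> y))"
proof -
  let ?L = "\<lambda>n. lift (Om n) (\<lambda>(r, xs). pword R Ap r (map \<theta> xs))"
  note L = lift_map_hom[OF CB bimodule_plus \<theta>_hom]
  note abTP = bimodule_abelian[OF tensor_power_bimodule[OF CB[of "Suc 0"]]]
  note b = balanced_comp[OF iter_comult_balanced[of n] L]
  have eq: "?L (Suc n) (snocp R (ccomp C (Suc 0)) n (iter_comult R C n x) y) = snocp R Ap n (ctb n x) (\<theta> y)"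
    if "x \<in> carrier (ccomp C n)" "y \<in> carrier (ccomp C (Suc 0))" for x y
    using lift_map_snocp[OF CB bimodule_plus \<theta>_hom that(2) add_hom_closed[OF right_homD[OF iter_comult_right_hom] that(1)]]
    by (simp add: coring_to_bar_def bar_comp_def)
  show bal: "balanced R (ccomp C n) (ccomp C (Suc 0)) (Om (Suc n)) (\<lambda>x y. snocp R Ap n (ctb n x) (\<theta> y))"
    by (rule balanced_cong[OF b CB CB]) (simp add: eq)
  assume c: "c \<in> carrier (ccomp C (Suc n))"
  then have d: "comult C n (Suc 0) c \<in> carrier (tensor R (ccomp C n) (ccomp C (Suc 0)))"
    using C.comult_closed[of c n "Suc 0"] by simp
  have "ctb (Suc n) c = ?L (Suc n) (lift (tensor_power R (ccomp C (Suc 0)) (Suc n))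
      (\<lambda>(x, y). snocp R (ccomp C (Suc 0)) n (iter_comult R C n x) y) (comult C n (Suc 0) c))"
    by (simp add: coring_to_bar_def bar_comp_def snocp_def)
  also have "\<dots> = lift (Om (Suc n)) (\<lambda>(x, y). ?L (Suc n) (snocp R (ccomp C (Suc 0)) n (iter_comult R C n x) y)) (comult C n (Suc 0) c)"
    by (rule lift_tensor_comp[OF CB CB iter_comult_balanced L abTP abelian_Om d])
  also have "\<dots> = lift (Om (Suc n)) (\<lambda>(x, y). snocp R Ap n (ctb n x) (\<theta> y)) (comult C n (Suc 0) c)"
    by (rule lift_tensor_cong[OF bal CB CB abelian_Om _ d]) (simp add: eq)
  finally show "ctb (Suc n) c = lift (Om (Suc n)) (\<lambda>(x, y). snocp R Ap n (ctb n x) (\<theta> y)) (comult C n (Suc 0) c)" .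
qed

lemma cons_ctb_balanced:
  "ctb n \<in> left_hom R (ccomp C n) (Om n) \<Longrightarrow>
    balanced R (ccomp C (Suc 0)) (ccomp C n) (Om (Suc n)) (\<lambda>x y. cn n (\<theta> x) (ctb n y))"
  by (rule balanced_comp_right[OF balanced_comp_left[OF balanced_cn \<theta>_right_hom]])

lemma ctb_hom_0: "ctb 0 \<in> bimodule_hom R (ccomp C 0) (Om 0)"
  by (auto simp: bimodule_hom_def ctb_0 counit_closed pword_Nil_closed pword_add_coeff[OF bimodule_plus]
      pword_smult[OF bimodule_plus] pword_rsmult_Nil[OF bimodule_plus] C.smult_closed C.rsmult_closed
      add_hom_add[OF bimodule_homD(3)[OF C.counit_hom]] left_hom_smult[OF bimodule_homD(1)[OF C.counit_hom]]
      right_hom_rsmult[OF bimodule_homD(2)[OF C.counit_hom]])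

text \<open>The second part is a recursion at the left end, the one that \<open>bd\<close>,
  \<open>cop\<close> and \<open>gam\<close> can use. It is obtained from the recursion at the right
  end by shifting one comultiplication with coassociativity; at the start both ends reduce to the
  counit. Linearity is proved along with it because left linearity makes the left recursion
  balanced.\<close>

lemma ctb_properties:
  "ctb n \<in> bimodule_hom R (ccomp C n) (Om n) \<and> (\<forall>c\<in>carrier (ccomp C (Suc n)).
    ctb (Suc n) c = lift (Om (Suc n)) (\<lambda>(x, y). cn n (\<theta> x) (ctb n y)) (comult C (Suc 0) n c))"
proof (induction n)
  case 0
  let ?g = "\<lambda>z. cn 0 (\<theta> z) (pword R Ap \<one>\<^bsub>R\<^esub> [])"
  have one: "pword R Ap \<one>\<^bsub>R\<^esub> [] \<in> carrier (Om 0)" by (rule pword_Nil_closed) simp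
  have g: "?g \<in> add_hom (ccomp C (Suc 0)) (Om (Suc 0))"
    by (rule add_hom_comp[OF bimodule_homD(3)[OF \<theta>_hom] balancedD(2)[OF balanced_cn one]])
  have e: "cn 0 a (pword R Ap r []) = pword R Ap \<one>\<^bsub>R\<^esub> [a \<triangleleft>\<^bsub>A\<^esub> r]" if "a \<in> carrier Ap" "r \<in> carrier R" for a r
    using consp_pword[OF bimodule_plus that(1,2), of "[]" 0] by simp
  have "ctb (Suc 0) c = lift (Om (Suc 0)) (\<lambda>(x, y). cn 0 (\<theta> x) (ctb 0 y)) (comult C (Suc 0) 0 c)"
    if c: "c \<in> carrier (ccomp C (Suc 0))" for c
  proof -
    have "ctb (Suc 0) c = ?g c"
      unfolding ctb_snoc[OF c]
    proof (rule C.counit_left_lift[OF g abelian_Om c])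
      fix x y assume xy: "x \<in> carrier (ccomp C 0)" "y \<in> carrier (ccomp C (Suc 0))"
      then show "snocp R Ap 0 (ctb 0 x) (\<theta> y) = ?g (counit C x \<odot>\<^bsub>ccomp C (Suc 0)\<^esub> y)"
        using snocp_pword[OF bimodule_plus \<theta>_closed[OF xy(2)], of "counit C x" "[]" 0]
          pword_scalar[OF bimodule_plus, of "\<one>\<^bsub>R\<^esub>" "counit C x" "\<theta> y" "[]"]
        by (simp add: ctb_0 counit_closed e \<theta>_closed C.smult_closed left_hom_smult[OF \<theta>_left_hom] plus_smult
            rsmult_one plus_carrier)
    qed
    also have "?g c = lift (Om (Suc 0)) (\<lambda>(x, y). cn 0 (\<theta> x) (ctb 0 y)) (comult C (Suc 0) 0 c)"
    proof (rule C.counit_right_lift[OF g abelian_Om c, symmetric])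
      fix x y assume xy: "x \<in> carrier (ccomp C (Suc 0))" "y \<in> carrier (ccomp C 0)"
      then show "cn 0 (\<theta> x) (ctb 0 y) = ?g (x \<triangleleft>\<^bsub>ccomp C (Suc 0)\<^esub> counit C y)"
        by (simp add: ctb_0 counit_closed e \<theta>_closed C.rsmult_closed right_hom_rsmult[OF \<theta>_right_hom] plus_rsmult
            rsmult_one plus_carrier rsmult_closed)
    qed
    finally show ?thesis .
  qed
  then show ?case using ctb_hom_0 by blast
next
  case (Suc n)
  then have IH: "ctb n \<in> bimodule_hom R (ccomp C n) (Om n)"
    and step: "\<And>c. c \<in> carrier (ccomp C (Suc n)) \<Longrightarrow>
      ctb (Suc n) c = lift (Om (Suc n)) (\<lambda>(x, y). cn n (\<theta> x) (ctb n y)) (comult C (Suc 0) n c)" by auto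
  note l = bimodule_homD(1)[OF IH] and r = bimodule_homD(2)[OF IH] and ctb_c = add_hom_closed[OF bimodule_homD(3)[OF IH]]
  note b = cons_ctb_balanced[OF l]
  have cm: "comult C (Suc 0) n \<in> bimodule_hom R (ccomp C (Suc n)) (tensor R (ccomp C (Suc 0)) (ccomp C n))"
    using C.comult_hom[of "Suc 0" n] by simp
  let ?L = "lift (Om (Suc n)) (\<lambda>(x, y). cn n (\<theta> x) (ctb n y))"
  have L: "?L \<in> left_hom R (tensor R (ccomp C (Suc 0)) (ccomp C n)) (Om (Suc n))"
    by (rule lift_tensor_left_hom[OF CB CB left_module_Om b])
      (simp add: left_hom_smult[OF \<theta>_left_hom] cn_smult \<theta>_closed ctb_c)
  have L': "?L \<in> right_hom R (tensor R (ccomp C (Suc 0)) (ccomp C n)) (Om (Suc n))"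
    by (rule lift_tensor_right_hom[OF CB CB bimodule_Om b])
      (simp add: right_hom_rsmult[OF r] cn_rsmult \<theta>_closed ctb_c)
  have Lc: "(\<lambda>c. ?L (comult C (Suc 0) n c)) \<in> bimodule_hom R (ccomp C (Suc n)) (Om (Suc n))"
    using left_hom_comp[OF bimodule_homD(1)[OF cm] L] L' bimodule_homD(2)[OF cm]
      add_hom_comp[OF bimodule_homD(3)[OF cm] left_homD[OF L]] add_hom_closed[OF bimodule_homD(3)[OF cm]]
    by (simp add: bimodule_hom_iff right_hom_def)
  have hom: "ctb (Suc n) \<in> bimodule_hom R (ccomp C (Suc n)) (Om (Suc n))"
    using Lc by (auto simp: bimodule_hom_def step C.smult_closed C.rsmult_closed)
  note hl = bimodule_homD(1)[OF hom]
  have "ctb (Suc (Suc n)) c = lift (Om (Suc (Suc n))) (\<lambda>(x, y). cn (Suc n) (\<theta> x) (ctb (Suc n) y)) (comult C (Suc 0) (Suc n) c)"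
    if c: "c \<in> carrier (ccomp C (Suc (Suc n)))" for c
  proof -
    let ?X = "Om (Suc (Suc n))"
    let ?F = "\<lambda>x y z. snocp R Ap (Suc n) (cn n (\<theta> x) (ctb n y)) (\<theta> z)"
    have d: "comult C (Suc n) (Suc 0) c \<in> carrier (tensor R (ccomp C (Suc n)) (ccomp C (Suc 0)))"
      "comult C (Suc 0) (Suc n) c \<in> carrier (tensor R (ccomp C (Suc 0)) (ccomp C (Suc n)))"
      using C.comult_closed[of c "Suc n" "Suc 0"] C.comult_closed[of c "Suc 0" "Suc n"] c by simp_all
    have F1: "balanced R (ccomp C (Suc 0)) (ccomp C n) ?X (\<lambda>x y. ?F x y z)" if "z \<in> carrier (ccomp C (Suc 0))" for z
      by (rule balanced_comp[OF b snocp_hom[OF bimodule_plus \<theta>_closed[OF that]]])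
    have rh: "(\<lambda>y. cn n (\<theta> x) (ctb n y)) \<in> right_hom R (ccomp C n) (Om (Suc n))" if "x \<in> carrier (ccomp C (Suc 0))" for x
      using that by (intro right_homI add_hom_comp[OF bimodule_homD(3)[OF IH] cn_hom])
        (simp_all add: \<theta>_closed right_hom_rsmult[OF r] cn_rsmult ctb_c)
    have F2: "balanced R (ccomp C n) (ccomp C (Suc 0)) ?X (\<lambda>y z. ?F x y z)" if "x \<in> carrier (ccomp C (Suc 0))" for x
      by (rule balanced_comp_right[OF balanced_comp_left[OF balanced_snocp[OF bimodule_plus] rh[OF that]] \<theta>_left_hom])
    have "ctb (Suc (Suc n)) c = lift ?X (\<lambda>(t, z). snocp R Ap (Suc n) (ctb (Suc n) t) (\<theta> z)) (comult C (Suc n) (Suc 0) c)"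
      by (rule ctb_snoc[OF c])
    also have "\<dots> = lift ?X (\<lambda>(t, z). lift ?X (\<lambda>(x, y). ?F x y z) (comult C (Suc 0) n t)) (comult C (Suc n) (Suc 0) c)"
    proof (rule lift_tensor_cong[OF ctb_snoc_balanced CB CB abelian_Om _ d(1), symmetric])
      fix t z assume t: "t \<in> carrier (ccomp C (Suc n))" and z: "z \<in> carrier (ccomp C (Suc 0))"
      have "comult C (Suc 0) n t \<in> carrier (tensor R (ccomp C (Suc 0)) (ccomp C n))"
        using C.comult_closed[of t "Suc 0" n] t by simp
      from lift_tensor_comp[OF CB CB b snocp_hom[OF bimodule_plus \<theta>_closed[OF z]] abelian_Om abelian_Om this]
      show "lift ?X (\<lambda>(x, y). ?F x y z) (comult C (Suc 0) n t) = snocp R Ap (Suc n) (ctb (Suc n) t) (\<theta> z)"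
        by (simp add: step[OF t])
    qed
    also have "\<dots> = lift ?X (\<lambda>(x, t). lift ?X (\<lambda>(y, z). ?F x y z) (comult C n (Suc 0) t)) (comult C (Suc 0) (Suc n) c)"
      using C.coassoc_lift[OF abelian_Om F1 F2, of c] c by simp
    also have "\<dots> = lift ?X (\<lambda>(x, y). cn (Suc n) (\<theta> x) (ctb (Suc n) y)) (comult C (Suc 0) (Suc n) c)"
    proof (rule lift_tensor_cong[OF cons_ctb_balanced[OF hl] CB CB abelian_Om _ d(2)])
      fix x t assume x: "x \<in> carrier (ccomp C (Suc 0))" and t: "t \<in> carrier (ccomp C (Suc n))"
      have dt: "comult C n (Suc 0) t \<in> carrier (tensor R (ccomp C n) (ccomp C (Suc 0)))"
        using C.comult_closed[of t n "Suc 0"] t by simp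
      have "cn (Suc n) (\<theta> x) (ctb (Suc n) t) =
          lift ?X (\<lambda>(y, z). cn (Suc n) (\<theta> x) (snocp R Ap n (ctb n y) (\<theta> z))) (comult C n (Suc 0) t)"
        unfolding ctb_snoc[OF t]
        by (rule lift_tensor_comp[OF CB CB ctb_snoc_balanced cn_hom[OF \<theta>_closed[OF x]] abelian_Om abelian_Om dt])
      also have "\<dots> = lift ?X (\<lambda>(y, z). ?F x y z) (comult C n (Suc 0) t)"
        by (rule lift_tensor_cong[OF F2[OF x] CB CB abelian_Om _ dt])
          (simp add: snocp_consp[OF bimodule_plus] \<theta>_closed x ctb_c)
      finally show "lift ?X (\<lambda>(y, z). ?F x y z) (comult C n (Suc 0) t) = cn (Suc n) (\<theta> x) (ctb (Suc n) t)" by simp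
    qed
    finally show ?thesis .
  qed
  then show ?case using hom by blast
qed

lemma ctb_hom: "ctb n \<in> bimodule_hom R (ccomp C n) (Om n)"
  using ctb_properties by blast

lemma ctb_cons:
  "c \<in> carrier (ccomp C (Suc n)) \<Longrightarrow>
    ctb (Suc n) c = lift (Om (Suc n)) (\<lambda>(x, y). cn n (\<theta> x) (ctb n y)) (comult C (Suc 0) n c)"
  using ctb_properties by blast

lemmas ctb_left_hom = bimodule_homD(1)[OF ctb_hom]
lemmas ctb_right_hom = bimodule_homD(2)[OF ctb_hom]
lemmas ctb_add_hom = bimodule_homD(3)[OF ctb_hom]
lemmas ctb_closed = add_hom_closed[OF ctb_add_hom]
lemmas cn_ctb_balanced = cons_ctb_balanced[OF ctb_left_hom]

lemma comult_closed':
  "c \<in> carrier (ccomp C k) \<Longrightarrow> k = m + n \<Longrightarrow> comult C m n c \<in> carrier (tensor R (ccomp C m) (ccomp C n))"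
  using C.comult_closed by blast

text \<open>Write the word as \<open>[\<theta>(x) | ctb y]\<close>. In its differential the term
  with \<open>bd (ctb y)\<close> vanishes by induction. The term \<open>\<theta>(x) ctb(y)\<close>
  exposes the product of the first two letters; coassociativity regroups these into
  \<open>comult C 1 1\<close>, where the Koszul relation makes the product zero.\<close>

lemma bd_ctb:
  assumes "c \<in> carrier (ccomp C n)" shows "bd n (ctb n c) = \<zero>\<^bsub>Om (n - 1)\<^esub>"
  using assms
proof (induction n arbitrary: c rule: bd.induct)
  case (3 n)
  note [simp del] = bd.simps(3)
  note c = "3.prems"
  note dc = comult_closed'[OF c, of "Suc 0" "Suc n"]
  let ?X = "Om (Suc n)"
  note lmb = balanced_comp_right[OF balanced_comp_left[OF balanced_lm[of n] \<theta>_right_hom] ctb_left_hom[of "Suc n"]]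
  have "bd (Suc (Suc n)) (ctb (Suc (Suc n)) c) =
      lift ?X (\<lambda>(x, y). bd (Suc (Suc n)) (cn (Suc n) (\<theta> x) (ctb (Suc n) y))) (comult C (Suc 0) (Suc n) c)"
    unfolding ctb_cons[OF c] by (rule lift_tensor_comp[OF CB CB cn_ctb_balanced bd_add_hom abelian_Om abelian_Om dc]) simp
  also have "\<dots> = lift ?X (\<lambda>(x, y). lm n (\<theta> x) (ctb (Suc n) y)) (comult C (Suc 0) (Suc n) c)"
  proof (rule lift_tensor_cong[OF lmb CB CB abelian_Om _ dc])
    fix x y assume x: "x \<in> carrier (ccomp C (Suc 0))" and y: "y \<in> carrier (ccomp C (Suc n))"
    show "bd (Suc (Suc n)) (cn (Suc n) (\<theta> x) (ctb (Suc n) y)) = lm n (\<theta> x) (ctb (Suc n) y)"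
      using "3.IH"[OF y] add_hom_zero[OF cn_hom[OF \<theta>_closed[OF x]] abelian_Om abelian_Om, of n]
      by (simp add: bd_cn \<theta>_closed x ctb_closed y lm_closed Om.M.diff_simps)
  qed simp
  also have "\<dots> = lift ?X (\<lambda>(x, t). lift ?X (\<lambda>(y, z). cn n (\<theta> x \<otimes>\<^bsub>A\<^esub> \<theta> y) (ctb n z)) (comult C (Suc 0) n t)) (comult C (Suc 0) (Suc n) c)"
  proof (rule lift_tensor_cong[OF lmb CB CB abelian_Om _ dc, symmetric])
    fix x t assume x: "x \<in> carrier (ccomp C (Suc 0))" and t: "t \<in> carrier (ccomp C (Suc n))"
    note dt = comult_closed'[OF t, of "Suc 0" n]
    have "lm n (\<theta> x) (ctb (Suc n) t) = lift ?X (\<lambda>(y, z). lm n (\<theta> x) (cn n (\<theta> y) (ctb n z))) (comult C (Suc 0) n t)"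
      unfolding ctb_cons[OF t]
      by (rule lift_tensor_comp[OF CB CB cn_ctb_balanced lm_hom[OF \<theta>_closed[OF x]] abelian_Om abelian_Om dt]) simp
    also have "\<dots> = lift ?X (\<lambda>(y, z). cn n (\<theta> x \<otimes>\<^bsub>A\<^esub> \<theta> y) (ctb n z)) (comult C (Suc 0) n t)"
      by (rule lift_tensor_cong[OF balanced_comp[OF cn_ctb_balanced lm_hom[OF \<theta>_closed[OF x]]] CB CB abelian_Om _ dt, symmetric])
        (simp_all add: lm_cn \<theta>_closed x ctb_closed)
    finally show "lift ?X (\<lambda>(y, z). cn n (\<theta> x \<otimes>\<^bsub>A\<^esub> \<theta> y) (ctb n z)) (comult C (Suc 0) n t) = lm n (\<theta> x) (ctb (Suc n) t)" by simp
  qed simp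
  also have "\<dots> = lift ?X (\<lambda>(t, z). lift ?X (\<lambda>(x, y). cn n (\<theta> x \<otimes>\<^bsub>A\<^esub> \<theta> y) (ctb n z)) (comult C (Suc 0) (Suc 0) t)) (comult C (Suc (Suc 0)) n c)"
  proof -
    have mb: "balanced R (ccomp C (Suc 0)) (ccomp C (Suc 0)) Ap (\<lambda>x y. \<theta> x \<otimes>\<^bsub>A\<^esub> \<theta> y)"
      using add_hom_add[OF bimodule_homD(3)[OF \<theta>_hom]]
      by (intro balancedI add_homI) (simp_all add: plus_mult \<theta>_closed A.l_distr A.r_distr plus_carrier
          right_hom_rsmult[OF \<theta>_right_hom] left_hom_smult[OF \<theta>_left_hom] mult_balanced)
    have F1: "balanced R (ccomp C (Suc 0)) (ccomp C (Suc 0)) ?X (\<lambda>x y. cn n (\<theta> x \<otimes>\<^bsub>A\<^esub> \<theta> y) (ctb n z))" if "z \<in> carrier (ccomp C n)" for z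
      by (rule balanced_comp[OF mb balancedD(2)[OF balanced_cn ctb_closed[OF that]]])
    have F2: "balanced R (ccomp C (Suc 0)) (ccomp C n) ?X (\<lambda>y z. cn n (\<theta> x \<otimes>\<^bsub>A\<^esub> \<theta> y) (ctb n z))" if "x \<in> carrier (ccomp C (Suc 0))" for x
      by (rule balanced_comp_right[OF balanced_comp_left[OF balanced_cn
              right_hom_comp[OF \<theta>_right_hom mult_right_hom[OF \<theta>_closed[OF that]]]] ctb_left_hom])
    show ?thesis using C.coassoc_lift[OF abelian_Om F1 F2, of c] c by simp
  qed
  also have "\<dots> = \<zero>\<^bsub>?X\<^esub>"
  proof (rule lift_tensor_eq_hom[OF CB CB abelian_Om add_hom_zero_map[OF abelian_Om]])
    fix t z assume t: "t \<in> carrier (ccomp C (Suc (Suc 0)))" and z: "z \<in> carrier (ccomp C n)"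
    note dt = comult_closed'[OF t, of "Suc 0" "Suc 0"]
    have mb: "balanced R (ccomp C (Suc 0)) (ccomp C (Suc 0)) A (\<lambda>x y. \<theta> x \<otimes>\<^bsub>A\<^esub> \<theta> y)"
      using add_hom_add[OF bimodule_homD(3)[OF \<theta>_hom]]
      by (intro balancedI add_homI) (simp_all add: \<theta>_closed A.l_distr A.r_distr plus_carrier
          right_hom_rsmult[OF \<theta>_right_hom] left_hom_smult[OF \<theta>_left_hom] mult_balanced)
    \<comment> \<open>The Koszul relation is an equation in \<open>A\<close>, while
      \<open>cn\<close> is additive only on \<open>Ap\<close>. Composition with
      \<open>plus_proj\<close> extends it to \<open>A\<close> without changing it on products of
      letters.\<close>
    note g = add_hom_comp[OF bimodule_homD(3)[OF plus_proj_hom] balancedD(2)[OF balanced_cn ctb_closed[OF z]]]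
    have "lift ?X (\<lambda>(x, y). cn n (\<theta> x \<otimes>\<^bsub>A\<^esub> \<theta> y) (ctb n z)) (comult C (Suc 0) (Suc 0) t) =
        lift ?X (\<lambda>(x, y). cn n (plus_proj (\<theta> x \<otimes>\<^bsub>A\<^esub> \<theta> y)) (ctb n z)) (comult C (Suc 0) (Suc 0) t)"
      by (rule lift_tensor_cong[OF balanced_comp[OF mb g] CB CB abelian_Om _ dt])
        (simp_all add: plus_proj_plus plus_mult \<theta>_closed)
    also have "\<dots> = cn n (plus_proj (lift A (\<lambda>(x, y). \<theta> x \<otimes>\<^bsub>A\<^esub> \<theta> y) (comult C (Suc 0) (Suc 0) t))) (ctb n z)"
      by (rule lift_tensor_comp[OF CB CB mb g M.abelian_group_axioms abelian_Om dt, symmetric]) simp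
    also have "\<dots> = \<zero>\<^bsub>?X\<^esub>"
      using add_hom_zero[OF g M.abelian_group_axioms abelian_Om] by (simp add: koszul_relation[OF t])
    finally show "lift ?X (\<lambda>(x, y). cn n (\<theta> x \<otimes>\<^bsub>A\<^esub> \<theta> y) (ctb n z)) (comult C (Suc 0) (Suc 0) t) = \<zero>\<^bsub>?X\<^esub>" .
  qed (use comult_closed'[OF c, of "Suc (Suc 0)" n] in simp)
  finally show ?case by simp
qed simp_all

lemma ctb_ctb_balanced:
  "balanced R (ccomp C p) (ccomp C q) (tensor R (Om p) (Om q)) (\<lambda>x y. tens R (Om p) (Om q) (ctb p x) (ctb q y))"
  by (rule balanced_comp_right[OF balanced_comp_left[OF balanced_tens[OF bimodule_Om bimodule_Om] ctb_right_hom] ctb_left_hom])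

text \<open>Both sides peel one letter at the left: \<open>cop\<close> by its recursion, the
  right-hand side by coassociativity, which splits the left factor of
  \<open>comult C (Suc p) q\<close> once more. The induction starts with the counit law.
  Multiplicativity of \<open>\<phi>\<close> and the comultiplication of \<open>Tor_coring\<close>
  both rest on this equality.\<close>

lemma cop_ctb:
  "c \<in> carrier (ccomp C (p + q)) \<Longrightarrow>
    cop p q (ctb (p + q) c) = tensor_map R (Om p) (Om q) (ctb p) (ctb q) (comult C p q c)"
proof (induction p arbitrary: c)
  case 0
  let ?one = "pword R Ap \<one>\<^bsub>R\<^esub> []"
  have one: "?one \<in> carrier (Om 0)" by (rule pword_Nil_closed) simp
  have "tensor_map R (Om 0) (Om q) (ctb 0) (ctb q) (comult C 0 q c) = tens R (Om 0) (Om q) ?one (ctb q c)"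
    unfolding tensor_map_def
  proof (rule C.counit_left_lift[OF add_hom_comp[OF ctb_add_hom balancedD(1)[OF balanced_tens[OF bimodule_Om bimodule_Om] one]] abelian_OmOm])
    show "c \<in> carrier (ccomp C q)" using 0 by simp
    fix x y assume x: "x \<in> carrier (ccomp C 0)" and y: "y \<in> carrier (ccomp C q)"
    have "ctb 0 x = ?one \<triangleleft>\<^bsub>Om 0\<^esub> counit C x"
      using x by (simp add: ctb_0 pword_rsmult_Nil[OF bimodule_plus] counit_closed)
    then show "tens R (Om 0) (Om q) (ctb 0 x) (ctb q y) = tens R (Om 0) (Om q) ?one (ctb q (counit C x \<odot>\<^bsub>ccomp C q\<^esub> y))"
      using x y one by (simp add: tens_balanced[OF bimodule_Om bimodule_Om] counit_closed ctb_closed left_hom_smult[OF ctb_left_hom])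
  qed
  then show ?case by simp
next
  case (Suc p)
  note [simp del] = cop.simps
  have c: "c \<in> carrier (ccomp C (Suc (p + q)))" using Suc.prems by simp
  note dc = comult_closed'[OF c, of "Suc 0" "p + q"]
  let ?X = "tensor R (Om (Suc p)) (Om q)"
  let ?F = "\<lambda>x y z. tens R (Om (Suc p)) (Om q) (cn p (\<theta> x) (ctb p y)) (ctb q z)"
  note cb = balanced_comp_right[OF balanced_comp_left[OF balanced_tcn \<theta>_right_hom] bimodule_homD(1)[OF cop_hom]]
  note cb' = balanced_comp_right[OF cb ctb_left_hom]
  have "cop (Suc p) q (ctb (Suc (p + q)) c) =
      lift ?X (\<lambda>(x, y). cop (Suc p) q (cn (p + q) (\<theta> x) (ctb (p + q) y))) (comult C (Suc 0) (p + q) c)"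
    unfolding ctb_cons[OF c]
    by (rule lift_tensor_comp[OF CB CB cn_ctb_balanced _ abelian_Om abelian_OmOm dc])
      (use bimodule_homD(3)[OF cop_hom[of "Suc p" q]] in simp_all)
  also have "\<dots> = lift ?X (\<lambda>(x, y). tcn p q (\<theta> x) (cop p q (ctb (p + q) y))) (comult C (Suc 0) (p + q) c)"
    by (rule lift_tensor_cong[OF cb' CB CB abelian_OmOm _ dc]) (simp_all add: cop_cn \<theta>_closed ctb_closed)
  also have "\<dots> = lift ?X (\<lambda>(x, t). lift ?X (\<lambda>(y, z). ?F x y z) (comult C p q t)) (comult C (Suc 0) (p + q) c)"
  proof (rule lift_tensor_cong[OF cb' CB CB abelian_OmOm _ dc, symmetric])
    fix x t assume x: "x \<in> carrier (ccomp C (Suc 0))" and t: "t \<in> carrier (ccomp C (p + q))"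
    note dt = comult_closed'[OF t, of p q]
    have "tcn p q (\<theta> x) (cop p q (ctb (p + q) t)) =
        lift ?X (\<lambda>(y, z). tcn p q (\<theta> x) (tens R (Om p) (Om q) (ctb p y) (ctb q z))) (comult C p q t)"
      unfolding Suc.IH[OF t] tensor_map_def[of R "Om p" "Om q" "ctb p" "ctb q"]
      by (rule lift_tensor_comp[OF CB CB ctb_ctb_balanced tcn_hom[OF \<theta>_closed[OF x]] abelian_OmOm abelian_OmOm dt]) simp
    also have "\<dots> = lift ?X (\<lambda>(y, z). ?F x y z) (comult C p q t)"
      by (rule lift_tensor_cong[OF balanced_comp[OF ctb_ctb_balanced tcn_hom[OF \<theta>_closed[OF x]]] CB CB abelian_OmOm _ dt, symmetric])
        (simp_all add: tcn_tens \<theta>_closed x ctb_closed)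
    finally show "lift ?X (\<lambda>(y, z). ?F x y z) (comult C p q t) = tcn p q (\<theta> x) (cop p q (ctb (p + q) t))" by simp
  qed simp
  also have "\<dots> = lift ?X (\<lambda>(t, z). lift ?X (\<lambda>(x, y). ?F x y z) (comult C (Suc 0) p t)) (comult C (Suc p) q c)"
  proof -
    have F1: "balanced R (ccomp C (Suc 0)) (ccomp C p) ?X (\<lambda>x y. ?F x y z)" if "z \<in> carrier (ccomp C q)" for z
      by (rule balanced_comp[OF cn_ctb_balanced balancedD(2)[OF balanced_tens[OF bimodule_Om bimodule_Om] ctb_closed[OF that]]])
    have F2: "balanced R (ccomp C p) (ccomp C q) ?X (\<lambda>y z. ?F x y z)" if "x \<in> carrier (ccomp C (Suc 0))" for x
      by (rule balanced_comp_right[OF balanced_comp_left[OF balanced_tens[OF bimodule_Om bimodule_Om]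
              right_hom_comp[OF ctb_right_hom cn_right_hom[OF \<theta>_closed[OF that]]]] ctb_left_hom])
    show ?thesis using C.coassoc_lift[OF abelian_OmOm F1 F2, of c] c by simp
  qed
  also have "\<dots> = lift ?X (\<lambda>(t, z). tens R (Om (Suc p)) (Om q) (ctb (Suc p) t) (ctb q z)) (comult C (Suc p) q c)"
  proof (rule lift_tensor_cong[OF ctb_ctb_balanced CB CB abelian_OmOm])
    fix t z assume t: "t \<in> carrier (ccomp C (Suc p))" and z: "z \<in> carrier (ccomp C q)"
    note dt = comult_closed'[OF t, of "Suc 0" p]
    show "lift ?X (\<lambda>(x, y). ?F x y z) (comult C (Suc 0) p t) = tens R (Om (Suc p)) (Om q) (ctb (Suc p) t) (ctb q z)"
      unfolding ctb_cons[OF t]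
      by (rule lift_tensor_comp[OF CB CB cn_ctb_balanced balancedD(2)[OF balanced_tens[OF bimodule_Om bimodule_Om] ctb_closed[OF z]]
            abelian_Om abelian_OmOm dt, symmetric]) simp
  qed (use comult_closed'[OF c, of "Suc p" q] in simp)
  finally show ?case by (simp add: tensor_map_def)
qed

end

section \<open>Comparison of the Koszul complex with the bar resolution\<close>

context abelian_group
begin

lemma minus_zero: "x \<in> carrier G \<Longrightarrow> x \<ominus> \<zero> = x"
  by (simp add: diff_simps)

text \<open>Bookkeeping for the inductive step of \<open>homotopy\<close>, with the same letters.
  The term \<open>L\<close> occurs twice with opposite signs; after substituting the two equations
  everything but \<open>g\<close> cancels.\<close>

lemma homotopy_arith:
  assumes c: "X \<in> carrier G" "L \<in> carrier G" "B \<in> carrier G" "M \<in> carrier G" "P \<in> carrier G" "Q \<in> carrier G"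
      "E \<in> carrier G" "w \<in> carrier G" "g \<in> carrier G"
    and eq: "X \<oplus> (P \<ominus> Q) \<oplus> g = M \<oplus> z" "z = B \<oplus> E \<oplus> w"
  shows "(\<zero> \<ominus> X \<ominus> (L \<ominus> B)) \<oplus> ((L \<oplus> M \<ominus> P) \<ominus> (\<zero> \<ominus> Q \<ominus> E)) \<oplus> w = g"
proof -
  have "(\<zero> \<ominus> X \<ominus> (L \<ominus> B)) \<oplus> ((L \<oplus> M \<ominus> P) \<ominus> (\<zero> \<ominus> Q \<ominus> E)) \<oplus> w = (M \<oplus> (B \<oplus> E \<oplus> w) \<oplus> Q) \<ominus> (X \<oplus> P)"
    using c by (simp add: diff_simps a_ac)
  also have "M \<oplus> (B \<oplus> E \<oplus> w) = X \<oplus> (P \<ominus> Q) \<oplus> g" using eq by simp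
  also have "(X \<oplus> (P \<ominus> Q) \<oplus> g \<oplus> Q) \<ominus> (X \<oplus> P) = g"
    using c by (simp add: diff_simps a_ac)
  finally show ?thesis .
qed

end

locale koszul = almost_koszul R A C \<theta>
  for R :: "('r, 'k) ring_scheme" and A :: "('r, 'a) graded_bimodule" and C :: "('r, 'c) graded_coring"
    and \<theta> :: "'c \<Rightarrow> 'a" +
  assumes semisimple: "semisimple_ring R" and koszul: "koszul_pair R A C \<theta>"
begin

section \<open>The Koszul complex as a complex of left \<open>A\<close>-modules\<close>

abbreviation "K n \<equiv> tensor R A (ccomp C n)"
abbreviation "kt n \<equiv> tens R A (ccomp C n)"
abbreviation "dK n \<equiv> koszul_diff R A C \<theta> n"

lemmas bimodule_K = tensor_bimodule[OF bimodule_A CB]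
lemmas abelian_K = bimodule_abelian[OF bimodule_K]
lemmas left_module_K = bimodule_left_module[OF bimodule_K]
lemmas kt_closed = tens_closed[OF bimodule_A CB]
lemmas kt_balanced = tens_balanced[OF bimodule_A CB]
lemmas balanced_kt = balanced_tens[OF bimodule_A CB]
lemmas K_hom_ext = tensor_hom_ext[OF bimodule_A CB]
lemmas kt_smult = tens_smult[OF bimodule_A CB]

sublocale K: bimodule R "K n" for n
  by (rule bimodule_K)

lemma mult_plus_right:
  assumes a: "a \<in> carrier A" and x: "x \<in> carrier Ap"
  shows "a \<otimes>\<^bsub>A\<^esub> x = plus_proj a \<otimes>\<^bsub>A\<^esub> x \<oplus>\<^bsub>A\<^esub> proj0 R A a \<odot>\<^bsub>A\<^esub> x" and "a \<otimes>\<^bsub>A\<^esub> x \<in> carrier Ap"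
proof -
  have "a \<otimes>\<^bsub>A\<^esub> x = (proj0 R A a \<odot>\<^bsub>A\<^esub> \<one>\<^bsub>A\<^esub>) \<otimes>\<^bsub>A\<^esub> x \<oplus>\<^bsub>A\<^esub> plus_proj a \<otimes>\<^bsub>A\<^esub> x"
    using assms proj0_plus_proj[OF a] A.l_distr[of "proj0 R A a \<odot>\<^bsub>A\<^esub> \<one>\<^bsub>A\<^esub>" "plus_proj a" x]
    by (simp add: scalar_closed proj0_closed plus_proj_closed plus_carrier)
  then show *: "a \<otimes>\<^bsub>A\<^esub> x = plus_proj a \<otimes>\<^bsub>A\<^esub> x \<oplus>\<^bsub>A\<^esub> proj0 R A a \<odot>\<^bsub>A\<^esub> x"
    using assms by (simp add: mult_left proj0_closed plus_carrier M.a_comm plus_proj_closed smult_closed)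
  show "a \<otimes>\<^bsub>A\<^esub> x \<in> carrier Ap"
    unfolding * using assms by (simp add: plus_add plus_mult plus_smult plus_proj_closed proj0_closed)
qed

lemma mult_right_hom': "a \<in> carrier A \<Longrightarrow> (\<lambda>b. a \<otimes>\<^bsub>A\<^esub> b) \<in> right_hom R A A"
  by (intro right_homI add_homI) (simp_all add: A.r_distr mult_right)

lemma \<theta>_right_hom': "\<theta> \<in> right_hom R (ccomp C (Suc 0)) A"
  using \<theta>_right_hom \<theta>_closed by (auto simp: right_hom_def add_hom_def plus_carrier)

lemma mult_\<theta>_balanced: "balanced R A (ccomp C (Suc 0)) A (\<lambda>a x. a \<otimes>\<^bsub>A\<^esub> \<theta> x)"
  using add_hom_add[OF bimodule_homD(3)[OF \<theta>_hom]]
  by (intro balancedI add_homI) (simp_all add: \<theta>_closed plus_carrier A.r_distr A.l_distr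
      left_hom_smult[OF \<theta>_left_hom] mult_balanced)

text \<open>With \<open>kF2\<close>, this gives balancedness of
  \<open>(a, x, y) \<mapsto> a \<theta>(x) \<otimes> y\<close> across both adjacent pairs, which
  makes the nested lifts in \<open>koszul_diff\<close> well defined.\<close>

lemma kF1: "y \<in> carrier (ccomp C n) \<Longrightarrow> balanced R A (ccomp C (Suc 0)) (K n) (\<lambda>a x. kt n (a \<otimes>\<^bsub>A\<^esub> \<theta> x) y)"
  by (rule balanced_comp[OF mult_\<theta>_balanced balancedD(2)[OF balanced_kt]])

lemma kF2: "a \<in> carrier A \<Longrightarrow> balanced R (ccomp C (Suc 0)) (ccomp C n) (K n) (\<lambda>x y. kt n (a \<otimes>\<^bsub>A\<^esub> \<theta> x) y)"
  by (rule balanced_comp_left[OF balanced_kt right_hom_comp[OF \<theta>_right_hom' mult_right_hom']])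

lemma comult1_hom: "comult C (Suc 0) n \<in> bimodule_hom R (ccomp C (Suc n)) (tensor R (ccomp C (Suc 0)) (ccomp C n))"
  using C.comult_hom[of "Suc 0" n] by simp

lemmas comult1_closed = add_hom_closed[OF bimodule_homD(3)[OF comult1_hom]]

lemma dK_balanced: "balanced R A (ccomp C (Suc n)) (K n)
    (\<lambda>a c. lift (K n) (\<lambda>(x, y). kt n (a \<otimes>\<^bsub>A\<^esub> \<theta> x) y) (comult C (Suc 0) n c))"
  by (rule balanced_comp_right[OF trilinear_right[OF bimodule_A CB CB abelian_K kF1 kF2] bimodule_homD(1)[OF comult1_hom]])

lemma dK_eq: "dK (Suc n) = lift (K n) (\<lambda>(a, c). lift (K n) (\<lambda>(x, y). kt n (a \<otimes>\<^bsub>A\<^esub> \<theta> x) y) (comult C (Suc 0) n c))"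
  by (simp add: koszul_diff_def koszul_comp_def)

lemma dK_kt:
  "a \<in> carrier A \<Longrightarrow> c \<in> carrier (ccomp C (Suc n)) \<Longrightarrow>
    dK (Suc n) (kt (Suc n) a c) = lift (K n) (\<lambda>(x, y). kt n (a \<otimes>\<^bsub>A\<^esub> \<theta> x) y) (comult C (Suc 0) n c)"
  unfolding dK_eq by (rule lift_tens[OF bimodule_A CB dK_balanced abelian_K])

lemma dK_left_hom: "dK (Suc n) \<in> left_hom R (K (Suc n)) (K n)"
  unfolding dK_eq
proof (rule lift_tensor_left_hom[OF bimodule_A CB left_module_K dK_balanced])
  fix r a c assume r: "r \<in> carrier R" and a: "a \<in> carrier A" and c: "c \<in> carrier (ccomp C (Suc n))"
  have "r \<odot>\<^bsub>K n\<^esub> lift (K n) (\<lambda>(x, y). kt n (a \<otimes>\<^bsub>A\<^esub> \<theta> x) y) (comult C (Suc 0) n c) =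
      lift (K n) (\<lambda>(x, y). r \<odot>\<^bsub>K n\<^esub> kt n (a \<otimes>\<^bsub>A\<^esub> \<theta> x) y) (comult C (Suc 0) n c)"
    by (rule lift_tensor_comp[OF CB CB kF2[OF a] K.smult_hom[OF r] abelian_K abelian_K comult1_closed[OF c]])
  also have "\<dots> = lift (K n) (\<lambda>(x, y). kt n ((r \<odot>\<^bsub>A\<^esub> a) \<otimes>\<^bsub>A\<^esub> \<theta> x) y) (comult C (Suc 0) n c)"
    by (rule lift_tensor_cong[OF kF2 CB CB abelian_K _ comult1_closed[OF c]])
      (simp_all add: r a smult_closed kt_smult \<theta>_closed plus_carrier mult_left)
  finally show "lift (K n) (\<lambda>(x, y). kt n ((r \<odot>\<^bsub>A\<^esub> a) \<otimes>\<^bsub>A\<^esub> \<theta> x) y) (comult C (Suc 0) n c) =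
      r \<odot>\<^bsub>K n\<^esub> lift (K n) (\<lambda>(x, y). kt n (a \<otimes>\<^bsub>A\<^esub> \<theta> x) y) (comult C (Suc 0) n c)" by simp
qed

lemmas dK_hom = left_homD[OF dK_left_hom]
lemmas dK_closed = add_hom_closed[OF dK_hom]

definition act :: "nat \<Rightarrow> 'a \<Rightarrow> (('a \<times> 'c) \<Rightarrow>\<^sub>0 int) set \<Rightarrow> (('a \<times> 'c) \<Rightarrow>\<^sub>0 int) set" where
  "act n a = tensor_map R A (ccomp C n) (\<lambda>b. a \<otimes>\<^bsub>A\<^esub> b) (\<lambda>y. y)"

lemma act_hom: "a \<in> carrier A \<Longrightarrow> act n a \<in> add_hom (K n) (K n)"
  unfolding act_def by (rule tensor_map_hom[OF bimodule_A CB bimodule_A CB mult_right_hom' left_hom_ident])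

lemma act_kt:
  "a \<in> carrier A \<Longrightarrow> b \<in> carrier A \<Longrightarrow> c \<in> carrier (ccomp C n) \<Longrightarrow> act n a (kt n b c) = kt n (a \<otimes>\<^bsub>A\<^esub> b) c"
  unfolding act_def by (rule tensor_map_tens[OF bimodule_A CB bimodule_A CB mult_right_hom' left_hom_ident])

lemma act_closed: "a \<in> carrier A \<Longrightarrow> t \<in> carrier (K n) \<Longrightarrow> act n a t \<in> carrier (K n)"
  by (rule add_hom_closed[OF act_hom])

lemma act_add_left:
  assumes "a \<in> carrier A" "b \<in> carrier A" "t \<in> carrier (K n)"
  shows "act n (a \<oplus>\<^bsub>A\<^esub> b) t = act n a t \<oplus>\<^bsub>K n\<^esub> act n b t"
  by (rule K_hom_ext[OF act_hom add_hom_plus[OF act_hom act_hom abelian_K] _ assms(3)])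
    (simp_all add: assms act_kt A.l_distr tens_add_left[OF bimodule_A CB])

lemma act_balanced:
  assumes "a \<in> carrier A" "r \<in> carrier R" "t \<in> carrier (K n)"
  shows "act n (a \<triangleleft>\<^bsub>A\<^esub> r) t = act n a (r \<odot>\<^bsub>K n\<^esub> t)"
  by (rule K_hom_ext[OF act_hom add_hom_comp[OF K.smult_hom act_hom] _ assms(3)])
    (simp_all add: assms act_kt rsmult_closed smult_closed kt_smult mult_balanced)

lemma act_smult:
  assumes "a \<in> carrier A" "r \<in> carrier R" "t \<in> carrier (K n)"
  shows "act n (r \<odot>\<^bsub>A\<^esub> a) t = r \<odot>\<^bsub>K n\<^esub> act n a t"
  by (rule K_hom_ext[OF act_hom add_hom_comp[OF act_hom K.smult_hom] _ assms(3)])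
    (simp_all add: assms act_kt smult_closed kt_smult mult_left)

lemma act_act:
  assumes "a \<in> carrier A" "b \<in> carrier A" "t \<in> carrier (K n)"
  shows "act n a (act n b t) = act n (a \<otimes>\<^bsub>A\<^esub> b) t"
  by (rule K_hom_ext[OF add_hom_comp[OF act_hom act_hom] act_hom _ assms(3)])
    (simp_all add: assms act_kt A.m_assoc)

lemma balanced_act: "balanced R Ap (K n) (K n) (act n)"
  by (intro balancedI add_homI) (simp_all add: plus_carrier act_closed act_add_left act_balanced add_hom_add[OF act_hom])

lemma dK_act:
  assumes a: "a \<in> carrier A" and t: "t \<in> carrier (K (Suc n))"
  shows "dK (Suc n) (act (Suc n) a t) = act n a (dK (Suc n) t)"
proof (rule K_hom_ext[OF add_hom_comp[OF act_hom[OF a] dK_hom] add_hom_comp[OF dK_hom act_hom[OF a]] _ t])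
  fix b c assume b: "b \<in> carrier A" and c: "c \<in> carrier (ccomp C (Suc n))"
  have "act n a (dK (Suc n) (kt (Suc n) b c)) =
      lift (K n) (\<lambda>(x, y). act n a (kt n (b \<otimes>\<^bsub>A\<^esub> \<theta> x) y)) (comult C (Suc 0) n c)"
    unfolding dK_kt[OF b c]
    by (rule lift_tensor_comp[OF CB CB kF2[OF b] act_hom[OF a] abelian_K abelian_K comult1_closed[OF c]])
  also have "\<dots> = lift (K n) (\<lambda>(x, y). kt n ((a \<otimes>\<^bsub>A\<^esub> b) \<otimes>\<^bsub>A\<^esub> \<theta> x) y) (comult C (Suc 0) n c)"
    by (rule lift_tensor_cong[OF kF2 CB CB abelian_K _ comult1_closed[OF c]])
      (simp_all add: a b act_kt \<theta>_closed plus_carrier A.m_assoc)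
  finally show "dK (Suc n) (act (Suc n) a (kt (Suc n) b c)) = act n a (dK (Suc n) (kt (Suc n) b c))"
    by (simp add: act_kt dK_kt a b c)
qed

text \<open>The functor \<open>R \<otimes>_A _\<close> on the induced module
  \<open>A \<otimes> C_n\<close>: tensoring with \<open>R\<close> over \<open>A\<close> leaves
  \<open>C_n\<close>, and the projection to degree 0 is the quotient map.\<close>

definition pr :: "nat \<Rightarrow> (('a \<times> 'c) \<Rightarrow>\<^sub>0 int) set \<Rightarrow> 'c" where
  "pr n = lift (ccomp C n) (\<lambda>(a, c). proj0 R A a \<odot>\<^bsub>ccomp C n\<^esub> c)"

lemma pr_balanced: "balanced R A (ccomp C n) (ccomp C n) (\<lambda>a c. proj0 R A a \<odot>\<^bsub>ccomp C n\<^esub> c)"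
  using add_hom_add[OF bimodule_homD(3)[OF proj0_hom]] right_hom_rsmult[OF bimodule_homD(2)[OF proj0_hom]]
  by (intro balancedI add_homI) (simp_all add: proj0_closed C.smult_closed C.smult_r_distr C.smult_l_distr C.smult_assoc)

lemma pr_left_hom: "pr n \<in> left_hom R (K n) (ccomp C n)"
  unfolding pr_def
  by (rule lift_tensor_left_hom[OF bimodule_A CB bimodule_left_module[OF CB] pr_balanced])
    (use left_hom_smult[OF bimodule_homD(1)[OF proj0_hom]] in \<open>simp add: proj0_closed C.smult_assoc\<close>)

lemmas pr_hom = left_homD[OF pr_left_hom]

lemma pr_kt: "a \<in> carrier A \<Longrightarrow> c \<in> carrier (ccomp C n) \<Longrightarrow> pr n (kt n a c) = proj0 R A a \<odot>\<^bsub>ccomp C n\<^esub> c"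
  unfolding pr_def by (rule lift_tens[OF bimodule_A CB pr_balanced abelian_C])

text \<open>The differential multiplies by elements \<open>\<theta> x\<close> of \<open>Ap\<close>,
  so its image lies in \<open>Ap\<close> times the complex. Consequently the Koszul complex reduces
  to \<open>C\<close> with zero differential.\<close>

lemma pr_dK:
  assumes t: "t \<in> carrier (K (Suc n))" shows "pr n (dK (Suc n) t) = \<zero>\<^bsub>ccomp C n\<^esub>"
proof (rule K_hom_ext[OF add_hom_comp[OF dK_hom pr_hom] add_hom_zero_map[OF abelian_C] _ t])
  fix a c assume a: "a \<in> carrier A" and c: "c \<in> carrier (ccomp C (Suc n))"
  have "pr n (dK (Suc n) (kt (Suc n) a c)) = lift (ccomp C n) (\<lambda>(x, y). pr n (kt n (a \<otimes>\<^bsub>A\<^esub> \<theta> x) y)) (comult C (Suc 0) n c)"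
    unfolding dK_kt[OF a c]
    by (rule lift_tensor_comp[OF CB CB kF2[OF a] pr_hom abelian_K abelian_C comult1_closed[OF c]])
  also have "\<dots> = \<zero>\<^bsub>ccomp C n\<^esub>"
    by (rule lift_tensor_eq_hom[OF CB CB abelian_C add_hom_zero_map[OF abelian_C] _ comult1_closed[OF c]])
      (simp add: a pr_kt \<theta>_closed plus_carrier mult_plus_right(2) proj0_plus)
  finally show "pr n (dK (Suc n) (kt (Suc n) a c)) = \<zero>\<^bsub>ccomp C n\<^esub>" .
qed

lemma pr_act:
  assumes a: "a \<in> carrier Ap" and t: "t \<in> carrier (K n)" shows "pr n (act n a t) = \<zero>\<^bsub>ccomp C n\<^esub>"
  by (rule K_hom_ext[OF add_hom_comp[OF act_hom pr_hom] add_hom_zero_map[OF abelian_C] _ t])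
    (simp_all add: a act_kt pr_kt plus_carrier mult_plus_left proj0_plus)

lemma
  shows aug_hom: "koszul_augmentation R A C \<in> add_hom (K 0) R"
    and aug_kt: "a \<in> carrier A \<Longrightarrow> c \<in> carrier (ccomp C 0) \<Longrightarrow>
      koszul_augmentation R A C (kt 0 a c) = proj0 R A a \<otimes>\<^bsub>R\<^esub> counit C c"
proof -
  have b: "balanced R A (ccomp C 0) R (\<lambda>a c. proj0 R A a \<otimes>\<^bsub>R\<^esub> counit C c)"
    using add_hom_add[OF bimodule_homD(3)[OF proj0_hom]] right_hom_rsmult[OF bimodule_homD(2)[OF proj0_hom]]
      add_hom_add[OF bimodule_homD(3)[OF C.counit_hom]] left_hom_smult[OF bimodule_homD(1)[OF C.counit_hom]]
    by (intro balancedI add_homI) (simp_all add: proj0_closed counit_closed R.r_distr R.l_distr R.m_assoc)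
  note ab = R.abelian_group_axioms
  show "koszul_augmentation R A C \<in> add_hom (K 0) R"
    unfolding koszul_augmentation_def by (rule lift_tensor_hom[OF bimodule_A CB b ab])
  show "a \<in> carrier A \<Longrightarrow> c \<in> carrier (ccomp C 0) \<Longrightarrow>
      koszul_augmentation R A C (kt 0 a c) = proj0 R A a \<otimes>\<^bsub>R\<^esub> counit C c"
    unfolding koszul_augmentation_def by (rule lift_tens[OF bimodule_A CB b ab])
qed

lemma aug_act:
  assumes a: "a \<in> carrier Ap" and t: "t \<in> carrier (K 0)"
  shows "koszul_augmentation R A C (act 0 a t) = \<zero>\<^bsub>R\<^esub>"
  by (rule K_hom_ext[OF add_hom_comp[OF act_hom aug_hom] add_hom_zero_map[OF R.abelian_group_axioms] _ t])
    (simp_all add: a act_kt aug_kt plus_carrier mult_plus_left proj0_plus counit_closed)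

lemma exact_0: "t \<in> carrier (K 0) \<Longrightarrow> koszul_augmentation R A C t = \<zero>\<^bsub>R\<^esub> \<Longrightarrow> t \<in> dK (Suc 0) ` carrier (K (Suc 0))"
  using koszul by (auto simp: koszul_pair_def koszul_comp_def a_kernel_def kernel_def)

lemma exact_Suc:
  assumes "t \<in> carrier (K (Suc n))" "dK (Suc n) t = \<zero>\<^bsub>K n\<^esub>"
  shows "t \<in> dK (Suc (Suc n)) ` carrier (K (Suc (Suc n)))"
proof -
  have "a_kernel (K (Suc n)) (K n) (dK (Suc n)) = dK (Suc (Suc n)) ` carrier (K (Suc (Suc n)))"
    using koszul unfolding koszul_pair_def koszul_comp_def by (elim conjE allE[of _ "Suc n"]) simp
  then show ?thesis using assms by (auto simp: a_kernel_def kernel_def)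
qed

text \<open>Choosing the section so that it sends \<open>d(1 \<otimes> c)\<close> back to \<open>1 \<otimes> c\<close> makes the comparison map
  \<open>gam\<close> a strict left inverse of \<open>ctb\<close>, so that no homotopy is needed on the Koszul side.\<close>

definition is_section :: "nat \<Rightarrow> ((('a \<times> 'c) \<Rightarrow>\<^sub>0 int) set \<Rightarrow> (('a \<times> 'c) \<Rightarrow>\<^sub>0 int) set) \<Rightarrow> bool" where
  "is_section n \<sigma> \<longleftrightarrow> (\<forall>y\<in>dK (Suc n) ` carrier (K (Suc n)). \<sigma> y \<in> carrier (K (Suc n)) \<and> dK (Suc n) (\<sigma> y) = y \<and>
      (\<forall>z\<in>dK (Suc n) ` carrier (K (Suc n)). \<sigma> (y \<oplus>\<^bsub>K n\<^esub> z) = \<sigma> y \<oplus>\<^bsub>K (Suc n)\<^esub> \<sigma> z) \<and>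
      (\<forall>r\<in>carrier R. \<sigma> (r \<odot>\<^bsub>K n\<^esub> y) = r \<odot>\<^bsub>K (Suc n)\<^esub> \<sigma> y)) \<and>
    (\<forall>v\<in>kt (Suc n) \<one>\<^bsub>A\<^esub> ` carrier (ccomp C (Suc n)). \<sigma> (dK (Suc n) v) = v)"

lemma kt_one_left_hom: "kt n \<one>\<^bsub>A\<^esub> \<in> left_hom R (ccomp C n) (K n)"
  by (rule left_homI[OF balancedD(1)[OF balanced_kt]]) (simp_all add: kt_smult unit_central kt_balanced)

lemma proj0_one: "proj0 R A \<one>\<^bsub>A\<^esub> = \<one>\<^bsub>R\<^esub>"
  using proj0_scalar[of "\<one>\<^bsub>R\<^esub>"] by (simp add: smult_one)

lemma pr_kt_one: "c \<in> carrier (ccomp C n) \<Longrightarrow> pr n (kt n \<one>\<^bsub>A\<^esub> c) = c"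
  by (simp add: pr_kt proj0_one C.smult_one)

text \<open>If \<open>1 \<otimes> c\<close> is a cycle, exactness makes it a boundary, so
  \<open>pr\<close> kills it; but \<open>pr\<close> returns \<open>c\<close>. The differential is
  therefore injective on these elements, and the section may be prescribed there.\<close>

lemma section_exists: "\<exists>\<sigma>. is_section n \<sigma>"
proof -
  have V: "left_submodule R (K (Suc n)) (kt (Suc n) \<one>\<^bsub>A\<^esub> ` carrier (ccomp C (Suc n)))"
    by (rule K.left_submodule_image[OF bimodule_left_module[OF CB] kt_one_left_hom C.left_submodule_carrier])
  show ?thesis
    unfolding is_section_def
  proof (rule K.linear_section[OF semisimple left_module_K dK_left_hom V])
    fix v assume "v \<in> kt (Suc n) \<one>\<^bsub>A\<^esub> ` carrier (ccomp C (Suc n))" and 0: "dK (Suc n) v = \<zero>\<^bsub>K n\<^esub>"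
    then obtain c where c: "c \<in> carrier (ccomp C (Suc n))" "v = kt (Suc n) \<one>\<^bsub>A\<^esub> c" by blast
    then have "v \<in> carrier (K (Suc n))" by (simp add: kt_closed)
    then have "v \<in> dK (Suc (Suc n)) ` carrier (K (Suc (Suc n)))" using 0 by (rule exact_Suc)
    then have "pr (Suc n) v = \<zero>\<^bsub>ccomp C (Suc n)\<^esub>" using pr_dK by auto
    then have "c = \<zero>\<^bsub>ccomp C (Suc n)\<^esub>" using c by (simp add: pr_kt_one)
    then show "v = \<zero>\<^bsub>K (Suc n)\<^esub>" using c add_hom_zero[OF left_homD[OF kt_one_left_hom] abelian_C abelian_K] by simp
  qed
qed

section \<open>The comparison map from the bar resolution to the Koszul complex\<close>

definition sig :: "nat \<Rightarrow> (('a \<times> 'c) \<Rightarrow>\<^sub>0 int) set \<Rightarrow> (('a \<times> 'c) \<Rightarrow>\<^sub>0 int) set" where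
  "sig n = (SOME \<sigma>. is_section n \<sigma>)"

lemma is_section_sig: "is_section n (sig n)"
  unfolding sig_def by (rule someI_ex[OF section_exists])

definition unit_C :: 'c where
  "unit_C = inv_into (carrier (ccomp C 0)) (counit C) \<one>\<^bsub>R\<^esub>"

lemma connected_C: "bij_betw (counit C) (carrier (ccomp C 0)) (carrier R)"
  using almost_koszul by (simp add: almost_koszul_pair_def connected_coring_def)

lemma unit_C: "unit_C \<in> carrier (ccomp C 0)" "counit C unit_C = \<one>\<^bsub>R\<^esub>"
  using connected_C inv_into_into[of "\<one>\<^bsub>R\<^esub>" "counit C" "carrier (ccomp C 0)"]
    f_inv_into_f[of "\<one>\<^bsub>R\<^esub>" "counit C" "carrier (ccomp C 0)"]
  by (auto simp: unit_C_def bij_betw_def)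

lemma counit_unit_C: "c \<in> carrier (ccomp C 0) \<Longrightarrow> counit C c \<odot>\<^bsub>ccomp C 0\<^esub> unit_C = c"
  using inj_onD[OF bij_betw_imp_inj_on[OF connected_C], of "counit C c \<odot>\<^bsub>ccomp C 0\<^esub> unit_C" c]
    left_hom_smult[OF bimodule_homD(1)[OF C.counit_hom], of "counit C c" unit_C]
  by (simp add: unit_C counit_closed C.smult_closed)

text \<open>The bar resolution is \<open>A \<otimes> Om n\<close> in degree \<open>n\<close>; \<open>gam n\<close> is the restriction to \<open>1 \<otimes> Om n\<close> of an
  \<open>A\<close>-linear comparison map to the Koszul complex, the argument of \<open>sig\<close> being the image of the
  boundary \<open>a\<^sub>1 [a\<^sub>2 | \<dots> | a\<^sub>n] - [d(a\<^sub>1 \<otimes> \<dots> \<otimes> a\<^sub>n)]\<close>.  Applying \<open>R \<otimes>\<^sub>A _\<close> to it gives \<open>gb\<close>.\<close>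

fun gam :: "nat \<Rightarrow> (('r \<times> 'a list) \<Rightarrow>\<^sub>0 int) set \<Rightarrow> (('a \<times> 'c) \<Rightarrow>\<^sub>0 int) set" where
  "gam 0 = (\<lambda>w. kt 0 (ept w \<odot>\<^bsub>A\<^esub> \<one>\<^bsub>A\<^esub>) unit_C)"
| "gam (Suc n) = (\<lambda>w. sig n (peel R Ap (K n) (\<lambda>a v. act n a (gam n v)) w \<ominus>\<^bsub>K n\<^esub> gam n (bd (Suc n) w)))"

abbreviation "pk n \<equiv> peel R Ap (K n) (\<lambda>a v. act n a (gam n v))"
abbreviation "ob n w \<equiv> pk n w \<ominus>\<^bsub>K n\<^esub> gam n (bd (Suc n) w)"

lemma
  assumes "gam n \<in> left_hom R (Om n) (K n)"
  shows pk_left_hom: "pk n \<in> left_hom R (Om (Suc n)) (K n)"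
    and pk_cn: "a \<in> carrier Ap \<Longrightarrow> v \<in> carrier (Om n) \<Longrightarrow> pk n (cn n a v) = act n a (gam n v)"
    and ob_left_hom: "(\<lambda>w. ob n w) \<in> left_hom R (Om (Suc n)) (K n)"
proof -
  note b = balanced_comp_right[OF balanced_act assms]
  show pk: "pk n \<in> left_hom R (Om (Suc n)) (K n)"
    by (rule peel_left_hom[OF bimodule_plus left_module_K b])
      (simp add: act_smult plus_carrier add_hom_closed[OF left_homD[OF assms]])
  show "a \<in> carrier Ap \<Longrightarrow> v \<in> carrier (Om n) \<Longrightarrow> pk n (cn n a v) = act n a (gam n v)"
    by (rule peel_cn[OF abelian_K b])
  show "(\<lambda>w. ob n w) \<in> left_hom R (Om (Suc n)) (K n)"
    by (rule K.left_hom_diff[OF pk left_hom_comp[OF bd_left_hom assms]])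
qed

text \<open>\<open>sig\<close> is linear only on boundaries, so the next \<open>gam\<close> is
  linear on condition that \<open>ob\<close> takes its values there.\<close>

lemma gam_step:
  assumes h: "gam n \<in> left_hom R (Om n) (K n)"
    and im: "\<And>w. w \<in> carrier (Om (Suc n)) \<Longrightarrow> ob n w \<in> dK (Suc n) ` carrier (K (Suc n))"
  shows "gam (Suc n) \<in> left_hom R (Om (Suc n)) (K (Suc n))"
    and "\<And>w. w \<in> carrier (Om (Suc n)) \<Longrightarrow> dK (Suc n) (gam (Suc n) w) = ob n w"
proof -
  note o = ob_left_hom[OF h]
  have s: "sig n y \<in> carrier (K (Suc n))" "dK (Suc n) (sig n y) = y"
    "\<And>z. z \<in> dK (Suc n) ` carrier (K (Suc n)) \<Longrightarrow> sig n (y \<oplus>\<^bsub>K n\<^esub> z) = sig n y \<oplus>\<^bsub>K (Suc n)\<^esub> sig n z"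
    "\<And>r. r \<in> carrier R \<Longrightarrow> sig n (r \<odot>\<^bsub>K n\<^esub> y) = r \<odot>\<^bsub>K (Suc n)\<^esub> sig n y"
    if "y \<in> dK (Suc n) ` carrier (K (Suc n))" for y
    using is_section_sig[of n] that unfolding is_section_def by blast+
  have eq: "gam (Suc n) = (\<lambda>w. sig n (ob n w))" by simp
  show "gam (Suc n) \<in> left_hom R (Om (Suc n)) (K (Suc n))"
    unfolding eq
  proof (intro left_homI add_homI)
    fix x y assume x: "x \<in> carrier (Om (Suc n))" and y: "y \<in> carrier (Om (Suc n))"
    show "sig n (ob n (x \<oplus>\<^bsub>Om (Suc n)\<^esub> y)) = sig n (ob n x) \<oplus>\<^bsub>K (Suc n)\<^esub> sig n (ob n y)"
      unfolding add_hom_add[OF left_homD[OF o] x y] by (rule s(3)[OF im[OF x] im[OF y]])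
  next
    fix r x assume r: "r \<in> carrier R" and x: "x \<in> carrier (Om (Suc n))"
    show "sig n (ob n (r \<odot>\<^bsub>Om (Suc n)\<^esub> x)) = r \<odot>\<^bsub>K (Suc n)\<^esub> sig n (ob n x)"
      unfolding left_hom_smult[OF o r x] by (rule s(4)[OF im[OF x] r])
  qed (rule s(1)[OF im])
  show "dK (Suc n) (gam (Suc n) w) = ob n w" if "w \<in> carrier (Om (Suc n))" for w
    unfolding eq by (rule s(2)[OF im[OF that]])
qed

text \<open>Linearity and the lifting condition depend on each other. For \<open>w = [a | v]\<close>
  the boundary of \<open>gam (bd w)\<close> is \<open>ob (bd w)\<close>, which by
  \<open>bd_bd\<close> equals \<open>a ob(v)\<close>, and this is also the boundary of
  \<open>a gam(v)\<close>; so \<open>ob w\<close> is a cycle, and exactness makes it a boundary. In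
  the lowest degree the augmentation, which vanishes on \<open>Ap\<close> times \<open>K 0\<close>,
  takes the place of the differential.\<close>

lemma gam_properties:
  "gam n \<in> left_hom R (Om n) (K n) \<and>
    (\<forall>w\<in>carrier (Om (Suc n)). ob n w \<in> dK (Suc n) ` carrier (K (Suc n)))"
proof (induction n)
  case 0
  have e: "ept \<in> left_hom R (Om 0) (regular_bimodule R)" by (rule bimodule_homD(1)[OF ept_bimodule_hom])
  have s: "(\<lambda>r. kt 0 (r \<odot>\<^bsub>A\<^esub> \<one>\<^bsub>A\<^esub>) unit_C) \<in> left_hom R (regular_bimodule R) (K 0)"
    by (intro left_homI add_homI) (simp_all add: kt_closed scalar_closed unit_C smult_l_distr
        tens_add_left[OF bimodule_A CB] smult_assoc kt_smult)
  have g: "gam 0 \<in> left_hom R (Om 0) (K 0)"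
    using left_hom_comp[OF e s] by simp
  note gc = add_hom_closed[OF left_homD[OF g]]
  have "ob 0 w \<in> dK (Suc 0) ` carrier (K (Suc 0))" if w: "w \<in> carrier (Om (Suc 0))" for w
  proof (rule exact_0)
    show "ob 0 w \<in> carrier (K 0)" by (rule add_hom_closed[OF left_homD[OF ob_left_hom[OF g]] w])
    show "koszul_augmentation R A C (ob 0 w) = \<zero>\<^bsub>R\<^esub>"
    proof (rule Om_Suc_hom_ext[OF add_hom_comp[OF left_homD[OF ob_left_hom[OF g]] aug_hom] add_hom_zero_map[OF R.abelian_group_axioms] _ w])
      fix a v assume a: "a \<in> carrier Ap" and v: "v \<in> carrier (Om 0)"
      have "gam 0 (bd (Suc 0) (cn 0 a v)) = \<zero>\<^bsub>K 0\<^esub>"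
        using add_hom_zero[OF left_homD[OF g] abelian_Om abelian_K] by simp
      moreover have "act 0 a (gam 0 v) \<in> carrier (K 0)" by (rule act_closed[OF plus_carrier[OF a] gc[OF v]])
      ultimately show "koszul_augmentation R A C (ob 0 (cn 0 a v)) = \<zero>\<^bsub>R\<^esub>"
        using aug_act[OF a gc[OF v]] by (simp only: pk_cn[OF g a v] K.M.minus_zero)
    qed
  qed
  then show ?case using g by blast
next
  case (Suc n)
  then have h: "gam n \<in> left_hom R (Om n) (K n)"
    and im: "\<And>w. w \<in> carrier (Om (Suc n)) \<Longrightarrow> ob n w \<in> dK (Suc n) ` carrier (K (Suc n))" by blast+
  have g: "gam (Suc n) \<in> left_hom R (Om (Suc n)) (K (Suc n))"
    by (rule gam_step(1)[OF h]) (rule im)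
  have dg: "dK (Suc n) (gam (Suc n) w) = ob n w" if "w \<in> carrier (Om (Suc n))" for w
    by (rule gam_step(2)[OF h _ that]) (rule im)
  note [simp del] = gam.simps bd.simps(3)
  note hc = add_hom_closed[OF left_homD[OF h]] and gc = add_hom_closed[OF left_homD[OF g]]
  note ob' = left_homD[OF ob_left_hom[OF g]] and pkh = left_homD[OF pk_left_hom[OF h]]
  note pkc = add_hom_closed[OF pkh]
  \<comment> \<open>\<open>pk\<close> is the \<open>A\<close>-linear extension of \<open>gam\<close>
    evaluated with the first letter as coefficient, so multiplying that letter by \<open>a\<close>
    is acting by \<open>a\<close> on the value.\<close>
  have pk_lm: "pk n (lm n a v) = act n a (pk n v)" if a: "a \<in> carrier Ap" and v: "v \<in> carrier (Om (Suc n))" for a v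
    by (rule Om_Suc_hom_ext[OF add_hom_comp[OF lm_hom[OF a] pkh] add_hom_comp[OF pkh act_hom[OF plus_carrier[OF a]]] _ v])
      (simp add: a lm_cn pk_cn[OF h] plus_mult act_act plus_carrier hc)
  have "ob (Suc n) w \<in> dK (Suc (Suc n)) ` carrier (K (Suc (Suc n)))" if w: "w \<in> carrier (Om (Suc (Suc n)))" for w
  proof (rule exact_Suc)
    show "ob (Suc n) w \<in> carrier (K (Suc n))" by (rule add_hom_closed[OF ob' w])
    show "dK (Suc n) (ob (Suc n) w) = \<zero>\<^bsub>K n\<^esub>"
    proof (rule Om_Suc_hom_ext[OF add_hom_comp[OF ob' dK_hom] add_hom_zero_map[OF abelian_K] _ w])
      fix a v assume a: "a \<in> carrier Ap" and v: "v \<in> carrier (Om (Suc n))"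
      have a': "a \<in> carrier A" using a by (rule plus_carrier)
      have w': "cn (Suc n) a v \<in> carrier (Om (Suc (Suc n)))" by (rule cn_closed[OF a v])
      have bw: "bd (Suc (Suc n)) (cn (Suc n) a v) \<in> carrier (Om (Suc n))" by (rule bd_closed[OF w'])
      have "dK (Suc n) (gam (Suc n) (bd (Suc (Suc n)) (cn (Suc n) a v))) = pk n (bd (Suc (Suc n)) (cn (Suc n) a v))"
        using dg[OF bw] bd_bd[OF w'] add_hom_zero[OF left_homD[OF h] abelian_Om abelian_K] pkc[OF bw]
        by (simp add: a_minus_def)
      also have "\<dots> = act n a (pk n v) \<ominus>\<^bsub>K n\<^esub> act n a (gam n (bd (Suc n) v))"
        using a v by (simp add: bd_cn add_hom_minus[OF pkh abelian_Om abelian_K] lm_closed cn_closed bd_closed pk_lm pk_cn[OF h])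
      also have "\<dots> = act n a (ob n v)"
        using a' v by (simp add: add_hom_minus[OF act_hom abelian_K abelian_K] pkc hc bd_closed)
      also have "\<dots> = dK (Suc n) (act (Suc n) a (gam (Suc n) v))"
        by (simp add: dK_act[OF a' gc[OF v]] dg[OF v])
      finally show "dK (Suc n) (ob (Suc n) (cn (Suc n) a v)) = \<zero>\<^bsub>K n\<^esub>"
        using dK_closed[OF act_closed[OF a' gc[OF v]]]
        by (simp only: pk_cn[OF g a v] add_hom_minus[OF dK_hom abelian_K abelian_K act_closed[OF a' gc[OF v]] gc[OF bw]])
          (simp add: a_minus_def K.M.r_neg)
    qed
  qed
  then show ?case using g by blast
qed

lemma gam_left_hom: "gam n \<in> left_hom R (Om n) (K n)"
  using gam_properties by blast

lemma dK_gam: "w \<in> carrier (Om (Suc n)) \<Longrightarrow> dK (Suc n) (gam (Suc n) w) = ob n w"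
  by (rule gam_step(2)[OF gam_left_hom]) (use gam_properties in blast)

lemmas gam_hom = left_homD[OF gam_left_hom]
lemmas gam_closed = add_hom_closed[OF gam_hom]
lemmas pk_hom = left_homD[OF pk_left_hom[OF gam_left_hom]]
lemmas pk_closed = add_hom_closed[OF pk_hom]
lemmas pk_cn' = pk_cn[OF gam_left_hom]

text \<open>Since \<open>ctb n c\<close> is a cycle, \<open>ob\<close> reduces to \<open>pk\<close>,
  and by induction \<open>pk\<close> turns the left recursion of \<open>ctb\<close> into the Koszul
  differential of \<open>1 \<otimes> c\<close>. The normalisation of \<open>sig\<close> on such
  boundaries returns \<open>1 \<otimes> c\<close> itself.\<close>

lemma gam_ctb: "c \<in> carrier (ccomp C n) \<Longrightarrow> gam n (ctb n c) = kt n \<one>\<^bsub>A\<^esub> c"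
proof (induction n arbitrary: c)
  case 0
  then show ?case
    by (simp add: ctb_0 ept_pword counit_closed unit_central kt_balanced unit_C counit_unit_C)
next
  case (Suc n)
  note c = Suc.prems
  have "pk n (ctb (Suc n) c) = lift (K n) (\<lambda>(x, y). pk n (cn n (\<theta> x) (ctb n y))) (comult C (Suc 0) n c)"
    unfolding ctb_cons[OF c]
    by (rule lift_tensor_comp[OF CB CB cn_ctb_balanced pk_hom abelian_Om abelian_K comult1_closed[OF c]])
  also have "\<dots> = lift (K n) (\<lambda>(x, y). kt n (\<one>\<^bsub>A\<^esub> \<otimes>\<^bsub>A\<^esub> \<theta> x) y) (comult C (Suc 0) n c)"
    by (rule lift_tensor_cong[OF kF2 CB CB abelian_K _ comult1_closed[OF c]])
      (simp_all add: pk_cn' \<theta>_closed ctb_closed Suc.IH act_kt plus_carrier)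
  also have "\<dots> = dK (Suc n) (kt (Suc n) \<one>\<^bsub>A\<^esub> c)" by (simp add: dK_kt c)
  finally have pk: "pk n (ctb (Suc n) c) = dK (Suc n) (kt (Suc n) \<one>\<^bsub>A\<^esub> c)" .
  have "ob n (ctb (Suc n) c) = dK (Suc n) (kt (Suc n) \<one>\<^bsub>A\<^esub> c)"
    using pk bd_ctb[OF c] add_hom_zero[OF gam_hom abelian_Om abelian_K] dK_closed[OF kt_closed[OF A.one_closed c]]
    by (simp add: a_minus_def)
  then have "gam (Suc n) (ctb (Suc n) c) = sig n (dK (Suc n) (kt (Suc n) \<one>\<^bsub>A\<^esub> c))"
    by (simp only: gam.simps)
  then show ?case using is_section_sig[of n] c by (simp add: is_section_def)
qed

definition gb :: "nat \<Rightarrow> (('r \<times> 'a list) \<Rightarrow>\<^sub>0 int) set \<Rightarrow> 'c" where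
  "gb n w = pr n (gam n w)"

lemma gb_left_hom: "gb n \<in> left_hom R (Om n) (ccomp C n)"
  unfolding gb_def[abs_def] by (rule left_hom_comp[OF gam_left_hom pr_left_hom])

lemmas gb_hom = left_homD[OF gb_left_hom]
lemmas gb_closed = add_hom_closed[OF gb_hom]

lemma gb_ctb: "c \<in> carrier (ccomp C n) \<Longrightarrow> gb n (ctb n c) = c"
  by (simp add: gb_def gam_ctb pr_kt_one)

text \<open>\<open>pr\<close> kills \<open>ob w\<close>, which is a boundary, and it kills
  \<open>pk n w\<close>, which lies in \<open>Ap\<close> times the complex. Their difference is
  \<open>gam n (bd (Suc n) w)\<close>.\<close>

lemma gb_bd:
  assumes w: "w \<in> carrier (Om (Suc n))" shows "gb n (bd (Suc n) w) = \<zero>\<^bsub>ccomp C n\<^esub>"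
proof -
  have "pr n (pk n w) = \<zero>\<^bsub>ccomp C n\<^esub>"
    by (rule Om_Suc_hom_ext[OF add_hom_comp[OF pk_hom pr_hom] add_hom_zero_map[OF abelian_C] _ w])
      (simp add: pk_cn' pr_act gam_closed)
  moreover have "pr n (ob n w) = \<zero>\<^bsub>ccomp C n\<^esub>"
    unfolding dK_gam[OF w, symmetric] by (rule pr_dK[OF gam_closed[OF w]])
  moreover have "pr n (ob n w) = pr n (pk n w) \<ominus>\<^bsub>ccomp C n\<^esub> pr n (gam n (bd (Suc n) w))"
    by (rule add_hom_minus[OF pr_hom abelian_K abelian_C pk_closed[OF w] gam_closed[OF bd_closed[OF w]]])
  ultimately have "\<zero>\<^bsub>ccomp C n\<^esub> \<ominus>\<^bsub>ccomp C n\<^esub> gb n (bd (Suc n) w) = \<zero>\<^bsub>ccomp C n\<^esub>"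
    by (simp add: gb_def)
  then show ?thesis
    using C.M.eq_of_minus_zero[OF _ C.M.zero_closed gb_closed[OF bd_closed[OF w]]] by simp
qed

text \<open>The extra degeneracy \<open>a \<otimes> w \<mapsto> [a | w]\<close> of the bar resolution on the image of the Koszul complex;
  \<open>a\<close> has to be replaced by its component in \<open>A\<^sub>+\<close>.\<close>

definition HK :: "nat \<Rightarrow> (('a \<times> 'c) \<Rightarrow>\<^sub>0 int) set \<Rightarrow> (('r \<times> 'a list) \<Rightarrow>\<^sub>0 int) set" where
  "HK n = lift (Om (Suc n)) (\<lambda>(a, c). cn n (plus_proj a) (ctb n c))"

lemma HK_balanced: "balanced R A (ccomp C n) (Om (Suc n)) (\<lambda>a c. cn n (plus_proj a) (ctb n c))"
  by (rule balanced_comp_right[OF balanced_comp_left[OF balanced_cn bimodule_homD(2)[OF plus_proj_hom]] ctb_left_hom])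

lemma HK_left_hom: "HK n \<in> left_hom R (K n) (Om (Suc n))"
  unfolding HK_def
  by (rule lift_tensor_left_hom[OF bimodule_A CB left_module_Om HK_balanced])
    (use left_hom_smult[OF bimodule_homD(1)[OF plus_proj_hom]] in \<open>simp add: cn_smult plus_proj_closed ctb_closed\<close>)

lemmas HK_hom = left_homD[OF HK_left_hom]
lemmas HK_closed = add_hom_closed[OF HK_hom]

lemma HK_kt: "a \<in> carrier A \<Longrightarrow> c \<in> carrier (ccomp C n) \<Longrightarrow> HK n (kt n a c) = cn n (plus_proj a) (ctb n c)"
  unfolding HK_def by (rule lift_tens[OF bimodule_A CB HK_balanced abelian_Om])

text \<open>On \<open>b \<otimes> c\<close> the left side is \<open>[a b | ctb c]\<close>; splitting
  \<open>b\<close> by \<open>mult_plus\<close> gives the term with the positive part of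
  \<open>b\<close> and a correction with its scalar part, which is moved across to
  \<open>c\<close>.\<close>

lemma HK_act:
  assumes a: "a \<in> carrier Ap" and t: "t \<in> carrier (K n)"
  shows "HK n (act n a t) = lm n a (HK n t) \<oplus>\<^bsub>Om (Suc n)\<^esub> cn n a (ctb n (pr n t))"
proof (rule K_hom_ext[OF add_hom_comp[OF act_hom[OF plus_carrier[OF a]] HK_hom]
      add_hom_plus[OF add_hom_comp[OF HK_hom lm_hom[OF a]] add_hom_comp[OF add_hom_comp[OF pr_hom ctb_add_hom] cn_hom[OF a]] abelian_Om] _ t])
  fix b c assume b: "b \<in> carrier A" and c: "c \<in> carrier (ccomp C n)"
  have "HK n (act n a (kt n b c)) = cn n (a \<otimes>\<^bsub>A\<^esub> plus_proj b \<oplus>\<^bsub>A\<^esub> a \<triangleleft>\<^bsub>A\<^esub> proj0 R A b) (ctb n c)"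
    using a b c by (simp add: act_kt HK_kt plus_carrier plus_proj_plus mult_plus_left mult_plus[symmetric])
  also have "\<dots> = lm n a (HK n (kt n b c)) \<oplus>\<^bsub>Om (Suc n)\<^esub> cn n a (ctb n (pr n (kt n b c)))"
    using a b c by (simp add: cn_add_left plus_mult plus_proj_closed plus_rsmult proj0_closed ctb_closed lm_cn HK_kt
        cn_balanced pr_kt left_hom_smult[OF ctb_left_hom])
  finally show "HK n (act n a (kt n b c)) = lm n a (HK n (kt n b c)) \<oplus>\<^bsub>Om (Suc n)\<^esub> cn n a (ctb n (pr n (kt n b c)))" .
qed

text \<open>The identity of a contracting homotopy, restricted to the image of the Koszul complex.
  It comes from splitting the coefficient \<open>a\<close> in \<open>a \<theta>(x)\<close>: the
  positive part gives the differential of \<open>[a | ctb c]\<close>, as \<open>ctb c\<close> is a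
  cycle, and the scalar part gives \<open>ctb\<close> of the reduced element.\<close>

lemma HK_dK:
  assumes t: "t \<in> carrier (K (Suc n))"
  shows "HK n (dK (Suc n) t) = bd (Suc (Suc n)) (HK (Suc n) t) \<oplus>\<^bsub>Om (Suc n)\<^esub> ctb (Suc n) (pr (Suc n) t)"
proof (rule K_hom_ext[OF add_hom_comp[OF dK_hom HK_hom]
      add_hom_plus[OF add_hom_comp[OF HK_hom bd_add_hom] add_hom_comp[OF pr_hom ctb_add_hom] abelian_Om] _ t])
  fix a c assume a: "a \<in> carrier A" and c: "c \<in> carrier (ccomp C (Suc n))"
  note [simp del] = bd.simps(3)
  let ?p = "proj0 R A a" and ?b = "plus_proj a"
  have p: "?p \<in> carrier R" and b: "?b \<in> carrier Ap" using a by (simp_all add: proj0_closed plus_proj_closed)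
  note d = comult1_closed[OF c]
  have h: "(\<lambda>w. lm n ?b w \<oplus>\<^bsub>Om (Suc n)\<^esub> ?p \<odot>\<^bsub>Om (Suc n)\<^esub> w) \<in> add_hom (Om (Suc n)) (Om (Suc n))"
    by (rule add_hom_plus[OF lm_hom[OF b] Om.smult_hom[OF p] abelian_Om])
  have "HK n (dK (Suc n) (kt (Suc n) a c)) = lift (Om (Suc n)) (\<lambda>(x, y). HK n (kt n (a \<otimes>\<^bsub>A\<^esub> \<theta> x) y)) (comult C (Suc 0) n c)"
    unfolding dK_kt[OF a c] by (rule lift_tensor_comp[OF CB CB kF2[OF a] HK_hom abelian_K abelian_Om d])
  also have "\<dots> = lift (Om (Suc n)) (\<lambda>(x, y). lm n ?b (cn n (\<theta> x) (ctb n y)) \<oplus>\<^bsub>Om (Suc n)\<^esub> ?p \<odot>\<^bsub>Om (Suc n)\<^esub> cn n (\<theta> x) (ctb n y)) (comult C (Suc 0) n c)"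
  proof (rule lift_tensor_cong[OF balanced_comp[OF cn_ctb_balanced h] CB CB abelian_Om _ d])
    fix x y assume x: "x \<in> carrier (ccomp C (Suc 0))" and y: "y \<in> carrier (ccomp C n)"
    have "plus_proj (a \<otimes>\<^bsub>A\<^esub> \<theta> x) = ?b \<otimes>\<^bsub>A\<^esub> \<theta> x \<oplus>\<^bsub>A\<^esub> ?p \<odot>\<^bsub>A\<^esub> \<theta> x"
      using mult_plus_right[OF a \<theta>_closed[OF x]] plus_proj_plus by simp
    then show "HK n (kt n (a \<otimes>\<^bsub>A\<^esub> \<theta> x) y) = lm n ?b (cn n (\<theta> x) (ctb n y)) \<oplus>\<^bsub>Om (Suc n)\<^esub> ?p \<odot>\<^bsub>Om (Suc n)\<^esub> cn n (\<theta> x) (ctb n y)"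
      using x y a p b by (simp add: HK_kt plus_carrier \<theta>_closed cn_add_left plus_mult plus_smult ctb_closed lm_cn cn_smult)
  qed
  also have "\<dots> = lm n ?b (ctb (Suc n) c) \<oplus>\<^bsub>Om (Suc n)\<^esub> ?p \<odot>\<^bsub>Om (Suc n)\<^esub> ctb (Suc n) c"
    unfolding ctb_cons[OF c] by (rule lift_tensor_comp[OF CB CB cn_ctb_balanced h abelian_Om abelian_Om d, symmetric])
  also have "lm n ?b (ctb (Suc n) c) = bd (Suc (Suc n)) (HK (Suc n) (kt (Suc n) a c))"
    using a b c bd_ctb[OF c] add_hom_zero[OF cn_hom[OF b] abelian_Om abelian_Om]
    by (simp add: HK_kt bd_cn ctb_closed lm_closed a_minus_def)
  also have "?p \<odot>\<^bsub>Om (Suc n)\<^esub> ctb (Suc n) c = ctb (Suc n) (pr (Suc n) (kt (Suc n) a c))"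
    using a c p by (simp add: pr_kt left_hom_smult[OF ctb_left_hom])
  finally show "HK n (dK (Suc n) (kt (Suc n) a c)) =
      bd (Suc (Suc n)) (HK (Suc n) (kt (Suc n) a c)) \<oplus>\<^bsub>Om (Suc n)\<^esub> ctb (Suc n) (pr (Suc n) (kt (Suc n) a c))" .
qed

text \<open>The usual recursion \<open>h = s (F - id - h d)\<close> on the bar resolution, where
  \<open>s\<close> is the extra degeneracy and \<open>F\<close> the composite of the two comparison
  maps. Since \<open>s\<close> kills \<open>1 \<otimes> w\<close> and the values of \<open>h\<close>
  on generators have this form, only \<open>s F\<close> and \<open>[a | h v]\<close> remain. The
  differential of the resolution reduces to \<open>- bd\<close> under
  \<open>R \<otimes>_A _\<close>, which accounts for the sign in front of \<open>HK\<close>.\<close>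

fun hs :: "nat \<Rightarrow> (('r \<times> 'a list) \<Rightarrow>\<^sub>0 int) set \<Rightarrow> (('r \<times> 'a list) \<Rightarrow>\<^sub>0 int) set" where
  "hs 0 = (\<lambda>w. \<zero>\<^bsub>Om (Suc 0)\<^esub>)"
| "hs (Suc n) = (\<lambda>w. \<zero>\<^bsub>Om (Suc (Suc n))\<^esub> \<ominus>\<^bsub>Om (Suc (Suc n))\<^esub> HK (Suc n) (gam (Suc n) w)
     \<ominus>\<^bsub>Om (Suc (Suc n))\<^esub> peel R Ap (Om (Suc (Suc n))) (\<lambda>a v. cn (Suc n) a (hs n v)) w)"

lemma hs_left_hom: "hs n \<in> left_hom R (Om n) (Om (Suc n))"
  and hs_balanced: "balanced R Ap (Om n) (Om (Suc (Suc n))) (\<lambda>a v. cn (Suc n) a (hs n v))"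
proof -
  have b: "balanced R Ap (Om n) (Om (Suc (Suc n))) (\<lambda>a v. cn (Suc n) a (hs n v))"
    if "hs n \<in> left_hom R (Om n) (Om (Suc n))" for n
    by (rule balanced_comp_right[OF balanced_cn that])
  show h: "hs n \<in> left_hom R (Om n) (Om (Suc n))" for n
  proof (induction n)
    case 0
    show ?case using bimodule_homD(1)[OF zero_bimodule_hom[OF bimodule_Om bimodule_Om]] by simp
  next
    case (Suc n)
    have p: "peel R Ap (Om (Suc (Suc n))) (\<lambda>a v. cn (Suc n) a (hs n v)) \<in> left_hom R (Om (Suc n)) (Om (Suc (Suc n)))"
      by (rule peel_left_hom[OF bimodule_plus left_module_Om b[OF Suc]])
        (simp add: cn_smult add_hom_closed[OF left_homD[OF Suc]])
    show ?case unfolding hs.simps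
      by (rule Om.left_hom_diff[OF Om.left_hom_diff[OF bimodule_homD(1)[OF zero_bimodule_hom[OF bimodule_Om bimodule_Om]]
              left_hom_comp[OF gam_left_hom HK_left_hom]] p])
  qed
  show "balanced R Ap (Om n) (Om (Suc (Suc n))) (\<lambda>a v. cn (Suc n) a (hs n v))"
    by (rule b[OF h])
qed

lemmas hs_hom = left_homD[OF hs_left_hom]
lemmas hs_closed = add_hom_closed[OF hs_hom]

lemma hs_cn:
  assumes a: "a \<in> carrier Ap" and v: "v \<in> carrier (Om n)"
  shows "hs (Suc n) (cn n a v) = \<zero>\<^bsub>Om (Suc (Suc n))\<^esub> \<ominus>\<^bsub>Om (Suc (Suc n))\<^esub> HK (Suc n) (gam (Suc n) (cn n a v))
     \<ominus>\<^bsub>Om (Suc (Suc n))\<^esub> cn (Suc n) a (hs n v)"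
  unfolding hs.simps peel_cn[OF abelian_Om hs_balanced a v] ..

text \<open>In degree 0 both reduced complexes are \<open>R\<close> and the two maps are inverse to
  each other, so \<open>hs 0\<close> can be zero.\<close>

lemma ctb_gb_0: "w \<in> carrier (Om 0) \<Longrightarrow> ctb 0 (gb 0 w) = w"
  by (simp add: gb_def pr_kt scalar_closed ept_closed unit_C proj0_scalar ctb_0 C.smult_closed pword_ept
      left_hom_smult[OF bimodule_homD(1)[OF C.counit_hom]])

text \<open>Expanding \<open>hs\<close> by its recursion on \<open>[a b | u]\<close> and on
  \<open>[b | u]\<close> produces the same term \<open>[a b | hs u]\<close>; what is left over are
  the two values of \<open>HK\<close> after \<open>gam\<close>.\<close>

lemma hs_lm:
  assumes a: "a \<in> carrier Ap" and v: "v \<in> carrier (Om (Suc n))"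
  shows "hs (Suc n) (lm n a v) = lm (Suc n) a (hs (Suc n) v) \<oplus>\<^bsub>Om (Suc (Suc n))\<^esub>
      lm (Suc n) a (HK (Suc n) (gam (Suc n) v)) \<ominus>\<^bsub>Om (Suc (Suc n))\<^esub> HK (Suc n) (gam (Suc n) (lm n a v))"
proof (rule Om_Suc_hom_ext[OF add_hom_comp[OF lm_hom[OF a] hs_hom]
      add_hom_diff[OF add_hom_plus[OF add_hom_comp[OF hs_hom lm_hom[OF a]]
        add_hom_comp[OF add_hom_comp[OF gam_hom HK_hom] lm_hom[OF a]] abelian_Om]
        add_hom_comp[OF add_hom_comp[OF lm_hom[OF a] gam_hom] HK_hom] abelian_Om] _ v])
  fix b u assume b: "b \<in> carrier Ap" and u: "u \<in> carrier (Om n)"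
  let ?X = "Om (Suc (Suc n))"
  note [simp del] = hs.simps gam.simps
  note lmz = add_hom_zero[OF lm_hom[OF a] abelian_Om abelian_Om, of "Suc n"]
  have c: "HK (Suc n) (gam (Suc n) (cn n b u)) \<in> carrier ?X" "cn (Suc n) b (hs n u) \<in> carrier ?X"
    "HK (Suc n) (gam (Suc n) (cn n (a \<otimes>\<^bsub>A\<^esub> b) u)) \<in> carrier ?X" "cn (Suc n) (a \<otimes>\<^bsub>A\<^esub> b) (hs n u) \<in> carrier ?X"
    using a b u by (simp_all add: HK_closed gam_closed cn_closed hs_closed plus_mult)
  show "hs (Suc n) (lm n a (cn n b u)) = lm (Suc n) a (hs (Suc n) (cn n b u)) \<oplus>\<^bsub>?X\<^esub>
      lm (Suc n) a (HK (Suc n) (gam (Suc n) (cn n b u))) \<ominus>\<^bsub>?X\<^esub> HK (Suc n) (gam (Suc n) (lm n a (cn n b u)))"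
    using a b u c
    by (simp add: lm_cn hs_cn plus_mult add_hom_minus[OF lm_hom abelian_Om abelian_Om] add_hom_add[OF lm_hom] lmz
        hs_closed lm_closed Om.M.diff_simps Om.M.a_ac)
qed

text \<open>Apply \<open>HK\<close> to the defining equation of \<open>gam\<close> on
  \<open>[a | v]\<close>, namely that its boundary is \<open>a gam(v) - gam(bd [a | v])\<close>. The
  left side is evaluated by \<open>HK_dK\<close>, the first term on the right by
  \<open>HK_act\<close>.\<close>

lemma homotopy_step:
  assumes a: "a \<in> carrier Ap" and v: "v \<in> carrier (Om n)"
  shows "bd (Suc (Suc n)) (HK (Suc n) (gam (Suc n) (cn n a v))) \<oplus>\<^bsub>Om (Suc n)\<^esub> HK n (gam n (bd (Suc n) (cn n a v)))
        \<oplus>\<^bsub>Om (Suc n)\<^esub> ctb (Suc n) (gb (Suc n) (cn n a v)) =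
      lm n a (HK n (gam n v)) \<oplus>\<^bsub>Om (Suc n)\<^esub> cn n a (ctb n (gb n v))"
proof -
  note [simp del] = hs.simps gam.simps bd.simps(3)
  have w: "cn n a v \<in> carrier (Om (Suc n))" by (rule cn_closed[OF a v])
  have "HK n (dK (Suc n) (gam (Suc n) (cn n a v))) = HK n (act n a (gam n v)) \<ominus>\<^bsub>Om (Suc n)\<^esub> HK n (gam n (bd (Suc n) (cn n a v)))"
    unfolding dK_gam[OF w] pk_cn'[OF a v]
    by (rule add_hom_minus[OF HK_hom abelian_K abelian_Om])
      (simp_all add: a v w plus_carrier act_closed gam_closed bd_closed)
  then have "HK n (dK (Suc n) (gam (Suc n) (cn n a v))) \<oplus>\<^bsub>Om (Suc n)\<^esub> HK n (gam n (bd (Suc n) (cn n a v))) = HK n (act n a (gam n v))"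
    using a v w by (simp add: Om.M.diff_simps HK_closed act_closed gam_closed bd_closed plus_carrier dK_closed)
  then show ?thesis
    using a v w
    by (simp add: HK_dK HK_act gam_closed gb_def[symmetric] Om.M.a_ac HK_closed bd_closed ctb_closed gb_closed)
qed

text \<open>Induction with the first letter split off. \<open>hs_cn\<close> and \<open>hs_lm\<close>
  expand the two homotopy terms on \<open>[a | v]\<close>, and \<open>homotopy_step\<close> relates
  the resulting values of \<open>HK\<close>. The lowest case is separate because
  \<open>ctb_gb_0\<close> has to stand in for the induction hypothesis there.\<close>

lemma homotopy:
  "w \<in> carrier (Om (Suc n)) \<Longrightarrow>
    bd (Suc (Suc n)) (hs (Suc n) w) \<oplus>\<^bsub>Om (Suc n)\<^esub> hs n (bd (Suc n) w) \<oplus>\<^bsub>Om (Suc n)\<^esub> w = ctb (Suc n) (gb (Suc n) w)"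
proof (induction n arbitrary: w)
  note [simp del] = hs.simps gam.simps bd.simps(3)
  case 0
  show ?case
  proof (rule Om_Suc_hom_ext[OF add_hom_plus[OF add_hom_plus[OF add_hom_comp[OF hs_hom bd_add_hom] add_hom_comp[OF bd_add_hom hs_hom] abelian_Om]
          add_hom_ident abelian_Om] add_hom_comp[OF gb_hom ctb_add_hom] _ 0])
    fix a v assume a: "a \<in> carrier Ap" and v: "v \<in> carrier (Om 0)"
    let ?w = "cn 0 a v"
    have w: "?w \<in> carrier (Om (Suc 0))" by (rule cn_closed[OF a v])
    have z: "HK 0 (gam 0 v) = \<zero>\<^bsub>Om (Suc 0)\<^esub>"
      using v add_hom_zero[OF balancedD(2)[OF balanced_cn ctb_closed[OF unit_C(1)]] bimodule_abelian[OF bimodule_plus] abelian_Om]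
      by (simp add: gam.simps HK_kt scalar_closed ept_closed unit_C plus_proj_scalar)
    have s0: "hs 0 u = \<zero>\<^bsub>Om (Suc 0)\<^esub>" for u by (simp add: hs.simps)
    have "HK 0 (gam 0 \<zero>\<^bsub>Om 0\<^esub>) = \<zero>\<^bsub>Om (Suc 0)\<^esub>"
      using add_hom_zero[OF add_hom_comp[OF gam_hom HK_hom] abelian_Om abelian_Om] .
    then have k: "bd (Suc (Suc 0)) (HK (Suc 0) (gam (Suc 0) ?w)) \<oplus>\<^bsub>Om (Suc 0)\<^esub> ctb (Suc 0) (gb (Suc 0) ?w) = ?w"
      using homotopy_step[OF a v] a v w add_hom_zero[OF lm_hom[OF a] abelian_Om abelian_Om, of 0]
      by (simp add: z ctb_gb_0 HK_closed gam_closed bd_closed ctb_closed gb_closed)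
    have "hs (Suc 0) ?w = \<zero>\<^bsub>Om (Suc (Suc 0))\<^esub> \<ominus>\<^bsub>Om (Suc (Suc 0))\<^esub> HK (Suc 0) (gam (Suc 0) ?w)"
      using a v w add_hom_zero[OF cn_hom[OF a] abelian_Om abelian_Om, of "Suc 0"]
      by (simp add: hs_cn s0 HK_closed gam_closed a_minus_def)
    then have "bd (Suc (Suc 0)) (hs (Suc 0) ?w) = \<zero>\<^bsub>Om (Suc 0)\<^esub> \<ominus>\<^bsub>Om (Suc 0)\<^esub> bd (Suc (Suc 0)) (HK (Suc 0) (gam (Suc 0) ?w))"
      using w by (simp add: add_hom_minus[OF bd_add_hom abelian_Om abelian_Om] HK_closed gam_closed
          add_hom_zero[OF bd_add_hom abelian_Om abelian_Om])
    then show "bd (Suc (Suc 0)) (hs (Suc 0) ?w) \<oplus>\<^bsub>Om (Suc 0)\<^esub> hs 0 (bd (Suc 0) ?w) \<oplus>\<^bsub>Om (Suc 0)\<^esub> ?w = ctb (Suc 0) (gb (Suc 0) ?w)"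
      using w k by (simp add: s0 Om.M.diff_simps HK_closed gam_closed bd_closed ctb_closed gb_closed Om.M.a_ac)
  qed
next
  case (Suc n)
  note [simp del] = hs.simps gam.simps bd.simps(3)
  let ?O = "Om (Suc (Suc n))"
  show ?case
  proof (rule Om_Suc_hom_ext[OF add_hom_plus[OF add_hom_plus[OF add_hom_comp[OF hs_hom bd_add_hom] add_hom_comp[OF bd_add_hom hs_hom] abelian_Om]
          add_hom_ident abelian_Om] add_hom_comp[OF gb_hom ctb_add_hom] _ Suc.prems])
    fix a v assume a: "a \<in> carrier Ap" and v: "v \<in> carrier (Om (Suc n))"
    let ?w = "cn (Suc n) a v"
    have w: "?w \<in> carrier ?O" by (rule cn_closed[OF a v])
    note hg = add_hom_comp[OF gam_hom HK_hom]
    let ?X = "bd (Suc (Suc (Suc n))) (HK (Suc (Suc n)) (gam (Suc (Suc n)) ?w))"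
    let ?L = "lm (Suc n) a (hs (Suc n) v)"
    let ?B = "cn (Suc n) a (bd (Suc (Suc n)) (hs (Suc n) v))"
    let ?M = "lm (Suc n) a (HK (Suc n) (gam (Suc n) v))"
    let ?P = "HK (Suc n) (gam (Suc n) (lm n a v))"
    let ?Q = "HK (Suc n) (gam (Suc n) (cn n a (bd (Suc n) v)))"
    let ?E = "cn (Suc n) a (hs n (bd (Suc n) v))"
    have c: "?X \<in> carrier ?O" "?L \<in> carrier ?O" "?B \<in> carrier ?O" "?M \<in> carrier ?O" "?P \<in> carrier ?O"
      "?Q \<in> carrier ?O" "?E \<in> carrier ?O"
      using a v w by (simp_all add: HK_closed gam_closed bd_closed cn_closed lm_closed hs_closed)
    have bw: "bd (Suc (Suc n)) ?w = lm n a v \<ominus>\<^bsub>Om (Suc n)\<^esub> cn n a (bd (Suc n) v)" by (rule bd_cn[OF a v])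
    have hsw: "bd (Suc (Suc (Suc n))) (hs (Suc (Suc n)) ?w) = \<zero>\<^bsub>?O\<^esub> \<ominus>\<^bsub>?O\<^esub> ?X \<ominus>\<^bsub>?O\<^esub> (?L \<ominus>\<^bsub>?O\<^esub> ?B)"
      using a v w
      by (simp add: hs_cn add_hom_minus[OF bd_add_hom abelian_Om abelian_Om] add_hom_zero[OF bd_add_hom abelian_Om abelian_Om]
          HK_closed gam_closed cn_closed hs_closed bd_cn)
    have hsb: "hs (Suc n) (bd (Suc (Suc n)) ?w) =
        (?L \<oplus>\<^bsub>?O\<^esub> ?M \<ominus>\<^bsub>?O\<^esub> ?P) \<ominus>\<^bsub>?O\<^esub> (\<zero>\<^bsub>?O\<^esub> \<ominus>\<^bsub>?O\<^esub> ?Q \<ominus>\<^bsub>?O\<^esub> ?E)"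
      unfolding bw using a v
      by (simp add: add_hom_minus[OF hs_hom abelian_Om abelian_Om] lm_closed cn_closed bd_closed hs_lm hs_cn)
    have hgb: "HK (Suc n) (gam (Suc n) (bd (Suc (Suc n)) ?w)) = ?P \<ominus>\<^bsub>?O\<^esub> ?Q"
      unfolding bw by (rule add_hom_minus[OF hg abelian_Om abelian_Om])
        (simp_all add: a v lm_closed cn_closed bd_closed)
    have key: "?X \<oplus>\<^bsub>?O\<^esub> (?P \<ominus>\<^bsub>?O\<^esub> ?Q) \<oplus>\<^bsub>?O\<^esub> ctb (Suc (Suc n)) (gb (Suc (Suc n)) ?w) =
        ?M \<oplus>\<^bsub>?O\<^esub> cn (Suc n) a (ctb (Suc n) (gb (Suc n) v))"
      using homotopy_step[OF a v] unfolding hgb .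
    \<comment> \<open>The induction hypothesis is applied to \<open>v\<close>, behind the first
      letter \<open>a\<close>.\<close>
    have "cn (Suc n) a (ctb (Suc n) (gb (Suc n) v)) = ?B \<oplus>\<^bsub>?O\<^esub> ?E \<oplus>\<^bsub>?O\<^esub> ?w"
      unfolding Suc.IH[OF v, symmetric] using a v
      by (simp add: add_hom_add[OF cn_hom] hs_closed bd_closed)
    then show "bd (Suc (Suc (Suc n))) (hs (Suc (Suc n)) ?w) \<oplus>\<^bsub>?O\<^esub> hs (Suc n) (bd (Suc (Suc n)) ?w) \<oplus>\<^bsub>?O\<^esub> ?w =
        ctb (Suc (Suc n)) (gb (Suc (Suc n)) ?w)"
      unfolding hsw hsb using key c w
      by (intro Om.M.homotopy_arith[where L = ?L]) (simp_all add: ctb_closed gb_closed)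
  qed
qed

end

section \<open>Graded duals\<close>

lemma add_hom_regular [simp]:
  "add_hom M (regular_bimodule R) = add_hom M R" "add_hom (regular_bimodule R) N = add_hom R N"
  by (auto simp: add_hom_def)

lemma left_dual_sel [simp]:
  "zero (left_dual R M) = (\<lambda>x\<in>carrier M. \<zero>\<^bsub>R\<^esub>)" "add (left_dual R M) = (\<lambda>f g. \<lambda>x\<in>carrier M. f x \<oplus>\<^bsub>R\<^esub> g x)"
  by (simp_all add: left_dual_def)

lemma left_dual_iff:
  "f \<in> carrier (left_dual R M) \<longleftrightarrow> f \<in> left_hom R M (regular_bimodule R) \<and> f \<in> extensional (carrier M)"
  by (auto simp: left_dual_def left_hom_def add_hom_def PiE_def)

lemma left_dual_eqI:
  "f \<in> carrier (left_dual R M) \<Longrightarrow> g \<in> carrier (left_dual R M) \<Longrightarrow> (\<And>x. x \<in> carrier M \<Longrightarrow> f x = g x) \<Longrightarrow> f = g"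
  by (rule extensionalityI) (auto simp: left_dual_iff)

context left_module
begin

lemma restrict_left_dual: "f \<in> left_hom R M (regular_bimodule R) \<Longrightarrow> restrict f (carrier M) \<in> carrier (left_dual R M)"
  using left_homD[of f R M "regular_bimodule R"]
  by (auto simp: left_dual_iff left_hom_def add_hom_def smult_closed)

lemma left_dual_abelian: "abelian_group (left_dual R M)"
proof (rule abelian_groupI)
  fix f assume f: "f \<in> carrier (left_dual R M)"
  then have fh: "f \<in> left_hom R M (regular_bimodule R)" by (simp add: left_dual_iff)
  have fc: "f x \<in> carrier R" if "x \<in> carrier M" for x using add_hom_closed[OF left_homD[OF fh] that] by simp
  have "(\<lambda>x. \<ominus>\<^bsub>R\<^esub> f x) \<in> left_hom R M (regular_bimodule R)"
    using add_hom_uminus[of f M R] left_homD[OF fh] left_hom_smult[OF fh] fc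
    by (intro left_homI) (simp_all add: R.abelian_group_axioms R.r_minus)
  then have "(\<lambda>x\<in>carrier M. \<ominus>\<^bsub>R\<^esub> f x) \<in> carrier (left_dual R M)" by (rule restrict_left_dual)
  then show "\<exists>g\<in>carrier (left_dual R M). g \<oplus>\<^bsub>left_dual R M\<^esub> f = \<zero>\<^bsub>left_dual R M\<^esub>"
    using fc by (intro bexI) (auto simp: restrict_def R.l_neg)
  show "\<zero>\<^bsub>left_dual R M\<^esub> \<oplus>\<^bsub>left_dual R M\<^esub> f = f"
    using f fc by (auto simp: left_dual_iff extensional_def restrict_def fun_eq_iff)
next
  show "\<zero>\<^bsub>left_dual R M\<^esub> \<in> carrier (left_dual R M)"
    unfolding left_dual_sel by (rule restrict_left_dual) (simp add: left_hom_def add_hom_def)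
  fix f g assume f: "f \<in> carrier (left_dual R M)" and g: "g \<in> carrier (left_dual R M)"
  then have h: "f \<in> left_hom R M (regular_bimodule R)" "g \<in> left_hom R M (regular_bimodule R)" by (simp_all add: left_dual_iff)
  have c: "f x \<in> carrier R" "g x \<in> carrier R" if "x \<in> carrier M" for x
    using add_hom_closed[OF left_homD[OF h(1)] that] add_hom_closed[OF left_homD[OF h(2)] that] by simp_all
  have "(\<lambda>x. f x \<oplus>\<^bsub>R\<^esub> g x) \<in> left_hom R M (regular_bimodule R)"
    using add_hom_plus[of f M R g] left_homD[OF h(1)] left_homD[OF h(2)] left_hom_smult[OF h(1)] left_hom_smult[OF h(2)] c
    by (intro left_homI) (simp_all add: R.abelian_group_axioms R.r_distr)
  then show "f \<oplus>\<^bsub>left_dual R M\<^esub> g \<in> carrier (left_dual R M)" unfolding left_dual_sel by (rule restrict_left_dual)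
  show "f \<oplus>\<^bsub>left_dual R M\<^esub> g = g \<oplus>\<^bsub>left_dual R M\<^esub> f" using c by (auto simp: restrict_def fun_eq_iff R.a_comm)
next
  fix f g k assume "f \<in> carrier (left_dual R M)" "g \<in> carrier (left_dual R M)" "k \<in> carrier (left_dual R M)"
  then have c: "f x \<in> carrier R \<and> g x \<in> carrier R \<and> k x \<in> carrier R" if "x \<in> carrier M" for x
    using that by (auto simp: left_dual_def)
  then show "f \<oplus>\<^bsub>left_dual R M\<^esub> g \<oplus>\<^bsub>left_dual R M\<^esub> k = f \<oplus>\<^bsub>left_dual R M\<^esub> (g \<oplus>\<^bsub>left_dual R M\<^esub> k)"
    by (auto simp: restrict_def fun_eq_iff R.a_assoc)
qed

end

lemma left_dual_hom: "f \<in> carrier (left_dual R M) \<Longrightarrow> f \<in> left_hom R M (regular_bimodule R)"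
  by (simp add: left_dual_iff)

lemma left_dual_add_hom: "f \<in> carrier (left_dual R M) \<Longrightarrow> f \<in> add_hom M R"
  using left_homD[OF left_dual_hom] by simp

lemma left_dual_smult:
  "f \<in> carrier (left_dual R M) \<Longrightarrow> r \<in> carrier R \<Longrightarrow> x \<in> carrier M \<Longrightarrow> f (r \<odot>\<^bsub>M\<^esub> x) = r \<otimes>\<^bsub>R\<^esub> f x"
  using left_hom_smult[OF left_dual_hom] by simp

text \<open>\<open>convolution\<close> lifts into the ring record \<open>R\<close>, whereas left
  linearity is a statement about the regular bimodule. The two records have the same additive
  structure, and the two lifts agree on the carrier.\<close>

lemma lift_regular:
  assumes M: "bimodule R M" and N: "bimodule R N" and b: "balanced R M N R \<beta>"
    and l: "\<And>r x y. r \<in> carrier R \<Longrightarrow> x \<in> carrier M \<Longrightarrow> y \<in> carrier N \<Longrightarrow> \<beta> (r \<odot>\<^bsub>M\<^esub> x) y = r \<otimes>\<^bsub>R\<^esub> \<beta> x y"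
  shows "lift R (\<lambda>(x, y). \<beta> x y) \<in> left_hom R (tensor R M N) (regular_bimodule R)"
proof -
  note R = bimodule_ring[OF M]
  interpret T: bimodule R "tensor R M N" by (rule tensor_bimodule[OF M N])
  have b': "balanced R M N (regular_bimodule R) \<beta>" using b by (simp add: balanced_def)
  let ?g = "lift (regular_bimodule R) (\<lambda>(x, y). \<beta> x y)"
  have g: "?g \<in> left_hom R (tensor R M N) (regular_bimodule R)"
    by (rule lift_tensor_left_hom[OF M N bimodule_left_module[OF regular_bimodule[OF R]] b']) (simp add: l)
  have "lift R (\<lambda>(x, y). \<beta> x y) t = ?g t" if "t \<in> carrier (tensor R M N)" for t
    by (rule lift_tensor_eq_hom[OF M N ring_abelian[OF R] _ _ that])
      (use left_homD[OF g] lift_tens[OF M N b' bimodule_abelian[OF regular_bimodule[OF R]]] in auto)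
  then show ?thesis using g by (auto simp: left_hom_def add_hom_def T.smult_closed)
qed

lemma rsmult_value_balanced:
  assumes M: "bimodule R M" and N: "bimodule R N" and g: "g \<in> left_hom R N (regular_bimodule R)"
  shows "balanced R M N M (\<lambda>x y. x \<triangleleft>\<^bsub>M\<^esub> g y)"
proof -
  interpret M: bimodule R M by (rule M)
  have gc: "g y \<in> carrier R" if "y \<in> carrier N" for y using add_hom_closed[OF left_homD[OF g] that] by simp
  show ?thesis
    using add_hom_add[OF left_homD[OF g]] left_hom_smult[OF g]
    by (intro balancedI add_homI) (simp_all add: gc M.rsmult_closed M.rsmult_r_distr M.rsmult_l_distr M.rsmult_assoc)
qed

text \<open>Left linearity of \<open>g\<close> balances \<open>x g(y)\<close> across the tensor
  sign, and additivity of \<open>f\<close> preserves this. This is why the convolution of left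
  linear functionals puts the value of the second inside the argument of the first.\<close>

lemma conv_balanced:
  assumes M: "bimodule R M" and N: "bimodule R N" and f: "f \<in> left_hom R M (regular_bimodule R)"
    and g: "g \<in> left_hom R N (regular_bimodule R)"
  shows "balanced R M N R (\<lambda>x y. f (x \<triangleleft>\<^bsub>M\<^esub> g y))"
  by (rule balanced_comp[OF rsmult_value_balanced[OF M N g]]) (use left_homD[OF f] in simp)

lemma conv_left_hom:
  assumes M: "bimodule R M" and N: "bimodule R N" and f: "f \<in> left_hom R M (regular_bimodule R)"
    and g: "g \<in> left_hom R N (regular_bimodule R)"
  shows "lift R (\<lambda>(x, y). f (x \<triangleleft>\<^bsub>M\<^esub> g y)) \<in> left_hom R (tensor R M N) (regular_bimodule R)"
proof (rule lift_regular[OF M N conv_balanced[OF M N f g]])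
  interpret M: bimodule R M by (rule M)
  fix r x y assume r: "r \<in> carrier R" and x: "x \<in> carrier M" and y: "y \<in> carrier N"
  have "g y \<in> carrier R" using add_hom_closed[OF left_homD[OF g] y] by simp
  then show "f ((r \<odot>\<^bsub>M\<^esub> x) \<triangleleft>\<^bsub>M\<^esub> g y) = r \<otimes>\<^bsub>R\<^esub> f (x \<triangleleft>\<^bsub>M\<^esub> g y)"
    using r x left_hom_smult[OF f, of r "x \<triangleleft>\<^bsub>M\<^esub> g y"] by (simp add: M.bimodule_assoc M.rsmult_closed)
qed

lemma graded_dual_sel [simp]:
  "rcomp (graded_dual R D) n = left_dual R (ccomp D n)" "gmult (graded_dual R D) = convolution R D"
  "gone (graded_dual R D) = restrict (counit D) (carrier (ccomp D 0))"
  by (simp_all add: graded_dual_def)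

context graded_coring
begin

interpretation CC: bimodule R "ccomp C n" for n
  by (rule ccomp_bimodule)

lemma convolution_closed:
  assumes "f \<in> carrier (left_dual R (ccomp C m))" "g \<in> carrier (left_dual R (ccomp C n))"
  shows "convolution R C m n f g \<in> carrier (left_dual R (ccomp C (m + n)))"
  unfolding convolution_def
  by (rule CC.restrict_left_dual)
    (rule left_hom_comp[OF comult_left_hom conv_left_hom[OF ccomp_bimodule ccomp_bimodule left_dual_hom[OF assms(1)] left_dual_hom[OF assms(2)]]])

text \<open>Associativity is \<open>coassoc_lift\<close> for the trilinear map
  \<open>f(x g(y k(z)))\<close>, and the unit laws are the counit laws. The work lies in rewriting
  each iterated convolution as a nested lift.\<close>

lemma graded_ring_graded_dual: "graded_ring (graded_dual R C)"
proof (rule graded_ring.intro)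
  note B = ccomp_bimodule and Rab = R.abelian_group_axioms
  note hom = left_dual_hom
  have cb: "balanced R (ccomp C m) (ccomp C n) R (\<lambda>x y. f (x \<triangleleft>\<^bsub>ccomp C m\<^esub> g y))"
    if "f \<in> carrier (left_dual R (ccomp C m))" "g \<in> carrier (left_dual R (ccomp C n))" for f g m n
    by (rule conv_balanced[OF B B hom[OF that(1)] hom[OF that(2)]])
  have val: "f x \<in> carrier R" if "f \<in> carrier (left_dual R (ccomp C n))" "x \<in> carrier (ccomp C n)" for f x n
    by (rule add_hom_closed[OF left_dual_add_hom[OF that(1)] that(2)])
  fix m n p
  show "abelian_group (rcomp (graded_dual R C) n)" by (simp add: CC.left_dual_abelian)
  show "gmult (graded_dual R C) m n f g \<in> carrier (rcomp (graded_dual R C) (m + n))"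
    if "f \<in> carrier (rcomp (graded_dual R C) m)" "g \<in> carrier (rcomp (graded_dual R C) n)" for f g
    using that by (simp add: convolution_closed)
  show "gmult (graded_dual R C) m n (f \<oplus>\<^bsub>rcomp (graded_dual R C) m\<^esub> f') g =
      gmult (graded_dual R C) m n f g \<oplus>\<^bsub>rcomp (graded_dual R C) (m + n)\<^esub> gmult (graded_dual R C) m n f' g"
    if f0: "f \<in> carrier (rcomp (graded_dual R C) m)" "f' \<in> carrier (rcomp (graded_dual R C) m)" "g \<in> carrier (rcomp (graded_dual R C) n)" for f f' g
  proof -
    have f: "f \<in> carrier (left_dual R (ccomp C m))" "f' \<in> carrier (left_dual R (ccomp C m))" "g \<in> carrier (left_dual R (ccomp C n))"
      using f0 by simp_all
    have s: "f \<oplus>\<^bsub>left_dual R (ccomp C m)\<^esub> f' \<in> carrier (left_dual R (ccomp C m))"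
      using abelian_group.axioms(1)[OF CC.left_dual_abelian, of m] f by (intro abelian_monoid.a_closed) auto
    have "lift R (\<lambda>(x, y). (f \<oplus>\<^bsub>left_dual R (ccomp C m)\<^esub> f') (x \<triangleleft>\<^bsub>ccomp C m\<^esub> g y)) t =
        lift R (\<lambda>(x, y). f (x \<triangleleft>\<^bsub>ccomp C m\<^esub> g y)) t \<oplus>\<^bsub>R\<^esub> lift R (\<lambda>(x, y). f' (x \<triangleleft>\<^bsub>ccomp C m\<^esub> g y)) t"
      if t: "t \<in> carrier (tensor R (ccomp C m) (ccomp C n))" for t
      by (rule tensor_hom_ext[OF B B lift_tensor_hom[OF B B cb[OF s f(3)] Rab] add_hom_plus[OF lift_tensor_hom[OF B B cb[OF f(1,3)] Rab]
              lift_tensor_hom[OF B B cb[OF f(2,3)] Rab] Rab] _ t])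
        (simp add: lift_tens[OF B B cb[OF s f(3)] Rab, simplified] lift_tens[OF B B cb[OF f(1,3)] Rab] lift_tens[OF B B cb[OF f(2,3)] Rab]
          CC.rsmult_closed val[OF f(3)])
    then show ?thesis by (auto simp: convolution_def fun_eq_iff restrict_def comult_closed)
  qed
  show "gmult (graded_dual R C) m n f (g \<oplus>\<^bsub>rcomp (graded_dual R C) n\<^esub> g') =
      gmult (graded_dual R C) m n f g \<oplus>\<^bsub>rcomp (graded_dual R C) (m + n)\<^esub> gmult (graded_dual R C) m n f g'"
    if f0: "f \<in> carrier (rcomp (graded_dual R C) m)" "g \<in> carrier (rcomp (graded_dual R C) n)" "g' \<in> carrier (rcomp (graded_dual R C) n)" for f g g'
  proof -
    have f: "f \<in> carrier (left_dual R (ccomp C m))" "g \<in> carrier (left_dual R (ccomp C n))" "g' \<in> carrier (left_dual R (ccomp C n))"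
      using f0 by simp_all
    have s: "g \<oplus>\<^bsub>left_dual R (ccomp C n)\<^esub> g' \<in> carrier (left_dual R (ccomp C n))"
      using abelian_group.axioms(1)[OF CC.left_dual_abelian, of n] f by (intro abelian_monoid.a_closed) auto
    have "lift R (\<lambda>(x, y). f (x \<triangleleft>\<^bsub>ccomp C m\<^esub> (g \<oplus>\<^bsub>left_dual R (ccomp C n)\<^esub> g') y)) t =
        lift R (\<lambda>(x, y). f (x \<triangleleft>\<^bsub>ccomp C m\<^esub> g y)) t \<oplus>\<^bsub>R\<^esub> lift R (\<lambda>(x, y). f (x \<triangleleft>\<^bsub>ccomp C m\<^esub> g' y)) t"
      if t: "t \<in> carrier (tensor R (ccomp C m) (ccomp C n))" for t
      by (rule tensor_hom_ext[OF B B lift_tensor_hom[OF B B cb[OF f(1) s] Rab] add_hom_plus[OF lift_tensor_hom[OF B B cb[OF f(1,2)] Rab]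
              lift_tensor_hom[OF B B cb[OF f(1,3)] Rab] Rab] _ t])
        (simp add: lift_tens[OF B B cb[OF f(1) s] Rab, simplified] lift_tens[OF B B cb[OF f(1,2)] Rab] lift_tens[OF B B cb[OF f(1,3)] Rab]
          CC.rsmult_closed CC.rsmult_r_distr val[OF f(2)] val[OF f(3)] add_hom_add[OF left_dual_add_hom[OF f(1)]])
    then show ?thesis by (auto simp: convolution_def fun_eq_iff restrict_def comult_closed)
  qed
  show "gmult (graded_dual R C) (m + n) p (gmult (graded_dual R C) m n f g) k =
      gmult (graded_dual R C) m (n + p) f (gmult (graded_dual R C) n p g k)"
    if f0: "f \<in> carrier (rcomp (graded_dual R C) m)" "g \<in> carrier (rcomp (graded_dual R C) n)" "k \<in> carrier (rcomp (graded_dual R C) p)" for f g k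
  proof -
    have f: "f \<in> carrier (left_dual R (ccomp C m))" "g \<in> carrier (left_dual R (ccomp C n))" "k \<in> carrier (left_dual R (ccomp C p))"
      using f0 by simp_all
    let ?F = "\<lambda>x y z. f (x \<triangleleft>\<^bsub>ccomp C m\<^esub> g (y \<triangleleft>\<^bsub>ccomp C n\<^esub> k z))"
    note fg = convolution_closed[OF f(1,2)] and gk = convolution_closed[OF f(2,3)]
    have gz: "(\<lambda>y. g (y \<triangleleft>\<^bsub>ccomp C n\<^esub> k z)) \<in> left_hom R (ccomp C n) (regular_bimodule R)" if z: "z \<in> carrier (ccomp C p)" for z
    proof -
      have "(\<lambda>y. y \<triangleleft>\<^bsub>ccomp C n\<^esub> k z) \<in> left_hom R (ccomp C n) (ccomp C n)"
        using val[OF f(3) z] CC.rsmult_hom by (intro left_homI) (simp_all add: CC.bimodule_assoc)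
      from left_hom_comp[OF this hom[OF f(2)]] show ?thesis .
    qed
    have fx: "(\<lambda>r. f (x \<triangleleft>\<^bsub>ccomp C m\<^esub> r)) \<in> add_hom R R" if x: "x \<in> carrier (ccomp C m)" for x
      using x add_hom_add[OF left_dual_add_hom[OF f(1)]]
      by (intro add_homI) (simp_all add: val[OF f(1)] CC.rsmult_closed CC.rsmult_r_distr)
    have F1: "balanced R (ccomp C m) (ccomp C n) R (\<lambda>x y. ?F x y z)" if "z \<in> carrier (ccomp C p)" for z
      by (rule conv_balanced[OF B B hom[OF f(1)] gz[OF that]])
    have F2: "balanced R (ccomp C n) (ccomp C p) R (?F x)" if "x \<in> carrier (ccomp C m)" for x
      by (rule balanced_comp[OF cb[OF f(2,3)] fx[OF that]])
    have "convolution R C (m + n) p (convolution R C m n f g) k c = convolution R C m (n + p) f (convolution R C n p g k) c"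
      if c: "c \<in> carrier (ccomp C (m + n + p))" for c
    proof -
      have c': "c \<in> carrier (ccomp C (m + (n + p)))" using c by (simp add: add.assoc)
      have "convolution R C (m + n) p (convolution R C m n f g) k c =
          lift R (\<lambda>(t, z). convolution R C m n f g (t \<triangleleft>\<^bsub>ccomp C (m + n)\<^esub> k z)) (comult C (m + n) p c)"
        using c by (simp add: convolution_def)
      also have "\<dots> = lift R (\<lambda>(t, z). lift R (\<lambda>(x, y). ?F x y z) (comult C m n t)) (comult C (m + n) p c)"
      proof (rule lift_tensor_cong[OF cb[OF fg f(3)] B B Rab _ comult_closed[OF c], symmetric])
        fix t z assume t: "t \<in> carrier (ccomp C (m + n))" and z: "z \<in> carrier (ccomp C p)"
        note kz = val[OF f(3) z]
        interpret T: bimodule R "tensor R (ccomp C m) (ccomp C n)" by (rule tensor_bimodule[OF B B])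
        \<comment> \<open>Right multiplication by \<open>k z\<close> acts on the second factor of a
          tensor. As the comultiplication is right linear, the same scalar may be applied before
          comultiplying.\<close>
        have "lift R (\<lambda>(x, y). ?F x y z) s = lift R (\<lambda>(x, y). f (x \<triangleleft>\<^bsub>ccomp C m\<^esub> g y)) (s \<triangleleft>\<^bsub>tensor R (ccomp C m) (ccomp C n)\<^esub> k z)"
          if s: "s \<in> carrier (tensor R (ccomp C m) (ccomp C n))" for s
          by (rule tensor_hom_ext[OF B B lift_tensor_hom[OF B B F1[OF z] Rab]
                add_hom_comp[OF T.rsmult_hom[OF kz] lift_tensor_hom[OF B B cb[OF f(1,2)] Rab]] _ s])
            (simp add: lift_tens[OF B B F1[OF z] Rab] lift_tens[OF B B cb[OF f(1,2)] Rab] tens_rsmult[OF B B] kz CC.rsmult_closed)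
        then show "lift R (\<lambda>(x, y). ?F x y z) (comult C m n t) = convolution R C m n f g (t \<triangleleft>\<^bsub>ccomp C (m + n)\<^esub> k z)"
          using t kz by (simp add: convolution_def CC.rsmult_closed comult_closed right_hom_rsmult[OF comult_right_hom])
      qed
      also have "\<dots> = lift R (\<lambda>(x, t). lift R (\<lambda>(y, z). ?F x y z) (comult C n p t)) (comult C m (n + p) c)"
        by (rule coassoc_lift[OF Rab F1 F2 c])
      also have "\<dots> = lift R (\<lambda>(x, t). f (x \<triangleleft>\<^bsub>ccomp C m\<^esub> convolution R C n p g k t)) (comult C m (n + p) c)"
      proof (rule lift_tensor_cong[OF cb[OF f(1) gk] B B Rab _ comult_closed[OF c']])
        fix x t assume x: "x \<in> carrier (ccomp C m)" and t: "t \<in> carrier (ccomp C (n + p))"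
        show "lift R (\<lambda>(y, z). ?F x y z) (comult C n p t) = f (x \<triangleleft>\<^bsub>ccomp C m\<^esub> convolution R C n p g k t)"
          using lift_tensor_comp[OF B B cb[OF f(2,3)] fx[OF x] Rab Rab comult_closed[OF t]] t by (simp add: convolution_def)
      qed
      also have "\<dots> = convolution R C m (n + p) f (convolution R C n p g k) c"
        using c' by (simp add: convolution_def)
      finally show ?thesis .
    qed
    then show ?thesis by (simp add: convolution_def fun_eq_iff restrict_def add.assoc)
  qed
  note ch = bimodule_homD(1)[OF counit_hom]
  show "gone (graded_dual R C) \<in> carrier (rcomp (graded_dual R C) 0)"
    using CC.restrict_left_dual[OF ch] by simp
  show "gmult (graded_dual R C) 0 n (gone (graded_dual R C)) f = f" if f0: "f \<in> carrier (rcomp (graded_dual R C) n)" for f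
  proof -
    have f: "f \<in> carrier (left_dual R (ccomp C n))" using f0 by simp
    have e: "lift R (\<lambda>(x, y). restrict (counit C) (carrier (ccomp C 0)) (x \<triangleleft>\<^bsub>ccomp C 0\<^esub> f y)) (comult C 0 n c) = f c"
      if c: "c \<in> carrier (ccomp C n)" for c
      by (rule counit_left_lift[OF left_dual_add_hom[OF f] Rab c])
        (simp add: val[OF f] CC.rsmult_closed counit_closed left_dual_smult[OF f] right_hom_rsmult[OF bimodule_homD(2)[OF counit_hom], simplified])
    show ?thesis
      by (rule left_dual_eqI[of _ R "ccomp C n"])
        (use f e convolution_closed[OF CC.restrict_left_dual[OF ch] f] in \<open>auto simp: convolution_def\<close>)
  qed
  show "gmult (graded_dual R C) n 0 f (gone (graded_dual R C)) = f" if f0: "f \<in> carrier (rcomp (graded_dual R C) n)" for f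
  proof -
    have f: "f \<in> carrier (left_dual R (ccomp C n))" using f0 by simp
    have e: "lift R (\<lambda>(x, y). f (x \<triangleleft>\<^bsub>ccomp C n\<^esub> restrict (counit C) (carrier (ccomp C 0)) y)) (comult C n 0 c) = f c"
      if c: "c \<in> carrier (ccomp C n)" for c
      by (rule counit_right_lift[OF left_dual_add_hom[OF f] Rab c]) simp
    show ?thesis
      by (rule left_dual_eqI[of _ R "ccomp C n"])
        (use f e convolution_closed[OF f CC.restrict_left_dual[OF ch]] in \<open>auto simp: convolution_def\<close>)
  qed
qed

end

section \<open>Transport of structure\<close>

text \<open>The ring axioms of \<open>B\<close> are pulled back along the injective \<open>h\<close>
  from those of \<open>B'\<close>. For \<open>Ext_ring\<close> this saves a direct verification of
  associativity and of the unit laws on cohomology classes.\<close>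

lemma graded_ring_isoI:
  assumes B': "graded_ring B'" and grp: "\<And>n. abelian_group (rcomp B n)"
    and h: "\<And>n. h n \<in> add_hom (rcomp B n) (rcomp B' n)" and bij: "\<And>n. bij_betw (h n) (carrier (rcomp B n)) (carrier (rcomp B' n))"
    and mc: "\<And>m n x y. x \<in> carrier (rcomp B m) \<Longrightarrow> y \<in> carrier (rcomp B n) \<Longrightarrow> gmult B m n x y \<in> carrier (rcomp B (m + n))"
    and hm: "\<And>m n x y. x \<in> carrier (rcomp B m) \<Longrightarrow> y \<in> carrier (rcomp B n) \<Longrightarrow>
      h (m + n) (gmult B m n x y) = gmult B' m n (h m x) (h n y)"
    and oc: "gone B \<in> carrier (rcomp B 0)" and ho: "h 0 (gone B) = gone B'"
  shows "graded_ring_iso B B' h"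
proof -
  interpret B': graded_ring B' by (rule B')
  have inj: "x = y" if "h n x = h n y" "x \<in> carrier (rcomp B n)" "y \<in> carrier (rcomp B n)" for n x y
    using bij[of n] that by (auto simp: bij_betw_def inj_on_def)
  note hc = add_hom_closed[OF h] and ha = add_hom_add[OF h]
  have ac: "x \<oplus>\<^bsub>rcomp B n\<^esub> y \<in> carrier (rcomp B n)" if "x \<in> carrier (rcomp B n)" "y \<in> carrier (rcomp B n)" for n x y
    using that abelian_group.axioms(1)[OF grp, of n] by (intro abelian_monoid.a_closed)
  have "graded_ring B"
  proof (rule graded_ring.intro)
    fix m n p x y z
    assume x: "x \<in> carrier (rcomp B m)" and y: "y \<in> carrier (rcomp B n)" and z: "z \<in> carrier (rcomp B p)"
    show "gmult B (m + n) p (gmult B m n x y) z = gmult B m (n + p) x (gmult B n p y z)"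
    proof (rule inj)
      show "h (m + n + p) (gmult B (m + n) p (gmult B m n x y) z) = h (m + n + p) (gmult B m (n + p) x (gmult B n p y z))"
        using hm[OF mc[OF x y] z] hm[OF x y] hm[OF x mc[OF y z]] hm[OF y z] B'.gmult_assoc[OF hc[OF x] hc[OF y] hc[OF z]]
        by (simp add: add.assoc)
      show "gmult B (m + n) p (gmult B m n x y) z \<in> carrier (rcomp B (m + n + p))" by (rule mc[OF mc[OF x y] z])
      show "gmult B m (n + p) x (gmult B n p y z) \<in> carrier (rcomp B (m + n + p))"
        using mc[OF x mc[OF y z]] by (simp add: add.assoc)
    qed
  next
    fix m n x x' y
    assume x: "x \<in> carrier (rcomp B m)" "x' \<in> carrier (rcomp B m)" and y: "y \<in> carrier (rcomp B n)"
    show "gmult B m n (x \<oplus>\<^bsub>rcomp B m\<^esub> x') y = gmult B m n x y \<oplus>\<^bsub>rcomp B (m + n)\<^esub> gmult B m n x' y"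
      by (rule inj[of "m + n"]) (simp_all add: x y ac mc hm ha hc B'.gmult_l_distr)
  next
    fix m n x y y'
    assume x: "x \<in> carrier (rcomp B m)" and y: "y \<in> carrier (rcomp B n)" "y' \<in> carrier (rcomp B n)"
    show "gmult B m n x (y \<oplus>\<^bsub>rcomp B n\<^esub> y') = gmult B m n x y \<oplus>\<^bsub>rcomp B (m + n)\<^esub> gmult B m n x y'"
      by (rule inj[of "m + n"]) (simp_all add: x y ac mc hm ha hc B'.gmult_r_distr)
  next
    fix n x assume x: "x \<in> carrier (rcomp B n)"
    show "gmult B 0 n (gone B) x = x"
      using hm[OF oc x] mc[OF oc x] x by (intro inj[of n]) (simp_all add: ho hc B'.gone_l)
    show "gmult B n 0 x (gone B) = x"
      using hm[OF x oc] mc[OF x oc] x by (intro inj[of n]) (simp_all add: ho hc B'.gone_r)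
  qed (simp_all add: grp mc oc)
  moreover have "h n \<in> iso (add_monoid (rcomp B n)) (add_monoid (rcomp B' n))" for n
    using bij[of n] hc ha by (auto simp: iso_def hom_def)
  ultimately show ?thesis using B' hm ho by (simp add: graded_ring_iso_def)
qed

lemma bimodule_hom_inv_into:
  assumes M: "bimodule R M" and N: "bimodule R N" and h: "h \<in> bimodule_hom R M N" and bij: "bij_betw h (carrier M) (carrier N)"
  shows "inv_into (carrier M) h \<in> bimodule_hom R N M"
proof -
  interpret M: bimodule R M by (rule M)
  interpret N: bimodule R N by (rule N)
  let ?k = "inv_into (carrier M) h"
  have k: "?k d \<in> carrier M" "h (?k d) = d" if "d \<in> carrier N" for d
    using bij that by (auto simp: bij_betw_def inv_into_into f_inv_into_f)
  have kh: "?k (h c) = c" if "c \<in> carrier M" for c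
    using bij that by (simp add: bij_betw_def inv_into_f_f)
  have "?k (x \<oplus>\<^bsub>N\<^esub> y) = ?k x \<oplus>\<^bsub>M\<^esub> ?k y" if "x \<in> carrier N" "y \<in> carrier N" for x y
    using that k[OF that(1)] k[OF that(2)] kh[of "?k x \<oplus>\<^bsub>M\<^esub> ?k y"] by (simp add: add_hom_add[OF bimodule_homD(3)[OF h]])
  moreover have "?k (r \<odot>\<^bsub>N\<^esub> x) = r \<odot>\<^bsub>M\<^esub> ?k x \<and> ?k (x \<triangleleft>\<^bsub>N\<^esub> r) = ?k x \<triangleleft>\<^bsub>M\<^esub> r"
    if "r \<in> carrier R" "x \<in> carrier N" for r x
    using that k[OF that(2)] kh[of "r \<odot>\<^bsub>M\<^esub> ?k x"] kh[of "?k x \<triangleleft>\<^bsub>M\<^esub> r"]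
    by (simp add: left_hom_smult[OF bimodule_homD(1)[OF h]] right_hom_rsmult[OF bimodule_homD(2)[OF h]] M.smult_closed M.rsmult_closed)
  ultimately show ?thesis using k(1) by (auto simp: bimodule_hom_def)
qed

text \<open>The dual device: compatibility with a bijective bimodule map determines the structure
  maps of \<open>D\<close>, so the coring axioms carry over from \<open>C\<close>. In particular
  \<open>Tor_coring\<close> is a coring as soon as its comultiplication is known on the image of
  \<open>C\<close>.\<close>

lemma graded_coring_isoI:
  fixes C :: "('r, 'c, 'l) graded_coring_scheme" and D :: "('r, 'd, 'l2) graded_coring_scheme"
  assumes C: "graded_coring R C" and DB: "\<And>n. bimodule R (ccomp D n)"
    and h: "\<And>n. h n \<in> bimodule_hom R (ccomp C n) (ccomp D n)" and bij: "\<And>n. bij_betw (h n) (carrier (ccomp C n)) (carrier (ccomp D n))"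
    and hm: "\<And>m n c. c \<in> carrier (ccomp C (m + n)) \<Longrightarrow>
      comult D m n (h (m + n) c) = tensor_map R (ccomp D m) (ccomp D n) (h m) (h n) (comult C m n c)"
    and he: "\<And>c. c \<in> carrier (ccomp C 0) \<Longrightarrow> counit D (h 0 c) = counit C c"
  shows "graded_coring_iso R C D h"
proof -
  interpret C: graded_coring R C by (rule C)
  note CB = C.ccomp_bimodule
  interpret CC: bimodule R "ccomp C n" for n by (rule CB)
  interpret DD: bimodule R "ccomp D n" for n by (rule DB)
  note hl = bimodule_homD(1)[OF h] and hr = bimodule_homD(2)[OF h] and hh = bimodule_homD(3)[OF h]
  note hc = add_hom_closed[OF hh]
  define k where "k n = inv_into (carrier (ccomp C n)) (h n)" for n
  have k: "k n d \<in> carrier (ccomp C n)" "h n (k n d) = d" if "d \<in> carrier (ccomp D n)" for n d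
    using bij[of n] that by (auto simp: k_def bij_betw_def inv_into_into f_inv_into_f)
  have kB: "k n \<in> bimodule_hom R (ccomp D n) (ccomp C n)" for n
    unfolding k_def by (rule bimodule_hom_inv_into[OF CB DB h bij])
  note kl = bimodule_homD(1)[OF kB] and kr = bimodule_homD(2)[OF kB]
  have tl: "tensor_map R (ccomp D m) (ccomp D n) (h m) (h n) \<in> left_hom R (tensor R (ccomp C m) (ccomp C n)) (tensor R (ccomp D m) (ccomp D n))"
    and tr: "tensor_map R (ccomp D m) (ccomp D n) (h m) (h n) \<in> right_hom R (tensor R (ccomp C m) (ccomp C n)) (tensor R (ccomp D m) (ccomp D n))" for m n
    by (rule tensor_map_left_hom[OF CB CB DB DB hr hl hl], rule tensor_map_right_hom[OF CB CB DB DB hr hl hr])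
  have ceq: "comult D m n d = tensor_map R (ccomp D m) (ccomp D n) (h m) (h n) (comult C m n (k (m + n) d))"
    if "d \<in> carrier (ccomp D (m + n))" for m n d
    using hm[OF k(1)[OF that]] k(2)[OF that] by simp
  have cD: "comult D m n \<in> bimodule_hom R (ccomp D (m + n)) (tensor R (ccomp D m) (ccomp D n))" for m n
  proof -
    have "(\<lambda>d. tensor_map R (ccomp D m) (ccomp D n) (h m) (h n) (comult C m n (k (m + n) d)))
        \<in> bimodule_hom R (ccomp D (m + n)) (tensor R (ccomp D m) (ccomp D n))"
      using left_hom_comp[OF left_hom_comp[OF kl C.comult_left_hom] tl] right_hom_comp[OF right_hom_comp[OF kr C.comult_right_hom] tr]
      by (simp add: bimodule_hom_iff)
    then show ?thesis
      using ceq[of _ m n] by (auto simp: bimodule_hom_def DD.smult_closed DD.rsmult_closed)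
  qed
  note cDc = add_hom_closed[OF bimodule_homD(3)[OF cD]]
  have lift_h: "lift X (\<lambda>(x, y). \<beta> x y) (comult D m n (h (m + n) c)) = lift X (\<lambda>(x, y). \<beta> (h m x) (h n y)) (comult C m n c)"
    if "balanced R (ccomp D m) (ccomp D n) X \<beta>" "abelian_group X" "c \<in> carrier (ccomp C (m + n))" for X :: "('x, 'l3) ring_scheme" and \<beta> m n c
    unfolding hm[OF that(3)] by (rule lift_tensor_map(1)[OF CB CB DB DB hr hl that(1,2) C.comult_closed[OF that(3)]])
  have bal_h: "balanced R (ccomp C m) (ccomp C n) X (\<lambda>x y. \<beta> (h m x) (h n y))"
    if "balanced R (ccomp D m) (ccomp D n) X \<beta>" for X :: "('x, 'l3) ring_scheme" and \<beta> m n
    by (rule balanced_comp_left[OF balanced_comp_right[OF that hl] hr])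
  have cuD: "counit D \<in> bimodule_hom R (ccomp D 0) (regular_bimodule R)"
  proof -
    have "(\<lambda>d. counit C (k 0 d)) \<in> bimodule_hom R (ccomp D 0) (regular_bimodule R)"
      using left_hom_comp[OF kl bimodule_homD(1)[OF C.counit_hom]] right_hom_comp[OF kr bimodule_homD(2)[OF C.counit_hom]]
      by (simp add: bimodule_hom_iff)
    moreover have "counit D d = counit C (k 0 d)" if "d \<in> carrier (ccomp D 0)" for d
      using he[OF k(1)[OF that]] k(2)[OF that] by simp
    ultimately show ?thesis
      by (auto simp: bimodule_hom_def DD.smult_closed DD.rsmult_closed)
  qed
  have cuDc: "counit D d \<in> carrier R" if "d \<in> carrier (ccomp D 0)" for d
    using add_hom_closed[OF bimodule_homD(3)[OF cuD] that] by simp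
  have "graded_coring R D"
  proof (rule graded_coring.intro[OF C.R.ring_axioms], rule graded_coring_axioms.intro)
    show "counit D \<in> bimodule_hom R (ccomp D 0) (regular_bimodule R)" by (rule cuD)
  next
    fix d m n p assume d: "d \<in> carrier (ccomp D (m + n + p))"
    define c where "c = k (m + n + p) d"
    have c: "c \<in> carrier (ccomp C (m + n + p))" "d = h (m + n + p) c" using k[OF d] by (simp_all add: c_def)
    have c': "c \<in> carrier (ccomp C (m + (n + p)))" "d = h (m + (n + p)) c" using c by (simp_all add: add.assoc)
    let ?T = "tensor R (ccomp D m) (tensor R (ccomp D n) (ccomp D p))"
    \<comment> \<open>Pulled back along \<open>h\<close>, the claim becomes coassociativity of
      \<open>C\<close> for the trilinear map
      \<open>(x, y, z) \<mapsto> h x \<otimes> (h y \<otimes> h z)\<close>.\<close>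
    let ?F = "\<lambda>x y z. tens R (ccomp D m) (tensor R (ccomp D n) (ccomp D p)) x (tens R (ccomp D n) (ccomp D p) y z)"
    note NP = tensor_bimodule[OF DB DB]
    note T = bimodule_abelian[OF tensor_bimodule[OF DB NP]]
    note F1 = tens_tens_balanced[OF DB DB DB]
    have F2: "balanced R (ccomp D n) (ccomp D p) ?T (?F x)" if "x \<in> carrier (ccomp D m)" for x
      by (rule balanced_comp[OF balanced_tens[OF DB DB] balancedD(1)[OF balanced_tens[OF DB NP] that]])
    note tL = tensor_assoc_balanced[OF DB DB DB, of m n p]
    have "tensor_assoc R (ccomp D m) (ccomp D n) (ccomp D p)
        (tensor_map R (tensor R (ccomp D m) (ccomp D n)) (ccomp D p) (comult D m n) (\<lambda>z. z) (comult D (m + n) p d)) =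
      lift ?T (\<lambda>(t, z). lift ?T (\<lambda>(x, y). ?F x y z) (comult D m n t)) (comult D (m + n) p d)"
      unfolding tensor_assoc_def
      by (rule lift_tensor_map(1)[OF DB DB NP DB bimodule_homD(2)[OF cD] left_hom_ident tL T cDc[OF d]])
    also have "\<dots> = lift ?T (\<lambda>(t, z). lift ?T (\<lambda>(x, y). ?F x y (h p z)) (comult D m n (h (m + n) t))) (comult C (m + n) p c)"
      unfolding c(2) by (rule lift_h[OF balanced_comp_left[OF tL bimodule_homD(2)[OF cD]] T c(1)])
    also have "\<dots> = lift ?T (\<lambda>(t, z). lift ?T (\<lambda>(x, y). ?F (h m x) (h n y) (h p z)) (comult C m n t)) (comult C (m + n) p c)"
      by (rule lift_tensor_cong[OF bal_h[OF balanced_comp_left[OF tL bimodule_homD(2)[OF cD]]] CB CB T _ C.comult_closed[OF c(1)], symmetric])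
        (simp add: lift_h[OF F1 T] hc)
    also have "\<dots> = lift ?T (\<lambda>(x, t). lift ?T (\<lambda>(y, z). ?F (h m x) (h n y) (h p z)) (comult C n p t)) (comult C m (n + p) c)"
      by (rule C.coassoc_lift[OF T bal_h[OF F1[OF hc]] bal_h[OF F2[OF hc]] c(1)])
    also have "\<dots> = lift ?T (\<lambda>(x, t). tens R (ccomp D m) (tensor R (ccomp D n) (ccomp D p)) (h m x) (comult D n p (h (n + p) t))) (comult C m (n + p) c)"
    proof (rule lift_tensor_cong[OF bal_h[OF balanced_comp_right[OF balanced_tens[OF DB NP] bimodule_homD(1)[OF cD]]] CB CB T _ C.comult_closed[OF c'(1)]])
      fix x t assume x: "x \<in> carrier (ccomp C m)" and t: "t \<in> carrier (ccomp C (n + p))"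
      have b: "balanced R (ccomp C n) (ccomp C p) (tensor R (ccomp D n) (ccomp D p)) (\<lambda>y z. tens R (ccomp D n) (ccomp D p) (h n y) (h p z))"
        by (rule bal_h[OF balanced_tens[OF DB DB]])
      show "lift ?T (\<lambda>(y, z). ?F (h m x) (h n y) (h p z)) (comult C n p t) =
          tens R (ccomp D m) (tensor R (ccomp D n) (ccomp D p)) (h m x) (comult D n p (h (n + p) t))"
        unfolding hm[OF t] tensor_map_def
        by (rule lift_tensor_comp[OF CB CB b balancedD(1)[OF balanced_tens[OF DB NP] hc[OF x]] bimodule_abelian[OF NP] T C.comult_closed[OF t], symmetric])
    qed
    also have "\<dots> = tensor_map R (ccomp D m) (tensor R (ccomp D n) (ccomp D p)) (\<lambda>x. x) (comult D n p) (comult D m (n + p) d)"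
      unfolding tensor_map_def[of R "ccomp D m" "tensor R (ccomp D n) (ccomp D p)"] c'(2)
      by (rule lift_h[OF balanced_comp_right[OF balanced_tens[OF DB NP] bimodule_homD(1)[OF cD]] T c'(1), symmetric])
    finally show "tensor_assoc R (ccomp D m) (ccomp D n) (ccomp D p)
        (tensor_map R (tensor R (ccomp D m) (ccomp D n)) (ccomp D p) (comult D m n) (\<lambda>z. z) (comult D (m + n) p d)) =
      tensor_map R (ccomp D m) (tensor R (ccomp D n) (ccomp D p)) (\<lambda>x. x) (comult D n p) (comult D m (n + p) d)" .
  next
    fix d n assume d: "d \<in> carrier (ccomp D n)"
    define c where "c = k n d"
    have c: "c \<in> carrier (ccomp C n)" "d = h n c" using k[OF d] by (simp_all add: c_def)
    note ab = DD.M.abelian_group_axioms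
    have cl: "comult C 0 n c \<in> carrier (tensor R (ccomp C 0) (ccomp C n))" "comult C n 0 c \<in> carrier (tensor R (ccomp C n) (ccomp C 0))"
      using C.comult_closed[of c 0 n] C.comult_closed[of c n 0] c(1) by simp_all
    have g: "h n \<in> add_hom (ccomp C n) (ccomp D n)" by (rule hh)
    have "lift (ccomp D n) (\<lambda>(x, y). counit D x \<odot>\<^bsub>ccomp D n\<^esub> y) (comult D 0 n d) =
        lift (ccomp D n) (\<lambda>(x, y). counit D x \<odot>\<^bsub>ccomp D n\<^esub> y)
          (tensor_map R (ccomp D 0) (ccomp D n) (h 0) (h n) (comult C 0 n c))"
      using hm[of c 0 n] c by simp
    also have "\<dots> = lift (ccomp D n) (\<lambda>(x, y). counit D (h 0 x) \<odot>\<^bsub>ccomp D n\<^esub> h n y) (comult C 0 n c)"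
    proof (rule lift_tensor_map(1)[OF CB CB DB DB hr hl _ ab cl(1)])
      show "balanced R (ccomp D 0) (ccomp D n) (ccomp D n) (\<lambda>x y. counit D x \<odot>\<^bsub>ccomp D n\<^esub> y)"
        by (intro balancedI add_homI)
          (simp_all add: cuDc DD.smult_closed DD.smult_r_distr DD.smult_l_distr DD.smult_assoc
            add_hom_add[OF bimodule_homD(3)[OF cuD]] right_hom_rsmult[OF bimodule_homD(2)[OF cuD]])
    qed
    also have "\<dots> = d" unfolding c(2)
      by (rule C.counit_left_lift[OF g ab c(1)]) (simp add: he C.counit_closed left_hom_smult[OF hl])
    finally show "lift (ccomp D n) (\<lambda>(x, y). counit D x \<odot>\<^bsub>ccomp D n\<^esub> y) (comult D 0 n d) = d" .
    have "lift (ccomp D n) (\<lambda>(x, y). x \<triangleleft>\<^bsub>ccomp D n\<^esub> counit D y) (comult D n 0 d) =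
        lift (ccomp D n) (\<lambda>(x, y). x \<triangleleft>\<^bsub>ccomp D n\<^esub> counit D y)
          (tensor_map R (ccomp D n) (ccomp D 0) (h n) (h 0) (comult C n 0 c))"
      using hm[of c n 0] c by simp
    also have "\<dots> = lift (ccomp D n) (\<lambda>(x, y). h n x \<triangleleft>\<^bsub>ccomp D n\<^esub> counit D (h 0 y)) (comult C n 0 c)"
    proof (rule lift_tensor_map(1)[OF CB CB DB DB hr hl _ ab cl(2)])
      show "balanced R (ccomp D n) (ccomp D 0) (ccomp D n) (\<lambda>x y. x \<triangleleft>\<^bsub>ccomp D n\<^esub> counit D y)"
        by (intro balancedI add_homI)
          (simp_all add: cuDc DD.rsmult_closed DD.rsmult_r_distr DD.rsmult_l_distr DD.rsmult_assoc
            add_hom_add[OF bimodule_homD(3)[OF cuD]] left_hom_smult[OF bimodule_homD(1)[OF cuD]])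
    qed
    also have "\<dots> = d" unfolding c(2)
      by (rule C.counit_right_lift[OF g ab c(1)]) (simp add: he C.counit_closed right_hom_rsmult[OF hr])
    finally show "lift (ccomp D n) (\<lambda>(x, y). x \<triangleleft>\<^bsub>ccomp D n\<^esub> counit D y) (comult D n 0 d) = d" .
  qed (rule DB, rule cD)
  then show ?thesis using C h bij hm he by (simp add: graded_coring_iso_def)
qed

lemma graded_ring_iso_trans:
  assumes "graded_ring_iso B B' f" "graded_ring_iso B' B'' g"
    and "\<And>n x. x \<in> carrier (rcomp B n) \<Longrightarrow> k n x = g n (f n x)"
  shows "graded_ring_iso B B'' k"
proof -
  interpret B: graded_ring B using assms(1) by (simp add: graded_ring_iso_def)
  have f: "f n \<in> iso (add_monoid (rcomp B n)) (add_monoid (rcomp B' n))" for n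
    using assms(1) by (simp add: graded_ring_iso_def)
  have g: "g n \<in> iso (add_monoid (rcomp B' n)) (add_monoid (rcomp B'' n))" for n
    using assms(2) by (simp add: graded_ring_iso_def)
  have fc: "f n x \<in> carrier (rcomp B' n)" if "x \<in> carrier (rcomp B n)" for n x
    using f[of n] that by (auto simp: iso_def hom_def)
  have gf: "g n \<circ> f n \<in> iso (add_monoid (rcomp B n)) (add_monoid (rcomp B'' n))" for n
    by (rule iso_set_trans[OF f g])
  moreover have "x \<oplus>\<^bsub>rcomp B n\<^esub> y \<in> carrier (rcomp B n)" if "x \<in> carrier (rcomp B n)" "y \<in> carrier (rcomp B n)" for n x y
    using that abelian_group.axioms(1)[OF B.rcomp_group] by (intro abelian_monoid.a_closed)
  ultimately have "k n \<in> iso (add_monoid (rcomp B n)) (add_monoid (rcomp B'' n))" for n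
    using gf[of n] assms(3)[of _ n] bij_betw_cong[of "carrier (rcomp B n)" "k n" "g n \<circ> f n"] by (simp add: iso_def hom_def Pi_iff)
  moreover have "k (m + n) (gmult B m n x y) = gmult B'' m n (k m x) (k n y)"
    if "x \<in> carrier (rcomp B m)" "y \<in> carrier (rcomp B n)" for m n x y
    using that assms(1,2) fc B.gmult_closed[OF that] by (simp add: assms(3) graded_ring_iso_def)
  moreover have "k 0 (gone B) = gone B''"
    using assms(1,2) B.gone_closed by (simp add: assms(3) graded_ring_iso_def)
  ultimately show ?thesis using assms(1,2) by (simp add: graded_ring_iso_def)
qed

text \<open>The transpose of the inverse of \<open>h\<close>. Multiplicativity comes from
  compatibility of \<open>h\<close> with comultiplication, and right linearity of \<open>h\<close>
  is needed because convolution multiplies the first argument by a value from the right.\<close>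

lemma graded_dual_iso:
  fixes C :: "('r, 'c, 'l) graded_coring_scheme" and D :: "('r, 'd, 'l2) graded_coring_scheme"
  assumes iso: "graded_coring_iso R C D h"
  shows "graded_ring_iso (graded_dual R C) (graded_dual R D)
    (\<lambda>n \<alpha>. \<lambda>t\<in>carrier (ccomp D n). \<alpha> (inv_into (carrier (ccomp C n)) (h n) t))"
proof -
  interpret C: graded_coring R C using iso by (simp add: graded_coring_iso_def)
  interpret D: graded_coring R D using iso by (simp add: graded_coring_iso_def)
  note CB = C.ccomp_bimodule and DB = D.ccomp_bimodule
  interpret CC: bimodule R "ccomp C n" for n by (rule CB)
  interpret DD: bimodule R "ccomp D n" for n by (rule DB)
  have h: "h n \<in> bimodule_hom R (ccomp C n) (ccomp D n)" and bij: "bij_betw (h n) (carrier (ccomp C n)) (carrier (ccomp D n))" for n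
    using iso by (simp_all add: graded_coring_iso_def)
  note hl = bimodule_homD(1)[OF h] and hr = bimodule_homD(2)[OF h]
  note hc = add_hom_closed[OF bimodule_homD(3)[OF h]]
  note bij_inv_hom = bimodule_hom_inv_into[OF CB DB h bij]
  define k where "k n = inv_into (carrier (ccomp C n)) (h n)" for n
  have k: "k n d \<in> carrier (ccomp C n)" "h n (k n d) = d" if "d \<in> carrier (ccomp D n)" for n d
    using bij[of n] that by (auto simp: k_def bij_betw_def inv_into_into f_inv_into_f)
  have kh: "k n (h n c) = c" if "c \<in> carrier (ccomp C n)" for n c
    using bij[of n] that by (simp add: k_def bij_betw_def inv_into_f_f)
  have kl: "k n \<in> left_hom R (ccomp D n) (ccomp C n)" for n
    unfolding k_def by (rule bimodule_homD(1)[OF bij_inv_hom])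
  define E where "E n \<alpha> = (\<lambda>t\<in>carrier (ccomp D n). \<alpha> (k n t))" for n and \<alpha> :: "'c \<Rightarrow> 'r"
  have Ec: "E n \<alpha> \<in> carrier (left_dual R (ccomp D n))" if "\<alpha> \<in> carrier (left_dual R (ccomp C n))" for n \<alpha>
    unfolding E_def by (rule DD.restrict_left_dual[OF left_hom_comp[OF kl left_dual_hom[OF that]]])
  have Hc: "(\<lambda>t\<in>carrier (ccomp C n). \<beta> (h n t)) \<in> carrier (left_dual R (ccomp C n))" if "\<beta> \<in> carrier (left_dual R (ccomp D n))" for n \<beta>
    by (rule CC.restrict_left_dual[OF left_hom_comp[OF hl left_dual_hom[OF that]]])
  have "graded_ring_iso (graded_dual R C) (graded_dual R D) E"
  proof (rule graded_ring_isoI)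
    show "graded_ring (graded_dual R D)" by (rule D.graded_ring_graded_dual)
  next
    fix n
    show "abelian_group (rcomp (graded_dual R C) n)" by (simp add: CC.left_dual_abelian)
    show "E n \<in> add_hom (rcomp (graded_dual R C) n) (rcomp (graded_dual R D) n)"
      by (rule add_homI) (simp_all only: graded_dual_sel Ec, auto simp: E_def k restrict_def fun_eq_iff)
    show "bij_betw (E n) (carrier (rcomp (graded_dual R C) n)) (carrier (rcomp (graded_dual R D) n))"
    proof (rule bij_betw_byWitness[where f' = "\<lambda>\<beta>. \<lambda>t\<in>carrier (ccomp C n). \<beta> (h n t)"])
      show "\<forall>\<alpha>\<in>carrier (rcomp (graded_dual R C) n). (\<lambda>t\<in>carrier (ccomp C n). E n \<alpha> (h n t)) = \<alpha>"
        by (auto intro!: left_dual_eqI[of _ R "ccomp C n"] Hc Ec) (simp add: E_def hc kh)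
      show "\<forall>\<beta>\<in>carrier (rcomp (graded_dual R D) n). E n (\<lambda>t\<in>carrier (ccomp C n). \<beta> (h n t)) = \<beta>"
        by (auto intro!: left_dual_eqI[of _ R "ccomp D n"] Hc Ec) (simp add: E_def k)
    qed (use Ec Hc in auto)
  next
    fix m n \<alpha> \<beta> assume "\<alpha> \<in> carrier (rcomp (graded_dual R C) m)" "\<beta> \<in> carrier (rcomp (graded_dual R C) n)"
    then have a: "\<alpha> \<in> carrier (left_dual R (ccomp C m))" and b: "\<beta> \<in> carrier (left_dual R (ccomp C n))" by simp_all
    show "gmult (graded_dual R C) m n \<alpha> \<beta> \<in> carrier (rcomp (graded_dual R C) (m + n))"
      by (simp add: C.convolution_closed[OF a b])
    have bc: "\<beta> y \<in> carrier R" if "y \<in> carrier (ccomp C n)" for y by (rule add_hom_closed[OF left_dual_add_hom[OF b] that])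
    have "E (m + n) (convolution R C m n \<alpha> \<beta>) t = convolution R D m n (E m \<alpha>) (E n \<beta>) t" if t: "t \<in> carrier (ccomp D (m + n))" for t
    proof -
      define c where "c = k (m + n) t"
      have c: "c \<in> carrier (ccomp C (m + n))" "t = h (m + n) c" using k[OF t] by (simp_all add: c_def)
      have "convolution R D m n (E m \<alpha>) (E n \<beta>) t =
          lift R (\<lambda>(x, y). E m \<alpha> (x \<triangleleft>\<^bsub>ccomp D m\<^esub> E n \<beta> y)) (tensor_map R (ccomp D m) (ccomp D n) (h m) (h n) (comult C m n c))"
        using t iso c by (simp add: convolution_def graded_coring_iso_def)
      also have "\<dots> = lift R (\<lambda>(x, y). E m \<alpha> (h m x \<triangleleft>\<^bsub>ccomp D m\<^esub> E n \<beta> (h n y))) (comult C m n c)"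
        by (rule lift_tensor_map(1)[OF CB CB DB DB hr hl conv_balanced[OF DB DB left_dual_hom[OF Ec[OF a]] left_dual_hom[OF Ec[OF b]]]
              C.R.abelian_group_axioms C.comult_closed[OF c(1)]])
      also have "\<dots> = lift R (\<lambda>(x, y). \<alpha> (x \<triangleleft>\<^bsub>ccomp C m\<^esub> \<beta> y)) (comult C m n c)"
        by (rule lift_tensor_cong[OF conv_balanced[OF CB CB left_dual_hom[OF a] left_dual_hom[OF b]] CB CB C.R.abelian_group_axioms
              _ C.comult_closed[OF c(1)]])
          (simp add: E_def hc kh bc DD.rsmult_closed right_hom_rsmult[OF hr, symmetric] CC.rsmult_closed)
      also have "\<dots> = E (m + n) (convolution R C m n \<alpha> \<beta>) t"
        using t c(1) by (simp add: E_def convolution_def c_def[symmetric])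
      finally show ?thesis by simp
    qed
    then show "E (m + n) (gmult (graded_dual R C) m n \<alpha> \<beta>) = gmult (graded_dual R D) m n (E m \<alpha>) (E n \<beta>)"
      using left_dual_eqI[OF Ec[OF C.convolution_closed[OF a b]] D.convolution_closed[OF Ec[OF a] Ec[OF b]]] by simp
  next
    have one: "restrict (counit C) (carrier (ccomp C 0)) \<in> carrier (left_dual R (ccomp C 0))"
      by (rule CC.restrict_left_dual[OF bimodule_homD(1)[OF C.counit_hom]])
    then show "gone (graded_dual R C) \<in> carrier (rcomp (graded_dual R C) 0)" by simp
    have "counit D t = counit C (k 0 t)" if "t \<in> carrier (ccomp D 0)" for t
      using iso k[OF that] unfolding graded_coring_iso_def by metis
    then show "E 0 (gone (graded_dual R C)) = gone (graded_dual R D)"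
      by (auto simp: E_def restrict_def fun_eq_iff k)
  qed
  then show ?thesis by (simp add: E_def[abs_def] k_def)
qed

section \<open>Quotients by kernels\<close>

text \<open>Cosets and set addition do not consult the carrier, so a coset of boundaries may be read
  in the cycles or in the ambient module.\<close>

lemma carrier_update_cosets [simp]:
  "a_r_coset (G\<lparr>carrier := X\<rparr>) = a_r_coset G" "set_add (G\<lparr>carrier := X\<rparr>) = set_add G"
  by (simp_all add: a_r_coset_def' set_add_def' fun_eq_iff)

lemma Union_const2:
  "(\<And>x y. x \<in> X \<Longrightarrow> y \<in> Y \<Longrightarrow> F x y = c) \<Longrightarrow> a \<in> X \<Longrightarrow> b \<in> Y \<Longrightarrow> (\<Union>x\<in>X. \<Union>y\<in>Y. F x y) = c"
  by auto

text \<open>One instance of the first isomorphism theorem for both halves of the result: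
  \<open>phi_cochain\<close> on cocycles modulo coboundaries, and \<open>gb\<close> on cycles modulo
  boundaries. The induced map is written with \<open>the_elem\<close> to match the definition of
  \<open>phi\<close>.\<close>

locale kernel_quotient = G: abelian_group G + K: abelian_group K
  for G :: "('g, 'm) ring_scheme" and K :: "('h, 'm2) ring_scheme" and \<rho> H +
  assumes \<rho>: "\<rho> \<in> add_hom G K" and H: "H = {x \<in> carrier G. \<rho> x = \<zero>\<^bsub>K\<^esub>}"
begin

lemmas \<rho>_closed = add_hom_closed[OF \<rho>]

lemma \<rho>_minus: "x \<in> carrier G \<Longrightarrow> y \<in> carrier G \<Longrightarrow> \<rho> (x \<ominus>\<^bsub>G\<^esub> y) = \<rho> x \<ominus>\<^bsub>K\<^esub> \<rho> y"
  by (rule add_hom_minus[OF \<rho> G.abelian_group_axioms K.abelian_group_axioms])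

lemma abelian_subgroup: "abelian_subgroup H G"
proof (rule abelian_subgroupI3[OF additive_subgroup.intro G.abelian_group_axioms])
  have "\<rho> (\<ominus>\<^bsub>G\<^esub> x) = \<zero>\<^bsub>K\<^esub>" if "x \<in> carrier G" "\<rho> x = \<zero>\<^bsub>K\<^esub>" for x
    using that \<rho>_minus[of "\<zero>\<^bsub>G\<^esub>" x] add_hom_zero[OF \<rho> G.abelian_group_axioms K.abelian_group_axioms]
    by (simp add: a_minus_def)
  then show "subgroup H (add_monoid G)"
    using add_hom_zero[OF \<rho> G.abelian_group_axioms K.abelian_group_axioms]
    by (intro G.add.subgroupI) (auto simp: H add_hom_add[OF \<rho>])
qed

sublocale S: abelian_subgroup H G
  by (rule abelian_subgroup)

lemma coset_eq_iff: "x \<in> carrier G \<Longrightarrow> y \<in> carrier G \<Longrightarrow> H +>\<^bsub>G\<^esub> x = H +>\<^bsub>G\<^esub> y \<longleftrightarrow> \<rho> x = \<rho> y"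
proof -
  assume xy: "x \<in> carrier G" "y \<in> carrier G"
  have "\<rho> x \<ominus>\<^bsub>K\<^esub> \<rho> y = \<zero>\<^bsub>K\<^esub> \<longleftrightarrow> \<rho> x = \<rho> y"
    using K.eq_of_minus_zero[OF _ \<rho>_closed[OF xy(1)] \<rho>_closed[OF xy(2)]] K.r_neg[OF \<rho>_closed[OF xy(2)]]
    by (metis a_minus_def)
  then show ?thesis using S.coset_eq_iff[OF xy] xy G.minus_closed[OF xy] by (simp only: H mem_Collect_eq \<rho>_minus simp_thms)
qed

lemma mem_coset_iff: "x \<in> carrier G \<Longrightarrow> y \<in> H +>\<^bsub>G\<^esub> x \<longleftrightarrow> y \<in> carrier G \<and> \<rho> y = \<rho> x"
  using S.mem_coset_iff[of x y] coset_eq_iff[of y x] by blast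

lemma coset_value: "x \<in> carrier G \<Longrightarrow> the_elem (\<rho> ` (H +>\<^bsub>G\<^esub> x)) = \<rho> x"
proof -
  assume x: "x \<in> carrier G"
  then have "\<rho> ` (H +>\<^bsub>G\<^esub> x) = {\<rho> x}" using mem_coset_iff[OF x] by auto
  then show ?thesis by simp
qed

lemma quotient_hom:
  assumes "carrier Q = a_rcosets\<^bsub>G\<^esub> H" "add Q = set_add G"
  shows "(\<lambda>X. the_elem (\<rho> ` X)) \<in> add_hom Q K"
  by (rule add_homI) (auto simp: assms rcosets_iff coset_value \<rho>_closed S.a_rcos_sum add_hom_add[OF \<rho>])

lemma quotient_bij:
  assumes "\<rho> ` carrier G = carrier K"
  shows "bij_betw (\<lambda>X. the_elem (\<rho> ` X)) (a_rcosets\<^bsub>G\<^esub> H) (carrier K)"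
proof (rule bij_betw_imageI)
  show "inj_on (\<lambda>X. the_elem (\<rho> ` X)) (a_rcosets\<^bsub>G\<^esub> H)"
  proof (rule inj_onI)
    fix X Y assume "X \<in> a_rcosets\<^bsub>G\<^esub> H" "Y \<in> a_rcosets\<^bsub>G\<^esub> H" and e: "the_elem (\<rho> ` X) = the_elem (\<rho> ` Y)"
    then obtain x y where xy: "x \<in> carrier G" "y \<in> carrier G" "X = H +>\<^bsub>G\<^esub> x" "Y = H +>\<^bsub>G\<^esub> y"
      by (auto simp: rcosets_iff)
    then show "X = Y" using e coset_eq_iff[OF xy(1,2)] by (simp only: xy coset_value)
  qed
  have "(\<lambda>X. the_elem (\<rho> ` X)) ` (a_rcosets\<^bsub>G\<^esub> H) = \<rho> ` carrier G"
  proof -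
    have "a_rcosets\<^bsub>G\<^esub> H = (\<lambda>x. H +>\<^bsub>G\<^esub> x) ` carrier G" by (auto simp: A_RCOSETS_def')
    then show ?thesis by (simp only: image_image) (rule image_cong[OF refl coset_value])
  qed
  then show "(\<lambda>X. the_elem (\<rho> ` X)) ` (a_rcosets\<^bsub>G\<^esub> H) = carrier K" by (simp add: assms)
qed

end

section \<open>Contraction of the bar complex with a cocycle\<close>

lemma bar_coring_sel [simp]:
  "ccomp (bar_coring R A) n = tensor_power R (plus_part A) n" "diff (bar_coring R A) = bar_diff R A"
  by (simp_all add: bar_coring_def bar_comp_def)

context connected_graded_ring
begin

lemma counit_bar [simp]: "counit (bar_coring R A) = ept"
  by (simp add: bar_coring_def ept_def)

text \<open>Contraction of the last \<open>q\<close> factors.  For a cocycle \<open>g\<close> it is a chain map up to a shift, which is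
  why convolution preserves cocycles.\<close>

definition ct :: "nat \<Rightarrow> nat \<Rightarrow> ((('r \<times> 'a list) \<Rightarrow>\<^sub>0 int) set \<Rightarrow> 'r) \<Rightarrow> (('r \<times> 'a list) \<Rightarrow>\<^sub>0 int) set
    \<Rightarrow> (('r \<times> 'a list) \<Rightarrow>\<^sub>0 int) set" where
  "ct p q g w = lift (Om p) (\<lambda>(x, y). x \<triangleleft>\<^bsub>Om p\<^esub> g y) (cop p q w)"

lemmas cop_closed = add_hom_closed[OF bimodule_homD(3)[OF cop_hom]]

context
  fixes q g
  assumes g: "g \<in> left_hom R (Om q) (regular_bimodule R)"
begin

lemma contraction_value_closed: "y \<in> carrier (Om q) \<Longrightarrow> g y \<in> carrier R"
  using add_hom_closed[OF left_homD[OF g]] by simp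

lemma contraction_balanced: "balanced R (Om p) (Om q) (Om p) (\<lambda>x y. x \<triangleleft>\<^bsub>Om p\<^esub> g y)"
  by (rule rsmult_value_balanced[OF bimodule_Om bimodule_Om g])

lemma contraction_hom: "lift (Om p) (\<lambda>(x, y). x \<triangleleft>\<^bsub>Om p\<^esub> g y) \<in> add_hom (tensor R (Om p) (Om q)) (Om p)"
  by (rule lift_tensor_hom[OF bimodule_Om bimodule_Om contraction_balanced abelian_Om])

lemma contraction_tens:
  "x \<in> carrier (Om p) \<Longrightarrow> y \<in> carrier (Om q) \<Longrightarrow>
    lift (Om p) (\<lambda>(x, y). x \<triangleleft>\<^bsub>Om p\<^esub> g y) (tens R (Om p) (Om q) x y) = x \<triangleleft>\<^bsub>Om p\<^esub> g y"
  by (rule lift_tens[OF bimodule_Om bimodule_Om contraction_balanced abelian_Om])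

lemma ct_hom: "ct p q g \<in> add_hom (Om (p + q)) (Om p)"
  unfolding ct_def[abs_def] by (rule add_hom_comp[OF bimodule_homD(3)[OF cop_hom] contraction_hom])

lemmas ct_closed = add_hom_closed[OF ct_hom]

lemma ct_0: "w \<in> carrier (Om q) \<Longrightarrow> ct 0 q g w = pword R Ap \<one>\<^bsub>R\<^esub> [] \<triangleleft>\<^bsub>Om 0\<^esub> g w"
  by (simp add: ct_def contraction_tens pword_Nil_closed)

lemma ct_cn:
  assumes a: "a \<in> carrier Ap" and w: "w \<in> carrier (Om (p + q))"
  shows "ct (Suc p) q g (cn (p + q) a w) = cn p a (ct p q g w)"
proof -
  have "lift (Om (Suc p)) (\<lambda>(x, y). x \<triangleleft>\<^bsub>Om (Suc p)\<^esub> g y) (tcn p q a t) = cn p a (lift (Om p) (\<lambda>(x, y). x \<triangleleft>\<^bsub>Om p\<^esub> g y) t)"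
    if t: "t \<in> carrier (tensor R (Om p) (Om q))" for t
    by (rule OmOm_hom_ext[OF add_hom_comp[OF tcn_hom[OF a] contraction_hom] add_hom_comp[OF contraction_hom cn_hom[OF a]] _ t])
      (simp add: a tcn_tens contraction_tens cn_closed cn_rsmult contraction_value_closed)
  then show ?thesis using a w by (simp add: ct_def cop_cn cop_closed del: cop.simps)
qed

lemma ct_lm:
  assumes a: "a \<in> carrier Ap" and v: "v \<in> carrier (Om (Suc (p + q)))"
  shows "ct (Suc p) q g (lm (p + q) a v) = lm p a (ct (Suc p) q g v)"
  by (rule Om_Suc_hom_ext[OF add_hom_comp[OF lm_hom[OF a] ct_hom[of "Suc p", unfolded add_Suc]]
        add_hom_comp[OF ct_hom[of "Suc p", unfolded add_Suc] lm_hom[OF a]] _ v])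
    (simp add: a lm_cn ct_cn plus_mult ct_closed)

text \<open>The products among the last \<open>q + 1\<close> letters add up, up to sign, to
  \<open>g\<close> of a boundary, which is zero; the products among the first \<open>p + 1\<close>
  letters form the differential of the contracted word. The induction peels letters from the left
  until only the first kind remains.\<close>

lemma ct_bd:
  assumes g0: "\<And>y. y \<in> carrier (Om (Suc q)) \<Longrightarrow> g (bd (Suc q) y) = \<zero>\<^bsub>R\<^esub>"
    and z: "z \<in> carrier (Om (Suc (p + q)))"
  shows "ct p q g (bd (Suc (p + q)) z) = bd (Suc p) (ct (Suc p) q g z)"
  using z
proof (induction p arbitrary: z)
  note [simp del] = bd.simps(3)
  case 0
  have "pword R Ap \<one>\<^bsub>R\<^esub> [] \<triangleleft>\<^bsub>Om 0\<^esub> \<zero>\<^bsub>R\<^esub> = \<zero>\<^bsub>Om 0\<^esub>"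
    using contraction_tens[of "pword R Ap \<one>\<^bsub>R\<^esub> []" 0 "\<zero>\<^bsub>Om q\<^esub>"]
      add_hom_zero[OF contraction_hom[of 0] abelian_OmOm abelian_Om]
      add_hom_zero[OF balancedD(1)[OF contraction_balanced pword_Nil_closed[OF R.one_closed]] abelian_Om abelian_Om]
      add_hom_zero[OF left_homD[OF g] abelian_Om bimodule_abelian[OF regular_bimodule[OF R.ring_axioms]]] by simp
  then show ?case using 0 by (simp add: ct_0 bd_closed g0)
next
  note [simp del] = bd.simps(3)
  case (Suc p)
  note ctS = ct_hom[of "Suc p", unfolded add_Suc] and ctSS = ct_hom[of "Suc (Suc p)", unfolded add_Suc]
  have z: "z \<in> carrier (Om (Suc (Suc (p + q))))" using Suc.prems by simp
  have "ct (Suc p) q g (bd (Suc (Suc (p + q))) z) = bd (Suc (Suc p)) (ct (Suc (Suc p)) q g z)"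
  proof (rule Om_Suc_hom_ext[OF add_hom_comp[OF bd_add_hom ctS] add_hom_comp[OF ctSS bd_add_hom] _ z])
    fix a v assume a: "a \<in> carrier Ap" and v: "v \<in> carrier (Om (Suc (p + q)))"
    have "ct (Suc p) q g (bd (Suc (Suc (p + q))) (cn (Suc (p + q)) a v)) =
        lm p a (ct (Suc p) q g v) \<ominus>\<^bsub>Om (Suc p)\<^esub> cn p a (ct p q g (bd (Suc (p + q)) v))"
      using a v by (simp add: bd_cn add_hom_minus[OF ctS abelian_Om abelian_Om] lm_closed cn_closed bd_closed ct_lm ct_cn)
    also have "\<dots> = bd (Suc (Suc p)) (cn (Suc p) a (ct (Suc p) q g v))"
      using a v add_hom_closed[OF ctS v] by (simp add: bd_cn Suc.IH)
    also have "\<dots> = bd (Suc (Suc p)) (ct (Suc (Suc p)) q g (cn (Suc (p + q)) a v))"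
      using a v ct_cn[of a v "Suc p"] by simp
    finally show "ct (Suc p) q g (bd (Suc (Suc (p + q))) (cn (Suc (p + q)) a v)) =
        bd (Suc (Suc p)) (ct (Suc (Suc p)) q g (cn (Suc (p + q)) a v))" .
  qed
  then show ?case by simp
qed

text \<open>With convolution written as contraction by \<open>g\<close> followed by
  \<open>f\<close>, the role of the Leibniz rule is taken over by \<open>ct_bd\<close>.\<close>

lemma convolution_bar:
  assumes f: "f \<in> left_hom R (Om p) (regular_bimodule R)" and w: "w \<in> carrier (Om (p + q))"
  shows "convolution R (bar_coring R A) p q f g w = f (ct p q g w)"
proof -
  have "f \<in> add_hom (Om p) R" using left_homD[OF f] by simp
  from lift_tensor_comp[OF bimodule_Om bimodule_Om contraction_balanced this abelian_Om R.abelian_group_axioms cop_closed[OF w]]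
  show ?thesis using w by (simp add: convolution_def bar_comult_eq ct_def)
qed

lemma convolution_bar_closed:
  assumes f: "f \<in> left_hom R (Om p) (regular_bimodule R)"
  shows "convolution R (bar_coring R A) p q f g \<in> carrier (left_dual R (Om (p + q)))"
proof -
  have "restrict (\<lambda>w. lift R (\<lambda>(x, y). f (x \<triangleleft>\<^bsub>Om p\<^esub> g y)) (cop p q w)) (carrier (Om (p + q))) \<in> carrier (left_dual R (Om (p + q)))"
    by (rule Om.restrict_left_dual[OF left_hom_comp[OF bimodule_homD(1)[OF cop_hom] conv_left_hom[OF bimodule_Om bimodule_Om f g]]])
  moreover have "convolution R (bar_coring R A) p q f g =
      restrict (\<lambda>w. lift R (\<lambda>(x, y). f (x \<triangleleft>\<^bsub>Om p\<^esub> g y)) (cop p q w)) (carrier (Om (p + q)))"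
    by (auto simp: convolution_def bar_comult_eq restrict_def fun_eq_iff)
  ultimately show ?thesis by simp
qed

end

lemma cocycles_iff:
  "f \<in> cocycles R (bar_coring R A) n \<longleftrightarrow>
    f \<in> carrier (left_dual R (Om n)) \<and> (\<forall>x\<in>carrier (Om (Suc n)). f (bd (Suc n) x) = \<zero>\<^bsub>R\<^esub>)"
  by (auto simp: cocycles_def codiff_def restrict_def fun_eq_iff bar_diff_eq)

lemma cocycles_convolution:
  assumes f: "f \<in> cocycles R (bar_coring R A) m" and g: "g \<in> cocycles R (bar_coring R A) n"
  shows "convolution R (bar_coring R A) m n f g \<in> cocycles R (bar_coring R A) (m + n)"
proof -
  have fl: "f \<in> left_hom R (Om m) (regular_bimodule R)" and gl: "g \<in> left_hom R (Om n) (regular_bimodule R)"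
    using f g by (simp_all add: cocycles_iff left_dual_hom)
  have "convolution R (bar_coring R A) m n f g (bd (Suc (m + n)) x) = \<zero>\<^bsub>R\<^esub>" if x: "x \<in> carrier (Om (Suc (m + n)))" for x
    using ct_bd[OF gl _ x] ct_hom[OF gl, of "Suc m"] x f g
    by (simp add: convolution_bar[OF gl fl] bd_closed[OF x] cocycles_iff add_hom_closed)
  then show ?thesis using convolution_bar_closed[OF gl fl] by (simp add: cocycles_iff)
qed

end

context almost_koszul
begin

lemma phi_cochain_closed:
  "f \<in> carrier (left_dual R (Om n)) \<Longrightarrow> phi_cochain R A C \<theta> n f \<in> carrier (left_dual R (ccomp C n))"
  unfolding phi_cochain_def by (rule C.restrict_left_dual[OF left_hom_comp[OF ctb_left_hom left_dual_hom]])

text \<open>Holds already for cochains, because \<open>cop_ctb\<close> is an equality and not merely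
  a homotopy. Right linearity of \<open>ctb\<close> moves the value of \<open>g\<close> through
  it.\<close>

lemma phi_cochain_convolution:
  assumes f: "f \<in> carrier (left_dual R (Om m))" and g: "g \<in> carrier (left_dual R (Om n))"
  shows "phi_cochain R A C \<theta> (m + n) (convolution R (bar_coring R A) m n f g) =
    convolution R C m n (phi_cochain R A C \<theta> m f) (phi_cochain R A C \<theta> n g)"
proof -
  note f' = left_dual_hom[OF f] and g' = left_dual_hom[OF g]
  note pf = phi_cochain_closed[OF f] and pg = phi_cochain_closed[OF g]
  note gc = contraction_value_closed[OF g']
  have "phi_cochain R A C \<theta> (m + n) (convolution R (bar_coring R A) m n f g) c =
      convolution R C m n (phi_cochain R A C \<theta> m f) (phi_cochain R A C \<theta> n g) c" if c: "c \<in> carrier (ccomp C (m + n))" for c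
  proof -
    have "phi_cochain R A C \<theta> (m + n) (convolution R (bar_coring R A) m n f g) c =
        lift R (\<lambda>(x, y). f (x \<triangleleft>\<^bsub>Om m\<^esub> g y)) (tensor_map R (Om m) (Om n) (ctb m) (ctb n) (comult C m n c))"
      using c by (simp add: phi_cochain_def convolution_def ctb_closed bar_comult_eq cop_ctb)
    also have "\<dots> = lift R (\<lambda>(x, y). f (ctb m x \<triangleleft>\<^bsub>Om m\<^esub> g (ctb n y))) (comult C m n c)"
      by (rule lift_tensor_map(1)[OF CB CB bimodule_Om bimodule_Om ctb_right_hom ctb_left_hom
            conv_balanced[OF bimodule_Om bimodule_Om f' g'] R.abelian_group_axioms C.comult_closed[OF c]])
    also have "\<dots> = lift R (\<lambda>(x, y). phi_cochain R A C \<theta> m f (x \<triangleleft>\<^bsub>ccomp C m\<^esub> phi_cochain R A C \<theta> n g y)) (comult C m n c)"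
      by (rule lift_tensor_cong[OF conv_balanced[OF CB CB left_dual_hom[OF pf] left_dual_hom[OF pg]] CB CB R.abelian_group_axioms
            _ C.comult_closed[OF c]])
        (simp add: phi_cochain_def gc ctb_closed C.rsmult_closed right_hom_rsmult[OF ctb_right_hom])
    also have "\<dots> = convolution R C m n (phi_cochain R A C \<theta> m f) (phi_cochain R A C \<theta> n g) c"
      using c by (simp add: convolution_def)
    finally show ?thesis .
  qed
  then show ?thesis by (auto simp: phi_cochain_def convolution_def fun_eq_iff restrict_def)
qed

end

section \<open>The cohomology ring\<close>

context koszul
begin

text \<open>Evaluate a cocycle \<open>f\<close> on the homotopy identity: the term with
  \<open>bd (hs x)\<close> vanishes, and if \<open>f\<close> vanishes on the image of
  \<open>ctb\<close>, so does the right side. Hence \<open>f\<close> is the coboundary of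
  \<open>- f hs\<close>. Conversely coboundaries vanish on the cycles \<open>ctb c\<close>. In
  degree 0 there are no coboundaries but zero, and \<open>ctb\<close> is onto.\<close>

lemma coboundaries_iff:
  "f \<in> coboundaries R (bar_coring R A) n \<longleftrightarrow>
    f \<in> cocycles R (bar_coring R A) n \<and> (\<forall>c\<in>carrier (ccomp C n). f (ctb n c) = \<zero>\<^bsub>R\<^esub>)"
proof (cases n)
  case 0
  have "f = \<zero>\<^bsub>left_dual R (Om 0)\<^esub>"
    if "f \<in> cocycles R (bar_coring R A) 0" "\<forall>c\<in>carrier (ccomp C 0). f (ctb 0 c) = \<zero>\<^bsub>R\<^esub>"
  proof (rule left_dual_eqI[of _ R "Om 0"])
    fix w assume w: "w \<in> carrier (Om 0)"
    show "f w = \<zero>\<^bsub>left_dual R (Om 0)\<^esub> w" using that(2) w ctb_gb_0[OF w] gb_closed[OF w] by (metis left_dual_sel(1) restrict_apply')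
  qed (use that abelian_monoid.zero_closed[OF abelian_group.axioms(1)[OF Om.left_dual_abelian]] in \<open>auto simp: cocycles_iff\<close>)
  moreover have "\<zero>\<^bsub>left_dual R (Om 0)\<^esub> \<in> cocycles R (bar_coring R A) 0"
    using abelian_monoid.zero_closed[OF abelian_group.axioms(1)[OF Om.left_dual_abelian], of 0] by (auto simp: cocycles_iff)
  ultimately show ?thesis by (auto simp: 0 coboundaries_def ctb_closed)
next
  case (Suc m)
  note [simp del] = bd.simps(3)
  show ?thesis
  proof
    assume "f \<in> coboundaries R (bar_coring R A) n"
    then obtain g where g: "g \<in> carrier (left_dual R (Om m))" "f = codiff (bar_coring R A) m g"
      by (auto simp: Suc coboundaries_def)
    have fx: "f = restrict (\<lambda>x. g (bd (Suc m) x)) (carrier (Om (Suc m)))"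
      by (auto simp: g(2) codiff_def bar_diff_eq restrict_def fun_eq_iff)
    have g0: "g \<zero>\<^bsub>Om m\<^esub> = \<zero>\<^bsub>R\<^esub>" by (rule add_hom_zero[OF left_dual_add_hom[OF g(1)] abelian_Om R.abelian_group_axioms])
    have "f \<in> carrier (left_dual R (Om (Suc m)))"
      unfolding fx by (rule Om.restrict_left_dual[OF left_hom_comp[OF bd_left_hom left_dual_hom[OF g(1)]]])
    then show "f \<in> cocycles R (bar_coring R A) n \<and> (\<forall>c\<in>carrier (ccomp C n). f (ctb n c) = \<zero>\<^bsub>R\<^esub>)"
      using bd_ctb[of _ "Suc m"] by (auto simp: Suc cocycles_iff fx bd_closed bd_bd ctb_closed g0)
  next
    assume f: "f \<in> cocycles R (bar_coring R A) n \<and> (\<forall>c\<in>carrier (ccomp C n). f (ctb n c) = \<zero>\<^bsub>R\<^esub>)"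
    then have fd: "f \<in> carrier (left_dual R (Om (Suc m)))" and fb: "\<And>x. x \<in> carrier (Om (Suc (Suc m))) \<Longrightarrow> f (bd (Suc (Suc m)) x) = \<zero>\<^bsub>R\<^esub>"
      and fc: "\<And>c. c \<in> carrier (ccomp C (Suc m)) \<Longrightarrow> f (ctb (Suc m) c) = \<zero>\<^bsub>R\<^esub>"
      by (auto simp: cocycles_iff Suc)
    note fh = left_dual_add_hom[OF fd]
    note fcl = add_hom_closed[OF fh]
    have k: "(\<lambda>x. \<ominus>\<^bsub>R\<^esub> f (hs m x)) \<in> left_hom R (Om m) (regular_bimodule R)"
      using add_hom_uminus[OF add_hom_comp[OF hs_hom fh] R.abelian_group_axioms]
      by (intro left_homI) (simp_all add: left_hom_smult[OF hs_left_hom] left_dual_smult[OF fd] hs_closed fcl R.r_minus)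
    have "f x = \<ominus>\<^bsub>R\<^esub> f (hs m (bd (Suc m) x))" if x: "x \<in> carrier (Om (Suc m))" for x
    proof -
      have "f (bd (Suc (Suc m)) (hs (Suc m) x)) \<oplus>\<^bsub>R\<^esub> f (hs m (bd (Suc m) x)) \<oplus>\<^bsub>R\<^esub> f x = f (ctb (Suc m) (gb (Suc m) x))"
        unfolding homotopy[OF x, symmetric] using x
        by (simp add: add_hom_add[OF fh] bd_closed hs_closed del: hs.simps)
      then have "f (hs m (bd (Suc m) x)) \<oplus>\<^bsub>R\<^esub> f x = \<zero>\<^bsub>R\<^esub>"
        using x by (simp add: fb fc hs_closed gb_closed bd_closed fcl del: hs.simps)
      then show ?thesis
        using R.minus_equality[of "f x" "f (hs m (bd (Suc m) x))"] x by (simp add: R.a_comm fcl hs_closed bd_closed)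
    qed
    then have "f = codiff (bar_coring R A) m (restrict (\<lambda>x. \<ominus>\<^bsub>R\<^esub> f (hs m x)) (carrier (Om m)))"
      using fd by (auto simp: codiff_def bar_diff_eq restrict_def fun_eq_iff bd_closed left_dual_def PiE_def extensional_def)
    then show "f \<in> coboundaries R (bar_coring R A) n"
      using Om.restrict_left_dual[OF k] by (auto simp: Suc coboundaries_def)
  qed
qed

abbreviation "ZZ n \<equiv> (left_dual R (Om n))\<lparr>carrier := cocycles R (bar_coring R A) n\<rparr>"

lemma cocycles_abelian: "abelian_group (ZZ n)"
proof -
  interpret L: abelian_group "left_dual R (Om n)" by (rule Om.left_dual_abelian)
  have z: "\<zero>\<^bsub>left_dual R (Om n)\<^esub> \<in> cocycles R (bar_coring R A) n"
    using L.zero_closed by (auto simp: cocycles_iff bd_closed simp del: bd.simps(3))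
  have a: "f \<oplus>\<^bsub>left_dual R (Om n)\<^esub> g \<in> cocycles R (bar_coring R A) n"
    if "f \<in> cocycles R (bar_coring R A) n" "g \<in> cocycles R (bar_coring R A) n" for f g
    using that L.a_closed[of f g] by (auto simp: cocycles_iff bd_closed simp del: bd.simps(3))
  have m: "\<ominus>\<^bsub>left_dual R (Om n)\<^esub> f \<in> cocycles R (bar_coring R A) n" if f: "f \<in> cocycles R (bar_coring R A) n" for f
  proof -
    have fc: "f \<in> carrier (left_dual R (Om n))" using f by (simp add: cocycles_iff)
    have "(\<ominus>\<^bsub>left_dual R (Om n)\<^esub> f) (bd (Suc n) x) = \<zero>\<^bsub>R\<^esub>" if x: "x \<in> carrier (Om (Suc n))" for x
    proof -
      have "(\<ominus>\<^bsub>left_dual R (Om n)\<^esub> f \<oplus>\<^bsub>left_dual R (Om n)\<^esub> f) (bd (Suc n) x) = \<zero>\<^bsub>R\<^esub>"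
        using L.l_neg[OF fc] x by (simp add: bd_closed del: bd.simps(3))
      then show ?thesis
        using f x add_hom_closed[OF left_dual_add_hom[OF L.a_inv_closed[OF fc]] bd_closed[OF x]]
        by (simp add: cocycles_iff bd_closed del: bd.simps(3))
    qed
    then show ?thesis using L.a_inv_closed[OF fc] by (simp add: cocycles_iff)
  qed
  have c: "f \<in> carrier (left_dual R (Om n))" if "f \<in> cocycles R (bar_coring R A) n" for f
    using that by (simp add: cocycles_iff)
  show ?thesis
  proof (rule abelian_groupI)
    fix f assume "f \<in> carrier (ZZ n)"
    then show "\<exists>g\<in>carrier (ZZ n). g \<oplus>\<^bsub>ZZ n\<^esub> f = \<zero>\<^bsub>ZZ n\<^esub>"
      using m[of f] L.l_neg[OF c, of f] by (intro bexI[of _ "\<ominus>\<^bsub>left_dual R (Om n)\<^esub> f"]) (simp_all del: left_dual_sel)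
  qed (simp_all add: z a c L.a_ac L.l_zero del: left_dual_sel)
qed

lemma kernel_quotient_cocycles:
  "kernel_quotient (ZZ n) (left_dual R (ccomp C n)) (phi_cochain R A C \<theta> n) (coboundaries R (bar_coring R A) n)"
proof (rule kernel_quotient.intro[OF cocycles_abelian C.left_dual_abelian], rule kernel_quotient_axioms.intro)
  show "phi_cochain R A C \<theta> n \<in> add_hom (ZZ n) (left_dual R (ccomp C n))"
  proof (rule add_homI)
    fix f assume "f \<in> carrier (ZZ n)"
    then show "phi_cochain R A C \<theta> n f \<in> carrier (left_dual R (ccomp C n))" by (simp add: cocycles_iff phi_cochain_closed)
  qed (auto simp: phi_cochain_def restrict_def fun_eq_iff ctb_closed)
  show "coboundaries R (bar_coring R A) n = {f \<in> carrier (ZZ n). phi_cochain R A C \<theta> n f = \<zero>\<^bsub>left_dual R (ccomp C n)\<^esub>}"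
    by (auto simp: coboundaries_iff phi_cochain_def restrict_def fun_eq_iff)
qed

sublocale Ext: kernel_quotient "ZZ n" "left_dual R (ccomp C n)" "phi_cochain R A C \<theta> n" "coboundaries R (bar_coring R A) n" for n
  by (rule kernel_quotient_cocycles)

text \<open>The functional \<open>\<alpha>\<close> is hit by \<open>\<alpha> gb\<close>: this is a
  cocycle since \<open>gb\<close> kills boundaries, and it restricts to \<open>\<alpha>\<close>
  since \<open>gb\<close> retracts \<open>ctb\<close>.\<close>

lemma phi_cochain_surj: "phi_cochain R A C \<theta> n ` cocycles R (bar_coring R A) n = carrier (left_dual R (ccomp C n))"
proof (intro equalityI subsetI)
  fix \<alpha> assume a: "\<alpha> \<in> carrier (left_dual R (ccomp C n))"
  let ?f = "restrict (\<lambda>x. \<alpha> (gb n x)) (carrier (Om n))"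
  have "?f \<in> carrier (left_dual R (Om n))"
    by (rule Om.restrict_left_dual[OF left_hom_comp[OF gb_left_hom left_dual_hom[OF a]]])
  then have "?f \<in> cocycles R (bar_coring R A) n"
    using add_hom_zero[OF left_dual_add_hom[OF a] abelian_C R.abelian_group_axioms]
    by (simp add: cocycles_iff bd_closed gb_bd del: bd.simps(3))
  moreover have "phi_cochain R A C \<theta> n ?f = \<alpha>"
    using a by (auto simp: phi_cochain_def restrict_def fun_eq_iff gb_ctb ctb_closed left_dual_def PiE_def extensional_def)
  ultimately show "\<alpha> \<in> phi_cochain R A C \<theta> n ` cocycles R (bar_coring R A) n" by force
qed (auto simp: cocycles_iff phi_cochain_closed)

lemma Ext_sel:
  "carrier (rcomp (Ext_ring R A) n) = a_rcosets\<^bsub>ZZ n\<^esub> (coboundaries R (bar_coring R A) n)"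
  "zero (rcomp (Ext_ring R A) n) = coboundaries R (bar_coring R A) n"
  "add (rcomp (Ext_ring R A) n) = set_add (ZZ n)"
  by (simp_all add: Ext_ring_def cohomology_ring_def)

lemma phi_iso: "graded_ring_iso (Ext_ring R A) (graded_dual R C) (phi R A C \<theta>)"
proof (rule graded_ring_isoI)
  let ?D = "bar_coring R A" and ?B = "\<lambda>n. coboundaries R (bar_coring R A) n" and ?\<rho> = "\<lambda>n. phi_cochain R A C \<theta> n"
  let ?cls = "\<lambda>n. a_r_coset (left_dual R (Om n)) (?B n)"
  note coset = Ext.coset_value[simplified] and eq = Ext.coset_eq_iff[simplified] and mem = Ext.mem_coset_iff[simplified]
  show "graded_ring (graded_dual R C)" by (rule C.graded_ring_graded_dual)
  show "abelian_group (rcomp (Ext_ring R A) n)" for n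
    by (rule abelian_subgroup.quotient_abelian_group[OF Ext.abelian_subgroup Ext_sel])
  show "phi R A C \<theta> n \<in> add_hom (rcomp (Ext_ring R A) n) (rcomp (graded_dual R C) n)" for n
    using Ext.quotient_hom[OF Ext_sel(1,3)] by (simp add: phi_def[abs_def])
  show "bij_betw (phi R A C \<theta> n) (carrier (rcomp (Ext_ring R A) n)) (carrier (rcomp (graded_dual R C) n))" for n
    using Ext.quotient_bij[of n] phi_cochain_surj[of n] by (simp add: phi_def[abs_def] Ext_sel)
  have cls: "X \<in> carrier (rcomp (Ext_ring R A) n) \<longleftrightarrow> (\<exists>f\<in>cocycles R ?D n. X = ?cls n f)" for X n
    unfolding Ext_sel rcosets_iff by simp
  have phi: "phi R A C \<theta> n (?cls n f) = ?\<rho> n f" if "f \<in> cocycles R ?D n" for n f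
    using coset[OF that] by (simp add: phi_def)
  have mult: "gmult (Ext_ring R A) m n (?cls m f) (?cls n g) = ?cls (m + n) (convolution R ?D m n f g)"
    if fg: "f \<in> cocycles R ?D m" "g \<in> cocycles R ?D n" for m n f g
  proof -
    \<comment> \<open>Two cocycles are cohomologous exactly when \<open>phi_cochain\<close> agrees
      on them, so multiplicativity of \<open>phi_cochain\<close> shows that the product does not
      depend on representatives; coboundaries never have to be shown to form an ideal.\<close>
    have "?cls (m + n) (convolution R ?D m n f' g') = ?cls (m + n) (convolution R ?D m n f g)"
      if "f' \<in> ?cls m f" "g' \<in> ?cls n g" for f' g'
      using that fg eq[OF cocycles_convolution cocycles_convolution]
      by (simp add: mem phi_cochain_convolution cocycles_iff)
    moreover have "f \<in> ?cls m f" "g \<in> ?cls n g" using fg by (simp_all add: mem)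
    ultimately have "(\<Union>f'\<in>?cls m f. \<Union>g'\<in>?cls n g. ?cls (m + n) (convolution R ?D m n f' g')) = ?cls (m + n) (convolution R ?D m n f g)"
      by (intro Union_const2)
    then show ?thesis by (simp add: Ext_ring_def cohomology_ring_def)
  qed
  fix m n X Y assume "X \<in> carrier (rcomp (Ext_ring R A) m)" "Y \<in> carrier (rcomp (Ext_ring R A) n)"
  then obtain f g where fg: "f \<in> cocycles R ?D m" "g \<in> cocycles R ?D n" and XY: "X = ?cls m f" "Y = ?cls n g"
    by (auto simp: cls)
  note fg' = cocycles_convolution[OF fg]
  show "gmult (Ext_ring R A) m n X Y \<in> carrier (rcomp (Ext_ring R A) (m + n))"
    using fg' by (auto simp: XY mult[OF fg] cls)
  show "phi R A C \<theta> (m + n) (gmult (Ext_ring R A) m n X Y) = gmult (graded_dual R C) m n (phi R A C \<theta> m X) (phi R A C \<theta> n Y)"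
    using fg phi_cochain_convolution[of f m g n] by (simp add: XY mult phi fg') (simp add: cocycles_iff)
next
  let ?e = "restrict ept (carrier (Om 0))"
  have e: "?e \<in> cocycles R (bar_coring R A) 0"
    using Om.restrict_left_dual[OF bimodule_homD(1)[OF ept_bimodule_hom]] add_hom_zero[OF ept_hom abelian_Om R.abelian_group_axioms]
    by (simp add: cocycles_iff)
  have g: "gone (Ext_ring R A) = a_r_coset (left_dual R (Om 0)) (coboundaries R (bar_coring R A) 0) ?e"
    by (simp add: Ext_ring_def cohomology_ring_def)
  show "gone (Ext_ring R A) \<in> carrier (rcomp (Ext_ring R A) 0)"
    unfolding g Ext_sel rcosets_iff using e by auto
  have "phi R A C \<theta> 0 (gone (Ext_ring R A)) = phi_cochain R A C \<theta> 0 ?e"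
    unfolding g phi_def using Ext.coset_value[of ?e 0] e by simp
  also have "\<dots> = restrict (counit C) (carrier (ccomp C 0))"
    by (auto simp: phi_cochain_def restrict_def fun_eq_iff ctb_closed ctb_0 ept_pword counit_closed pword_Nil_closed)
  finally show "phi R A C \<theta> 0 (gone (Ext_ring R A)) = gone (graded_dual R C)" by simp
qed

end

section \<open>Quotient bimodules\<close>

context
  fixes R :: "('r, 'k) ring_scheme" and M :: "('r, 'm, 'l) bimodule_scheme" and N
  assumes M: "bimodule R M" and N: "sub_bimodule R M N"
begin

interpretation M: bimodule R M by (rule M)

private lemma N_subgroup: "abelian_subgroup N M"
  using N by (intro abelian_subgroupI3 additive_subgroup.intro) (simp_all add: sub_bimodule_def left_submodule_def M.M.abelian_group_axioms)

interpretation N: abelian_subgroup N M by (rule N_subgroup)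

lemma quot_bimodule_smult: "r \<in> carrier R \<Longrightarrow> x \<in> carrier M \<Longrightarrow> r \<odot>\<^bsub>quot_bimodule M N\<^esub> (N +>\<^bsub>M\<^esub> x) = N +>\<^bsub>M\<^esub> (r \<odot>\<^bsub>M\<^esub> x)"
  using N N.quot_smult_coset[OF M.smult_hom, of r x]
  by (auto simp: quot_bimodule_def sub_bimodule_def left_submodule_def image_subset_iff)

lemma quot_bimodule_rsmult: "r \<in> carrier R \<Longrightarrow> x \<in> carrier M \<Longrightarrow> (N +>\<^bsub>M\<^esub> x) \<triangleleft>\<^bsub>quot_bimodule M N\<^esub> r = N +>\<^bsub>M\<^esub> (x \<triangleleft>\<^bsub>M\<^esub> r)"
  using N N.quot_smult_coset[OF M.rsmult_hom, of r x]
  by (auto simp: quot_bimodule_def sub_bimodule_def left_submodule_def image_subset_iff)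

lemma coset_hom: "(\<lambda>x. N +>\<^bsub>M\<^esub> x) \<in> bimodule_hom R M (quot_bimodule M N)"
  by (auto simp: bimodule_hom_def N.a_rcos_sum quot_bimodule_smult quot_bimodule_rsmult rcosets_iff)

lemma quot_bimodule_bimodule: "bimodule R (quot_bimodule M N)"
proof -
  have rep: "\<exists>x\<in>carrier M. X = N +>\<^bsub>M\<^esub> x" if "X \<in> carrier (quot_bimodule M N)" for X
    using that by (simp add: rcosets_iff)
  have add: "(N +>\<^bsub>M\<^esub> x) <+>\<^bsub>M\<^esub> (N +>\<^bsub>M\<^esub> y) = N +>\<^bsub>M\<^esub> (x \<oplus>\<^bsub>M\<^esub> y)" if "x \<in> carrier M" "y \<in> carrier M" for x y
    using that by (rule N.a_rcos_sum)
  note simps = rcosets_iff quot_bimodule_smult quot_bimodule_rsmult add M.smult_closed M.rsmult_closed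
    M.smult_l_distr M.smult_r_distr M.smult_assoc M.smult_one M.rsmult_l_distr M.rsmult_r_distr M.rsmult_assoc M.rsmult_one
    M.bimodule_assoc
  have "abelian_group (quot_bimodule M N)" by (rule N.quotient_abelian_group) simp_all
  then show ?thesis
    by (intro bimodule.intro left_module.intro left_module_axioms.intro bimodule_axioms.intro M.R.ring_axioms)
      (auto dest!: rep simp: simps)
qed

end

section \<open>The homology coring of the bar complex\<close>

context connected_graded_ring
begin

lemma bar_diff_hom: "bar_diff R A (Suc n) \<in> bimodule_hom R (Om (Suc n)) (Om n)"
  using bd_Suc_hom[of n] by (auto simp: bimodule_hom_def bar_diff_eq Om.smult_closed Om.rsmult_closed simp del: bd.simps(3))

lemma cycles_iff: "x \<in> cycles (bar_coring R A) n \<longleftrightarrow> x \<in> carrier (Om n) \<and> bd n x = \<zero>\<^bsub>Om (n - 1)\<^esub>"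
  using bar_diff_eq[of x n] by (cases "x \<in> carrier (Om n)") (simp_all add: cycles_def)

lemma boundaries_iff: "x \<in> boundaries (bar_coring R A) n \<longleftrightarrow> (\<exists>z\<in>carrier (Om (Suc n)). x = bd (Suc n) z)"
  by (auto simp: boundaries_def bar_diff_eq image_iff)

lemma cycles_bimodule: "bimodule R (cycle_bimodule (bar_coring R A) n)"
proof -
  note h = bimodule_homD[OF bd_hom[of n]]
  note z = add_hom_zero[OF h(3) abelian_Om abelian_Om]
  have "r \<odot>\<^bsub>Om (n - 1)\<^esub> \<zero>\<^bsub>Om (n - 1)\<^esub> = \<zero>\<^bsub>Om (n - 1)\<^esub>" "\<zero>\<^bsub>Om (n - 1)\<^esub> \<triangleleft>\<^bsub>Om (n - 1)\<^esub> r = \<zero>\<^bsub>Om (n - 1)\<^esub>" if "r \<in> carrier R" for r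
    using add_hom_zero[OF Om.smult_hom[OF that] abelian_Om abelian_Om] add_hom_zero[OF Om.rsmult_hom[OF that] abelian_Om abelian_Om] by auto
  then have "sub_bimodule R (Om n) (cycles (bar_coring R A) n)"
    unfolding sub_bimodule_def
    by (intro conjI Om.left_submoduleI)
      (auto simp: cycles_iff z add_hom_add[OF h(3)] left_hom_smult[OF h(1)] right_hom_rsmult[OF h(2)] Om.smult_closed Om.rsmult_closed)
  from sub_bimodule_bimodule[OF bimodule_Om this] show ?thesis by (simp add: cycle_bimodule_def)
qed

lemma cycle_bimodule_sel [simp]:
  "carrier (cycle_bimodule (bar_coring R A) n) = cycles (bar_coring R A) n"
  "add (cycle_bimodule (bar_coring R A) n) = add (Om n)" "zero (cycle_bimodule (bar_coring R A) n) = zero (Om n)"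
  "smult (cycle_bimodule (bar_coring R A) n) = smult (Om n)" "rsmult (cycle_bimodule (bar_coring R A) n) = rsmult (Om n)"
  "a_r_coset (cycle_bimodule (bar_coring R A) n) = a_r_coset (Om n)"
  by (simp_all add: cycle_bimodule_def)

lemma boundaries_cycles: "x \<in> boundaries (bar_coring R A) n \<Longrightarrow> x \<in> cycles (bar_coring R A) n"
proof -
  assume "x \<in> boundaries (bar_coring R A) n"
  then obtain z where z: "z \<in> carrier (Om (Suc n))" "x = bd (Suc n) z" by (auto simp: boundaries_iff)
  show ?thesis
  proof (cases n)
    case (Suc m)
    then show ?thesis using z bd_bd[of z m] bd_closed[of z n] by (simp add: cycles_iff del: bd.simps(3))
  qed (use z bd_closed[of z n] in \<open>simp add: cycles_iff\<close>)
qed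

lemma boundaries_sub_bimodule: "sub_bimodule R (cycle_bimodule (bar_coring R A) n) (boundaries (bar_coring R A) n)"
proof -
  interpret Z: bimodule R "cycle_bimodule (bar_coring R A) n" by (rule cycles_bimodule)
  note h = bimodule_homD[OF bd_Suc_hom[of n]]
  have "\<zero>\<^bsub>Om n\<^esub> \<in> boundaries (bar_coring R A) n"
    using add_hom_zero[OF h(3) abelian_Om abelian_Om] by (metis boundaries_iff Om.M.zero_closed)
  moreover have "x \<oplus>\<^bsub>Om n\<^esub> y \<in> boundaries (bar_coring R A) n"
    if "x \<in> boundaries (bar_coring R A) n" "y \<in> boundaries (bar_coring R A) n" for x y
    using that add_hom_add[OF h(3)] by (metis boundaries_iff Om.M.a_closed)
  moreover have "r \<odot>\<^bsub>Om n\<^esub> x \<in> boundaries (bar_coring R A) n" "x \<triangleleft>\<^bsub>Om n\<^esub> r \<in> boundaries (bar_coring R A) n"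
    if "x \<in> boundaries (bar_coring R A) n" "r \<in> carrier R" for x r
    using that left_hom_smult[OF h(1)] right_hom_rsmult[OF h(2)] by (metis boundaries_iff Om.smult_closed, metis boundaries_iff Om.rsmult_closed)
  ultimately show ?thesis
    unfolding sub_bimodule_def by (intro conjI Z.left_submoduleI) (auto simp: boundaries_cycles)
qed

lemmas bimodule_homology = quot_bimodule_bimodule[OF cycles_bimodule boundaries_sub_bimodule, folded homology_def]
lemmas homology_class_hom = coset_hom[OF cycles_bimodule boundaries_sub_bimodule, folded homology_def]

end

context koszul
begin

abbreviation "CZ n \<equiv> cycle_bimodule (bar_coring R A) n"
abbreviation "HH n \<equiv> homology (bar_coring R A) n"
abbreviation "cls n \<equiv> a_r_coset (Om n) (boundaries (bar_coring R A) n)"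

text \<open>For a cycle \<open>x\<close> with \<open>gb x = 0\<close> the homotopy identity loses
  two terms and reads \<open>bd (hs x) + x = 0\<close>, so \<open>x\<close> bounds
  \<open>- hs x\<close>. In degree 0 the inverse maps of \<open>ctb_gb_0\<close> give
  \<open>x = 0\<close>.\<close>

lemma boundaries_kernel: "boundaries (bar_coring R A) n = {x \<in> carrier (CZ n). gb n x = \<zero>\<^bsub>ccomp C n\<^esub>}"
proof (intro equalityI subsetI)
  fix x assume "x \<in> {x \<in> carrier (CZ n). gb n x = \<zero>\<^bsub>ccomp C n\<^esub>}"
  then have x: "x \<in> carrier (Om n)" "bd n x = \<zero>\<^bsub>Om (n - 1)\<^esub>" "gb n x = \<zero>\<^bsub>ccomp C n\<^esub>" by (auto simp: cycles_iff)
  note c0 = add_hom_zero[OF ctb_add_hom abelian_C abelian_Om]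
  show "x \<in> boundaries (bar_coring R A) n"
  proof (cases n)
    case 0
    then have "x = \<zero>\<^bsub>Om 0\<^esub>" using x(1,3) ctb_gb_0[of x] c0[of 0] by simp
    then show ?thesis using add_hom_zero[OF bd_add_hom abelian_Om abelian_Om, of 0] 0 by (metis boundaries_iff Om.M.zero_closed)
  next
    case (Suc m)
    note [simp del] = bd.simps(3) hs.simps
    have x': "x \<in> carrier (Om (Suc m))" using x Suc by simp
    let ?s = "hs (Suc m) x"
    have sc: "?s \<in> carrier (Om (Suc (Suc m)))" by (rule hs_closed[OF x'])
    have "bd (Suc (Suc m)) ?s \<oplus>\<^bsub>Om (Suc m)\<^esub> x = \<zero>\<^bsub>Om (Suc m)\<^esub>"
      using homotopy[OF x'] x c0[of "Suc m"] add_hom_zero[OF hs_hom abelian_Om abelian_Om, of m]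
      by (simp add: Suc bd_closed[OF sc])
    then have "x = \<ominus>\<^bsub>Om (Suc m)\<^esub> bd (Suc (Suc m)) ?s"
      using Om.M.minus_equality[OF _ bd_closed[OF sc] x'] Om.M.a_comm[OF x' bd_closed[OF sc]] by simp
    also have "\<dots> = bd (Suc (Suc m)) (\<ominus>\<^bsub>Om (Suc (Suc m))\<^esub> ?s)"
      using add_hom_minus[OF bd_add_hom abelian_Om abelian_Om Om.M.zero_closed sc] add_hom_zero[OF bd_add_hom abelian_Om abelian_Om, of "Suc m"]
      by (simp add: a_minus_def bd_closed[OF sc] sc)
    finally show ?thesis unfolding Suc boundaries_iff using sc by blast
  qed
qed (auto simp: boundaries_cycles boundaries_iff gb_bd simp del: bd.simps(3))

lemma kernel_quotient_cycles: "kernel_quotient (CZ n) (ccomp C n) (gb n) (boundaries (bar_coring R A) n)"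
proof (rule kernel_quotient.intro[OF bimodule_abelian[OF cycles_bimodule] abelian_C], rule kernel_quotient_axioms.intro[OF _ boundaries_kernel])
  show "gb n \<in> add_hom (CZ n) (ccomp C n)"
    by (rule add_homI) (auto simp: cycles_iff gb_closed add_hom_add[OF gb_hom])
qed

sublocale Tor: kernel_quotient "CZ n" "ccomp C n" "gb n" "boundaries (bar_coring R A) n" for n
  by (rule kernel_quotient_cycles)

lemma ctb_cycle: "c \<in> carrier (ccomp C n) \<Longrightarrow> ctb n c \<in> cycles (bar_coring R A) n"
  by (simp add: cycles_iff ctb_closed bd_ctb)

text \<open>\<open>x\<close> and \<open>ctb (gb x)\<close> are cycles with the same image under
  \<open>gb\<close>, so they differ by an element of its kernel on cycles, a boundary.\<close>

lemma cycle_decomposition: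
  assumes x: "x \<in> cycles (bar_coring R A) n"
  obtains z where "z \<in> carrier (Om (Suc n))" "x = ctb n (gb n x) \<oplus>\<^bsub>Om n\<^esub> bd (Suc n) z"
proof -
  have xc: "x \<in> carrier (Om n)" using x by (simp add: cycles_iff)
  note gx = gb_closed[OF xc]
  have "x \<in> cls n (ctb n (gb n x))"
    using Tor.mem_coset_iff[of "ctb n (gb n x)" n x] x ctb_cycle[OF gx] by (simp add: gb_ctb[OF gx])
  then obtain b where "b \<in> boundaries (bar_coring R A) n" "x = b \<oplus>\<^bsub>Om n\<^esub> ctb n (gb n x)"
    by (auto simp: a_r_coset_def')
  then show ?thesis using that ctb_closed[OF gx] by (metis boundaries_iff bd_closed Om.M.a_comm)
qed

text \<open>\<open>gb\<close> depends on a choice of left linear sections and is right linear only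
  here. On a cycle \<open>x = ctb (gb x) + bd z\<close>, and both \<open>ctb\<close> and
  \<open>bd\<close> are right linear; applying \<open>gb\<close> to \<open>x r\<close> removes the
  boundary and recovers \<open>gb x\<close> times \<open>r\<close>.\<close>

lemma gb_cycles_hom: "gb n \<in> bimodule_hom R (CZ n) (ccomp C n)"
proof -
  have "gb n (x \<triangleleft>\<^bsub>Om n\<^esub> r) = gb n x \<triangleleft>\<^bsub>ccomp C n\<^esub> r" if x: "x \<in> cycles (bar_coring R A) n" and r: "r \<in> carrier R" for x r
  proof -
    have xc: "x \<in> carrier (Om n)" using x by (simp add: cycles_iff)
    note gx = gb_closed[OF xc]
    obtain z where z: "z \<in> carrier (Om (Suc n))" "x = ctb n (gb n x) \<oplus>\<^bsub>Om n\<^esub> bd (Suc n) z"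
      by (rule cycle_decomposition[OF x])
    have "x \<triangleleft>\<^bsub>Om n\<^esub> r = ctb n (gb n x \<triangleleft>\<^bsub>ccomp C n\<^esub> r) \<oplus>\<^bsub>Om n\<^esub> bd (Suc n) (z \<triangleleft>\<^bsub>Om (Suc n)\<^esub> r)"
      using r z(1) gx
      by (subst z(2)) (simp add: Om.rsmult_l_distr ctb_closed bd_closed right_hom_rsmult[OF ctb_right_hom]
          right_hom_rsmult[OF bimodule_homD(2)[OF bd_Suc_hom]] del: bd.simps(3))
    then show ?thesis
      using r z(1) gx by (simp add: add_hom_add[OF gb_hom] ctb_closed bd_closed gb_bd gb_ctb C.rsmult_closed Om.rsmult_closed del: bd.simps(3))
  qed
  then show ?thesis by (auto simp: bimodule_hom_def cycles_iff gb_closed add_hom_add[OF gb_hom] left_hom_smult[OF gb_left_hom])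
qed

lemma ctb_cycles_hom: "ctb n \<in> bimodule_hom R (ccomp C n) (CZ n)"
  by (auto simp: bimodule_hom_def ctb_cycle add_hom_add[OF ctb_add_hom] left_hom_smult[OF ctb_left_hom] right_hom_rsmult[OF ctb_right_hom])

lemma homology_carrier: "X \<in> carrier (HH n) \<longleftrightarrow> (\<exists>x\<in>cycles (bar_coring R A) n. X = cls n x)"
  by (simp add: homology_def rcosets_iff)

lemma cls_hom: "cls n \<in> bimodule_hom R (CZ n) (HH n)"
  using homology_class_hom[of n] by simp

lemma coring_to_Tor_eq: "coring_to_Tor R A C \<theta> n = (\<lambda>c. cls n (ctb n c))"
  by (simp add: coring_to_Tor_def fun_eq_iff bar_comp_def)

abbreviation "hT n \<equiv> coring_to_Tor R A C \<theta> n"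

lemma hT_hom: "hT n \<in> bimodule_hom R (ccomp C n) (HH n)"
  unfolding coring_to_Tor_eq
  using left_hom_comp[OF bimodule_homD(1)[OF ctb_cycles_hom] bimodule_homD(1)[OF cls_hom]]
    right_hom_comp[OF bimodule_homD(2)[OF ctb_cycles_hom] bimodule_homD(2)[OF cls_hom]]
  by (simp add: bimodule_hom_iff)

text \<open>The map that \<open>gb\<close> induces on homology; it turns out to be the inverse of
  \<open>hT\<close>.\<close>

definition kT where "kT n X = the_elem (gb n ` X)"

lemma kT_cls: "x \<in> cycles (bar_coring R A) n \<Longrightarrow> kT n (cls n x) = gb n x"
  using Tor.coset_value[of x n] by (simp add: kT_def)

lemma kT_hT: "c \<in> carrier (ccomp C n) \<Longrightarrow> kT n (hT n c) = c"
  by (simp add: coring_to_Tor_eq kT_cls ctb_cycle gb_ctb)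

lemma hT_gb: "x \<in> cycles (bar_coring R A) n \<Longrightarrow> hT n (gb n x) = cls n x"
  using Tor.coset_eq_iff[of "ctb n (gb n x)" n x] gb_closed[of x n]
  by (simp add: coring_to_Tor_eq ctb_cycle gb_ctb cycles_iff ctb_closed bd_ctb)

lemma kT_closed: "X \<in> carrier (HH n) \<Longrightarrow> kT n X \<in> carrier (ccomp C n)"
  by (auto simp: homology_carrier kT_cls gb_closed cycles_iff)

lemma hT_kT: "X \<in> carrier (HH n) \<Longrightarrow> hT n (kT n X) = X"
  by (auto simp: homology_carrier kT_cls hT_gb)

lemma hT_bij: "bij_betw (hT n) (carrier (ccomp C n)) (carrier (HH n))"
  by (rule bij_betw_byWitness[where f' = "kT n"])
    (use add_hom_closed[OF bimodule_homD(3)[OF hT_hom]] in \<open>auto simp: kT_hT hT_kT kT_closed\<close>)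

text \<open>Linearity on both sides is inherited from the bijective bimodule map \<open>hT\<close>,
  whose inverse \<open>kT\<close> is.\<close>

lemma kT_hom: "kT n \<in> bimodule_hom R (HH n) (ccomp C n)"
proof -
  interpret H: bimodule R "HH n" by (rule bimodule_homology)
  have "kT n X = inv_into (carrier (ccomp C n)) (hT n) X" if X: "X \<in> carrier (HH n)" for X
    using inv_into_f_f[OF bij_betw_imp_inj_on[OF hT_bij] kT_closed[OF X]] hT_kT[OF X] by simp
  then show ?thesis
    using bimodule_hom_inv_into[OF CB bimodule_homology hT_hom hT_bij, of n]
    by (auto simp: bimodule_hom_def H.smult_closed H.rsmult_closed)
qed

text \<open>Contracting with a functional \<open>f\<close> on \<open>C\<^sub>q\<close> turns the Kuenneth condition into an identity in
  \<open>C\<^sub>p\<close>, since \<open>gb\<close> kills boundaries.\<close>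

lemma kunneth_contraction:
  assumes f: "f \<in> left_hom R (ccomp C q) (regular_bimodule R)" and x: "x \<in> cycles (bar_coring R A) (p + q)"
    and kun: "kunneth_components R (bar_coring R A) (p + q) x \<tau>"
  shows "lift (ccomp C p) (\<lambda>(x, y). x \<triangleleft>\<^bsub>ccomp C p\<^esub> f y) (tensor_map R (ccomp C p) (ccomp C q) (kT p) (kT q) (\<tau> p)) =
    lift (ccomp C p) (\<lambda>(x, y). x \<triangleleft>\<^bsub>ccomp C p\<^esub> f y) (comult C p q (gb (p + q) x))"
proof -
  note [simp del] = bd.simps(3)
  let ?D = "bar_coring R A"
  have e: "p + q - p = q" "Suc (p + q) - p = Suc q" by simp_all
  obtain u w where u: "u p \<in> carrier (tensor R (CZ p) (CZ q))"
    and \<tau>: "\<tau> p = tensor_map R (HH p) (HH q) (cls p) (cls q) (u p)"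
    and w: "w (Suc p) \<in> carrier (tensor R (Om (Suc p)) (Om q))" "w p \<in> carrier (tensor R (Om p) (Om (Suc q)))"
    and cm: "comult ?D p q x = tensor_map R (Om p) (Om q) (\<lambda>z. z) (\<lambda>z. z) (u p) \<oplus>\<^bsub>tensor R (Om p) (Om q)\<^esub> tensor_diff R ?D (p + q) w p"
  proof -
    from kun obtain u w where
      1: "\<forall>p'\<le>p + q. u p' \<in> carrier (tensor R (CZ p') (CZ (p + q - p'))) \<and>
        \<tau> p' = tensor_map R (HH p') (HH (p + q - p')) (cls p') (cls (p + q - p')) (u p')" and
      2: "\<forall>p'\<le>Suc (p + q). w p' \<in> carrier (tensor R (Om p') (Om (Suc (p + q) - p')))" and
      3: "\<forall>p'\<le>p + q. comult ?D p' (p + q - p') x = tensor_map R (Om p') (Om (p + q - p')) (\<lambda>z. z) (\<lambda>z. z) (u p')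
        \<oplus>\<^bsub>tensor R (Om p') (Om (p + q - p'))\<^esub> tensor_diff R ?D (p + q) w p'"
      unfolding kunneth_components_def bar_coring_sel by blast
    show thesis
      by (rule that[of u w]) (use 1[rule_format, of p] 2[rule_format, of "Suc p"] 2[rule_format, of p] 3[rule_format, of p] e in simp_all)
  qed
  have xc: "x \<in> carrier (Om (p + q))" using x by (simp add: cycles_iff)
  \<comment> \<open>Pulled back along \<open>gb\<close>, the functional \<open>f\<close> becomes a
    cocycle on the bar complex, so contraction with it is a chain map by
    \<open>ct_bd\<close>.\<close>
  define g where "g y = f (gb q y)" for y
  have g: "g \<in> left_hom R (Om q) (regular_bimodule R)"
    unfolding g_def[abs_def] by (rule left_hom_comp[OF gb_left_hom f])
  have fc: "f y \<in> carrier R" if "y \<in> carrier (ccomp C q)" for y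
    using add_hom_closed[OF left_homD[OF f] that] by simp
  have g0: "g (bd (Suc q) y) = \<zero>\<^bsub>R\<^esub>" if "y \<in> carrier (Om (Suc q))" for y
    using add_hom_zero[OF left_homD[OF f] abelian_C bimodule_abelian[OF regular_bimodule[OF R.ring_axioms]]]
    by (simp add: g_def gb_bd[OF that])
  define L where "L = lift (Om p) (\<lambda>(x, y). x \<triangleleft>\<^bsub>Om p\<^esub> g y)"
  note L_hom = contraction_hom[OF g, of p, folded L_def] and L_tens = contraction_tens[OF g, of _ p, folded L_def]
  note gc = contraction_value_closed[OF g]
  have GL: "(\<lambda>t. gb p (L t)) \<in> add_hom (tensor R (Om p) (Om q)) (ccomp C p)" by (rule add_hom_comp[OF L_hom gb_hom])
  note fb = rsmult_value_balanced[OF CB CB f]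
  have idr: "(\<lambda>z. z) \<in> right_hom R (CZ p) (Om p)" and idl: "(\<lambda>z. z) \<in> left_hom R (CZ q) (Om q)"
    by (auto simp: right_hom_def left_hom_def add_hom_def cycles_iff)
  have ct: "ct p q g v = L (cop p q v)" for v by (simp add: ct_def L_def)

  define t1 where "t1 = tensor_map R (Om p) (Om q) (bar_diff R A (Suc p)) (\<lambda>y. y) (w (Suc p))"
  define t2 where "t2 = tensor_map R (Om p) (Om q) (\<lambda>x. x) (bar_diff R A (Suc q)) (w p)"
  note bdh = bimodule_homD[OF bar_diff_hom]
  note tm1 = tensor_map_hom[OF bimodule_Om bimodule_Om bimodule_Om bimodule_Om bdh(2) left_hom_ident]
  note tm2 = tensor_map_hom[OF bimodule_Om bimodule_Om bimodule_Om bimodule_Om right_hom_ident bdh(1)]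
  have tc: "t1 \<in> carrier (tensor R (Om p) (Om q))" "t2 \<in> carrier (tensor R (Om p) (Om q))"
    unfolding t1_def t2_def by (rule add_hom_closed[OF tm1 w(1)], rule add_hom_closed[OF tm2 w(2)])
  \<comment> \<open>In the first part of the tensor differential the contraction leaves a boundary
    of degree \<open>p\<close>, which \<open>gb\<close> kills; in the second part the boundary sits
    in the contracted factor, where \<open>g\<close> kills it.\<close>
  have z1: "gb p (L t1) = \<zero>\<^bsub>ccomp C p\<^esub>"
    unfolding t1_def
  proof (rule tensor_hom_ext[OF bimodule_Om bimodule_Om add_hom_comp[OF tm1 GL] add_hom_zero_map[OF abelian_C] _ w(1)])
    fix a b assume a: "a \<in> carrier (Om (Suc p))" and b: "b \<in> carrier (Om q)"
    have "L (tensor_map R (Om p) (Om q) (bar_diff R A (Suc p)) (\<lambda>y. y) (tens R (Om (Suc p)) (Om q) a b)) = bd (Suc p) (a \<triangleleft>\<^bsub>Om (Suc p)\<^esub> g b)"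
      using a b gc[OF b] right_hom_rsmult[OF bimodule_homD(2)[OF bd_Suc_hom], of "g b" a p]
      by (simp add: tensor_map_tens[OF bimodule_Om bimodule_Om bimodule_Om bimodule_Om bdh(2) left_hom_ident] L_tens bar_diff_eq bd_closed)
    then show "gb p (L (tensor_map R (Om p) (Om q) (bar_diff R A (Suc p)) (\<lambda>y. y) (tens R (Om (Suc p)) (Om q) a b))) = \<zero>\<^bsub>ccomp C p\<^esub>"
      using gb_bd[OF Om.rsmult_closed[OF gc[OF b] a]] by simp
  qed
  have z2: "gb p (L t2) = \<zero>\<^bsub>ccomp C p\<^esub>"
    unfolding t2_def
  proof (rule tensor_hom_ext[OF bimodule_Om bimodule_Om add_hom_comp[OF tm2 GL] add_hom_zero_map[OF abelian_C] _ w(2)])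
    fix a b assume a: "a \<in> carrier (Om p)" and b: "b \<in> carrier (Om (Suc q))"
    have "g \<zero>\<^bsub>Om q\<^esub> = \<zero>\<^bsub>R\<^esub>"
      using add_hom_zero[OF left_homD[OF g] abelian_Om bimodule_abelian[OF regular_bimodule[OF R.ring_axioms]]] by simp
    then have "a \<triangleleft>\<^bsub>Om p\<^esub> \<zero>\<^bsub>R\<^esub> = \<zero>\<^bsub>Om p\<^esub>"
      using add_hom_zero[OF balancedD(1)[OF contraction_balanced[OF g] a] abelian_Om abelian_Om] by simp
    then show "gb p (L (tensor_map R (Om p) (Om q) (\<lambda>x. x) (bar_diff R A (Suc q)) (tens R (Om p) (Om (Suc q)) a b))) = \<zero>\<^bsub>ccomp C p\<^esub>"
      using a b add_hom_zero[OF gb_hom abelian_Om abelian_C, of p]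
      by (simp add: tensor_map_tens[OF bimodule_Om bimodule_Om bimodule_Om bimodule_Om right_hom_ident bdh(1)] L_tens bar_diff_eq bd_closed g0)
  qed
  have td: "tensor_diff R ?D (p + q) w p = t1 \<oplus>\<^bsub>tensor R (Om p) (Om q)\<^esub> [((-1::int) ^ p)] \<cdot>\<^bsub>tensor R (Om p) (Om q)\<^esub> t2"
    by (simp add: tensor_diff_def t1_def t2_def)
  note pc = OmOm.M.add.int_pow_closed[OF tc(2), of "(-1) ^ p"]
  have z: "gb p (L (tensor_diff R ?D (p + q) w p)) = \<zero>\<^bsub>ccomp C p\<^esub>" and dc: "tensor_diff R ?D (p + q) w p \<in> carrier (tensor R (Om p) (Om q))"
    unfolding td using tc pc by (simp_all add: add_hom_add[OF GL] add_hom_int_pow[OF GL abelian_OmOm abelian_C] z1 z2 C.M.add.int_pow_one)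
  note iu = add_hom_closed[OF tensor_map_hom[OF cycles_bimodule cycles_bimodule bimodule_Om bimodule_Om idr idl] u]

  have "lift (ccomp C p) (\<lambda>(x, y). x \<triangleleft>\<^bsub>ccomp C p\<^esub> f y) (tensor_map R (ccomp C p) (ccomp C q) (kT p) (kT q) (\<tau> p)) =
      gb p (L (tensor_map R (Om p) (Om q) (\<lambda>z. z) (\<lambda>z. z) (u p)))"
    unfolding \<tau>
  proof (rule tensor_hom_ext[OF cycles_bimodule cycles_bimodule
        add_hom_comp[OF add_hom_comp[OF tensor_map_hom[OF cycles_bimodule cycles_bimodule bimodule_homology bimodule_homology
              bimodule_homD(2)[OF cls_hom] bimodule_homD(1)[OF cls_hom]]
            tensor_map_hom[OF bimodule_homology bimodule_homology CB CB bimodule_homD(2)[OF kT_hom] bimodule_homD(1)[OF kT_hom]]]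
          lift_tensor_hom[OF CB CB fb abelian_C]]
        add_hom_comp[OF tensor_map_hom[OF cycles_bimodule cycles_bimodule bimodule_Om bimodule_Om idr idl] GL] _ u])
    fix a b assume "a \<in> carrier (CZ p)" "b \<in> carrier (CZ q)"
    then have a: "a \<in> cycles ?D p" "a \<in> carrier (Om p)" and b: "b \<in> cycles ?D q" "b \<in> carrier (Om q)" by (auto simp: cycles_iff)
    have ca: "cls p a \<in> carrier (HH p)" and cb: "cls q b \<in> carrier (HH q)" using a b by (auto simp: homology_carrier)
    have "lift (ccomp C p) (\<lambda>(x, y). x \<triangleleft>\<^bsub>ccomp C p\<^esub> f y) (tensor_map R (ccomp C p) (ccomp C q) (kT p) (kT q)
          (tensor_map R (HH p) (HH q) (cls p) (cls q) (tens R (CZ p) (CZ q) a b))) = gb p a \<triangleleft>\<^bsub>ccomp C p\<^esub> f (gb q b)"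
      using a b ca cb
      by (simp add: tensor_map_tens[OF cycles_bimodule cycles_bimodule bimodule_homology bimodule_homology
              bimodule_homD(2)[OF cls_hom] bimodule_homD(1)[OF cls_hom]]
            tensor_map_tens[OF bimodule_homology bimodule_homology CB CB bimodule_homD(2)[OF kT_hom] bimodule_homD(1)[OF kT_hom]]
            lift_tens[OF CB CB fb abelian_C] kT_cls gb_closed)
    \<comment> \<open>The scalar \<open>g b\<close> may be moved out of \<open>gb\<close> because
      \<open>a\<close> is a cycle. This is why \<open>u p\<close> is taken in the tensor product of
      cycles.\<close>
    also have "\<dots> = gb p (L (tensor_map R (Om p) (Om q) (\<lambda>z. z) (\<lambda>z. z) (tens R (CZ p) (CZ q) a b)))"
      using a b gc[OF b(2)] right_hom_rsmult[OF bimodule_homD(2)[OF gb_cycles_hom], of "g b" a p]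
      by (simp add: tensor_map_tens[OF cycles_bimodule cycles_bimodule bimodule_Om bimodule_Om idr idl] L_tens g_def)
    finally show "lift (ccomp C p) (\<lambda>(x, y). x \<triangleleft>\<^bsub>ccomp C p\<^esub> f y) (tensor_map R (ccomp C p) (ccomp C q) (kT p) (kT q)
          (tensor_map R (HH p) (HH q) (cls p) (cls q) (tens R (CZ p) (CZ q) a b))) =
        gb p (L (tensor_map R (Om p) (Om q) (\<lambda>z. z) (\<lambda>z. z) (tens R (CZ p) (CZ q) a b)))" .
  qed
  also have "\<dots> = gb p (ct p q g x)"
    using iu dc z cm add_hom_closed[OF GL iu] by (simp add: ct bar_comult_eq[OF xc] add_hom_add[OF GL])
  \<comment> \<open>A cycle differs from \<open>ctb (gb x)\<close> by a boundary; contraction turns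
    that boundary into one of degree \<open>p\<close>, again killed by \<open>gb\<close>.\<close>
  also have "\<dots> = gb p (ct p q g (ctb (p + q) (gb (p + q) x)))"
  proof -
    obtain v where v: "v \<in> carrier (Om (Suc (p + q)))" "x = ctb (p + q) (gb (p + q) x) \<oplus>\<^bsub>Om (p + q)\<^esub> bd (Suc (p + q)) v"
      by (rule cycle_decomposition[OF x])
    note cc = ctb_closed[OF gb_closed[OF xc]]
    have vc: "ct (Suc p) q g v \<in> carrier (Om (Suc p))" using ct_closed[OF g, of v "Suc p"] v(1) by simp
    have "ct p q g x = ct p q g (ctb (p + q) (gb (p + q) x)) \<oplus>\<^bsub>Om p\<^esub> bd (Suc p) (ct (Suc p) q g v)"
      using v(1) cc by (subst v(2)) (simp add: add_hom_add[OF ct_hom[OF g]] bd_closed ct_bd[OF g g0])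
    then show ?thesis
      using vc ct_closed[OF g cc] by (simp add: add_hom_add[OF gb_hom] bd_closed gb_bd gb_closed)
  qed
  also have "\<dots> = gb p (L (tensor_map R (Om p) (Om q) (ctb p) (ctb q) (comult C p q (gb (p + q) x))))"
    by (simp add: ct cop_ctb gb_closed xc)
  also have "\<dots> = lift (ccomp C p) (\<lambda>(x, y). x \<triangleleft>\<^bsub>ccomp C p\<^esub> f y) (comult C p q (gb (p + q) x))"
  proof (rule tensor_hom_ext[OF CB CB add_hom_comp[OF tensor_map_hom[OF CB CB bimodule_Om bimodule_Om ctb_right_hom ctb_left_hom] GL]
        lift_tensor_hom[OF CB CB fb abelian_C] _ C.comult_closed[OF gb_closed[OF xc]]])
    fix a b assume a: "a \<in> carrier (ccomp C p)" and b: "b \<in> carrier (ccomp C q)"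
    show "gb p (L (tensor_map R (Om p) (Om q) (ctb p) (ctb q) (tens R (ccomp C p) (ccomp C q) a b))) =
        lift (ccomp C p) (\<lambda>(x, y). x \<triangleleft>\<^bsub>ccomp C p\<^esub> f y) (tens R (ccomp C p) (ccomp C q) a b)"
      using a b fc[OF b]
      by (simp add: tensor_map_tens[OF CB CB bimodule_Om bimodule_Om ctb_right_hom ctb_left_hom] L_tens ctb_closed g_def gb_ctb
          right_hom_rsmult[OF ctb_right_hom, symmetric] C.rsmult_closed lift_tens[OF CB CB fb abelian_C])
  qed
  finally show ?thesis .
qed

text \<open>For a representative of the form \<open>ctb n c\<close> the Kuenneth condition holds on
  the nose by \<open>cop_ctb\<close>: the representative \<open>u\<close> is the image of
  \<open>comult C\<close> under \<open>ctb \<otimes> ctb\<close>, and the correcting chain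
  \<open>w\<close> is zero.\<close>

lemma kunneth_ctb:
  assumes c: "c \<in> carrier (ccomp C n)"
  shows "kunneth_components R (bar_coring R A) n (ctb n c)
    (\<lambda>p. tensor_map R (HH p) (HH (n - p)) (hT p) (hT (n - p)) (comult C p (n - p) c))"
  unfolding kunneth_components_def bar_coring_sel
proof (intro exI conjI allI impI)
  let ?u = "\<lambda>p. tensor_map R (CZ p) (CZ (n - p)) (ctb p) (ctb (n - p)) (comult C p (n - p) c)"
  let ?w = "\<lambda>p. \<zero>\<^bsub>tensor R (Om p) (Om (Suc n - p))\<^esub>"
  note ctr = bimodule_homD(2)[OF ctb_cycles_hom] and ctl = bimodule_homD(1)[OF ctb_cycles_hom]
  note clr = bimodule_homD(2)[OF cls_hom] and cll = bimodule_homD(1)[OF cls_hom]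
  fix p
  show "?w p \<in> carrier (tensor R (Om p) (Om (Suc n - p)))" by (rule OmOm.M.zero_closed)
  assume p: "p \<le> n"
  then obtain q where n: "n = p + q" using le_Suc_ex by blast
  then have q: "n - p = q" "Suc n - p = Suc q" "Suc n - Suc p = q" by simp_all
  have c': "c \<in> carrier (ccomp C (p + q))" using c n by simp
  note dc = C.comult_closed[OF c']
  note uc = add_hom_closed[OF tensor_map_hom[OF CB CB cycles_bimodule cycles_bimodule ctr ctl] dc]
  show "?u p \<in> carrier (tensor R (CZ p) (CZ (n - p)))" unfolding q by (rule uc)
  show "tensor_map R (HH p) (HH (n - p)) (hT p) (hT (n - p)) (comult C p (n - p) c) =
      tensor_map R (HH p) (HH (n - p)) (cls p) (cls (n - p)) (?u p)"
    unfolding q coring_to_Tor_eq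
    by (rule tensor_map_comp[OF CB CB cycles_bimodule cycles_bimodule bimodule_homology bimodule_homology ctr ctl clr cll dc, symmetric])
  have idr: "(\<lambda>z. z) \<in> right_hom R (CZ p) (Om p)" and idl: "(\<lambda>z. z) \<in> left_hom R (CZ q) (Om q)"
    by (auto simp: right_hom_def left_hom_def add_hom_def cycles_iff)
  have u: "tensor_map R (Om p) (Om q) (\<lambda>z. z) (\<lambda>z. z) (tensor_map R (CZ p) (CZ q) (ctb p) (ctb q) (comult C p q c)) =
      tensor_map R (Om p) (Om q) (ctb p) (ctb q) (comult C p q c)"
    by (rule tensor_map_comp[OF CB CB cycles_bimodule cycles_bimodule bimodule_Om bimodule_Om ctr ctl idr idl dc])
  note bdh = bimodule_homD[OF bar_diff_hom]
  have "tensor_diff R (bar_coring R A) n ?w p = \<zero>\<^bsub>tensor R (Om p) (Om q)\<^esub>"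
    unfolding tensor_diff_def bar_coring_sel q
    using add_hom_zero[OF tensor_map_hom[OF bimodule_Om bimodule_Om bimodule_Om bimodule_Om bdh(2) left_hom_ident] abelian_OmOm abelian_OmOm, of p q]
      add_hom_zero[OF tensor_map_hom[OF bimodule_Om bimodule_Om bimodule_Om bimodule_Om right_hom_ident bdh(1)] abelian_OmOm abelian_OmOm, of p q]
    by (simp add: OmOm.M.add.int_pow_one)
  then show "comult (bar_coring R A) p (n - p) (ctb n c) = tensor_map R (Om p) (Om (n - p)) (\<lambda>z. z) (\<lambda>z. z) (?u p)
      \<oplus>\<^bsub>tensor R (Om p) (Om (n - p))\<^esub> tensor_diff R (bar_coring R A) n ?w p"
    using add_hom_closed[OF tensor_map_hom[OF CB CB bimodule_Om bimodule_Om ctb_right_hom ctb_left_hom] dc] ctb_closed[OF c']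
    unfolding q u by (simp add: n bar_comult_eq cop_ctb[OF c'])
qed

text \<open>The comultiplication of homology is a definite description, so a solution and its
  uniqueness are required for every representative of the class. Existence is
  \<open>kunneth_ctb\<close>. For uniqueness, \<open>kunneth_contraction\<close> shows that
  \<open>kT \<otimes> kT\<close> sends any solution to a tensor with the same contractions as
  \<open>comult C p q c\<close>; a dual basis of \<open>C_q\<close> makes the two tensors equal, and
  \<open>hT \<otimes> hT\<close> returns to homology.\<close>

lemma comult_Tor:
  assumes fg: "finitely_generated R (ccomp C q)" and c: "c \<in> carrier (ccomp C (p + q))"
  shows "comult (Tor_coring R A) p q (hT (p + q) c) = tensor_map R (HH p) (HH q) (hT p) (hT q) (comult C p q c)"
proof -
  let ?T = "tensor_map R (HH p) (HH q) (hT p) (hT q) (comult C p q c)"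
  obtain B where B: "dual_basis R (ccomp C q) B"
    by (rule left_module.dual_basis_exists[OF bimodule_left_module[OF CB] semisimple fg])
  have mem: "x \<in> hT (p + q) c \<longleftrightarrow> x \<in> cycles (bar_coring R A) (p + q) \<and> gb (p + q) x = c" for x
    using Tor.mem_coset_iff[of "ctb (p + q) c" "p + q" x] c by (simp add: coring_to_Tor_eq ctb_cycle gb_ctb)
  note kTr = bimodule_homD(2)[OF kT_hom] and kTl = bimodule_homD(1)[OF kT_hom]
  note hTr = bimodule_homD(2)[OF hT_hom] and hTl = bimodule_homD(1)[OF hT_hom]
  have unique: "\<tau> p = ?T" if x: "x \<in> hT (p + q) c" and k: "kunneth_components R (bar_coring R A) (p + q) x \<tau>" for x \<tau>
  proof -
    have xc: "x \<in> cycles (bar_coring R A) (p + q)" "gb (p + q) x = c" using x by (simp_all add: mem)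
    obtain u where u: "u p \<in> carrier (tensor R (CZ p) (CZ (p + q - p)))"
        "\<tau> p = tensor_map R (HH p) (HH (p + q - p)) (cls p) (cls (p + q - p)) (u p)"
      using k unfolding kunneth_components_def bar_coring_sel by (metis le_add1)
    then have \<tau>c: "\<tau> p \<in> carrier (tensor R (HH p) (HH q))"
      using add_hom_closed[OF tensor_map_hom[OF cycles_bimodule cycles_bimodule bimodule_homology bimodule_homology
          bimodule_homD(2)[OF cls_hom] bimodule_homD(1)[OF cls_hom]]] by simp
    have "tensor_map R (ccomp C p) (ccomp C q) (kT p) (kT q) (\<tau> p) = comult C p q c"
    proof (rule dual_basis_tensor_eqI[OF CB CB B _ C.comult_closed[OF c]])
      show "tensor_map R (ccomp C p) (ccomp C q) (kT p) (kT q) (\<tau> p) \<in> carrier (tensor R (ccomp C p) (ccomp C q))"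
        by (rule add_hom_closed[OF tensor_map_hom[OF bimodule_homology bimodule_homology CB CB kTr kTl] \<tau>c])
      fix f e assume "(f, e) \<in> set B"
      then have "f \<in> left_hom R (ccomp C q) (regular_bimodule R)" using B by (auto simp: dual_basis_def)
      from kunneth_contraction[OF this xc(1) k]
      show "lift (ccomp C p) (\<lambda>(x, y). x \<triangleleft>\<^bsub>ccomp C p\<^esub> f y) (tensor_map R (ccomp C p) (ccomp C q) (kT p) (kT q) (\<tau> p)) =
          lift (ccomp C p) (\<lambda>(x, y). x \<triangleleft>\<^bsub>ccomp C p\<^esub> f y) (comult C p q c)" by (simp only: xc(2))
    qed
    then have "?T = tensor_map R (HH p) (HH q) (hT p) (hT q) (tensor_map R (ccomp C p) (ccomp C q) (kT p) (kT q) (\<tau> p))"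
      by simp
    also have "\<dots> = tensor_map R (HH p) (HH q) (\<lambda>x. hT p (kT p x)) (\<lambda>y. hT q (kT q y)) (\<tau> p)"
      by (rule tensor_map_comp[OF bimodule_homology bimodule_homology CB CB bimodule_homology bimodule_homology kTr kTl hTr hTl \<tau>c])
    also have "\<dots> = \<tau> p" by (rule tensor_map_ident[OF bimodule_homology bimodule_homology \<tau>c hT_kT hT_kT])
    finally show ?thesis by simp
  qed
  have m: "ctb (p + q) c \<in> hT (p + q) c" using c by (simp add: mem ctb_cycle gb_ctb)
  have "\<exists>x\<in>hT (p + q) c. \<exists>\<tau>. kunneth_components R (bar_coring R A) (p + q) x \<tau> \<and> \<tau> p = ?T"
    by (rule bexI[OF _ m], rule exI, rule conjI, rule kunneth_ctb[OF c]) simp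
  then show ?thesis
    unfolding Tor_coring_def homology_coring_def graded_coring.simps by (intro the_equality) (use unique in blast)+
qed

text \<open>Local finiteness of \<open>C\<close> enters through the dual bases behind
  \<open>comult_Tor\<close>; the coring axioms of \<open>Tor_coring\<close> are delivered by
  \<open>graded_coring_isoI\<close>.\<close>

lemma coring_to_Tor_iso:
  assumes "locally_finite_coring R C"
  shows "graded_coring_iso R C (Tor_coring R A) (coring_to_Tor R A C \<theta>)"
proof (rule graded_coring_isoI[OF C.graded_coring_axioms])
  have T: "ccomp (Tor_coring R A) = homology (bar_coring R A)" by (simp add: Tor_coring_def homology_coring_def)
  show "bimodule R (ccomp (Tor_coring R A) n)" for n unfolding T by (rule bimodule_homology)
  show "hT n \<in> bimodule_hom R (ccomp C n) (ccomp (Tor_coring R A) n)" for n unfolding T by (rule hT_hom)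
  show "bij_betw (hT n) (carrier (ccomp C n)) (carrier (ccomp (Tor_coring R A) n))" for n unfolding T by (rule hT_bij)
  show "comult (Tor_coring R A) m n (hT (m + n) c) =
      tensor_map R (ccomp (Tor_coring R A) m) (ccomp (Tor_coring R A) n) (hT m) (hT n) (comult C m n c)"
    if "c \<in> carrier (ccomp C (m + n))" for m n c
    unfolding T using assms that by (intro comult_Tor) (simp_all add: locally_finite_coring_def)
  fix c assume c: "c \<in> carrier (ccomp C 0)"
  \<comment> \<open>Zero is the only boundary in degree 0, so the class is a singleton, and the
    counit, given by \<open>the_elem\<close>, is evaluated at \<open>ctb 0 c\<close>.\<close>
  have "x \<in> hT 0 c \<longleftrightarrow> x = ctb 0 c" for x
    using Tor.mem_coset_iff[of "ctb 0 c" 0 x] c ctb_gb_0[of x] gb_ctb[OF c] ctb_cycle[OF c]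
    by (auto simp: coring_to_Tor_eq cycles_iff)
  then have "hT 0 c = {ctb 0 c}" by blast
  then show "counit (Tor_coring R A) (hT 0 c) = counit C c"
    using c by (simp add: Tor_coring_def homology_coring_def ctb_0 ept_pword counit_closed)
qed

end

theorem theorem2p3:
  fixes R :: "('r, 'k) ring_scheme"
    and A :: "('r, 'a) graded_bimodule"
    and C :: "('r, 'c) graded_coring"
    and \<theta> :: "'c \<Rightarrow> 'a"
  assumes "semisimple_ring R"
    and "koszul_pair R A C \<theta>"
    and "locally_finite_ring R A"
    and "locally_finite_coring R C"
  shows "graded_ring_iso (Ext_ring R A) (graded_dual R C) (phi R A C \<theta>) \<and>
    graded_coring_iso R C (Tor_coring R A) (coring_to_Tor R A C \<theta>) \<and>
    graded_ring_iso (Ext_ring R A) (graded_dual R (Tor_coring R A)) (phi_Tor R A C \<theta>)"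
proof -
  have ak: "almost_koszul_pair R A C \<theta>" using assms(2) by (simp add: koszul_pair_def)
  then interpret koszul R A C \<theta>
    using assms(1,2)
    by (intro koszul.intro almost_koszul.intro connected_graded_ring.intro koszul_axioms.intro almost_koszul_axioms.intro
        connected_graded_ring_axioms.intro)
      (simp_all add: almost_koszul_pair_def)
  note T = coring_to_Tor_iso[OF assms(4)]
  \<comment> \<open>By its definition \<open>phi_Tor\<close> is \<open>phi\<close> followed by the
    transpose of the inverse of \<open>C \<rightarrow> T(A)\<close>, so the two isomorphisms
    compose.\<close>
  have "graded_ring_iso (Ext_ring R A) (graded_dual R (Tor_coring R A)) (phi_Tor R A C \<theta>)"
    by (rule graded_ring_iso_trans[OF phi_iso graded_dual_iso[OF T]]) (simp add: phi_Tor_def)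
  then show ?thesis using phi_iso T by blast
qed

end
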